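(* Let $u\in B^{1/3}_{3,c(\mathbb N)}\cap L^2(\mathbb R^3)$ be a divergence-free vector field on $\mathbb R^3$. Then its total energy flux vanishes, i.e. $\lim_{Q\to\infty}\Pi_Q=0$. In particular, every weak solution $u$ to the Euler equations on $\mathbb R^3\times[0,T]$ that belongs to the class $L^3([0,T];B^{1/3}_{3,c(\mathbb N)})\cap C_w([0,T];L^2(\mathbb R^3))$ conserves energy, i.e. $\frac12\|u(t)\|_{L^2}^2=\frac12\|u(0)\|_{L^2}^2$ for all $t\in[0,T]$.
   Context: Littlewood-Paley notation. $\lambda_q=2^q$. Fix a nonnegative radial $\chi\in C_0^\infty(B(0,1))$ on $\mathbb R^3$ with $\chi(\xi)=1$ for $|\xi|\le 1/2$, and let $\varphi(\xi)=\chi(\xi/2)-\chi(\xi)$. With $\mathcal F$ the Fourier transform, $\Delta_q u=\mathcal F^{-1}(\varphi(\lambda_q^{-1}\xi)\mathcal F u)$ for $q\ge 0$, $\Delta_{-1}u=\mathcal F^{-1}(\chi(\xi)\mathcal F u)$, and $S_Q=\sum_{q=-1}^{Q}\Delta_q$, so $S_Qu=\mathcal F^{-1}(\chi(\lambda_{Q+1}^{-1}\xi)\mathcal F u)$. The space $B^{1/3}_{3,c(\mathbb N)}$ is the class of tempered distributions $u$ on $\mathbb R^3$ with $\lim_{q\to\infty}\lambda_q^{1/3}\|\Delta_q u\|_{L^3}=0$, with the norm inherited from $B^{1/3}_{3,\infty}$: $\|u\|=\|\Delta_{-1}u\|_{L^3}+\sup_{q\ge0}\lambda_q^{1/3}\|\Delta_qu\|_{L^3}$.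 Energy flux at wave number $\lambda_Q$ of a divergence-free $u\in L^2(\mathbb R^3)$: $\Pi_Q=\int_{\mathbb R^3}\mathrm{Tr}[S_Q(u\otimes u)\cdot\nabla S_Qu]\,dx=\int_{\mathbb R^3}\sum_{i,j}S_Q(u_iu_j)\,\partial_i S_Qu_j\,dx$. Weak solution: $C_w([0,T];L^2)$ denotes weakly continuous functions with values in $L^2$. A function $u\in C_w([0,T];L^2(\mathbb R^3))$ with $\nabla_x\cdot u(t)=0$ in the sense of distributions for every $t\in[0,T]$ is a weak solution of the Euler equations (with initial data $u(0)=u_0\in L^2$) if for every $\psi\in C^1([0,T];\mathcal S(\mathbb R^3))$ with $\nabla_x\cdot\psi=0$ and every $0\le t\le T$, $$(u(t),\psi(t))-(u(0),\psi(0))-\int_0^t(u(s),\partial_s\psi(s))\,ds=\int_0^t b(u,\psi,u)(s)\,ds,$$ where $(u,v)=\int u\cdot v\,dx$ and $b(u,v,w)=\int (u\cdot\nabla v)\cdot w\,dx$. *)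

theory Defs
  imports "HOL-Analysis.Analysis"
begin

type_synonym R3 = "real ^ 3"

section \<open>Schwartz functions and tempered distributions\<close>

definition partial :: "3 \<Rightarrow> (R3 \<Rightarrow> 'b::real_normed_vector) \<Rightarrow> R3 \<Rightarrow> 'b" where
  "partial i f x = frechet_derivative f (at x) (axis i 1)"

text \<open>A multi-index is given as the list of directions in which one differentiates.\<close>

fun partials :: "3 list \<Rightarrow> (R3 \<Rightarrow> 'b::real_normed_vector) \<Rightarrow> R3 \<Rightarrow> 'b" where
  "partials [] f = f"
| "partials (i # is) f = partial i (partials is f)"

definition smooth :: "(R3 \<Rightarrow> 'b::real_normed_vector) \<Rightarrow> bool" where
  "smooth f \<longleftrightarrow> (\<forall>is x. partials is f differentiable (at x))"

definition schwartz :: "(R3 \<Rightarrow> 'b::real_normed_vector) \<Rightarrow> bool" where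
  "schwartz f \<longleftrightarrow> smooth f \<and>
     (\<forall>k is. bounded (range (\<lambda>x. (1 + norm x) ^ k *\<^sub>R partials is f x)))"

definition schwartz_seminorm ::
    "nat \<Rightarrow> 3 list \<Rightarrow> (R3 \<Rightarrow> 'b::real_normed_vector) \<Rightarrow> real" where
  "schwartz_seminorm k is f = (SUP x. (1 + norm x) ^ k * norm (partials is f x))"

text \<open>Convergence in the Frechet topology of the Schwartz space.\<close>

definition schwartz_tendsto ::
    "('i \<Rightarrow> R3 \<Rightarrow> 'b::real_normed_vector) \<Rightarrow> (R3 \<Rightarrow> 'b) \<Rightarrow> 'i filter \<Rightarrow> bool" where
  "schwartz_tendsto f g F \<longleftrightarrow>
     (\<forall>k is. ((\<lambda>s. schwartz_seminorm k is (\<lambda>x. f s x - g x)) \<longlongrightarrow> 0) F)"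

text \<open>A distribution is a functional of which only the values at Schwartz functions matter.\<close>

type_synonym dist3 = "(R3 \<Rightarrow> complex) \<Rightarrow> complex"

definition tempered :: "dist3 \<Rightarrow> bool" where
  "tempered U \<longleftrightarrow>
     (\<forall>a b f g. schwartz f \<longrightarrow> schwartz g \<longrightarrow>
        U (\<lambda>x. a * f x + b * g x) = a * U f + b * U g) \<and>
     (\<forall>f g. (\<forall>n::nat. schwartz (f n)) \<longrightarrow> schwartz g \<longrightarrow>
        schwartz_tendsto f g sequentially \<longrightarrow> (\<lambda>n. U (f n)) \<longlonglongrightarrow> U g)"

definition dist_of :: "(R3 \<Rightarrow> complex) \<Rightarrow> dist3" where
  "dist_of g = (\<lambda>f. \<integral>x. g x * f x \<partial>lborel)"

definition represents :: "(R3 \<Rightarrow> complex) \<Rightarrow> dist3 \<Rightarrow> bool" where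
  "represents g U \<longleftrightarrow>
     (\<forall>f. schwartz f \<longrightarrow> integrable lborel (\<lambda>x. g x * f x) \<and> U f = dist_of g f)"

text \<open>The pointwise values of a distribution which is a continuous function, such as
  \<open>S\<^sub>Q u\<close>; that function is unique.\<close>

definition fun_of_dist :: "dist3 \<Rightarrow> R3 \<Rightarrow> complex" where
  "fun_of_dist U = (THE g. continuous_on UNIV g \<and> represents g U)"

definition fourier :: "(R3 \<Rightarrow> complex) \<Rightarrow> R3 \<Rightarrow> complex" where
  "fourier f \<xi> = (\<integral>x. f x * cis (- (x \<bullet> \<xi>)) \<partial>lborel)"

definition inv_fourier :: "(R3 \<Rightarrow> complex) \<Rightarrow> R3 \<Rightarrow> complex" where
  "inv_fourier f x = complex_of_real (1 / (2 * pi) ^ 3) * (\<integral>\<xi>. f \<xi> * cis (x \<bullet> \<xi>) \<partial>lborel)"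

text \<open>The Fourier transform, its inverse, and multiplication by a function, all on tempered
  distributions by duality.\<close>

definition dist_fourier :: "dist3 \<Rightarrow> dist3" where
  "dist_fourier U = (\<lambda>f. U (fourier f))"

definition dist_inv_fourier :: "dist3 \<Rightarrow> dist3" where
  "dist_inv_fourier U = (\<lambda>f. U (inv_fourier f))"

definition dist_mult :: "(R3 \<Rightarrow> complex) \<Rightarrow> dist3 \<Rightarrow> dist3" where
  "dist_mult m U = (\<lambda>f. U (\<lambda>\<xi>. m \<xi> * f \<xi>))"

section \<open>Littlewood-Paley decomposition\<close>

definition lp_cutoff :: "(R3 \<Rightarrow> real) \<Rightarrow> bool" where
  "lp_cutoff chi \<longleftrightarrow> smooth chi \<and> closure {\<xi>. chi \<xi> \<noteq> 0} \<subseteq> ball 0 1 \<and>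
     (\<forall>\<xi>. 0 \<le> chi \<xi>) \<and> (\<forall>\<xi> \<eta>. norm \<xi> = norm \<eta> \<longrightarrow> chi \<xi> = chi \<eta>) \<and>
     (\<forall>\<xi>. norm \<xi> \<le> 1/2 \<longrightarrow> chi \<xi> = 1)"

definition wave_number :: "int \<Rightarrow> real" where
  "wave_number q = 2 powr real_of_int q"

definition lp_bump :: "(R3 \<Rightarrow> real) \<Rightarrow> R3 \<Rightarrow> real" where
  "lp_bump chi \<xi> = chi (\<xi> /\<^sub>R 2) - chi \<xi>"

text \<open>Only the indices \<open>q \<ge> -1\<close> are used.\<close>

definition lp_symbol :: "(R3 \<Rightarrow> real) \<Rightarrow> int \<Rightarrow> R3 \<Rightarrow> real" where
  "lp_symbol chi q \<xi> = (if q \<ge> 0 then lp_bump chi (\<xi> /\<^sub>R wave_number q) else chi \<xi>)"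

definition lp_block :: "(R3 \<Rightarrow> real) \<Rightarrow> int \<Rightarrow> dist3 \<Rightarrow> dist3" where
  "lp_block chi q U =
     dist_inv_fourier (dist_mult (\<lambda>\<xi>. complex_of_real (lp_symbol chi q \<xi>)) (dist_fourier U))"

definition lp_partial_sum :: "(R3 \<Rightarrow> real) \<Rightarrow> int \<Rightarrow> dist3 \<Rightarrow> dist3" where
  "lp_partial_sum chi Q U = (\<lambda>f. \<Sum>q\<in>{-1..Q}. lp_block chi q U f)"

section \<open>Function spaces\<close>

definition in_Lp :: "real \<Rightarrow> (R3 \<Rightarrow> 'b::real_normed_vector) \<Rightarrow> bool" where
  "in_Lp p f \<longleftrightarrow> f \<in> borel_measurable lborel \<and> integrable lborel (\<lambda>x. norm (f x) powr p)"

definition Lp_norm :: "real \<Rightarrow> (R3 \<Rightarrow> 'b::real_normed_vector) \<Rightarrow> real" where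
  "Lp_norm p f = (\<integral>x. norm (f x) powr p \<partial>lborel) powr (1 / p)"

text \<open>Vector-valued distributions are families of three components. The norm is infinite when the
  distribution is not an \<open>L\<^sup>p\<close> function; otherwise the infimum is over the representatives of one
  almost-everywhere class, with the Euclidean norm on the values.\<close>

definition dist_Lp_norm :: "real \<Rightarrow> (3 \<Rightarrow> dist3) \<Rightarrow> ennreal" where
  "dist_Lp_norm p U =
     (INF f\<in>{f :: R3 \<Rightarrow> complex ^ 3. in_Lp p f \<and> (\<forall>j. represents (\<lambda>x. f x $ j) (U j))}.
        ennreal (Lp_norm p f))"

definition field_dist :: "(R3 \<Rightarrow> R3) \<Rightarrow> 3 \<Rightarrow> dist3" where
  "field_dist u j = dist_of (\<lambda>x. complex_of_real (u x $ j))"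

definition besov_norm :: "(R3 \<Rightarrow> real) \<Rightarrow> (3 \<Rightarrow> dist3) \<Rightarrow> ennreal" where
  "besov_norm chi U = dist_Lp_norm 3 (\<lambda>j. lp_block chi (-1) (U j)) +
     (SUP q::nat. ennreal (wave_number (int q) powr (1/3)) *
        dist_Lp_norm 3 (\<lambda>j. lp_block chi (int q) (U j)))"

definition besov_c :: "(R3 \<Rightarrow> real) \<Rightarrow> (3 \<Rightarrow> dist3) \<Rightarrow> bool" where
  "besov_c chi U \<longleftrightarrow> (\<forall>j. tempered (U j)) \<and>
     (\<lambda>q::nat. ennreal (wave_number (int q) powr (1/3)) *
        dist_Lp_norm 3 (\<lambda>j. lp_block chi (int q) (U j))) \<longlonglongrightarrow> 0"

text \<open>The Bochner space \<open>L\<^sup>3([0,T]; B)\<close> for \<open>B = B\<^sup>1\<^sup>/\<^sup>3\<close> with the \<open>c(N)\<close> condition: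
  strong measurability (almost everywhere limit in norm of simple \<open>B\<close>-valued functions), and
  integrability of the cube of the norm.\<close>

definition in_L3_besov_c :: "(R3 \<Rightarrow> real) \<Rightarrow> real \<Rightarrow> (real \<Rightarrow> 3 \<Rightarrow> dist3) \<Rightarrow> bool" where
  "in_L3_besov_c chi T U \<longleftrightarrow>
     (AE t in restrict_space lborel {0..T}. besov_c chi (U t)) \<and>
     (\<exists>s :: nat \<Rightarrow> real \<Rightarrow> 3 \<Rightarrow> dist3.
        (\<forall>n. simple_function (restrict_space lborel {0..T}) (s n)) \<and>
        (\<forall>n. \<forall>t\<in>{0..T}. besov_c chi (s n t) \<and> besov_norm chi (s n t) < \<infinity>) \<and>
        (AE t in restrict_space lborel {0..T}.
           (\<lambda>n. besov_norm chi (\<lambda>j f. U t j f - s n t j f)) \<longlonglongrightarrow> 0)) \<and>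
     (\<integral>\<^sup>+t. besov_norm chi (U t) ^ 3 \<partial>restrict_space lborel {0..T}) < \<infinity>"

section \<open>Energy flux\<close>

text \<open>Vanishing of the divergence in the sense of distributions, for locally integrable \<open>u\<close>.\<close>

definition div_free :: "(R3 \<Rightarrow> R3) \<Rightarrow> bool" where
  "div_free u \<longleftrightarrow>
     (\<forall>f :: R3 \<Rightarrow> real. smooth f \<and> compact (closure {x. f x \<noteq> 0}) \<longrightarrow>
        (\<integral>x. (\<Sum>i\<in>UNIV. u x $ i * partial i f x) \<partial>lborel) = 0)"

definition energy_flux :: "(R3 \<Rightarrow> real) \<Rightarrow> int \<Rightarrow> (R3 \<Rightarrow> R3) \<Rightarrow> complex" where
  "energy_flux chi Q u =
     (\<integral>x. (\<Sum>i\<in>UNIV. \<Sum>j\<in>UNIV.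
        fun_of_dist (lp_partial_sum chi Q
          (dist_of (\<lambda>y. complex_of_real (u y $ i * u y $ j)))) x *
        partial i (fun_of_dist (lp_partial_sum chi Q (field_dist u j))) x) \<partial>lborel)"

section \<open>Weak solutions of the Euler equations\<close>

definition l2_inner :: "(R3 \<Rightarrow> R3) \<Rightarrow> (R3 \<Rightarrow> R3) \<Rightarrow> real" where
  "l2_inner u v = (\<integral>x. u x \<bullet> v x \<partial>lborel)"

definition euler_b :: "(R3 \<Rightarrow> R3) \<Rightarrow> (R3 \<Rightarrow> R3) \<Rightarrow> (R3 \<Rightarrow> R3) \<Rightarrow> real" where
  "euler_b u v w = (\<integral>x. (\<Sum>i\<in>UNIV. u x $ i *\<^sub>R partial i v x) \<bullet> w x \<partial>lborel)"

definition weakly_continuous_L2 :: "real \<Rightarrow> (real \<Rightarrow> R3 \<Rightarrow> R3) \<Rightarrow> bool" where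
  "weakly_continuous_L2 T u \<longleftrightarrow> (\<forall>t\<in>{0..T}. in_Lp 2 (u t)) \<and>
     (\<forall>v. in_Lp 2 v \<longrightarrow> continuous_on {0..T} (\<lambda>t. l2_inner (u t) v))"

text \<open>\<open>\<psi>\<close> is in \<open>C\<^sup>1\<close> of \<open>[0,T]\<close> with values in the Schwartz space, with time derivative \<open>\<psi>'\<close>
  (one-sided at the end points).\<close>

definition C1_schwartz ::
    "real \<Rightarrow> (real \<Rightarrow> R3 \<Rightarrow> R3) \<Rightarrow> (real \<Rightarrow> R3 \<Rightarrow> R3) \<Rightarrow> bool" where
  "C1_schwartz T \<psi> \<psi>' \<longleftrightarrow> (\<forall>t\<in>{0..T}.
     schwartz (\<psi> t) \<and> schwartz (\<psi>' t) \<and>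
     schwartz_tendsto (\<lambda>s x. (\<psi> s x - \<psi> t x) /\<^sub>R (s - t)) (\<psi>' t) (at t within {0..T}) \<and>
     schwartz_tendsto \<psi>' (\<psi>' t) (at t within {0..T}))"

definition weak_euler_solution :: "real \<Rightarrow> (real \<Rightarrow> R3 \<Rightarrow> R3) \<Rightarrow> bool" where
  "weak_euler_solution T u \<longleftrightarrow>
     weakly_continuous_L2 T u \<and> (\<forall>t\<in>{0..T}. div_free (u t)) \<and>
     (\<forall>\<psi> \<psi>'. C1_schwartz T \<psi> \<psi>' \<and>
        (\<forall>t\<in>{0..T}. \<forall>x. (\<Sum>i\<in>UNIV. partial i (\<psi> t) x $ i) = 0) \<longrightarrow>
        (\<forall>t\<in>{0..T}.
           l2_inner (u t) (\<psi> t) - l2_inner (u 0) (\<psi> 0)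
             - (LBINT s:{0..t}. l2_inner (u s) (\<psi>' s))
           = (LBINT s:{0..t}. euler_b (u s) (\<psi> s) (u s))))"

end

theory Submission
  imports Defs "HOL-Probability.Probability"
begin

text \<open>
  Write \<open>S\<close> for the mollification at frequency \<open>r = 2\<^sup>Q\<close>. The cubic expression
  \<open>\<integral> Su\<^sub>i Su\<^sub>j \<partial>\<^sub>i Su\<^sub>j\<close> vanishes for divergence-free \<open>u\<close>, so the flux only sees
  \<open>S(u\<^sub>i u\<^sub>j) - Su\<^sub>i Su\<^sub>j\<close>, which is quadratic in the increments \<open>u(x - y) - u(x)\<close>; the
  gradient of \<open>Su\<^sub>j\<close> is linear in them. If these increments are at most
  \<open>\<omega> (1 + r |y|)\<close> in \<open>L\<^sup>3\<close>, the flux is at most a constant times \<open>r \<omega>\<^sup>3\<close>. Splitting \<open>u\<close> into its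
  dyadic blocks gives \<open>\<omega> = r\<^sup>-\<^sup>1\<^sup>/\<^sup>3 d\<close>, where \<open>d\<close> is a convolution of the sequence
  \<open>\<lambda>\<^sub>q\<^sup>1\<^sup>/\<^sup>3 \<parallel>\<Delta>\<^sub>q u\<parallel>\<^sub>3\<close> with a summable kernel; hence \<open>d\<close> tends to 0 with that sequence and is bounded by
  its supremum.

  For a weak solution, test functions constant in time and the density of divergence-free Schwartz
  fields, obtained from the Leray projector away from frequency 0, give
  \<open>(u(t) - u(s), SSv) = \<integral>\<^sub>s\<^sup>t b(u, SSv, u)\<close> for every divergence-free \<open>v\<close> in \<open>L\<^sup>2\<close>. With \<open>v = u(t)\<close> and
  \<open>v = u(s)\<close> the symmetry of \<open>SS\<close> turns the sum into \<open>\<parallel>Su(t)\<parallel>\<^sup>2 - \<parallel>Su(s)\<parallel>\<^sup>2\<close>, and refining a partition of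
  \<open>[0,t]\<close> identifies \<open>\<parallel>Su(t)\<parallel>\<^sup>2 - \<parallel>Su(0)\<parallel>\<^sup>2\<close> as twice the time integral of the flux. Dominated
  convergence in time concludes.\<close>

section \<open>Smooth and Schwartz functions\<close>

text \<open>The exponent 1/3 is critical: the flux carries one factor r from the gradient and three
  increments of size r^(-1/3) d, so the powers of r cancel and only the smallness of d is left.
  Increments can replace u throughout because the filter kernel has mass one and its gradient has
  mean zero.

  A weak solution cannot be tested with itself, since u is only weakly continuous in time. Freezing
  the test field at the two ends of each time step avoids a time derivative; both ends are used
  because the cross terms (u(t), SSu(s)) then cancel. Smoothing twice makes the pairing an energy,
  and one S can be moved back onto the products of components.

  Three things must be earned: joint measurability in (t,x) is obtained for filtered fields only and
  passed on by limits; the Besov norm is replaced by a measurable supremum over blocks; a bound in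
  time for the filtered energy is drawn from the energy increments themselves. Distributions are
  left behind early: on functions the multipliers act as convolutions with real kernels, and all
  later estimates concern real components.\<close>

lemma partials_append: "partials (is @ js) f = partials is (partials js f)"
  by (induction "is") auto

lemma smooth_differentiable: "smooth f \<Longrightarrow> f differentiable (at x)"
  unfolding smooth_def by (metis partials.simps(1))

lemma smooth_partial: "smooth f \<Longrightarrow> smooth (partial i f)"
proof -
  assume "smooth f"
  then have "partials (is @ [i]) f differentiable (at x)" for "is" x
    by (auto simp: smooth_def)
  then show ?thesis by (simp add: smooth_def partials_append)
qed

text \<open>\<open>smooth\<close> quantifies over all lists of directions, so an invariant class
  closed under \<open>partial\<close> takes the place of an induction on multi-indices. Each use
  turns on a class wide enough to contain the derivatives of its members.\<close>

lemma smooth_coinduct: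
  assumes "P f"
    and diff: "\<And>f x. P f \<Longrightarrow> f differentiable (at x)"
    and step: "\<And>f i. P f \<Longrightarrow> P (partial i f)"
  shows "smooth f"
proof -
  have "P (partials is f)" for "is" by (induction "is") (use assms in auto)
  then show ?thesis using diff by (auto simp: smooth_def)
qed

text \<open>Decay is asked only of the members of the class; closure under \<open>partial\<close>
  hands it to every derivative.\<close>

lemma schwartz_coinduct:
  assumes "P f"
    and diff: "\<And>f x. P f \<Longrightarrow> f differentiable (at x)"
    and step: "\<And>f i. P f \<Longrightarrow> P (partial i f)"
    and bd: "\<And>f k. P f \<Longrightarrow> \<exists>C. \<forall>x. (1 + norm x) ^ k * norm (f x) \<le> C"
  shows "schwartz f"
proof -
  have P: "P (partials is f)" for "is" by (induction "is") (use assms in auto)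
  have "smooth f" by (rule smooth_coinduct[where P=P]) (use assms in auto)
  moreover have "bounded (range (\<lambda>x. (1 + norm x) ^ k *\<^sub>R partials is f x))" for k "is"
    using bd[OF P[of "is"], of k] by (auto simp: bounded_iff abs_mult power_abs)
  ultimately show ?thesis by (auto simp: schwartz_def)
qed

lemma schwartz_smooth: "schwartz f \<Longrightarrow> smooth f"
  by (simp add: schwartz_def)

lemma schwartz_partial: "schwartz f \<Longrightarrow> schwartz (partial i f)"
proof -
  assume f: "schwartz f"
  then have "bounded (range (\<lambda>x. (1 + norm x) ^ k *\<^sub>R partials (is @ [i]) f x))" for k "is"
    by (auto simp: schwartz_def)
  then show ?thesis using f by (simp add: schwartz_def smooth_partial partials_append)
qed

lemma schwartz_bound:
  assumes "schwartz f"
  obtains C where "C > 0" "\<And>x. norm (f x) \<le> C / (1 + norm x) ^ k"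
proof -
  have "bounded (range (\<lambda>x. (1 + norm x) ^ k *\<^sub>R partials [] f x))"
    using assms by (simp only: schwartz_def)
  then obtain C where C: "C > 0" "\<And>x. norm ((1 + norm x) ^ k *\<^sub>R f x) \<le> C"
    by (auto simp: bounded_pos)
  have "norm (f x) \<le> C / (1 + norm x) ^ k" for x
  proof -
    have "(1 + norm x) ^ k * norm (f x) \<le> C" using C(2)[of x] by (simp add: abs_mult power_abs)
    moreover have "(1 + norm x) ^ k > 0" by (simp add: add_pos_nonneg)
    ultimately show ?thesis by (simp add: field_simps)
  qed
  with C(1) show ?thesis using that by blast
qed

lemma partialI: "(f has_derivative f') (at x) \<Longrightarrow> partial i f x = f' (axis i 1)"
  unfolding partial_def using frechet_derivative_at by metis

lemma has_derivative_partial: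
  assumes "f differentiable (at x)"
  shows "(f has_derivative (\<lambda>v. \<Sum>i\<in>UNIV. v $ i *\<^sub>R partial i f x)) (at x)"
proof -
  have d: "(f has_derivative frechet_derivative f (at x)) (at x)"
    using assms by (simp add: frechet_derivative_works)
  then interpret bounded_linear "frechet_derivative f (at x)" by (rule has_derivative_bounded_linear)
  have "frechet_derivative f (at x) v = (\<Sum>i\<in>UNIV. v $ i *\<^sub>R partial i f x)" for v :: R3
  proof -
    have "v = (\<Sum>i\<in>UNIV. v $ i *\<^sub>R axis i 1)" by (metis basis_expansion scalar_mult_eq_scaleR)
    then have "frechet_derivative f (at x) v = frechet_derivative f (at x) (\<Sum>i\<in>UNIV. v $ i *\<^sub>R axis i 1)"
      by (rule arg_cong)
    then show ?thesis by (simp add: sum scaleR partial_def)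
  qed
  with d show ?thesis by (metis (no_types, lifting) ext)
qed

lemma smooth_continuous: "smooth f \<Longrightarrow> continuous_on S f"
  by (meson continuous_at_imp_continuous_on differentiable_imp_continuous_within smooth_differentiable)

lemma smooth_measurable: "smooth (f :: R3 \<Rightarrow> 'b::{real_normed_vector,second_countable_topology}) \<Longrightarrow> f \<in> borel_measurable borel"
  by (simp add: borel_measurable_continuous_onI smooth_continuous)

lemma partial_bounded_linear:
  assumes "bounded_linear T" "f differentiable (at x)"
  shows "partial i (\<lambda>x. T (f x)) x = T (partial i f x)"
    and "(\<lambda>x. T (f x)) differentiable (at x)"
proof -
  interpret bounded_linear T by fact
  have d: "((\<lambda>x. T (f x)) has_derivative (\<lambda>v. T (\<Sum>i\<in>UNIV. v $ i *\<^sub>R partial i f x))) (at x)"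
    using has_derivative[OF has_derivative_partial[OF assms(2)]] .
  then show "(\<lambda>x. T (f x)) differentiable (at x)" by (auto simp: differentiable_def)
  have "(\<Sum>k\<in>UNIV. (axis i (1::real) :: R3) $ k *\<^sub>R partial k f x) = partial i f x"
    by (subst sum.remove[of UNIV i]) (auto simp: axis_def intro!: sum.neutral)
  with partialI[OF d, of i]
  show "partial i (\<lambda>x. T (f x)) x = T (partial i f x)" by simp
qed

lemma partial_add:
  assumes "f differentiable (at x)" "g differentiable (at x)"
  shows "partial i (\<lambda>x. f x + g x) x = partial i f x + partial i g x"
  using has_derivative_add[OF assms[unfolded frechet_derivative_works]]
  by (metis (no_types, lifting) partialI partial_def)

lemma partial_sum:
  assumes "\<And>a. a \<in> A \<Longrightarrow> f a differentiable (at x)"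
  shows "partial i (\<lambda>x. \<Sum>a\<in>A. f a x) x = (\<Sum>a\<in>A. partial i (f a) x)"
  using has_derivative_sum[of A f, OF assms[unfolded frechet_derivative_works]]
  by (metis (no_types, lifting) partialI partial_def sum.cong)

lemma partial_mult:
  fixes f g :: "R3 \<Rightarrow> 'b::real_normed_algebra"
  assumes "f differentiable (at x)" "g differentiable (at x)"
  shows "partial i (\<lambda>x. f x * g x) x = partial i f x * g x + f x * partial i g x"
  using has_derivative_mult[OF assms[unfolded frechet_derivative_works]]
  by (metis (no_types, lifting) partialI partial_def add.commute)

lemma partial_const [simp]: "partial i (\<lambda>x. c) = (\<lambda>x. 0)"
  by (rule ext, subst partialI[OF has_derivative_const]) simp

lemma partial_affine:
  assumes "f differentiable (at (a *\<^sub>R x + b))"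
  shows "partial i (\<lambda>x. f (a *\<^sub>R x + b)) x = a *\<^sub>R partial i f (a *\<^sub>R x + b)"
    and "(\<lambda>x. f (a *\<^sub>R x + b)) differentiable (at x)"
proof -
  have h: "((\<lambda>x. a *\<^sub>R x + b) has_derivative (\<lambda>v. a *\<^sub>R v)) (at x)"
    by (auto intro!: derivative_eq_intros)
  note d = has_derivative_compose[OF h has_derivative_partial[OF assms]]
  then show "(\<lambda>x. f (a *\<^sub>R x + b)) differentiable (at x)" by (auto simp: differentiable_def)
  have "(\<Sum>k\<in>UNIV. (a *\<^sub>R (axis i (1::real) :: R3)) $ k *\<^sub>R partial k f (a *\<^sub>R x + b))
      = a *\<^sub>R partial i f (a *\<^sub>R x + b)"
    by (subst sum.remove[of UNIV i]) (auto simp: axis_def intro!: sum.neutral)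
  with partialI[OF d, of i] show "partial i (\<lambda>x. f (a *\<^sub>R x + b)) x = a *\<^sub>R partial i f (a *\<^sub>R x + b)"
    by simp
qed

lemma partial_scale:
  assumes "f differentiable (at (a *\<^sub>R x))"
  shows "partial i (\<lambda>x. f (a *\<^sub>R x)) x = a *\<^sub>R partial i f (a *\<^sub>R x)"
    and "(\<lambda>x. f (a *\<^sub>R x)) differentiable (at x)"
  using partial_affine[where b=0 and f=f and a=a and x=x] assms by simp_all

lemma smooth_bounded_linear:
  assumes "bounded_linear T" "smooth f"
  shows "smooth (\<lambda>x. T (f x))"
proof (rule smooth_coinduct[where P="\<lambda>F. \<exists>f. smooth f \<and> F = (\<lambda>x. T (f x))"], goal_cases)
  case 1 show ?case using assms by blast
next
  case (2 f x) then show ?case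
    using partial_bounded_linear(2)[OF assms(1)] smooth_differentiable by blast
next
  case (3 F i)
  then obtain f where f: "smooth f" "F = (\<lambda>x. T (f x))" by blast
  then have "partial i F = (\<lambda>x. T (partial i f x))"
    using partial_bounded_linear(1)[OF assms(1)] smooth_differentiable by blast
  with f show ?case using smooth_partial by blast
qed

lemma schwartz_bounded_linear:
  assumes "bounded_linear T" "schwartz f"
  shows "schwartz (\<lambda>x. T (f x))"
proof (rule schwartz_coinduct[where P="\<lambda>F. \<exists>f. schwartz f \<and> F = (\<lambda>x. T (f x))"], goal_cases)
  case 1 show ?case using assms by blast
next
  case (2 f x) then show ?case
    using partial_bounded_linear(2)[OF assms(1)] smooth_differentiable schwartz_smooth by blast
next
  case (3 F i)
  then obtain f where f: "schwartz f" "F = (\<lambda>x. T (f x))" by blast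
  then have "partial i F = (\<lambda>x. T (partial i f x))"
    using partial_bounded_linear(1)[OF assms(1)] smooth_differentiable schwartz_smooth by blast
  with f show ?case using schwartz_partial by blast
next
  case (4 F k)
  then obtain f where f: "schwartz f" "F = (\<lambda>x. T (f x))" by blast
  obtain K where K: "0 < K" "\<And>x. norm (T x) \<le> norm x * K"
    using bounded_linear.pos_bounded[OF assms(1)] by blast
  obtain C where C: "C > 0" "\<And>x. norm (f x) \<le> C / (1 + norm x) ^ k"
    using schwartz_bound[OF f(1), of k] by blast
  have "(1 + norm x) ^ k * norm (F x) \<le> C * K" for x
  proof -
    have p: "(1 + norm x) ^ k > 0" by (simp add: add_pos_nonneg)
    have "norm (F x) \<le> C / (1 + norm x) ^ k * K"
      using K(2)[of "f x"] mult_right_mono[OF C(2)[of x], of K] K(1) f(2) by simp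
    with p show ?thesis by (simp add: field_simps)
  qed
  then show ?case by blast
qed

lemma schwartz_add:
  assumes "schwartz f" "schwartz g"
  shows "schwartz (\<lambda>x. f x + g x)"
proof (rule schwartz_coinduct[where P="\<lambda>F. \<exists>f g. schwartz f \<and> schwartz g \<and> F = (\<lambda>x. f x + g x)"], goal_cases)
  case 1 show ?case using assms by blast
next
  case (2 F x) then show ?case
    using smooth_differentiable schwartz_smooth differentiable_add by blast
next
  case (3 F i)
  then obtain f g where f: "schwartz f" "schwartz g" "F = (\<lambda>x. f x + g x)" by blast
  then have "partial i F = (\<lambda>x. partial i f x + partial i g x)"
    using partial_add smooth_differentiable schwartz_smooth by blast
  with f show ?case using schwartz_partial by blast
next
  case (4 F k)
  then obtain f g where f: "schwartz f" "schwartz g" "F = (\<lambda>x. f x + g x)" by blast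
  obtain C where C: "C > 0" "\<And>x. norm (f x) \<le> C / (1 + norm x) ^ k"
    using schwartz_bound[OF f(1), of k] by blast
  obtain D where D: "D > 0" "\<And>x. norm (g x) \<le> D / (1 + norm x) ^ k"
    using schwartz_bound[OF f(2), of k] by blast
  have "(1 + norm x) ^ k * norm (F x) \<le> C + D" for x
  proof -
    have p: "(1 + norm x) ^ k > 0" by (simp add: add_pos_nonneg)
    have "norm (F x) \<le> C / (1 + norm x) ^ k + D / (1 + norm x) ^ k"
      using C(2)[of x] D(2)[of x] norm_triangle_ineq[of "f x" "g x"] f(3) by simp
    with p show ?thesis by (simp add: add_divide_distrib[symmetric] pos_le_divide_eq mult.commute)
  qed
  then show ?case by blast
qed

lemma schwartz_zero [simp]: "schwartz (\<lambda>x. 0)"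
  by (rule schwartz_coinduct[where P="\<lambda>F. F = (\<lambda>x. 0)"]) auto

lemma schwartz_sum:
  assumes "\<And>a. a \<in> A \<Longrightarrow> schwartz (f a)"
  shows "schwartz (\<lambda>x. \<Sum>a\<in>A. f a x)"
  using assms by (induction A rule: infinite_finite_induct) (auto intro: schwartz_add)

lemma vec3_expand: "(\<chi> j. f j) = (\<Sum>j\<in>UNIV. f j *\<^sub>R (axis j 1 :: R3))"
  by (simp add: vec_eq_iff axis_def if_distrib[of "\<lambda>x. _ * x"] cong: if_cong)

lemma schwartz_vec:
  assumes "\<And>j. schwartz (f j)"
  shows "schwartz (\<lambda>x. (\<chi> j. f j x) :: R3)"
proof -
  have "(\<chi> j. f j x) = (\<Sum>j\<in>UNIV. f j x *\<^sub>R (axis j 1 :: R3))" for x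
    by (rule vec3_expand)
  moreover have "schwartz (\<lambda>x. \<Sum>j\<in>UNIV. f j x *\<^sub>R (axis j 1 :: R3))"
    by (intro schwartz_sum schwartz_bounded_linear[OF _ assms] bounded_linear_scaleR_left)
  ultimately show ?thesis by simp
qed

lemma partial_vec:
  assumes "\<And>j. smooth (f j)"
  shows "partial i (\<lambda>x. (\<chi> j. f j x) :: R3) x $ j = partial i (f j) x"
proof -
  have eq: "(\<chi> j. f j x) = (\<Sum>j\<in>UNIV. f j x *\<^sub>R (axis j 1 :: R3))" for x
    by (rule vec3_expand)
  have d: "(\<lambda>x. f j x *\<^sub>R (axis j 1 :: R3)) differentiable (at x)" for j
    using partial_bounded_linear(2)[OF bounded_linear_scaleR_left smooth_differentiable[OF assms]] .
  have "(\<lambda>x. (\<chi> j. f j x) :: R3) differentiable (at x)"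
    unfolding eq using d by (intro differentiable_sum) auto
  from partial_bounded_linear(1)[OF bounded_linear_vec_nth this, of i j] show ?thesis by simp
qed

text \<open>A class of single products is not closed under \<open>partial\<close>, because the
  Leibniz rule turns one product into two. The invariant class therefore consists of finite sums of
  products, represented by lists of pairs of smooth factors.\<close>

lemma smooth_mult:
  fixes f g :: "R3 \<Rightarrow> 'b::real_normed_algebra"
  assumes "smooth f" "smooth g"
  shows "smooth (\<lambda>x. f x * g x)"
proof -
  have *: "(\<lambda>x::R3. \<Sum>(a,b)\<leftarrow>ps. a x * b x :: 'b) differentiable (at x) \<and>
     partial i (\<lambda>x::R3. \<Sum>(a,b)\<leftarrow>ps. a x * b x :: 'b) x =
       (\<Sum>(a,b)\<leftarrow>concat (map (\<lambda>(a,b). [(partial i a, b), (a, partial i b)]) ps). a x * b x)"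
    if "\<forall>(a,b)\<in>set ps. smooth a \<and> smooth b" for ps x i
    using that
  proof (induction ps)
    case Nil show ?case by simp
  next
    case (Cons p ps)
    obtain a b where p: "p = (a,b)" by force
    have s: "smooth a" "smooth b" using Cons.prems p by auto
    have IH: "(\<lambda>x. \<Sum>(a,b)\<leftarrow>ps. a x * b x) differentiable (at x)"
      "partial i (\<lambda>x. \<Sum>(a,b)\<leftarrow>ps. a x * b x) x =
        (\<Sum>(a,b)\<leftarrow>concat (map (\<lambda>(a,b). [(partial i a, b), (a, partial i b)]) ps). a x * b x)"
      using Cons by auto
    have m: "(\<lambda>x. a x * b x) differentiable (at x)"
      by (intro differentiable_mult smooth_differentiable s)
    show ?case
      using differentiable_add[OF m IH(1)] partial_add[OF m IH(1), of i] IH(2)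
        partial_mult[OF smooth_differentiable[OF s(1)] smooth_differentiable[OF s(2)], of i x]
      by (simp add: p)
  qed
  show ?thesis
  proof (rule smooth_coinduct[where P="\<lambda>F. \<exists>ps. (\<forall>(a,b)\<in>set ps. smooth a \<and> smooth b) \<and>
     F = (\<lambda>x::R3. \<Sum>(a,b)\<leftarrow>ps. a x * b x :: 'b)"], goal_cases)
    case 1 show ?case using assms by (intro exI[of _ "[(f,g)]"]) simp
  next
    case (2 F x)
    then show ?case using * by blast
  next
    case (3 F i)
    then obtain ps where ps: "\<forall>(a,b)\<in>set ps. smooth a \<and> smooth b"
      "F = (\<lambda>x::R3. \<Sum>(a,b)\<leftarrow>ps. a x * b x :: 'b)" by blast
    show ?case
      using ps *[OF ps(1), of _ i]
      by (intro exI[of _ "concat (map (\<lambda>(a,b). [(partial i a, b), (a, partial i b)]) ps)"])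
         (auto intro: smooth_partial)
  qed
qed

lemma smooth_affine:
  assumes "smooth f"
  shows "smooth (\<lambda>x. c *\<^sub>R f (a *\<^sub>R x + b))"
proof (rule smooth_coinduct[where P="\<lambda>F. \<exists>c f. smooth f \<and> F = (\<lambda>x. c *\<^sub>R f (a *\<^sub>R x + b))"], goal_cases)
  case 1 show ?case using assms by blast
next
  case (2 F x) then show ?case
    using partial_bounded_linear(2)[OF bounded_linear_scaleR_right partial_affine(2)[OF smooth_differentiable]]
    by blast
next
  case (3 F i)
  then obtain c f where f: "smooth f" "F = (\<lambda>x. c *\<^sub>R f (a *\<^sub>R x + b))" by blast
  have "partial i F x = c *\<^sub>R a *\<^sub>R partial i f (a *\<^sub>R x + b)" for x
    using partial_affine(1)[of f a x b i] partial_affine(2)[of f a x b] smooth_differentiable[OF f(1)] f(2)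
     partial_bounded_linear(1)[OF bounded_linear_scaleR_right[of c], of "\<lambda>x. f (a *\<^sub>R x + b)" x i]
    by simp
  then have "partial i F = (\<lambda>x. (c * a) *\<^sub>R partial i f (a *\<^sub>R x + b))" by auto
  with f show ?case using smooth_partial by blast
qed

lemma smooth_const [simp]: "smooth (\<lambda>x. c)"
proof (rule smooth_coinduct[where P="\<lambda>F. \<exists>c. F = (\<lambda>x. c)"], goal_cases)
  case (2 f x) then show ?case using differentiable_const by blast
next
  case (3 f i) then show ?case using partial_const by blast
qed blast

text \<open>The partial derivative of a linear map is constant, so the invariant class has to
  include the constants.\<close>

lemma smooth_bl:
  assumes "bounded_linear f"
  shows "smooth f"
proof (rule smooth_coinduct[where P="\<lambda>F. bounded_linear F \<or> (\<exists>c. F = (\<lambda>x. c))"], goal_cases)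
  case 1 show ?case using assms ..
next
  case (2 F x)
  then show ?case
    by (auto simp: differentiable_def intro: bounded_linear_imp_has_derivative has_derivative_const)
next
  case (3 F i)
  then show ?case
  proof
    assume b: "bounded_linear F"
    have "partial i F x = F (axis i 1)" for x
      by (rule partialI[OF bounded_linear_imp_has_derivative[OF b]])
    then have "partial i F = (\<lambda>x. F (axis i 1))" by auto
    then show ?thesis by blast
  qed auto
qed

lemma smooth_coord: "smooth (\<lambda>x. x $ i)"
  by (rule smooth_bl[OF bounded_linear_vec_nth])

lemma smooth_add: "smooth f \<Longrightarrow> smooth g \<Longrightarrow> smooth (\<lambda>x. f x + g x)"
proof (rule smooth_coinduct[where P="\<lambda>F. \<exists>f g. smooth f \<and> smooth g \<and> F = (\<lambda>x. f x + g x)"], goal_cases)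
  case 1 then show ?case by blast
next
  case (2 F x) then show ?case
    using smooth_differentiable differentiable_add by blast
next
  case (3 F i)
  then obtain f g where f: "smooth f" "smooth g" "F = (\<lambda>x. f x + g x)" by blast
  then have "partial i F = (\<lambda>x. partial i f x + partial i g x)"
    using partial_add smooth_differentiable by blast
  with f show ?case using smooth_partial by blast
qed

lemma smooth_sum:
  "(\<And>a. a \<in> A \<Longrightarrow> smooth (f a)) \<Longrightarrow> smooth (\<lambda>x. \<Sum>a\<in>A. f a x)"
  by (induction A rule: infinite_finite_induct) (auto intro: smooth_add)

lemma norm_sq_sum: "(norm (x::R3))\<^sup>2 = (\<Sum>k\<in>UNIV. x $ k * x $ k)"
  by (simp add: power2_norm_eq_inner inner_vec_def)

lemma smooth_norm_sq: "smooth (\<lambda>x::R3. (norm x)\<^sup>2)"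
  unfolding norm_sq_sum by (intro smooth_sum smooth_mult smooth_coord)

text \<open>Differentiability and derivative depend only on the germ at x. The use is for functions
  that vanish on a whole neighbourhood, near the origin or outside a bounded support.\<close>

lemma partial_local:
  assumes "r > 0" "\<And>y. norm (y - x) < r \<Longrightarrow> f y = g y" "g differentiable (at x)"
  shows "partial i f x = partial i g x" "f differentiable (at x)"
proof -
  have "(f has_derivative (\<lambda>v. \<Sum>i\<in>UNIV. v $ i *\<^sub>R partial i g x)) (at x)"
  proof (rule has_derivative_transform_within[OF has_derivative_partial[OF assms(3)] assms(1)])
    show "\<And>x'. x' \<in> UNIV \<Longrightarrow> dist x' x < r \<Longrightarrow> g x' = f x'" using assms(2) by (metis dist_norm)
  qed simp
  from partialI[OF this, of i] partialI[OF has_derivative_partial[OF assms(3)], of i]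
    this show "partial i f x = partial i g x" "f differentiable (at x)"
    by (auto simp: differentiable_def)
qed

text \<open>Dividing by powers of \<open>norm \<xi> ^ 2\<close> keeps the class of functions vanishing near the origin
  closed under partial derivatives; at the origin itself the junk value \<open>0 / 0 = 0\<close> is the right one.\<close>

lemma smooth_div_norm_sq:
  fixes g :: "R3 \<Rightarrow> real"
  assumes "smooth g" "\<epsilon> > 0" "\<And>x. norm x < \<epsilon> \<Longrightarrow> g x = 0"
  shows "smooth (\<lambda>x. g x / (norm x)\<^sup>2)"
proof (rule smooth_coinduct[where P="\<lambda>F. \<exists>n g. smooth g \<and> (\<forall>x. norm x < \<epsilon> \<longrightarrow> g x = 0) \<and>
     F = (\<lambda>x. g x / ((norm x)\<^sup>2) ^ n)"], goal_cases)
  case 1 show ?case using assms by (intro exI[of _ 1] exI[of _ g]) auto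
next
  have d: "F differentiable (at x) \<and> partial i F x =
     (partial i g x * (norm x)\<^sup>2 - g x * (2 * real n * x $ i)) / ((norm x)\<^sup>2) ^ (Suc n)"
    if g: "smooth g" "\<forall>x. norm x < \<epsilon> \<longrightarrow> g x = 0" "F = (\<lambda>x. g x / ((norm x)\<^sup>2) ^ n)" for F g n x i
  proof (cases "norm x < \<epsilon>")
    case True
    have loc: "g y = 0" if "norm (y - x) < \<epsilon> - norm x" for y
    proof -
      have "norm y \<le> norm (y - x) + norm x" by (metis diff_add_cancel norm_triangle_ineq)
      then show ?thesis using that g(2) by simp
    qed
    have p: "\<epsilon> - norm x > 0" using True by simp
    have "partial i g x = 0" using partial_local(1)[OF p, where x=x and f=g and g="\<lambda>x. 0" and i=i] loc by simp
    moreover have "partial i F x = 0" "F differentiable (at x)"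
      using partial_local(1)[OF p, where x=x and f=F and g="\<lambda>x. 0" and i=i] partial_local(2)[OF p, where x=x and f=F and g="\<lambda>x. 0"] loc g(3) by auto
    ultimately show ?thesis using g(2) True by simp
  next
    case False
    then have x: "x \<noteq> 0" using assms(2) by auto
    have N: "((\<lambda>x::R3. (norm x)\<^sup>2) has_derivative (\<lambda>v. 2 * (x \<bullet> v))) (at x)"
      unfolding power2_norm_eq_inner by (auto intro!: derivative_eq_intros simp: inner_commute)
    note G = has_derivative_partial[OF smooth_differentiable[OF g(1)], of x]
    have "(F has_derivative (\<lambda>v. ((\<Sum>i\<in>UNIV. v $ i *\<^sub>R partial i g x) * ((norm x)\<^sup>2) ^ n
        - g x * (of_nat n * (2 * (x \<bullet> v)) * ((norm x)\<^sup>2) ^ (n - 1))) / (((norm x)\<^sup>2) ^ n * ((norm x)\<^sup>2) ^ n))) (at x)"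
      unfolding g(3) by (rule has_derivative_divide'[OF G has_derivative_power[OF N]]) (use x in simp)
    then have "F differentiable (at x)" and
      e: "partial i F x = ((\<Sum>k\<in>UNIV. axis i 1 $ k *\<^sub>R partial k g x) * ((norm x)\<^sup>2) ^ n
        - g x * (of_nat n * (2 * (x \<bullet> axis i 1)) * ((norm x)\<^sup>2) ^ (n - 1))) / (((norm x)\<^sup>2) ^ n * ((norm x)\<^sup>2) ^ n)"
      using partialI[of F _ x i] by (auto simp: differentiable_def)
    moreover have "(\<Sum>k\<in>UNIV. (axis i (1::real) :: R3) $ k *\<^sub>R partial k g x) = partial i g x"
      by (subst sum.remove[of UNIV i]) (auto simp: axis_def intro!: sum.neutral)
    \<comment> \<open>The power rule leaves the exponent n - 1 with truncated subtraction. For n = 0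
      the factor \<open>of_nat n\<close> removes that term; otherwise a common factor N ^ (n - 1)
      cancels.\<close>
    moreover have alg: "(p * N ^ n - q * (of_nat n * (2 * c) * N ^ (n - 1))) / (N ^ n * N ^ n)
      = (p * N - q * (2 * real n * c)) / N ^ Suc n" if "N \<noteq> 0" for p q c N :: real
    proof (cases n)
      case 0 then show ?thesis using that by simp
    next
      case (Suc m)
      have "p * N ^ n - q * (of_nat n * (2 * c) * N ^ (n - 1)) = N ^ m * (p * N - q * (2 * real n * c))"
        unfolding Suc by (simp add: algebra_simps)
      moreover have "N ^ n * N ^ n = N ^ m * N ^ Suc n"
        unfolding Suc by (simp add: ac_simps)
      ultimately show ?thesis using that by simp
    qed
    have nz: "(norm x)\<^sup>2 \<noteq> 0" using x by simp
    have "partial i F x = (partial i g x * (norm x)\<^sup>2 - g x * (2 * real n * x $ i)) / ((norm x)\<^sup>2) ^ (Suc n)"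
      using e calculation(3) alg[OF nz, of "partial i g x" "g x" "x $ i"]
      by (simp only: inner_axis real_inner_1_right)
    with calculation(1) show ?thesis by blast
  qed
  {
    case (2 F x) then show ?case using d by blast
  next
    case (3 F i)
    then obtain g n where g: "smooth g" "\<forall>x. norm x < \<epsilon> \<longrightarrow> g x = 0" "F = (\<lambda>x. g x / ((norm x)\<^sup>2) ^ n)"
      by blast
    let ?h = "\<lambda>x. partial i g x * (norm x)\<^sup>2 + g x * ((- 2 * real n) *\<^sub>R x $ i)"
    have "smooth ?h"
      by (intro smooth_add smooth_mult smooth_partial smooth_norm_sq g(1)
         smooth_bounded_linear[OF bounded_linear_scaleR_right smooth_coord])
    moreover have "partial i g x = 0" if "norm x < \<epsilon>" for x
    proof -
      have loc: "g y = 0" if "norm (y - x) < \<epsilon> - norm x" for y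
      proof -
        have "norm y \<le> norm (y - x) + norm x" by (metis diff_add_cancel norm_triangle_ineq)
        then show ?thesis using that g(2) by simp
      qed
      show ?thesis using partial_local(1)[where r="\<epsilon> - norm x" and x=x and f=g and g="\<lambda>x. 0" and i=i] loc that by simp
    qed
    moreover have "partial i F = (\<lambda>x. ?h x / ((norm x)\<^sup>2) ^ Suc n)"
      using d[OF g, of _ i] by (auto simp: fun_eq_iff mult.commute mult.left_commute)
    ultimately show ?case using g(2)
      by (intro exI[of _ "Suc n"] exI[of _ ?h] conjI allI impI) auto
  }
qed

section \<open>Integration and convolution\<close>

lemma nn_integral_affine:
  fixes f :: "R3 \<Rightarrow> ennreal"
  assumes [measurable]: "f \<in> borel_measurable borel" and c: "c \<noteq> 0"
  shows "(\<integral>\<^sup>+x. f x \<partial>lborel) = ennreal (\<bar>c\<bar> ^ 3) * (\<integral>\<^sup>+x. f (t + c *\<^sub>R x) \<partial>lborel)"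
  by (subst lborel_affine[OF c, of t])
     (simp add: nn_integral_density nn_integral_distr nn_integral_cmult)

lemma integral_affine:
  fixes f :: "R3 \<Rightarrow> 'b::{banach,second_countable_topology}"
  assumes [measurable]: "f \<in> borel_measurable borel" and c: "c \<noteq> 0"
  shows "(\<integral>x. f x \<partial>lborel) = \<bar>c\<bar> ^ 3 *\<^sub>R (\<integral>x. f (t + c *\<^sub>R x) \<partial>lborel)"
  by (subst lborel_affine[OF c, of t]) (simp add: integral_density integral_distr)

lemma integrable_affine:
  fixes f :: "R3 \<Rightarrow> 'b::{banach,second_countable_topology}"
  assumes f: "integrable lborel f" and c: "c \<noteq> 0"
  shows "integrable lborel (\<lambda>x. f (t + c *\<^sub>R x))"
proof -
  have [measurable]: "f \<in> borel_measurable borel" using f by auto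
  have "(\<integral>\<^sup>+x. norm (f x) \<partial>lborel) < \<infinity>" using f by (simp add: integrable_iff_bounded)
  moreover have "ennreal (\<bar>c\<bar> ^ 3) \<noteq> 0" using c by simp
  ultimately have "(\<integral>\<^sup>+x. norm (f (t + c *\<^sub>R x)) \<partial>lborel) < \<infinity>"
    using nn_integral_affine[of "\<lambda>x. ennreal (norm (f x))" c t] c
    by (auto simp: less_top[symmetric] ennreal_mult_eq_top_iff)
  then show ?thesis by (simp add: integrable_iff_bounded)
qed

lemma nn_integral_shift:
  fixes f :: "R3 \<Rightarrow> ennreal"
  assumes "f \<in> borel_measurable borel"
  shows "(\<integral>\<^sup>+x. f (x - y) \<partial>lborel) = (\<integral>\<^sup>+x. f x \<partial>lborel)" "(\<integral>\<^sup>+x. f (y - x) \<partial>lborel) = (\<integral>\<^sup>+x. f x \<partial>lborel)"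
  using nn_integral_affine[OF assms, of 1 "-y"] nn_integral_affine[OF assms, of "-1" "y"] by simp_all

lemma integral_shift:
  fixes f :: "R3 \<Rightarrow> 'b::{banach,second_countable_topology}"
  assumes "f \<in> borel_measurable borel"
  shows "(\<integral>x. f (x - y) \<partial>lborel) = (\<integral>x. f x \<partial>lborel)" "(\<integral>x. f (y - x) \<partial>lborel) = (\<integral>x. f x \<partial>lborel)"
  using integral_affine[OF assms, of 1 "-y"] integral_affine[OF assms, of "-1" "y"] by simp_all

lemma integrable_shift:
  fixes f :: "R3 \<Rightarrow> 'b::{banach,second_countable_topology}"
  assumes "integrable lborel f"
  shows "integrable lborel (\<lambda>x. f (x - y))" "integrable lborel (\<lambda>x. f (y - x))"
  using integrable_affine[OF assms, of 1 "-y"] integrable_affine[OF assms, of "-1" "y"] by simp_all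

lemma norm_integral_le:
  fixes f :: "'a \<Rightarrow> 'b::{banach,second_countable_topology}"
  assumes "integrable M f" "integrable M g" "\<And>x. x \<in> space M \<Longrightarrow> norm (f x) \<le> g x"
  shows "norm (\<integral>x. f x \<partial>M) \<le> (\<integral>x. g x \<partial>M)"
  by (rule order_trans[OF integral_norm_bound integral_mono]) (use assms in auto)

section \<open>Differentiation under the integral sign and integration by parts\<close>

text \<open>Dominated convergence is applied to the difference quotients. The mean value inequality
  on the unit ball around x bounds them by a multiple of g, which is why the hypotheses are local to
  that ball. It serves convolutions and Fourier integrals alike.\<close>

lemma has_derivative_integral:
  fixes F :: "R3 \<Rightarrow> 'a \<Rightarrow> 'b::{banach,second_countable_topology}"
  assumes der: "\<And>z y. norm (z - x) < 1 \<Longrightarrow> y \<in> space M \<Longrightarrow> ((\<lambda>z. F z y) has_derivative F' z y) (at z)"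
    and bd: "\<And>z y v. norm (z - x) < 1 \<Longrightarrow> y \<in> space M \<Longrightarrow> norm (F' z y v) \<le> g y * norm v"
    and g: "integrable M g"
    and int: "\<And>z. norm (z - x) < 1 \<Longrightarrow> integrable M (F z)"
    and meas: "\<And>v. (\<lambda>y. F' x y v) \<in> borel_measurable M"
  shows "((\<lambda>z. \<integral>y. F z y \<partial>M) has_derivative (\<lambda>v. \<integral>y. F' x y v \<partial>M)) (at x)"
proof -
  have x0: "norm (x - x) < 1" by simp
  have bl: "bounded_linear (F' z y)" if "norm (z - x) < 1" "y \<in> space M" for z y
    using der[OF that] by (rule has_derivative_bounded_linear)
  have g0: "0 \<le> g y" if "y \<in> space M" for y
    using order_trans[OF norm_ge_zero bd[OF x0 that, of "axis 1 1"]] by (simp add: norm_axis_1)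
  have intF': "integrable M (\<lambda>y. F' x y v)" for v
  proof (rule Bochner_Integration.integrable_bound[OF integrable_mult_left[OF g, of "norm v"] meas], rule AE_I2)
    fix y assume "y \<in> space M"
    from order_trans[OF bd[OF x0 this, of v] abs_ge_self]
    show "norm (F' x y v) \<le> norm (g y * norm v)" by (simp only: real_norm_def)
  qed
  have lip: "norm (F (x + v) y - F x y) \<le> g y * norm v" if v: "norm v < 1" and y: "y \<in> space M" for v y
  proof -
    have "norm (F (x + v) y - F x y) \<le> g y * norm ((x + v) - x)"
    proof (rule differentiable_bound[of "ball x 1" "\<lambda>z. F z y" "\<lambda>z. F' z y"])
      show "((\<lambda>z. F z y) has_derivative F' z y) (at z within ball x 1)" if "z \<in> ball x 1" for z
        using der[of z y] that y by (auto simp: dist_norm norm_minus_commute intro: has_derivative_at_withinI)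
      show "onorm (F' z y) \<le> g y" if "z \<in> ball x 1" for z
        using bd[of z y] that y g0[OF y] by (intro onorm_bound) (auto simp: dist_norm norm_minus_commute)
    qed (use v in \<open>auto simp: dist_norm\<close>)
    then show ?thesis by simp
  qed
  show ?thesis unfolding has_derivative_at
  proof
    show "bounded_linear (\<lambda>v. \<integral>y. F' x y v \<partial>M)"
    proof (rule bounded_linear_intro[where K="\<integral>y. g y \<partial>M"])
      fix v w
      show "(\<integral>y. F' x y (v + w) \<partial>M) = (\<integral>y. F' x y v \<partial>M) + (\<integral>y. F' x y w \<partial>M)"
        by (subst Bochner_Integration.integral_add[OF intF' intF', symmetric])
           (rule Bochner_Integration.integral_cong[OF refl], rule linear_add[OF bounded_linear.linear[OF bl[OF x0]]])
    next
      fix r v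
      show "(\<integral>y. F' x y (r *\<^sub>R v) \<partial>M) = r *\<^sub>R (\<integral>y. F' x y v \<partial>M)"
        by (subst Bochner_Integration.integral_scaleR_right[symmetric])
           (rule Bochner_Integration.integral_cong[OF refl], rule linear_scale[OF bounded_linear.linear[OF bl[OF x0]]])
    next
      fix v
      have "norm (\<integral>y. F' x y v \<partial>M) \<le> (\<integral>y. g y * norm v \<partial>M)"
        by (rule norm_integral_le[OF intF' integrable_mult_left[OF g]]) (rule bd[OF x0])
      then show "norm (\<integral>y. F' x y v \<partial>M) \<le> norm v * (\<integral>y. g y \<partial>M)" by (simp add: mult.commute)
    qed
    show "((\<lambda>h. norm ((\<integral>y. F (x + h) y \<partial>M) - (\<integral>y. F x y \<partial>M) - (\<integral>y. F' x y h \<partial>M)) / norm h) \<longlongrightarrow> 0) (at 0)"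
      unfolding tendsto_at_iff_sequentially
    proof (intro allI impI)
      fix X :: "nat \<Rightarrow> R3" assume X: "\<forall>i. X i \<in> UNIV - {0}" "X \<longlonglongrightarrow> 0"
      then obtain N where N: "\<And>n. n \<ge> N \<Longrightarrow> norm (X n) < 1"
        using LIMSEQ_D[of X 0 1] by auto
      \<comment> \<open>Discarding the first N terms keeps every x + X n in the unit ball around x;
        \<open>LIMSEQ_offset\<close> restores them at the end.\<close>
      define Y where "Y n = X (n + N)" for n
      have Y: "Y n \<noteq> 0" "norm (Y n) < 1" for n using X(1) N by (auto simp: Y_def)
      have Y0: "Y \<longlonglongrightarrow> 0" using X(2) unfolding Y_def by (rule LIMSEQ_ignore_initial_segment)
      let ?q = "\<lambda>n y. F (x + Y n) y - F x y - F' x y (Y n)"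
      have qi: "integrable M (?q n)" for n
        using Y(2)[of n] by (intro Bochner_Integration.integrable_diff int intF') simp_all
      have qb: "norm (?q n y) \<le> 2 * g y * norm (Y n)" if "y \<in> space M" for n y
        using norm_triangle_ineq4[of "F (x + Y n) y - F x y" "F' x y (Y n)"]
          lip[OF Y(2) that, of n] bd[OF x0 that, of "Y n"] by linarith
      have lim: "(\<lambda>n. \<integral>y. norm (?q n y) / norm (Y n) \<partial>M) \<longlonglongrightarrow> (\<integral>y. 0 \<partial>M)"
      proof (rule integral_dominated_convergence[where w="\<lambda>y. 2 * g y"])
        show "(\<lambda>y. norm (?q n y) / norm (Y n)) \<in> borel_measurable M" for n
          using qi[of n] by auto
        show "AE y in M. norm (norm (?q n y) / norm (Y n)) \<le> 2 * g y" for n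
        proof (rule AE_I2)
          fix y assume "y \<in> space M"
          from qb[OF this, of n] show "norm (norm (?q n y) / norm (Y n)) \<le> 2 * g y"
            using Y(1)[of n] by (simp add: divide_le_eq)
        qed
        show "AE y in M. (\<lambda>n. norm (?q n y) / norm (Y n)) \<longlonglongrightarrow> 0"
        proof (rule AE_I2)
          fix y assume y: "y \<in> space M"
          from der[OF x0 y] have "((\<lambda>h. norm (F (x + h) y - F x y - F' x y h) / norm h) \<longlongrightarrow> 0) (at 0)"
            by (simp add: has_derivative_at)
          then show "(\<lambda>n. norm (?q n y) / norm (Y n)) \<longlonglongrightarrow> 0"
            using Y Y0 unfolding tendsto_at_iff_sequentially o_def by auto
        qed
      qed (use g in auto)
      have "norm (norm ((\<integral>y. F (x + Y n) y \<partial>M) - (\<integral>y. F x y \<partial>M) - (\<integral>y. F' x y (Y n) \<partial>M)) / norm (Y n))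
           \<le> (\<integral>y. norm (?q n y) / norm (Y n) \<partial>M)" for n
      proof -
        have i1: "integrable M (F (x + Y n))" "integrable M (F x)"
          using Y(2)[of n] int[OF x0] by (auto intro!: int)
        have "(\<integral>y. F (x + Y n) y \<partial>M) - (\<integral>y. F x y \<partial>M) - (\<integral>y. F' x y (Y n) \<partial>M) = (\<integral>y. ?q n y \<partial>M)"
          by (simp only: Bochner_Integration.integral_diff[OF Bochner_Integration.integrable_diff[OF i1] intF']
               Bochner_Integration.integral_diff[OF i1])
        moreover have "norm (\<integral>y. ?q n y \<partial>M) \<le> (\<integral>y. norm (?q n y) \<partial>M)"
          by (rule integral_norm_bound)
        ultimately show ?thesis by (simp add: divide_right_mono)
      qed
      then have "(\<lambda>n. norm ((\<integral>y. F (x + Y n) y \<partial>M) - (\<integral>y. F x y \<partial>M) - (\<integral>y. F' x y (Y n) \<partial>M)) / norm (Y n)) \<longlonglongrightarrow> 0"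
        using lim[unfolded Bochner_Integration.integral_zero]
        by (rule Lim_null_comparison[OF always_eventually[OF allI]])
      then show "((\<lambda>h. norm ((\<integral>y. F (x + h) y \<partial>M) - (\<integral>y. F x y \<partial>M) - (\<integral>y. F' x y h \<partial>M)) / norm h) \<circ> X) \<longlonglongrightarrow> 0"
        unfolding o_def Y_def by (rule LIMSEQ_offset)
    qed
  qed
qed

text \<open>The integral of F(x + e) - F(x) vanishes by translation invariance. By the fundamental
  theorem of calculus and Fubini it is also the integral over s in [0,1] of translates of
  \<open>partial i F\<close>, all of which have the same integral. Boundary terms at infinity never
  arise.\<close>

lemma integral_partial_eq_0:
  fixes F :: "R3 \<Rightarrow> 'b::euclidean_space"
  assumes F: "\<And>x. F differentiable (at x)" and c: "continuous_on UNIV (partial i F)"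
    and iF: "integrable lborel F" and ig: "integrable lborel (partial i F)"
  shows "(\<integral>x. partial i F x \<partial>lborel) = 0"
proof -
  define e :: R3 where "e = axis i 1"
  let ?g = "partial i F"
  have g[measurable]: "?g \<in> borel_measurable borel" using ig by auto
  have Fm: "F \<in> borel_measurable borel" using iF by auto
  have ftc: "(\<integral>s. indicator {0..1} s *\<^sub>R ?g (x + s *\<^sub>R e) \<partial>lborel) = F (x + e) - F x" for x
  proof -
    have "(\<integral>s. indicator {0..1} s *\<^sub>R ?g (x + s *\<^sub>R e) \<partial>lborel) = F (x + 1 *\<^sub>R e) - F (x + 0 *\<^sub>R e)"
    proof (rule integral_FTC_atLeastAtMost)
      fix s :: real
      have "((\<lambda>s. x + s *\<^sub>R e) has_derivative (\<lambda>t. t *\<^sub>R e)) (at s within {0..1})"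
        by (auto intro!: derivative_eq_intros)
      from has_derivative_compose[OF this has_derivative_partial[OF F]]
      have "((\<lambda>s. F (x + s *\<^sub>R e)) has_derivative (\<lambda>t. \<Sum>k\<in>UNIV. (t *\<^sub>R e) $ k *\<^sub>R partial k F (x + s *\<^sub>R e))) (at s within {0..1})" .
      moreover have "(\<Sum>k\<in>UNIV. (t *\<^sub>R e) $ k *\<^sub>R partial k F (x + s *\<^sub>R e)) = t *\<^sub>R ?g (x + s *\<^sub>R e)" for t
        by (subst sum.remove[of UNIV i]) (auto simp: e_def axis_def intro!: sum.neutral)
      ultimately show "((\<lambda>s. F (x + s *\<^sub>R e)) has_vector_derivative ?g (x + s *\<^sub>R e)) (at s within {0..1})"
        by (simp add: has_vector_derivative_def)
    next
      show "continuous_on {0..1} (\<lambda>s. ?g (x + s *\<^sub>R e))"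
        by (rule continuous_on_compose2[OF c]) (auto intro!: continuous_intros)
    qed simp
    then show ?thesis by simp
  qed
  have sh: "(\<integral>x. ?g (x + s *\<^sub>R e) \<partial>lborel) = (\<integral>x. ?g x \<partial>lborel)" for s
    using integral_shift(1)[OF g, of "- s *\<^sub>R e"] by simp
  have nsh: "(\<integral>x. norm (?g (x + s *\<^sub>R e)) \<partial>lborel) = (\<integral>x. norm (?g x) \<partial>lborel)" for s
    using integral_shift(1)[of "\<lambda>x. norm (?g x)" "- s *\<^sub>R e"] by simp
  have ish: "integrable lborel (\<lambda>x. ?g (x + s *\<^sub>R e))" for s
    using integrable_shift(1)[OF ig, of "- s *\<^sub>R e"] by simp
  have pm: "(\<lambda>(s, x). indicator {0..1} s *\<^sub>R ?g (x + s *\<^sub>R e)) \<in> borel_measurable (lborel \<Otimes>\<^sub>M lborel)"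
    by measurable
  have "integrable (lborel \<Otimes>\<^sub>M lborel) (\<lambda>(s::real, x). indicator {0..1} s *\<^sub>R ?g (x + s *\<^sub>R e))"
  proof (rule lborel_pair.Fubini_integrable[OF pm])
    have "(\<lambda>s::real. \<integral>y. norm (indicator {0..1} s *\<^sub>R ?g (y + s *\<^sub>R e)) \<partial>lborel)
       = (\<lambda>s. indicator {0..1} s *\<^sub>R (\<integral>x. norm (?g x) \<partial>lborel))"
      by (auto simp: fun_eq_iff indicator_def nsh)
    then show "integrable lborel (\<lambda>s::real. \<integral>y. norm (case (s, y) of (s, x) \<Rightarrow> indicator {0..1} s *\<^sub>R ?g (x + s *\<^sub>R e)) \<partial>lborel)"
      by simp
    show "AE s::real in lborel. integrable lborel (\<lambda>y. case (s, y) of (s, x) \<Rightarrow> indicator {0..1} s *\<^sub>R ?g (x + s *\<^sub>R e))"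
      using ish by auto
  qed
  from lborel_pair.Fubini_integral[OF this]
  have "(\<integral>x. (\<integral>s. indicator {0..1} s *\<^sub>R ?g (x + s *\<^sub>R e) \<partial>(lborel::real measure)) \<partial>lborel)
     = (\<integral>s. (\<integral>x. indicator {0..1} s *\<^sub>R ?g (x + s *\<^sub>R e) \<partial>lborel) \<partial>(lborel::real measure))" .
  also have "\<dots> = (\<integral>s. indicator {0..1::real} s *\<^sub>R (\<integral>x. ?g x \<partial>lborel) \<partial>lborel)"
    by (intro Bochner_Integration.integral_cong refl) (simp add: sh)
  also have "\<dots> = (\<integral>x. ?g x \<partial>lborel)" by simp
  also have "(\<integral>x. (\<integral>s. indicator {0..1} s *\<^sub>R ?g (x + s *\<^sub>R e) \<partial>(lborel::real measure)) \<partial>lborel)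
     = (\<integral>x. F (x + e) - F x \<partial>lborel)" by (simp add: ftc)
  also have "\<dots> = 0"
    using integral_shift(1)[OF Fm, of "-e"] integrable_shift(1)[OF iF, of "-e"] iF by simp
  finally show ?thesis by simp
qed

section \<open>A polynomial weight and convolution with Schwartz kernels\<close>

lemma one_plus_norm_pos [simp]: "0 < 1 + norm x" "1 + norm x \<noteq> 0"
  by (smt (verit) norm_ge_zero)+

text \<open>The exponent 6 is twice the dimension: the weight then lies below the product over the
  three coordinates of 1/(1 + t^2) and is integrable.\<close>

definition wt :: "R3 \<Rightarrow> real" where "wt x = 1 / (1 + norm x) ^ 6"

lemma wt_nonneg: "0 \<le> wt x"
  by (simp add: wt_def)

lemma wt_measurable [measurable]: "wt \<in> borel_measurable borel"
  unfolding wt_def by measurable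

lemma wt_integrable: "integrable lborel wt"
proof -
  have "set_integrable lborel (einterval (-\<infinity>) \<infinity>) (\<lambda>x::real. inverse (1 + x^2))"
    by (rule integrable_inverse_1_plus_square)
  then have "integrable lborel (\<lambda>x::real. inverse (1 + x^2))"
    by (simp add: set_integrable_def)
  then have fin: "(\<integral>\<^sup>+x. ennreal (inverse (1 + (x::real)^2)) \<partial>lborel) < \<infinity>"
    by (simp add: integrable_iff_bounded)
  have "(\<integral>\<^sup>+x. ennreal (wt x) \<partial>lborel) \<le> (\<integral>\<^sup>+x. (\<Prod>b\<in>(Basis :: R3 set). ennreal (inverse (1 + (x \<bullet> b)^2))) \<partial>lborel)"
  proof (rule nn_integral_mono)
    fix x :: R3
    have "(\<Prod>b\<in>(Basis :: R3 set). 1 + (x \<bullet> b)^2) \<le> (\<Prod>b\<in>(Basis :: R3 set). (1 + norm x)^2)"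
    proof (rule prod_mono)
      fix b :: R3 assume b: "b \<in> Basis"
      have "(x \<bullet> b)^2 \<le> (norm x)^2" using Basis_le_norm[OF b, of x] by (metis abs_ge_zero power2_abs power_mono)
      also have "1 + (norm x)^2 \<le> (1 + norm x)^2" by (simp add: power2_sum)
      finally show "0 \<le> 1 + (x \<bullet> b)^2 \<and> 1 + (x \<bullet> b)^2 \<le> (1 + norm x)^2" by simp
    qed
    also have "\<dots> = (1 + norm x) ^ 6" by (simp add: power_mult[symmetric])
    finally have "1 / (1 + norm x) ^ 6 \<le> 1 / (\<Prod>b\<in>(Basis :: R3 set). 1 + (x \<bullet> b)^2)"
      by (intro divide_left_mono mult_pos_pos prod_pos) (auto simp: add_pos_nonneg)
    then show "ennreal (wt x) \<le> (\<Prod>b\<in>(Basis :: R3 set). ennreal (inverse (1 + (x \<bullet> b)^2)))"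
      by (subst prod_ennreal) (auto simp: wt_def prod_inversef[symmetric] inverse_eq_divide o_def prod_dividef intro!: ennreal_leI)
  qed
  also have "\<dots> = (\<Prod>b\<in>(Basis :: R3 set). (\<integral>\<^sup>+x. ennreal (inverse (1 + (x::real)^2)) \<partial>lborel))"
    by (rule nn_integral_lborel_prod) auto
  also have "\<dots> < \<infinity>" using fin by (simp add: less_top[symmetric] power_eq_top_ennreal)
  finally show ?thesis by (simp add: integrable_iff_bounded wt_nonneg)
qed

text \<open>Peetre's inequality with exponent one. It recentres a weight at the cost of a polynomial
  factor, so that a kernel at x - y can be dominated by a weight in y alone.\<close>

lemma one_plus_norm_le: "1 + norm y \<le> (1 + norm x) * (1 + norm (x - y :: 'a::real_normed_vector))"
proof -
  have "norm y \<le> norm x + norm (x - y)" by (metis norm_minus_commute norm_triangle_sub)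
  moreover have "0 \<le> norm x * norm (x - y)" by simp
  ultimately show ?thesis unfolding distrib_left distrib_right by linarith
qed

lemma wt_shift: "wt (x - y) \<le> (1 + norm x) ^ 6 * wt y"
proof -
  have "(1 + norm y) ^ 6 \<le> ((1 + norm x) * (1 + norm (x - y))) ^ 6"
    by (intro power_mono one_plus_norm_le) auto
  then have "1 * (1 + norm y) ^ 6 \<le> (1 + norm x) ^ 6 * (1 + norm (x - y)) ^ 6"
    by (simp add: power_mult_distrib)
  then have "1 / (1 + norm (x - y)) ^ 6 \<le> (1 + norm x) ^ 6 / (1 + norm y) ^ 6"
    by (simp add: divide_le_eq pos_le_divide_eq mult.commute)
  then show ?thesis by (simp add: wt_def)
qed

lemma wt_le_1: "wt y \<le> 1"
  by (simp add: wt_def one_le_power)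

lemma schwartz_wt:
  assumes "schwartz k"
  obtains C where "C > 0" "\<And>x. norm (k x) \<le> C * wt x"
  using schwartz_bound[OF assms, of 6] by (auto simp: wt_def)

lemma schwartz_measurable: "schwartz (f :: R3 \<Rightarrow> 'b::{real_normed_vector,second_countable_topology}) \<Longrightarrow> f \<in> borel_measurable borel"
  by (simp add: schwartz_smooth smooth_measurable)

lemma schwartz_integrable:
  fixes k :: "R3 \<Rightarrow> 'b::{banach,second_countable_topology}"
  assumes "schwartz k" shows "integrable lborel k"
proof -
  obtain C where C: "C > 0" "\<And>x. norm (k x) \<le> C * wt x" using schwartz_wt[OF assms] by blast
  show ?thesis
    by (rule Bochner_Integration.integrable_bound[OF integrable_mult_right[OF wt_integrable, of C]])
       (use C schwartz_measurable[OF assms] in \<open>auto intro!: AE_I2 order_trans[OF C(2) abs_ge_self]\<close>)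
qed

definition conv :: "(R3 \<Rightarrow> real) \<Rightarrow> (R3 \<Rightarrow> real) \<Rightarrow> R3 \<Rightarrow> real" where
  "conv k u x = (\<integral>y. k (x - y) * u y \<partial>lborel)"

text \<open>A common domain for convolution with every Schwartz kernel; it contains integrable,
  bounded and square integrable functions (\<open>tame_integrable\<close>,
  \<open>tame_bounded\<close>, \<open>tame_LP2\<close>).\<close>

definition tame :: "(R3 \<Rightarrow> real) \<Rightarrow> bool" where
  "tame u \<longleftrightarrow> u \<in> borel_measurable borel \<and> integrable lborel (\<lambda>y. wt y * \<bar>u y\<bar>)"

lemma tame_measurable: "tame u \<Longrightarrow> u \<in> borel_measurable borel"
  by (simp add: tame_def)

lemma conv_integrable:
  assumes k: "schwartz k" and u: "tame u"
  shows "integrable lborel (\<lambda>y. k (x - y) * u y)"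
proof -
  obtain C where C: "C > 0" "\<And>x. norm (k x) \<le> C * wt x" using schwartz_wt[OF k] by blast
  note [measurable] = schwartz_measurable[OF k] tame_measurable[OF u]
  have ui: "integrable lborel (\<lambda>y. wt y * \<bar>u y\<bar>)" using u by (simp add: tame_def)
  show ?thesis
  proof (rule Bochner_Integration.integrable_bound[OF integrable_mult_right[OF ui, of "C * (1 + norm x) ^ 6"]])
    have "\<bar>k (x - y)\<bar> \<le> C * ((1 + norm x) ^ 6 * wt y)" for y
      using order_trans[OF C(2)[of "x - y"] mult_left_mono[OF wt_shift[of x y] less_imp_le[OF C(1)]]]
      by (simp only: real_norm_def)
    then have "\<bar>k (x - y)\<bar> * \<bar>u y\<bar> \<le> C * ((1 + norm x) ^ 6 * wt y) * \<bar>u y\<bar>" for y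
      by (rule mult_right_mono) simp
    then show "AE y in lborel. norm (k (x - y) * u y) \<le> norm (C * (1 + norm x) ^ 6 * (wt y * \<bar>u y\<bar>))"
      using C(1) wt_nonneg by (auto intro!: AE_I2 simp: abs_mult mult_ac)
  qed measurable
qed

lemma conv_has_derivative:
  assumes k: "schwartz k" and u: "tame u"
  shows "(conv k u has_derivative (\<lambda>v. \<integral>y. (\<Sum>i\<in>UNIV. v $ i * partial i k (x - y)) * u y \<partial>lborel)) (at x)"
proof -
  have "\<exists>C>0. \<forall>x. norm (partial i k x) \<le> C * wt x" for i
    using schwartz_wt[OF schwartz_partial[OF k, of i]] by blast
  then obtain C where C: "\<And>i. C i > 0" "\<And>i x. norm (partial i k x) \<le> C i * wt x" by metis
  define D where "D = (\<Sum>i\<in>UNIV. C i)"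
  have D: "D \<ge> 0" unfolding D_def using C(1) by (intro sum_nonneg) (auto intro: less_imp_le)
  note [measurable] = schwartz_measurable[OF k] tame_measurable[OF u] schwartz_measurable[OF schwartz_partial[OF k]]
  have ui: "integrable lborel (\<lambda>y. wt y * \<bar>u y\<bar>)" using u by (simp add: tame_def)
  show ?thesis unfolding conv_def
  proof (rule has_derivative_integral[where F="\<lambda>z y. k (z - y) * u y" and F'="\<lambda>z y v. (\<Sum>i\<in>UNIV. v $ i * partial i k (z - y)) * u y"
        and g="\<lambda>y. D * (2 + norm x) ^ 6 * (wt y * \<bar>u y\<bar>)"])
    fix z y :: R3
    have s: "((\<lambda>z. z - y) has_derivative (\<lambda>v. v)) (at z)" by (auto intro!: derivative_eq_intros)
    have "((\<lambda>z. k (z - y)) has_derivative (\<lambda>v. \<Sum>i\<in>UNIV. v $ i *\<^sub>R partial i k (z - y))) (at z)"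
      by (rule has_derivative_compose[OF s has_derivative_partial[OF smooth_differentiable[OF schwartz_smooth[OF k]]]])
    from has_derivative_mult_left[OF this, of "u y"]
    show "((\<lambda>z. k (z - y) * u y) has_derivative (\<lambda>v. (\<Sum>i\<in>UNIV. v $ i * partial i k (z - y)) * u y)) (at z)"
      by simp
  next
    fix z y v :: R3 assume z: "norm (z - x) < 1"
    have "norm z \<le> norm (z - x) + norm x" by (metis diff_add_cancel norm_triangle_ineq)
    \<comment> \<open>Uniformity over the unit ball around x is where the base 2 + norm x of the
      dominating function comes from.\<close>
    then have nz: "1 + norm z \<le> 2 + norm x" using z by simp
    have "\<bar>\<Sum>i\<in>UNIV. v $ i * partial i k (z - y)\<bar> \<le> (\<Sum>i\<in>UNIV. norm v * (C i * wt (z - y)))"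
    proof (rule order_trans[OF sum_abs sum_mono])
      fix i show "\<bar>v $ i * partial i k (z - y)\<bar> \<le> norm v * (C i * wt (z - y))"
        unfolding abs_mult using component_le_norm_cart[of v i] C(2)[of i "z - y"]
        by (intro mult_mono) auto
    qed
    also have "\<dots> = norm v * D * wt (z - y)"
      by (simp add: D_def sum_distrib_left sum_distrib_right mult.assoc)
    also have "\<dots> \<le> norm v * D * ((2 + norm x) ^ 6 * wt y)"
    proof (rule mult_left_mono)
      have "wt (z - y) \<le> (1 + norm z) ^ 6 * wt y" by (rule wt_shift)
      also have "\<dots> \<le> (2 + norm x) ^ 6 * wt y"
        by (intro mult_right_mono power_mono nz wt_nonneg) auto
      finally show "wt (z - y) \<le> (2 + norm x) ^ 6 * wt y" .
    qed (use D in auto)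
    finally have "\<bar>\<Sum>i\<in>UNIV. v $ i * partial i k (z - y)\<bar> * \<bar>u y\<bar> \<le> norm v * D * ((2 + norm x) ^ 6 * wt y) * \<bar>u y\<bar>"
      by (rule mult_right_mono) simp
    then show "norm ((\<Sum>i\<in>UNIV. v $ i * partial i k (z - y)) * u y) \<le> D * (2 + norm x) ^ 6 * (wt y * \<bar>u y\<bar>) * norm v"
      by (simp add: abs_mult mult_ac)
  next
    show "integrable lborel (\<lambda>y. D * (2 + norm x) ^ 6 * (wt y * \<bar>u y\<bar>))"
      by (rule integrable_mult_right[OF ui])
    show "integrable lborel (\<lambda>y. k (z - y) * u y)" for z by (rule conv_integrable[OF k u])
    show "(\<lambda>y. (\<Sum>i\<in>UNIV. v $ i * partial i k (x - y)) * u y) \<in> borel_measurable lborel" for v by measurable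
  qed
qed

lemma partial_conv:
  assumes k: "schwartz k" and u: "tame u"
  shows "partial i (conv k u) = conv (partial i k) u"
proof
  fix x
  have "(\<Sum>j\<in>UNIV. (axis i (1::real) :: R3) $ j * partial j k z) = partial i k z" for z
    by (subst sum.remove[of UNIV i]) (auto simp: axis_def intro!: sum.neutral)
  with partialI[OF conv_has_derivative[OF k u, of x], of i]
  show "partial i (conv k u) x = conv (partial i k) u x" by (simp add: conv_def)
qed

lemma conv_differentiable:
  assumes k: "schwartz k" and u: "tame u" shows "conv k u differentiable (at x)"
  using conv_has_derivative[OF assms] by (auto simp: differentiable_def)

lemma smooth_conv:
  assumes k: "schwartz k" and u: "tame u" shows "smooth (conv k u)"
proof (rule smooth_coinduct[where P="\<lambda>F. \<exists>k. schwartz k \<and> F = conv k u"], goal_cases)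
  case 1 show ?case using k by blast
next
  case (2 f x) then show ?case using conv_differentiable[OF _ u] by blast
next
  case (3 f i) then show ?case using partial_conv[OF _ u] schwartz_partial by blast
qed

lemma conv_measurable: 
  assumes "schwartz k" "tame u" shows "conv k u \<in> borel_measurable borel"
  by (rule smooth_measurable[OF smooth_conv[OF assms]])

lemma conv_commute:
  assumes [measurable]: "k \<in> borel_measurable borel" "u \<in> borel_measurable borel"
  shows "conv k u x = (\<integral>y. k y * u (x - y) \<partial>lborel)"
  unfolding conv_def using integral_shift(2)[of "\<lambda>y. k (x - y) * u y" x] by simp

text \<open>The variable y stays in the ball of radius R, so decay in x - y is decay in x up to the
  factor (1 + R)^n. Truncated fields become Schwartz test fields in this way.\<close>

lemma schwartz_conv_bounded_support:
  assumes k: "schwartz k" and u: "integrable lborel u" "\<And>y. norm y > R \<Longrightarrow> u y = 0" and R: "R \<ge> 0"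
  shows "tame u" "schwartz (conv k u)"
proof -
  have [measurable]: "u \<in> borel_measurable borel" using u(1) by auto
  show t: "tame u" unfolding tame_def
  proof
    show "integrable lborel (\<lambda>y. wt y * \<bar>u y\<bar>)"
    proof (rule Bochner_Integration.integrable_bound[OF u(1)])
      show "AE x in lborel. norm (wt x * \<bar>u x\<bar>) \<le> norm (u x)"
        using mult_right_mono[OF wt_le_1 abs_ge_zero] wt_nonneg by (auto intro!: AE_I2 simp: abs_mult)
    qed measurable
  qed measurable
  show "schwartz (conv k u)"
  proof (rule schwartz_coinduct[where P="\<lambda>F. \<exists>k. schwartz k \<and> F = conv k u"], goal_cases)
    case 1 show ?case using k by blast
  next
    case (2 f x) then show ?case using conv_differentiable[OF _ t] by blast
  next
    case (3 f i) then show ?case using partial_conv[OF _ t] schwartz_partial by blast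
  next
    case (4 f n)
    then obtain k where k: "schwartz k" and f: "f = conv k u" by blast
    obtain C where C: "C > 0" "\<And>x. norm (k x) \<le> C / (1 + norm x) ^ n" using schwartz_bound[OF k] by blast
    have "(1 + norm x) ^ n * norm (f x) \<le> (\<integral>y. C * (1 + R) ^ n * \<bar>u y\<bar> \<partial>lborel)" for x
    proof -
      have "norm (\<integral>y. (1 + norm x) ^ n * (k (x - y) * u y) \<partial>lborel) \<le> (\<integral>y. C * (1 + R) ^ n * \<bar>u y\<bar> \<partial>lborel)"
      proof (rule norm_integral_le)
        fix y
        show "norm ((1 + norm x) ^ n * (k (x - y) * u y)) \<le> C * (1 + R) ^ n * \<bar>u y\<bar>"
        proof (cases "norm y > R")
          case False
          have "(1 + norm x) ^ n \<le> ((1 + norm y) * (1 + norm (x - y))) ^ n"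
            using one_plus_norm_le[of x y] by (intro power_mono) (auto simp: norm_minus_commute)
          also have "\<dots> \<le> ((1 + R) * (1 + norm (x - y))) ^ n"
            using False by (intro power_mono mult_right_mono) auto
          finally have "(1 + norm x) ^ n * \<bar>k (x - y)\<bar> \<le> ((1 + R) * (1 + norm (x - y))) ^ n * (C / (1 + norm (x - y)) ^ n)"
            using C(2)[of "x - y"] R by (intro mult_mono) auto
          also have "\<dots> = C * (1 + R) ^ n"
            by (simp add: power_mult_distrib add_nonneg_eq_0_iff)
          finally have "(1 + norm x) ^ n * \<bar>k (x - y)\<bar> * \<bar>u y\<bar> \<le> C * (1 + R) ^ n * \<bar>u y\<bar>"
            by (rule mult_right_mono) simp
          then show ?thesis by (simp add: abs_mult power_abs mult.assoc)
        qed (use u(2) in simp)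
      qed (use conv_integrable[OF k t] u(1) in auto)
      then show ?thesis by (simp add: f conv_def abs_mult power_abs)
    qed
    then show ?case by blast
  qed
qed

section \<open>Bounds in Lebesgue spaces\<close>

text \<open>The norm bound is a predicate, so that measurability, membership and bound travel
  together and Minkowski, Young and Fatou become closure rules. The condition 0 \<le> A is explicit
  because an even power would hide a sign.\<close>

definition LP :: "nat \<Rightarrow> (R3 \<Rightarrow> real) \<Rightarrow> real \<Rightarrow> bool" where
  "LP p f A \<longleftrightarrow> f \<in> borel_measurable borel \<and> 0 \<le> A \<and> (\<integral>\<^sup>+x. ennreal (\<bar>f x\<bar> ^ p) \<partial>lborel) \<le> ennreal (A ^ p)"

lemma LP_measurable: "LP p f A \<Longrightarrow> f \<in> borel_measurable borel"
  and LP_nonneg: "LP p f A \<Longrightarrow> 0 \<le> A"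
  and LP_le: "LP p f A \<Longrightarrow> (\<integral>\<^sup>+x. ennreal (\<bar>f x\<bar> ^ p) \<partial>lborel) \<le> ennreal (A ^ p)"
  by (auto simp: LP_def)

lemma LP_integrable: "LP p f A \<Longrightarrow> integrable lborel (\<lambda>x. \<bar>f x\<bar> ^ p)"
  by (rule integrableI_nonneg) (auto simp: LP_def intro: le_less_trans)

lemma LP_integral_le:
  assumes "LP p f A" shows "(\<integral>x. \<bar>f x\<bar> ^ p \<partial>lborel) \<le> A ^ p"
proof -
  have "ennreal (\<integral>x. \<bar>f x\<bar> ^ p \<partial>lborel) = (\<integral>\<^sup>+x. ennreal (\<bar>f x\<bar> ^ p) \<partial>lborel)"
    using LP_integrable[OF assms] by (subst nn_integral_eq_integral) auto
  with LP_le[OF assms] have "ennreal (\<integral>x. \<bar>f x\<bar> ^ p \<partial>lborel) \<le> ennreal (A ^ p)" by simp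
  then show ?thesis using LP_nonneg[OF assms] by (subst (asm) ennreal_le_iff) auto
qed

lemma LPI:
  assumes "f \<in> borel_measurable borel" "integrable lborel (\<lambda>x. \<bar>f x\<bar> ^ p)" "0 \<le> A" "(\<integral>x. \<bar>f x\<bar> ^ p \<partial>lborel) \<le> A ^ p"
  shows "LP p f A"
  unfolding LP_def using assms by (auto simp: nn_integral_eq_integral intro: ennreal_leI)

lemma LP_mono: "LP p f A \<Longrightarrow> A \<le> B \<Longrightarrow> LP p f B"
  unfolding LP_def by (auto intro!: ennreal_leI power_mono elim!: order_trans)

lemma LP_mono_abs:
  assumes "LP p f A" "g \<in> borel_measurable borel" "\<And>x. \<bar>g x\<bar> \<le> \<bar>f x\<bar>"
  shows "LP p g A"
  unfolding LP_def using assms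
  by (auto simp: LP_def intro!: order_trans[OF nn_integral_mono[OF ennreal_leI[OF power_mono[OF assms(3)]]]])

lemma LP_cmult:
  assumes "LP p f A" shows "LP p (\<lambda>x. c * f x) (\<bar>c\<bar> * A)"
proof -
  have [measurable]: "f \<in> borel_measurable borel" using assms by (rule LP_measurable)
  have "(\<integral>\<^sup>+x. ennreal (\<bar>c * f x\<bar> ^ p) \<partial>lborel) = (\<integral>\<^sup>+x. ennreal (\<bar>c\<bar> ^ p) * ennreal (\<bar>f x\<bar> ^ p) \<partial>lborel)"
    by (simp add: abs_mult power_mult_distrib ennreal_mult)
  also have "\<dots> = ennreal (\<bar>c\<bar> ^ p) * (\<integral>\<^sup>+x. ennreal (\<bar>f x\<bar> ^ p) \<partial>lborel)"
    by (rule nn_integral_cmult) measurable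
  also have "\<dots> \<le> ennreal (\<bar>c\<bar> ^ p) * ennreal (A ^ p)" using LP_le[OF assms] by (rule mult_left_mono) simp
  also have "\<dots> = ennreal ((\<bar>c\<bar> * A) ^ p)"
    using LP_nonneg[OF assms] by (simp add: power_mult_distrib ennreal_mult)
  finally show ?thesis using LP_nonneg[OF assms] by (simp add: LP_def)
qed

lemma LP_uminus: "LP p f A \<Longrightarrow> LP p (\<lambda>x. - f x) A"
  using LP_cmult[of p f A "-1"] by simp

text \<open>Minkowski's inequality is proved by dividing by the bounds, and an infimum over
  representatives need not be attained. In both situations the estimate is first obtained with A +
  \<epsilon>.\<close>

lemma LP_limit:
  assumes "\<And>\<epsilon>. \<epsilon> > 0 \<Longrightarrow> LP p f (A + \<epsilon>)" "A \<ge> 0"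
  shows "LP p f A"
proof -
  have "(\<lambda>n. ennreal ((A + inverse (real (Suc n))) ^ p)) \<longlonglongrightarrow> ennreal ((A + 0) ^ p)"
    by (intro tendsto_intros LIMSEQ_inverse_real_of_nat)
  then have "(\<integral>\<^sup>+x. ennreal (\<bar>f x\<bar> ^ p) \<partial>lborel) \<le> ennreal ((A + 0) ^ p)"
    using LP_le[OF assms(1)] by (intro LIMSEQ_le_const) auto
  then show ?thesis using assms(2) LP_measurable[OF assms(1)[of 1]] by (simp add: LP_def)
qed

text \<open>Convexity of the power function on the half line, in the form of its supporting line at
  m. The Minkowski and Jensen inequalities below both rest on it.\<close>

lemma power_tangent:
  fixes x m :: real assumes "x \<ge> 0" "m \<ge> 0"
  shows "m ^ Suc n + real (Suc n) * m ^ n * (x - m) \<le> x ^ Suc n"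
proof (induction n)
  case (Suc n)
  have "m ^ Suc (Suc n) + real (Suc (Suc n)) * m ^ Suc n * (x - m)
     = x * (m ^ Suc n + real (Suc n) * m ^ n * (x - m)) - real (Suc n) * m ^ n * (x - m)\<^sup>2"
    by (simp add: algebra_simps power2_eq_square)
  also have "\<dots> \<le> x * (m ^ Suc n + real (Suc n) * m ^ n * (x - m))" using assms by simp
  also have "\<dots> \<le> x * x ^ Suc n" by (rule mult_left_mono[OF Suc.IH assms(1)])
  finally show ?case by simp
qed simp

lemma power_convex:
  fixes x y a b :: real assumes "x \<ge> 0" "y \<ge> 0" "a \<ge> 0" "b \<ge> 0" "a + b = 1"
  shows "(a * x + b * y) ^ Suc n \<le> a * x ^ Suc n + b * y ^ Suc n"
proof -
  define m where "m = a * x + b * y"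
  have m: "m \<ge> 0" using assms by (simp add: m_def)
  have "a * (m ^ Suc n + real (Suc n) * m ^ n * (x - m)) + b * (m ^ Suc n + real (Suc n) * m ^ n * (y - m))
     \<le> a * x ^ Suc n + b * y ^ Suc n"
    using assms m by (intro add_mono mult_left_mono power_tangent)
  moreover have "a * (m ^ Suc n + real (Suc n) * m ^ n * (x - m)) + b * (m ^ Suc n + real (Suc n) * m ^ n * (y - m))
     = (a + b) * m ^ Suc n + real (Suc n) * m ^ n * (a * x + b * y - (a + b) * m)"
    by (simp add: algebra_simps)
  ultimately show ?thesis by (simp add: assms(5) m_def[symmetric])
qed

text \<open>Minkowski's inequality by normalisation: f + g is A + B times the convex combination of
  f / A and g / B with weights A/(A + B) and B/(A + B), to which \<open>power_convex\<close> applies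
  pointwise. The coefficients \<open>?a\<close> and \<open>?b\<close> collect what the normalisation
  leaves over.\<close>

lemma LP_add_pos:
  assumes "LP (Suc n) f A" "LP (Suc n) g B" "A > 0" "B > 0"
  shows "LP (Suc n) (\<lambda>x. f x + g x) (A + B)"
proof -
  have [measurable]: "f \<in> borel_measurable borel" "g \<in> borel_measurable borel"
    using assms LP_measurable by auto
  let ?s = "A + B" and ?p = "Suc n"
  have s: "?s > 0" using assms by simp
  let ?a = "?s ^ ?p * (A / ?s) / A ^ ?p" and ?b = "?s ^ ?p * (B / ?s) / B ^ ?p"
  have ab: "?a \<ge> 0" "?b \<ge> 0" using assms by auto
  have pw: "\<bar>f x + g x\<bar> ^ ?p \<le> ?a * \<bar>f x\<bar> ^ ?p + ?b * \<bar>g x\<bar> ^ ?p" for x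
  proof -
    have "\<bar>f x + g x\<bar> ^ ?p \<le> (\<bar>f x\<bar> + \<bar>g x\<bar>) ^ ?p" by (intro power_mono) auto
    also have "\<dots> = ?s ^ ?p * ((A / ?s) * (\<bar>f x\<bar> / A) + (B / ?s) * (\<bar>g x\<bar> / B)) ^ ?p"
    proof -
      have "A / ?s * (\<bar>f x\<bar> / A) = \<bar>f x\<bar> / ?s" "B / ?s * (\<bar>g x\<bar> / B) = \<bar>g x\<bar> / ?s" using assms by simp_all
      moreover have "?s * (\<bar>f x\<bar> / ?s + \<bar>g x\<bar> / ?s) = \<bar>f x\<bar> + \<bar>g x\<bar>"
        using s by (simp add: add_divide_distrib[symmetric])
      ultimately show ?thesis by (simp only: power_mult_distrib[symmetric])
    qed
    also have "\<dots> \<le> ?s ^ ?p * ((A / ?s) * (\<bar>f x\<bar> / A) ^ ?p + (B / ?s) * (\<bar>g x\<bar> / B) ^ ?p)"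
    proof (intro mult_left_mono power_convex)
      show "A / ?s + B / ?s = 1" using s by (simp add: add_divide_distrib[symmetric])
    qed (use assms in auto)
    also have "\<dots> = ?a * \<bar>f x\<bar> ^ ?p + ?b * \<bar>g x\<bar> ^ ?p"
      unfolding power_divide distrib_left by simp
    finally show ?thesis .
  qed
  have "(\<integral>\<^sup>+x. ennreal (\<bar>f x + g x\<bar> ^ ?p) \<partial>lborel)
      \<le> (\<integral>\<^sup>+x. ennreal ?a * ennreal (\<bar>f x\<bar> ^ ?p) + ennreal ?b * ennreal (\<bar>g x\<bar> ^ ?p) \<partial>lborel)"
  proof (rule nn_integral_mono)
    fix x
    have "ennreal (\<bar>f x + g x\<bar> ^ ?p) \<le> ennreal (?a * \<bar>f x\<bar> ^ ?p + ?b * \<bar>g x\<bar> ^ ?p)" by (rule ennreal_leI[OF pw])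
    also have "\<dots> = ennreal ?a * ennreal (\<bar>f x\<bar> ^ ?p) + ennreal ?b * ennreal (\<bar>g x\<bar> ^ ?p)"
      using ab by (simp only: ennreal_plus ennreal_mult mult_nonneg_nonneg zero_le_power abs_ge_zero)
    finally show "ennreal (\<bar>f x + g x\<bar> ^ ?p) \<le> ennreal ?a * ennreal (\<bar>f x\<bar> ^ ?p) + ennreal ?b * ennreal (\<bar>g x\<bar> ^ ?p)" .
  qed
  also have "\<dots> = ennreal ?a * (\<integral>\<^sup>+x. ennreal (\<bar>f x\<bar> ^ ?p) \<partial>lborel) + ennreal ?b * (\<integral>\<^sup>+x. ennreal (\<bar>g x\<bar> ^ ?p) \<partial>lborel)"
    by (subst nn_integral_add) (simp_all add: nn_integral_cmult del: power_Suc)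
  also have "\<dots> \<le> ennreal ?a * ennreal (A ^ ?p) + ennreal ?b * ennreal (B ^ ?p)"
    using LP_le[OF assms(1)] LP_le[OF assms(2)] by (intro add_mono mult_left_mono) auto
  also have "\<dots> = ennreal (?a * A ^ ?p + ?b * B ^ ?p)"
    using ab assms by (simp only: ennreal_plus ennreal_mult mult_nonneg_nonneg zero_le_power less_imp_le)
  also have "?a * A ^ ?p + ?b * B ^ ?p = ?s ^ ?p * (A / ?s + B / ?s)"
    using assms by (simp add: distrib_left del: power_Suc)
  also have "A / ?s + B / ?s = 1" using s by (simp add: add_divide_distrib[symmetric])
  finally show ?thesis using s by (simp add: LP_def del: power_Suc)
qed

lemma LP_add:
  assumes "LP p f A" "LP p g B" "p > 0"
  shows "LP p (\<lambda>x. f x + g x) (A + B)"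
proof (rule LP_limit)
  fix \<epsilon> :: real assume e: "\<epsilon> > 0"
  obtain n where n: "p = Suc n" using assms(3) by (cases p) auto
  have "LP (Suc n) f (A + \<epsilon>/2)" "LP (Suc n) g (B + \<epsilon>/2)"
    using LP_mono[OF assms(1), of "A + \<epsilon>/2"] LP_mono[OF assms(2), of "B + \<epsilon>/2"] e n by simp_all
  then have "LP (Suc n) (\<lambda>x. f x + g x) ((A + \<epsilon>/2) + (B + \<epsilon>/2))"
    using e LP_nonneg[OF assms(1)] LP_nonneg[OF assms(2)] by (intro LP_add_pos) auto
  then show "LP p (\<lambda>x. f x + g x) (A + B + \<epsilon>)" by (simp add: n algebra_simps)
qed (use LP_nonneg[OF assms(1)] LP_nonneg[OF assms(2)] in simp)

lemma LP_diff:
  assumes "LP p f A" "LP p g B" "p > 0"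
  shows "LP p (\<lambda>x. f x - g x) (A + B)"
  using LP_add[OF assms(1) LP_uminus[OF assms(2)] assms(3)] by simp

lemma LP_zero: "p > 0 \<Longrightarrow> LP p (\<lambda>x. 0) 0"
  by (simp add: LP_def zero_power)

lemma LP_sum:
  assumes "\<And>a. a \<in> S \<Longrightarrow> LP p (f a) (A a)" "p > 0" "finite S"
  shows "LP p (\<lambda>x. \<Sum>a\<in>S. f a x) (\<Sum>a\<in>S. A a)"
  using assms(3,1)
proof (induction S rule: finite_induct)
  case empty show ?case using LP_zero[OF assms(2)] by simp
next
  case (insert a S)
  then show ?case using LP_add[OF _ _ assms(2), of "f a" "A a"] by simp
qed

lemma LP_shift:
  assumes "LP p f A" shows "LP p (\<lambda>x. f (x - y)) A" "LP p (\<lambda>x. f (y - x)) A"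
proof -
  have [measurable]: "f \<in> borel_measurable borel" using assms by (rule LP_measurable)
  have m: "(\<lambda>x. ennreal (\<bar>f x\<bar> ^ p)) \<in> borel_measurable borel" by measurable
  show "LP p (\<lambda>x. f (x - y)) A" "LP p (\<lambda>x. f (y - x)) A"
    using assms nn_integral_shift[OF m, of y] by (simp_all add: LP_def)
qed

lemma LP_Fatou:
  assumes "\<And>n. LP p (f n) A" "g \<in> borel_measurable borel" "AE x in lborel. (\<lambda>n. f n x) \<longlonglongrightarrow> g x"
  shows "LP p g A"
proof -
  have [measurable]: "f n \<in> borel_measurable borel" for n using assms(1) by (rule LP_measurable)
  have "(\<integral>\<^sup>+x. ennreal (\<bar>g x\<bar> ^ p) \<partial>lborel) = (\<integral>\<^sup>+x. liminf (\<lambda>n. ennreal (\<bar>f n x\<bar> ^ p)) \<partial>lborel)"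
  proof (rule nn_integral_cong_AE)
    show "AE x in lborel. ennreal (\<bar>g x\<bar> ^ p) = liminf (\<lambda>n. ennreal (\<bar>f n x\<bar> ^ p))"
      using assms(3)
    proof eventually_elim
      case (elim x)
      then have "(\<lambda>n. ennreal (\<bar>f n x\<bar> ^ p)) \<longlonglongrightarrow> ennreal (\<bar>g x\<bar> ^ p)"
        by (intro tendsto_intros)
      then show ?case by (rule lim_imp_Liminf[OF trivial_limit_sequentially, symmetric])
    qed
  qed
  also have "\<dots> \<le> liminf (\<lambda>n. \<integral>\<^sup>+x. ennreal (\<bar>f n x\<bar> ^ p) \<partial>lborel)"
    by (rule nn_integral_liminf) measurable
  also have "\<dots> \<le> liminf (\<lambda>n. ennreal (A ^ p))"
    using LP_le[OF assms(1)] by (intro Liminf_mono) auto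
  also have "\<dots> = ennreal (A ^ p)" by (simp add: Liminf_const)
  finally show ?thesis using assms(2) LP_nonneg[OF assms(1)] by (simp add: LP_def)
qed

text \<open>The supporting line of the power at the mean m of |f| under the measure |k| / K is
  integrated, and its linear term cancels. Zero mass and an infinite right-hand side are split off
  first, since m needs K > 0 and a finite mean.\<close>

lemma Jensen_nn_integral:
  fixes k f :: "'a \<Rightarrow> real"
  assumes [measurable]: "k \<in> borel_measurable M" "f \<in> borel_measurable M"
    and C: "C \<ge> 0" "(\<integral>\<^sup>+x. ennreal \<bar>k x\<bar> \<partial>M) \<le> ennreal C"
  shows "(\<integral>\<^sup>+x. ennreal \<bar>k x * f x\<bar> \<partial>M) ^ Suc n \<le> ennreal (C ^ n) * (\<integral>\<^sup>+x. ennreal (\<bar>k x\<bar> * \<bar>f x\<bar> ^ Suc n) \<partial>M)"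
proof (cases "(\<integral>\<^sup>+x. ennreal \<bar>k x\<bar> \<partial>M) = 0")
  case True
  then have "AE x in M. k x = 0" by (subst (asm) nn_integral_0_iff_AE) auto
  then have "(\<integral>\<^sup>+x. ennreal \<bar>k x * f x\<bar> \<partial>M) = (\<integral>\<^sup>+x. 0 \<partial>M)"
    by (intro nn_integral_cong_AE) auto
  then show ?thesis by simp
next
  case k0: False
  have ik: "integrable M (\<lambda>x. \<bar>k x\<bar>)"
    using C(2) by (intro integrableI_nonneg) (auto intro: le_less_trans)
  define K where "K = (\<integral>x. \<bar>k x\<bar> \<partial>M)"
  have Ke: "(\<integral>\<^sup>+x. ennreal \<bar>k x\<bar> \<partial>M) = ennreal K" unfolding K_def using ik by (subst nn_integral_eq_integral) auto
  have K: "K > 0" using k0 unfolding Ke by (simp add: not_le[symmetric] ennreal_eq_0_iff)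
  have KC: "K \<le> C" using C unfolding Ke by (simp add: ennreal_le_iff)
  show ?thesis
  proof (cases "(\<integral>\<^sup>+x. ennreal (\<bar>k x\<bar> * \<bar>f x\<bar> ^ Suc n) \<partial>M) = \<infinity>")
    case True
    have "ennreal (C ^ n) \<noteq> 0" using K KC by (simp add: ennreal_eq_0_iff not_le)
    then show ?thesis by (simp add: True ennreal_mult_top del: power_Suc)
  next
    case False
    have iJ: "integrable M (\<lambda>x. \<bar>k x\<bar> * \<bar>f x\<bar> ^ Suc n)"
      using False by (intro integrableI_nonneg) (auto simp: less_top)
    have iI: "integrable M (\<lambda>x. \<bar>k x * f x\<bar>)"
    proof (rule Bochner_Integration.integrable_bound[OF Bochner_Integration.integrable_add[OF ik iJ]])
      \<comment> \<open>Finiteness of the mass and of the power moment gives finiteness of the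
        mean.\<close>
      have "y \<le> 1 + y ^ Suc n" if "y \<ge> 0" for y :: real
      proof (cases "y \<le> 1")
        case True then show ?thesis using that by (simp add: add_increasing2)
      next
        case False then have "y * 1 \<le> y * y ^ n" using that by (intro mult_left_mono one_le_power) auto
        then show ?thesis by simp
      qed
      from mult_left_mono[OF this, of "\<bar>f _\<bar>" "\<bar>k _\<bar>"]
      have "\<bar>k x\<bar> * \<bar>f x\<bar> \<le> \<bar>k x\<bar> + \<bar>k x\<bar> * \<bar>f x\<bar> ^ Suc n" for x by (simp add: distrib_left)
      then show "AE x in M. norm \<bar>k x * f x\<bar> \<le> norm (\<bar>k x\<bar> + \<bar>k x\<bar> * \<bar>f x\<bar> ^ Suc n)"
        by (intro AE_I2) (simp add: abs_mult)
    qed measurable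
    define I J where "I = (\<integral>x. \<bar>k x * f x\<bar> \<partial>M)" and "J = (\<integral>x. \<bar>k x\<bar> * \<bar>f x\<bar> ^ Suc n \<partial>M)"
    define m where "m = I / K"
    have I0: "I \<ge> 0" and J0: "J \<ge> 0" by (simp_all add: I_def J_def)
    have m: "m \<ge> 0" "I = m * K" using K I0 by (auto simp: m_def)
    have "m ^ Suc n * K + real (Suc n) * m ^ n * (I - m * K)
       = (\<integral>x. m ^ Suc n * \<bar>k x\<bar> + real (Suc n) * m ^ n * (\<bar>k x * f x\<bar> - m * \<bar>k x\<bar>) \<partial>M)"
      using ik iI by (simp add: I_def K_def del: power_Suc of_nat_Suc)
    also have "\<dots> \<le> J" unfolding J_def
    proof (rule integral_mono)
      show "integrable M (\<lambda>x. m ^ Suc n * \<bar>k x\<bar> + real (Suc n) * m ^ n * (\<bar>k x * f x\<bar> - m * \<bar>k x\<bar>))"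
        using ik iI by simp
      fix x
      have "\<bar>k x\<bar> * (m ^ Suc n + real (Suc n) * m ^ n * (\<bar>f x\<bar> - m)) \<le> \<bar>k x\<bar> * \<bar>f x\<bar> ^ Suc n"
        using m by (intro mult_left_mono power_tangent) auto
      then show "m ^ Suc n * \<bar>k x\<bar> + real (Suc n) * m ^ n * (\<bar>k x * f x\<bar> - m * \<bar>k x\<bar>) \<le> \<bar>k x\<bar> * \<bar>f x\<bar> ^ Suc n"
        by (simp add: algebra_simps abs_mult)
    qed (rule iJ)
    finally have mJ: "m ^ Suc n * K \<le> J" using m by simp
    have "I ^ Suc n = K ^ n * (m ^ Suc n * K)" by (simp add: m(2) power_mult_distrib)
    also have "\<dots> \<le> C ^ n * J" using K KC mJ m J0 by (intro mult_mono power_mono) auto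
    finally have "ennreal (I ^ Suc n) \<le> ennreal (C ^ n * J)" by (rule ennreal_leI)
    moreover have "(\<integral>\<^sup>+x. ennreal \<bar>k x * f x\<bar> \<partial>M) = ennreal I"
      unfolding I_def using iI by (subst nn_integral_eq_integral) auto
    moreover have "(\<integral>\<^sup>+x. ennreal (\<bar>k x\<bar> * \<bar>f x\<bar> ^ Suc n) \<partial>M) = ennreal J"
      unfolding J_def using iJ by (subst nn_integral_eq_integral) auto
    ultimately show ?thesis using I0 J0 C(1) by (simp only: ennreal_power ennreal_mult zero_le_power)
  qed
qed

lemma ennreal_abs_integral_le:
  fixes f :: "'a \<Rightarrow> real"
  shows "ennreal \<bar>\<integral>x. f x \<partial>M\<bar> \<le> (\<integral>\<^sup>+x. ennreal \<bar>f x\<bar> \<partial>M)"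
proof (cases "integrable M f")
  case True then show ?thesis using integral_norm_bound_ennreal[OF True] by simp
next
  case False then show ?thesis by (simp add: not_integrable_integral_eq)
qed

text \<open>Jensen's form of Minkowski's integral inequality: the mean of the norms is replaced by a power mean.\<close>

lemma LP_integral:
  fixes k :: "R3 \<Rightarrow> real" and F :: "R3 \<Rightarrow> R3 \<Rightarrow> real"
  assumes k[measurable]: "k \<in> borel_measurable borel"
    and F[measurable]: "(\<lambda>(x, y). F x y) \<in> borel_measurable (borel \<Otimes>\<^sub>M borel)"
    and w: "\<And>y. LP p (\<lambda>x. F x y) (w y)" and p: "p > 0"
    and C: "(\<integral>\<^sup>+y. ennreal \<bar>k y\<bar> \<partial>lborel) \<le> ennreal C" "C \<ge> 0"
    and A: "(\<integral>\<^sup>+y. ennreal (\<bar>k y\<bar> * w y ^ p) \<partial>lborel) \<le> ennreal (C * A ^ p)" "A \<ge> 0"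
  shows "LP p (\<lambda>x. \<integral>y. k y * F x y \<partial>lborel) (C * A)"
proof -
  obtain n where n: "p = Suc n" using p by (cases p) auto
  have Fm: "(\<lambda>y. F x y) \<in> borel_measurable borel" for x by measurable
  have "(\<integral>\<^sup>+x. ennreal (\<bar>\<integral>y. k y * F x y \<partial>lborel\<bar> ^ p) \<partial>lborel)
     \<le> (\<integral>\<^sup>+x. ennreal (C ^ n) * (\<integral>\<^sup>+y. ennreal (\<bar>k y\<bar> * \<bar>F x y\<bar> ^ p) \<partial>lborel) \<partial>lborel)"
  proof (rule nn_integral_mono)
    fix x
    have "ennreal (\<bar>\<integral>y. k y * F x y \<partial>lborel\<bar> ^ p) = ennreal \<bar>\<integral>y. k y * F x y \<partial>lborel\<bar> ^ p"
      by (simp add: ennreal_power)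
    also have "\<dots> \<le> (\<integral>\<^sup>+y. ennreal \<bar>k y * F x y\<bar> \<partial>lborel) ^ p"
      by (intro power_mono ennreal_abs_integral_le) simp
    also have "\<dots> \<le> ennreal (C ^ n) * (\<integral>\<^sup>+y. ennreal (\<bar>k y\<bar> * \<bar>F x y\<bar> ^ p) \<partial>lborel)"
      unfolding n by (rule Jensen_nn_integral) (use Fm C in auto)
    finally show "ennreal (\<bar>\<integral>y. k y * F x y \<partial>lborel\<bar> ^ p) \<le> ennreal (C ^ n) * (\<integral>\<^sup>+y. ennreal (\<bar>k y\<bar> * \<bar>F x y\<bar> ^ p) \<partial>lborel)" .
  qed
  also have "\<dots> = ennreal (C ^ n) * (\<integral>\<^sup>+x. (\<integral>\<^sup>+y. ennreal (\<bar>k y\<bar> * \<bar>F x y\<bar> ^ p) \<partial>lborel) \<partial>lborel)"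
    by (rule nn_integral_cmult) measurable
  also have "(\<integral>\<^sup>+x. (\<integral>\<^sup>+y. ennreal (\<bar>k y\<bar> * \<bar>F x y\<bar> ^ p) \<partial>lborel) \<partial>lborel)
     = (\<integral>\<^sup>+y. (\<integral>\<^sup>+x. ennreal (\<bar>k y\<bar> * \<bar>F x y\<bar> ^ p) \<partial>lborel) \<partial>lborel)"
    by (rule lborel_pair.Fubini'[symmetric]) measurable
  also have "\<dots> \<le> (\<integral>\<^sup>+y. ennreal (\<bar>k y\<bar> * w y ^ p) \<partial>lborel)"
  proof (rule nn_integral_mono)
    fix y
    have [measurable]: "(\<lambda>x. F x y) \<in> borel_measurable borel" by (rule LP_measurable[OF w])
    have "(\<integral>\<^sup>+x. ennreal (\<bar>k y\<bar> * \<bar>F x y\<bar> ^ p) \<partial>lborel) = ennreal \<bar>k y\<bar> * (\<integral>\<^sup>+x. ennreal (\<bar>F x y\<bar> ^ p) \<partial>lborel)"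
      by (simp add: ennreal_mult nn_integral_cmult)
    also have "\<dots> \<le> ennreal \<bar>k y\<bar> * ennreal (w y ^ p)" by (intro mult_left_mono LP_le[OF w]) simp
    finally show "(\<integral>\<^sup>+x. ennreal (\<bar>k y\<bar> * \<bar>F x y\<bar> ^ p) \<partial>lborel) \<le> ennreal (\<bar>k y\<bar> * w y ^ p)"
      using LP_nonneg[OF w] by (simp add: ennreal_mult)
  qed
  also note A(1)
  also have "ennreal (C ^ n) * ennreal (C * A ^ p) = ennreal ((C * A) ^ p)"
    using C A by (simp add: ennreal_mult[symmetric] n power_mult_distrib mult_ac)
  finally have "(\<integral>\<^sup>+x. ennreal (\<bar>\<integral>y. k y * F x y \<partial>lborel\<bar> ^ p) \<partial>lborel) \<le> ennreal ((C * A) ^ p)"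
    by (simp add: mult_left_mono)
  moreover have "(\<lambda>x. \<integral>y. k y * F x y \<partial>lborel) \<in> borel_measurable borel" by measurable
  ultimately show ?thesis unfolding LP_def using A C by simp
qed

text \<open>Young's inequality for an integrable kernel: all translates of u share the bound A, so
  the power mean in \<open>LP_integral\<close> is constant.\<close>

lemma LP_conv:
  assumes k: "k \<in> borel_measurable borel" "(\<integral>\<^sup>+y. ennreal \<bar>k y\<bar> \<partial>lborel) \<le> ennreal C" "C \<ge> 0"
    and u: "LP p u A" and p: "p > 0"
  shows "LP p (conv k u) (C * A)"
proof -
  note [measurable] = k(1) LP_measurable[OF u]
  have "LP p (\<lambda>x. \<integral>y. k y * u (x - y) \<partial>lborel) (C * A)"
  proof (rule LP_integral[where w="\<lambda>_. A"])
    show "LP p (\<lambda>x. u (x - y)) A" for y by (rule LP_shift(1)[OF u])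
    have "(\<integral>\<^sup>+y. ennreal (\<bar>k y\<bar> * A ^ p) \<partial>lborel) = (\<integral>\<^sup>+y. ennreal \<bar>k y\<bar> \<partial>lborel) * ennreal (A ^ p)"
      using LP_nonneg[OF u] by (simp add: ennreal_mult nn_integral_multc)
    also have "\<dots> \<le> ennreal C * ennreal (A ^ p)" using k(2) by (rule mult_right_mono) simp
    finally show "(\<integral>\<^sup>+y. ennreal (\<bar>k y\<bar> * A ^ p) \<partial>lborel) \<le> ennreal (C * A ^ p)"
      using k(3) LP_nonneg[OF u] by (simp add: ennreal_mult)
  qed (use k p LP_nonneg[OF u] in auto)
  moreover have "conv k u = (\<lambda>x. \<integral>y. k y * u (x - y) \<partial>lborel)"
    by (rule ext) (rule conv_commute[OF k(1) LP_measurable[OF u]])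
  ultimately show ?thesis by simp
qed

text \<open>Cauchy-Schwarz from a weighted pointwise inequality: with weights B/(2A) and A/(2B) the
  two squares contribute A B / 2 each. Bounds equal to zero are reached through A + 1/n and B +
  1/n.\<close>

lemma LP2_prod:
  assumes "LP 2 f A" "LP 2 g B"
  shows "(\<integral>\<^sup>+x. ennreal \<bar>f x * g x\<bar> \<partial>lborel) \<le> ennreal (A * B)"
    "integrable lborel (\<lambda>x. f x * g x)" "\<bar>\<integral>x. f x * g x \<partial>lborel\<bar> \<le> A * B"
proof -
  have [measurable]: "f \<in> borel_measurable borel" "g \<in> borel_measurable borel"
    using assms LP_measurable by auto
  have pos: "(\<integral>\<^sup>+x. ennreal \<bar>f x * g x\<bar> \<partial>lborel) \<le> ennreal (A * B)"
    if "LP 2 f A" "LP 2 g B" "A > 0" "B > 0" for A B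
  proof -
    let ?a = "B / (2 * A)" and ?b = "A / (2 * B)"
    have ab: "?a \<ge> 0" "?b \<ge> 0" using that by auto
    have pw: "\<bar>f x * g x\<bar> \<le> ?a * \<bar>f x\<bar> ^ 2 + ?b * \<bar>g x\<bar> ^ 2" for x
    proof -
      have "0 \<le> (B * \<bar>f x\<bar> - A * \<bar>g x\<bar>)\<^sup>2" by simp
      then have "2 * A * B * (\<bar>f x\<bar> * \<bar>g x\<bar>) \<le> B * B * \<bar>f x\<bar> ^ 2 + A * A * \<bar>g x\<bar> ^ 2"
        by (simp add: power2_eq_square algebra_simps)
      then show ?thesis using that by (simp add: abs_mult divide_simps) (simp add: algebra_simps)
    qed
    have "(\<integral>\<^sup>+x. ennreal \<bar>f x * g x\<bar> \<partial>lborel) \<le> (\<integral>\<^sup>+x. ennreal ?a * ennreal (\<bar>f x\<bar> ^ 2) + ennreal ?b * ennreal (\<bar>g x\<bar> ^ 2) \<partial>lborel)"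
    proof (rule nn_integral_mono)
      fix x
      have "ennreal \<bar>f x * g x\<bar> \<le> ennreal (?a * \<bar>f x\<bar> ^ 2 + ?b * \<bar>g x\<bar> ^ 2)" by (rule ennreal_leI[OF pw])
      also have "\<dots> = ennreal ?a * ennreal (\<bar>f x\<bar> ^ 2) + ennreal ?b * ennreal (\<bar>g x\<bar> ^ 2)"
        using ab by (simp only: ennreal_plus ennreal_mult mult_nonneg_nonneg zero_le_power abs_ge_zero)
      finally show "ennreal \<bar>f x * g x\<bar> \<le> ennreal ?a * ennreal (\<bar>f x\<bar> ^ 2) + ennreal ?b * ennreal (\<bar>g x\<bar> ^ 2)" .
    qed
    also have "\<dots> = ennreal ?a * (\<integral>\<^sup>+x. ennreal (\<bar>f x\<bar> ^ 2) \<partial>lborel) + ennreal ?b * (\<integral>\<^sup>+x. ennreal (\<bar>g x\<bar> ^ 2) \<partial>lborel)"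
      by (subst nn_integral_add, measurable, subst nn_integral_cmult, measurable, subst nn_integral_cmult, measurable)
    also have "\<dots> \<le> ennreal ?a * ennreal (A ^ 2) + ennreal ?b * ennreal (B ^ 2)"
      using LP_le[OF that(1)] LP_le[OF that(2)] by (intro add_mono mult_left_mono) auto
    also have "\<dots> = ennreal (?a * A ^ 2 + ?b * B ^ 2)"
      using ab by (simp only: ennreal_plus ennreal_mult mult_nonneg_nonneg zero_le_power2)
    also have "?a * A ^ 2 + ?b * B ^ 2 = A * B" using that by (simp add: power2_eq_square)
    finally show ?thesis .
  qed
  have nn: "0 \<le> A" "0 \<le> B" using assms LP_nonneg by auto
  have "(\<lambda>n. ennreal ((A + inverse (real (Suc n))) * (B + inverse (real (Suc n))))) \<longlonglongrightarrow> ennreal ((A + 0) * (B + 0))"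
    by (intro tendsto_intros LIMSEQ_inverse_real_of_nat)
  then have "(\<integral>\<^sup>+x. ennreal \<bar>f x * g x\<bar> \<partial>lborel) \<le> ennreal ((A + 0) * (B + 0))"
  proof (rule LIMSEQ_le_const, intro exI allI impI)
    fix n :: nat
    show "(\<integral>\<^sup>+x. ennreal \<bar>f x * g x\<bar> \<partial>lborel) \<le> ennreal ((A + inverse (real (Suc n))) * (B + inverse (real (Suc n))))"
      using nn by (intro pos LP_mono[OF assms(1)] LP_mono[OF assms(2)]) (auto simp: add_nonneg_pos)
  qed
  then show le: "(\<integral>\<^sup>+x. ennreal \<bar>f x * g x\<bar> \<partial>lborel) \<le> ennreal (A * B)" by simp
  show "integrable lborel (\<lambda>x. f x * g x)"
    by (rule integrableI_bounded) (use le in \<open>auto intro: le_less_trans\<close>)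
  have "ennreal \<bar>\<integral>x. f x * g x \<partial>lborel\<bar> \<le> ennreal (A * B)"
    using ennreal_abs_integral_le[of lborel "\<lambda>x. f x * g x"] le by (rule order_trans)
  then show "\<bar>\<integral>x. f x * g x \<partial>lborel\<bar> \<le> A * B"
    using nn by (subst (asm) ennreal_le_iff) auto
qed

lemma AMGM3:
  fixes x y z :: real assumes "x \<ge> 0" "y \<ge> 0" "z \<ge> 0"
  shows "3 * (x * y * z) \<le> x ^ 3 + y ^ 3 + z ^ 3"
proof -
  have "x ^ 3 + y ^ 3 + z ^ 3 - 3 * (x * y * z) = (x + y + z) * ((x - y)\<^sup>2 + (y - z)\<^sup>2 + (z - x)\<^sup>2) / 2"
    by (simp add: power3_eq_cube power2_eq_square algebra_simps)
  also have "\<dots> \<ge> 0" using assms by (intro divide_nonneg_pos mult_nonneg_nonneg add_nonneg_nonneg) auto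
  finally show ?thesis by simp
qed

text \<open>Hoelder's inequality for three factors, by the arithmetic-geometric mean applied to |f|
  / A, |g| / B and |h| / C. The \<open>nn_integral\<close> form also yields integrability of
  products for which it was not known before.\<close>

lemma LP3_prod:
  assumes "LP 3 f A" "LP 3 g B" "LP 3 h C"
  shows "(\<integral>\<^sup>+x. ennreal \<bar>f x * g x * h x\<bar> \<partial>lborel) \<le> ennreal (A * B * C)"
proof -
  have [measurable]: "f \<in> borel_measurable borel" "g \<in> borel_measurable borel" "h \<in> borel_measurable borel"
    using assms LP_measurable by auto
  have pos: "(\<integral>\<^sup>+x. ennreal \<bar>f x * g x * h x\<bar> \<partial>lborel) \<le> ennreal (A * B * C)"
    if "LP 3 f A" "LP 3 g B" "LP 3 h C" "A > 0" "B > 0" "C > 0" for A B C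
  proof -
    let ?P = "A * B * C / 3"
    let ?a = "?P / A ^ 3" and ?b = "?P / B ^ 3" and ?c = "?P / C ^ 3"
    have ab: "?a \<ge> 0" "?b \<ge> 0" "?c \<ge> 0" using that by auto
    have pw: "\<bar>f x * g x * h x\<bar> \<le> ?a * \<bar>f x\<bar> ^ 3 + ?b * \<bar>g x\<bar> ^ 3 + ?c * \<bar>h x\<bar> ^ 3" for x
    proof -
      have "3 * ((\<bar>f x\<bar> / A) * (\<bar>g x\<bar> / B) * (\<bar>h x\<bar> / C)) \<le> (\<bar>f x\<bar> / A) ^ 3 + (\<bar>g x\<bar> / B) ^ 3 + (\<bar>h x\<bar> / C) ^ 3"
        using that by (intro AMGM3) auto
      from mult_left_mono[OF this, of ?P]
      have "?P * (3 * ((\<bar>f x\<bar> / A) * (\<bar>g x\<bar> / B) * (\<bar>h x\<bar> / C))) \<le> ?P * ((\<bar>f x\<bar> / A) ^ 3 + (\<bar>g x\<bar> / B) ^ 3 + (\<bar>h x\<bar> / C) ^ 3)"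
        using that by simp
      moreover have "?P * (3 * ((\<bar>f x\<bar> / A) * (\<bar>g x\<bar> / B) * (\<bar>h x\<bar> / C))) = \<bar>f x * g x * h x\<bar>"
        using that by (simp add: abs_mult)
      moreover have "?P * ((\<bar>f x\<bar> / A) ^ 3 + (\<bar>g x\<bar> / B) ^ 3 + (\<bar>h x\<bar> / C) ^ 3) = ?a * \<bar>f x\<bar> ^ 3 + ?b * \<bar>g x\<bar> ^ 3 + ?c * \<bar>h x\<bar> ^ 3"
        by (simp only: power_divide distrib_left times_divide_eq_right times_divide_eq_left)
      ultimately show ?thesis by simp
    qed
    have "(\<integral>\<^sup>+x. ennreal \<bar>f x * g x * h x\<bar> \<partial>lborel)
       \<le> (\<integral>\<^sup>+x. ennreal ?a * ennreal (\<bar>f x\<bar> ^ 3) + ennreal ?b * ennreal (\<bar>g x\<bar> ^ 3) + ennreal ?c * ennreal (\<bar>h x\<bar> ^ 3) \<partial>lborel)"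
    proof (rule nn_integral_mono)
      fix x
      have "ennreal \<bar>f x * g x * h x\<bar> \<le> ennreal (?a * \<bar>f x\<bar> ^ 3 + ?b * \<bar>g x\<bar> ^ 3 + ?c * \<bar>h x\<bar> ^ 3)" by (rule ennreal_leI[OF pw])
      also have "\<dots> = ennreal ?a * ennreal (\<bar>f x\<bar> ^ 3) + ennreal ?b * ennreal (\<bar>g x\<bar> ^ 3) + ennreal ?c * ennreal (\<bar>h x\<bar> ^ 3)"
        using ab by (simp only: ennreal_plus ennreal_mult mult_nonneg_nonneg zero_le_power abs_ge_zero add_nonneg_nonneg)
      finally show "ennreal \<bar>f x * g x * h x\<bar> \<le> ennreal ?a * ennreal (\<bar>f x\<bar> ^ 3) + ennreal ?b * ennreal (\<bar>g x\<bar> ^ 3) + ennreal ?c * ennreal (\<bar>h x\<bar> ^ 3)" .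
    qed
    also have "\<dots> = ennreal ?a * (\<integral>\<^sup>+x. ennreal (\<bar>f x\<bar> ^ 3) \<partial>lborel) + ennreal ?b * (\<integral>\<^sup>+x. ennreal (\<bar>g x\<bar> ^ 3) \<partial>lborel)
        + ennreal ?c * (\<integral>\<^sup>+x. ennreal (\<bar>h x\<bar> ^ 3) \<partial>lborel)"
      by (subst nn_integral_add, measurable, subst nn_integral_add, measurable, subst nn_integral_cmult, measurable,
          subst nn_integral_cmult, measurable, subst nn_integral_cmult, measurable)
    also have "\<dots> \<le> ennreal ?a * ennreal (A ^ 3) + ennreal ?b * ennreal (B ^ 3) + ennreal ?c * ennreal (C ^ 3)"
      using LP_le[OF that(1)] LP_le[OF that(2)] LP_le[OF that(3)] by (intro add_mono mult_left_mono) auto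
    also have "\<dots> = ennreal (?a * A ^ 3 + ?b * B ^ 3 + ?c * C ^ 3)"
      using ab that by (simp only: ennreal_plus ennreal_mult mult_nonneg_nonneg zero_le_power add_nonneg_nonneg less_imp_le)
    also have "?a * A ^ 3 + ?b * B ^ 3 + ?c * C ^ 3 = A * B * C" using that by simp
    finally show ?thesis .
  qed
  have nn: "0 \<le> A" "0 \<le> B" "0 \<le> C" using assms LP_nonneg by auto
  let ?e = "\<lambda>n. inverse (real (Suc n))"
  have "(\<lambda>n. ennreal ((A + ?e n) * (B + ?e n) * (C + ?e n))) \<longlonglongrightarrow> ennreal ((A + 0) * (B + 0) * (C + 0))"
    by (intro tendsto_intros LIMSEQ_inverse_real_of_nat)
  then have "(\<integral>\<^sup>+x. ennreal \<bar>f x * g x * h x\<bar> \<partial>lborel) \<le> ennreal ((A + 0) * (B + 0) * (C + 0))"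
  proof (rule LIMSEQ_le_const, intro exI allI impI)
    fix n :: nat
    show "(\<integral>\<^sup>+x. ennreal \<bar>f x * g x * h x\<bar> \<partial>lborel) \<le> ennreal ((A + ?e n) * (B + ?e n) * (C + ?e n))"
      using nn by (intro pos LP_mono[OF assms(1)] LP_mono[OF assms(2)] LP_mono[OF assms(3)]) (auto simp: add_nonneg_pos)
  qed
  then show ?thesis by simp
qed

text \<open>Filtered functions are bounded and square integrable; the pointwise inequality |f|^3
  \<le> M |f|^2 then places them in L^3.\<close>

lemma LP_interpolate_3:
  assumes "LP 2 f A" "\<And>x. \<bar>f x\<bar> \<le> M" "M * A\<^sup>2 \<le> B ^ 3" "B \<ge> 0"
  shows "LP 3 f B"
proof -
  have [measurable]: "f \<in> borel_measurable borel" using assms LP_measurable by auto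
  have M: "M \<ge> 0" using order_trans[OF abs_ge_zero assms(2)] .
  have "(\<integral>\<^sup>+x. ennreal (\<bar>f x\<bar> ^ 3) \<partial>lborel) \<le> (\<integral>\<^sup>+x. ennreal M * ennreal (\<bar>f x\<bar> ^ 2) \<partial>lborel)"
  proof (rule nn_integral_mono)
    fix x
    have "\<bar>f x\<bar> ^ 3 \<le> M * \<bar>f x\<bar> ^ 2"
      using mult_right_mono[OF assms(2)[of x], of "\<bar>f x\<bar> ^ 2"] by (simp add: power3_eq_cube power2_eq_square)
    then show "ennreal (\<bar>f x\<bar> ^ 3) \<le> ennreal M * ennreal (\<bar>f x\<bar> ^ 2)"
      using M by (simp only: ennreal_mult[symmetric] zero_le_power abs_ge_zero ennreal_leI)
  qed
  also have "\<dots> = ennreal M * (\<integral>\<^sup>+x. ennreal (\<bar>f x\<bar> ^ 2) \<partial>lborel)" by (rule nn_integral_cmult) measurable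
  also have "\<dots> \<le> ennreal M * ennreal (A ^ 2)" by (intro mult_left_mono LP_le[OF assms(1)]) simp
  also have "\<dots> = ennreal (M * A ^ 2)" using M by (simp add: ennreal_mult)
  also have "\<dots> \<le> ennreal (B ^ 3)" by (rule ennreal_leI[OF assms(3)])
  finally show ?thesis using assms(4) by (simp add: LP_def)
qed

section \<open>Fourier multipliers\<close>

text \<open>The symbols for which Fourier inversion is proved: smoothness gives decay of the
  transform, and the bounded support makes all frequency integrals absolutely convergent.\<close>

definition bump :: "(R3 \<Rightarrow> 'b::real_normed_vector) \<Rightarrow> bool" where
  "bump m \<longleftrightarrow> smooth m \<and> (\<exists>R. \<forall>x. norm x > R \<longrightarrow> m x = 0)"

lemma bumpD:
  assumes "bump m" shows "\<exists>R>0. \<forall>x. norm x > R \<longrightarrow> m x = 0"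
proof -
  obtain R where "\<forall>x. norm x > R \<longrightarrow> m x = 0" using assms by (auto simp: bump_def)
  then show ?thesis by (intro exI[of _ "max R 1"]) auto
qed

lemma bump_smooth: "bump m \<Longrightarrow> smooth m" by (simp add: bump_def)

lemma bump_partial:
  assumes "bump m" shows "bump (partial i m)"
proof -
  have sm: "smooth m" using assms by (rule bump_smooth)
  obtain R where R0: "R > 0" and R': "\<forall>x. norm x > R \<longrightarrow> m x = 0" using bumpD[OF assms] by blast
  note R = R'[rule_format] sm
  have "partial i m x = 0" if x: "norm x > R" for x
  proof -
    have "m y = 0" if "norm (y - x) < norm x - R" for y
    proof (rule R(1))
      have "norm x \<le> norm y + norm (y - x)" using norm_triangle_sub[of x y] by (simp add: norm_minus_commute)
      then show "norm y > R" using that by simp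
    qed
    then show ?thesis using partial_local(1)[where r="norm x - R" and x=x and f=m and g="\<lambda>x. 0" and i=i] x by simp
  qed
  then show ?thesis using R(2) smooth_partial unfolding bump_def by blast
qed

lemma bump_mult:
  fixes m :: "R3 \<Rightarrow> 'b::real_normed_algebra"
  assumes "bump m" "smooth f" shows "bump (\<lambda>x. f x * m x)"
  using assms smooth_mult[of f m] unfolding bump_def by fastforce

lemma bump_bounded_linear:
  assumes "bounded_linear T" "bump m" shows "bump (\<lambda>x. T (m x))"
  using assms smooth_bounded_linear[of T m] linear_0[OF bounded_linear.linear[OF assms(1)]]
  unfolding bump_def by fastforce

lemma bump_bounded:
  assumes "bump m" obtains M where "M > 0" "\<And>x. norm (m x) \<le> M"
proof -
  obtain R where R: "R > 0" "\<forall>x. norm x > R \<longrightarrow> m x = 0" using bumpD[OF assms] by blast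
  have "compact (m ` cball 0 R)"
    by (intro compact_continuous_image smooth_continuous bump_smooth[OF assms]) auto
  from compact_imp_bounded[OF this] obtain M where "M > 0" "\<forall>y\<in>m ` cball 0 R. norm y \<le> M"
    unfolding bounded_pos by blast
  then have M: "M > 0" "\<And>x. x \<in> cball 0 R \<Longrightarrow> norm (m x) \<le> M" by simp_all
  have "norm (m x) \<le> M" for x
    using M(2)[of x] R(2) M(1) by (cases "norm x > R") auto
  with M(1) that show ?thesis by blast
qed

lemma bump_schwartz:
  assumes "bump m" shows "schwartz m"
proof (rule schwartz_coinduct[where P=bump], goal_cases)
  case 1 show ?case by fact
next
  case (2 f x) then show ?case by (auto simp: bump_def intro: smooth_differentiable)
next
  case (3 f i) then show ?case by (rule bump_partial)
next
  case (4 f k)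
  obtain R where R: "R > 0" "\<forall>x. norm x > R \<longrightarrow> f x = 0" using bumpD[OF 4] by blast
  obtain M where M: "M > 0" "\<And>x. norm (f x) \<le> M" using bump_bounded[OF 4] by blast
  have "(1 + norm x) ^ k * norm (f x) \<le> (1 + R) ^ k * M" for x
  proof (cases "norm x > R")
    case True then show ?thesis using R M by simp
  next
    case False then show ?thesis using M R by (intro mult_mono power_mono) auto
  qed
  then show ?case by blast
qed

lemma bump_integrable:
  fixes m :: "R3 \<Rightarrow> 'b::{banach,second_countable_topology}"
  shows "bump m \<Longrightarrow> integrable lborel m"
  by (intro schwartz_integrable bump_schwartz)

lemma bump_measurable:
  fixes m :: "R3 \<Rightarrow> 'b::{real_normed_vector,second_countable_topology}"
  shows "bump m \<Longrightarrow> m \<in> borel_measurable borel"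
  by (simp add: bump_def smooth_measurable)

section \<open>The Fourier integral of a smooth symbol with bounded support\<close>

text \<open>The inverse Fourier transform without its factor (2 pi)^(-3), which \<open>ker\<close>
  restores.\<close>

definition E :: "(R3 \<Rightarrow> complex) \<Rightarrow> R3 \<Rightarrow> complex" where
  "E m x = (\<integral>\<xi>. m \<xi> * cis (x \<bullet> \<xi>) \<partial>lborel)"

lemma cis_measurable [measurable]: "cis \<in> borel_measurable borel"
  by (intro borel_measurable_continuous_onI continuous_intros)

lemma integrable_mult_cis:
  assumes "integrable lborel m"
  shows "integrable lborel (\<lambda>\<xi>. m \<xi> * cis (x \<bullet> \<xi>))"
proof (rule Bochner_Integration.integrable_bound[OF assms])
  have [measurable]: "m \<in> borel_measurable borel" using assms by auto
  show "(\<lambda>\<xi>. m \<xi> * cis (x \<bullet> \<xi>)) \<in> borel_measurable lborel" by measurable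
qed (auto simp: norm_mult)

lemma smooth_of_real: "smooth f \<Longrightarrow> smooth (\<lambda>x. complex_of_real (f x))"
  using smooth_bounded_linear[OF bounded_linear_of_real] .

lemma E_has_derivative:
  assumes m: "bump m"
  shows "(E m has_derivative (\<lambda>v. \<integral>\<xi>. m \<xi> * ((v \<bullet> \<xi>) *\<^sub>R (\<i> * cis (x \<bullet> \<xi>))) \<partial>lborel)) (at x)"
proof -
  obtain R where R: "R > 0" "\<forall>x. norm x > R \<longrightarrow> m x = 0" using bumpD[OF m] by blast
  show ?thesis unfolding E_def
proof (rule has_derivative_integral[where F="\<lambda>z \<xi>. m \<xi> * cis (z \<bullet> \<xi>)"
     and F'="\<lambda>z \<xi> v. m \<xi> * ((v \<bullet> \<xi>) *\<^sub>R (\<i> * cis (z \<bullet> \<xi>)))"])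
  note [measurable] = bump_measurable[OF m]
  show "integrable lborel (\<lambda>\<xi>. R * norm (m \<xi>))" using bump_integrable[OF m] by simp
  show "integrable lborel (\<lambda>\<xi>. m \<xi> * cis (z \<bullet> \<xi>))" for z by (rule integrable_mult_cis[OF bump_integrable[OF m]])
  show "(\<lambda>\<xi>. m \<xi> * ((v \<bullet> \<xi>) *\<^sub>R (\<i> * cis (x \<bullet> \<xi>)))) \<in> borel_measurable lborel" for v by measurable
  show "norm (m \<xi> * ((v \<bullet> \<xi>) *\<^sub>R (\<i> * cis (z \<bullet> \<xi>)))) \<le> R * norm (m \<xi>) * norm v" for z \<xi> v
  proof (cases "norm \<xi> > R")
    case False
    have "\<bar>v \<bullet> \<xi>\<bar> \<le> norm v * R"
      using Cauchy_Schwarz_ineq2[of v \<xi>] False mult_left_mono[of "norm \<xi>" R "norm v"] by simp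
    then have "norm (m \<xi>) * \<bar>v \<bullet> \<xi>\<bar> \<le> norm (m \<xi>) * (norm v * R)" by (rule mult_left_mono) simp
    then show ?thesis by (simp add: norm_mult mult_ac)
  qed (use R in simp)
  show "((\<lambda>z. m \<xi> * cis (z \<bullet> \<xi>)) has_derivative (\<lambda>v. m \<xi> * ((v \<bullet> \<xi>) *\<^sub>R (\<i> * cis (z \<bullet> \<xi>))))) (at z)" for z \<xi>
    by (auto intro!: derivative_eq_intros)
qed
qed

lemma partial_E:
  assumes m: "bump m"
  shows "partial i (E m) = E (\<lambda>\<xi>. \<i> * complex_of_real (\<xi> $ i) * m \<xi>)"
proof
  fix x
  show "partial i (E m) x = E (\<lambda>\<xi>. \<i> * complex_of_real (\<xi> $ i) * m \<xi>) x"
    unfolding partialI[OF E_has_derivative[OF m]] E_def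
    by (intro Bochner_Integration.integral_cong refl) (simp add: inner_axis' scaleR_conv_of_real mult_ac)
qed

lemma bump_coord:
  fixes m :: "R3 \<Rightarrow> complex"
  shows "bump m \<Longrightarrow> bump (\<lambda>\<xi>. \<i> * complex_of_real (\<xi> $ i) * m \<xi>)"
  by (rule bump_mult[OF _ smooth_mult[OF smooth_const smooth_of_real[OF smooth_coord]]])

text \<open>The integral of \<open>partial j\<close> of cis(x \<bullet> \<xi>) m(\<xi>) vanishes,
  and the Leibniz rule splits it into x_j times the transform of m and the transform of the
  derivative.\<close>

lemma E_coord:
  assumes m: "bump m"
  shows "complex_of_real (x $ j) * E m x = \<i> * E (partial j m) x"
proof -
  let ?F = "\<lambda>\<xi>. cis (x \<bullet> \<xi>) * m \<xi>"
  have sc: "smooth (\<lambda>\<xi>. cis (x \<bullet> \<xi>))"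
  proof (rule smooth_coinduct[where P="\<lambda>F. \<exists>c. F = (\<lambda>\<xi>. c * cis (x \<bullet> \<xi>))"], goal_cases)
    case 1 show ?case by (rule exI[of _ 1]) simp
  next
    case (2 F y)
    then obtain c where "F = (\<lambda>\<xi>. c * cis (x \<bullet> \<xi>))" by blast
    moreover have "((\<lambda>\<xi>. c * cis (x \<bullet> \<xi>)) has_derivative (\<lambda>v. c * ((x \<bullet> v) *\<^sub>R (\<i> * cis (x \<bullet> y))))) (at y)"
      by (auto intro!: derivative_eq_intros)
    ultimately show ?case by (auto simp: differentiable_def)
  next
    case (3 F i)
    then obtain c where F: "F = (\<lambda>\<xi>. c * cis (x \<bullet> \<xi>))" by blast
    have "((\<lambda>\<xi>. c * cis (x \<bullet> \<xi>)) has_derivative (\<lambda>v. c * ((x \<bullet> v) *\<^sub>R (\<i> * cis (x \<bullet> y))))) (at y)" for y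
      by (auto intro!: derivative_eq_intros)
    from partialI[OF this, of i]
    have "partial i F = (\<lambda>\<xi>. (c * \<i> * complex_of_real (x $ i)) * cis (x \<bullet> \<xi>))"
      by (auto simp: F inner_axis scaleR_conv_of_real mult_ac)
    then show ?case by blast
  qed
  have dc: "partial j (\<lambda>\<xi>. cis (x \<bullet> \<xi>)) y = \<i> * complex_of_real (x $ j) * cis (x \<bullet> y)" for y
  proof -
    have "((\<lambda>\<xi>. cis (x \<bullet> \<xi>)) has_derivative (\<lambda>v. ((x \<bullet> v) *\<^sub>R (\<i> * cis (x \<bullet> y))))) (at y)"
      by (auto intro!: derivative_eq_intros)
    from partialI[OF this, of j] show ?thesis by (simp add: inner_axis scaleR_conv_of_real mult_ac)
  qed
  have b: "bump ?F" by (rule bump_mult[OF m sc])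
  have sm: "smooth m" using m by (simp add: bump_def)
  have pF: "partial j ?F y = \<i> * complex_of_real (x $ j) * (m y * cis (x \<bullet> y)) + partial j m y * cis (x \<bullet> y)" for y
    using partial_mult[OF smooth_differentiable[OF sc] smooth_differentiable[OF sm], of j y] dc[of y]
    by (simp add: mult_ac)
  have "(\<integral>y. partial j ?F y \<partial>lborel) = 0"
  proof (rule integral_partial_eq_0)
    show "?F differentiable (at y)" for y using b by (auto simp: bump_def intro: smooth_differentiable)
    show "continuous_on UNIV (partial j ?F)" using bump_partial[OF b, of j] by (auto simp: bump_def intro: smooth_continuous)
    show "integrable lborel ?F" by (rule bump_integrable[OF b])
    show "integrable lborel (partial j ?F)" by (rule bump_integrable[OF bump_partial[OF b]])
  qed
  then have "\<i> * complex_of_real (x $ j) * E m x + E (partial j m) x = 0"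
    unfolding pF E_def
    using integrable_mult_cis[OF bump_integrable[OF m], of x] integrable_mult_cis[OF bump_integrable[OF bump_partial[OF m, of j]], of x]
    by simp
  then have "\<i> * (\<i> * complex_of_real (x $ j) * E m x + E (partial j m) x) = \<i> * 0" by simp
  then show ?thesis by (simp add: algebra_simps)
qed

lemma norm_E_le:
  assumes "integrable lborel m" shows "norm (E m x) \<le> (\<integral>\<xi>. norm (m \<xi>) \<partial>lborel)"
  unfolding E_def using integral_norm_bound[of lborel "\<lambda>\<xi>. m \<xi> * cis (x \<bullet> \<xi>)"] by (simp add: norm_mult)

text \<open>One factor 1 + |x| is at most 1 plus the sum of the |x_j|, and \<open>E_coord\<close>
  turns each x_j into a derivative of the symbol. Derivatives are again symbols of the same class,
  so the induction on k runs over all of them at once.\<close>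

lemma E_decay:
  assumes "bump m" shows "\<exists>C. \<forall>x. (1 + norm x) ^ k * norm (E m x) \<le> C"
  using assms
proof (induction k arbitrary: m)
  case 0
  then show ?case using norm_E_le[OF bump_integrable[OF 0]] by auto
next
  case (Suc k)
  obtain C where C: "\<And>x. (1 + norm x) ^ k * norm (E m x) \<le> C" using Suc by blast
  have "\<exists>D. \<forall>x. (1 + norm x) ^ k * norm (E (partial j m) x) \<le> D" for j
    using Suc.IH[OF bump_partial[OF Suc.prems]] .
  then obtain D where D: "\<And>j x. (1 + norm x) ^ k * norm (E (partial j m) x) \<le> D j" by metis
  have "(1 + norm x) ^ Suc k * norm (E m x) \<le> C + (\<Sum>j\<in>UNIV. D j)" for x
  proof -
    have "norm x \<le> (\<Sum>j\<in>UNIV. \<bar>x $ j\<bar>)" by (rule norm_le_l1_cart)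
    then have "norm x * norm (E m x) \<le> (\<Sum>j\<in>UNIV. \<bar>x $ j\<bar>) * norm (E m x)" by (rule mult_right_mono) simp
    also have "\<dots> = (\<Sum>j\<in>UNIV. norm (complex_of_real (x $ j) * E m x))" by (simp add: sum_distrib_right norm_mult)
    also have "\<dots> = (\<Sum>j\<in>UNIV. norm (E (partial j m) x))" by (simp add: E_coord[OF Suc.prems] norm_mult)
    finally have "(1 + norm x) ^ k * (norm (E m x) + norm x * norm (E m x))
       \<le> (1 + norm x) ^ k * (norm (E m x) + (\<Sum>j\<in>UNIV. norm (E (partial j m) x)))"
      by (intro mult_left_mono add_left_mono) auto
    also have "\<dots> = (1 + norm x) ^ k * norm (E m x) + (\<Sum>j\<in>UNIV. (1 + norm x) ^ k * norm (E (partial j m) x))"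
      by (simp add: distrib_left sum_distrib_left)
    also have "\<dots> \<le> C + (\<Sum>j\<in>UNIV. D j)" by (intro add_mono sum_mono C D)
    finally show ?thesis by (simp add: algebra_simps)
  qed
  then show ?case by blast
qed

lemma schwartz_E:
  assumes "bump m" shows "schwartz (E m)"
proof (rule schwartz_coinduct[where P="\<lambda>F. \<exists>m. bump m \<and> F = E m"], goal_cases)
  case 1 show ?case using assms by blast
next
  case (2 f x) then show ?case using E_has_derivative by (auto simp: differentiable_def)
next
  case (3 f i) then show ?case using partial_E bump_coord by blast
next
  case (4 f k) then show ?case using E_decay by blast
qed

section \<open>Gaussian summability and Fourier inversion\<close>

lemma lborel_R3_prod:
  fixes f :: "R3 \<Rightarrow> real \<Rightarrow> complex"
  assumes f: "\<And>b. b \<in> Basis \<Longrightarrow> integrable lborel (f b)"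
  shows "(\<integral>x. (\<Prod>b\<in>Basis. f b (x \<bullet> b)) \<partial>lborel) = (\<Prod>b\<in>Basis. \<integral>t. f b t \<partial>lborel)"
    and "integrable lborel (\<lambda>x. (\<Prod>b\<in>Basis. f b (x \<bullet> b)))"
proof -
  interpret product_sigma_finite "\<lambda>_::R3. lborel :: real measure" ..
  have [measurable]: "b \<in> Basis \<Longrightarrow> f b \<in> borel_measurable borel" for b using f[of b] by auto
  have T: "(\<lambda>g. \<Sum>b\<in>Basis. g b *\<^sub>R b) \<in> measurable (\<Pi>\<^sub>M b\<in>(Basis::R3 set). lborel) borel" by measurable
  have M: "(\<lambda>x. \<Prod>b\<in>(Basis::R3 set). f b (x \<bullet> b)) \<in> borel_measurable borel" by measurable
  have eq: "(\<Prod>b\<in>Basis. f b ((\<Sum>c\<in>(Basis::R3 set). g c *\<^sub>R c) \<bullet> b)) = (\<Prod>b\<in>Basis. f b (g b))" for g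
    by (intro prod.cong refl) simp
  show "(\<integral>x. (\<Prod>b\<in>Basis. f b (x \<bullet> b)) \<partial>lborel) = (\<Prod>b\<in>Basis. \<integral>t. f b t \<partial>lborel)"
    by (subst lborel_eq, subst integral_distr[OF T M]) (simp only: eq product_integral_prod[OF finite_Basis f])
  show "integrable lborel (\<lambda>x. (\<Prod>b\<in>Basis. f b (x \<bullet> b)))"
    by (subst lborel_eq, subst integrable_distr_eq[OF T M]) (simp only: eq product_integrable_prod[OF finite_Basis f])
qed

definition gauss :: "R3 \<Rightarrow> real" where "gauss x = exp (- (norm x)\<^sup>2 / 2)"

text \<open>The Gaussian factors over the coordinates into standard normal densities, whose
  characteristic function is available from probability theory.\<close>

lemma gauss_fourier:
  "(\<integral>x. complex_of_real (gauss x) * cis (x \<bullet> \<eta>) \<partial>lborel) = complex_of_real ((sqrt (2 * pi)) ^ 3 * gauss \<eta>)"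
  and gauss_integrable: "integrable lborel gauss"
proof -
  define f where "f b t = complex_of_real (std_normal_density t) * cis (t * (\<eta> \<bullet> b))" for b t
  have ms: "std_normal_density \<in> borel_measurable borel" by measurable
  have fi: "integrable lborel (f b)" for b
  proof (rule Bochner_Integration.integrable_bound)
    show "integrable lborel std_normal_density" by simp
    show "f b \<in> borel_measurable lborel" unfolding f_def by measurable
    show "AE t in lborel. norm (f b t) \<le> norm (std_normal_density t)"
      by (auto simp: f_def norm_mult)
  qed
  have f1: "(\<integral>t. f b t \<partial>lborel) = complex_of_real (exp (- ((\<eta> \<bullet> b)\<^sup>2) / 2))" for b
  proof -
    have "char std_normal_distribution (\<eta> \<bullet> b) = (\<integral>t. std_normal_density t *\<^sub>R iexp ((\<eta> \<bullet> b) * t) \<partial>lborel)"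
      unfolding char_def by (subst integral_density) (auto simp: normal_density_nonneg)
    also have "\<dots> = (\<integral>t. f b t \<partial>lborel)"
      by (intro Bochner_Integration.integral_cong refl) (simp add: f_def scaleR_conv_of_real cis_conv_exp mult_ac)
    finally show ?thesis by (simp add: char_std_normal_distribution)
  qed
  have g: "(\<Prod>b\<in>Basis. f b (x \<bullet> b)) = complex_of_real (gauss x / (sqrt (2 * pi)) ^ 3) * cis (x \<bullet> \<eta>)" for x
  proof -
    have "(\<Prod>b\<in>Basis. f b (x \<bullet> b)) = complex_of_real (\<Prod>b\<in>(Basis::R3 set). std_normal_density (x \<bullet> b)) * (\<Prod>b\<in>Basis. cis ((x \<bullet> b) * (\<eta> \<bullet> b)))"
      by (simp add: f_def prod.distrib)
    also have "(\<Prod>b\<in>(Basis::R3 set). std_normal_density (x \<bullet> b)) = (\<Prod>b\<in>(Basis::R3 set). 1 / sqrt (2 * pi)) * (\<Prod>b\<in>(Basis::R3 set). exp (- (x \<bullet> b)\<^sup>2 / 2))"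
      unfolding std_normal_density_def by (rule prod.distrib)
    also have "(\<Prod>b\<in>(Basis::R3 set). exp (- (x \<bullet> b)\<^sup>2 / 2)) = exp (\<Sum>b\<in>(Basis::R3 set). - (x \<bullet> b)\<^sup>2 / 2)"
      by (rule exp_sum[symmetric]) simp
    also have "(\<Sum>b\<in>(Basis::R3 set). - (x \<bullet> b)\<^sup>2 / 2) = - (norm x)\<^sup>2 / 2"
      by (simp add: norm_eq_sqrt_inner euclidean_inner[of x x] sum_negf sum_divide_distrib[symmetric] power2_eq_square sum_nonneg)
    also have "(\<Prod>b\<in>(Basis::R3 set). 1 / sqrt (2 * pi)) = 1 / (sqrt (2 * pi)) ^ 3" by (simp add: power_divide)
    also have "(\<Prod>b\<in>(Basis::R3 set). cis ((x \<bullet> b) * (\<eta> \<bullet> b))) = cis (x \<bullet> \<eta>)"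
      by (simp add: cis_conv_exp euclidean_inner[of x \<eta>] exp_sum sum_distrib_left)
    finally show ?thesis by (simp add: gauss_def)
  qed
  have "(\<integral>x. complex_of_real (gauss x / (sqrt (2 * pi)) ^ 3) * cis (x \<bullet> \<eta>) \<partial>lborel) = complex_of_real (gauss \<eta>)"
  proof -
    have "(\<Prod>b\<in>(Basis::R3 set). exp (- (\<eta> \<bullet> b)\<^sup>2 / 2)) = exp (\<Sum>b\<in>(Basis::R3 set). - (\<eta> \<bullet> b)\<^sup>2 / 2)"
      by (rule exp_sum[symmetric]) simp
    also have "(\<Sum>b\<in>(Basis::R3 set). - (\<eta> \<bullet> b)\<^sup>2 / 2) = - (norm \<eta>)\<^sup>2 / 2"
      by (simp add: norm_eq_sqrt_inner euclidean_inner[of \<eta> \<eta>] sum_negf sum_divide_distrib[symmetric] power2_eq_square sum_nonneg)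
    finally show ?thesis
      using lborel_R3_prod(1)[of f, OF fi] unfolding g f1 by (simp add: gauss_def of_real_prod[symmetric] del: of_real_prod)
  qed
  then have "complex_of_real (1 / (sqrt (2 * pi)) ^ 3) * (\<integral>x. complex_of_real (gauss x) * cis (x \<bullet> \<eta>) \<partial>lborel) = complex_of_real (gauss \<eta>)"
    by (subst Bochner_Integration.integral_mult_right_zero[symmetric]) (simp add: mult_ac)
  then show "(\<integral>x. complex_of_real (gauss x) * cis (x \<bullet> \<eta>) \<partial>lborel) = complex_of_real ((sqrt (2 * pi)) ^ 3 * gauss \<eta>)"
    by (simp add: field_simps)
  have gm: "gauss \<in> borel_measurable borel" unfolding gauss_def by measurable
  have "integrable lborel (\<lambda>x. complex_of_real (gauss x / (sqrt (2 * pi)) ^ 3) * cis (x \<bullet> \<eta>))"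
    using lborel_R3_prod(2)[of f, OF fi] unfolding g .
  from integrable_norm[OF this] have "integrable lborel (\<lambda>x. gauss x / (sqrt (2 * pi)) ^ 3)"
    by (simp add: norm_mult norm_divide norm_power gauss_def)
  from integrable_mult_right[OF this, of "(sqrt (2 * pi)) ^ 3"] show "integrable lborel gauss" by simp
qed

lemma Fubini_kernel:
  fixes f g :: "R3 \<Rightarrow> complex" and K :: "R3 \<Rightarrow> R3 \<Rightarrow> complex"
  assumes f: "integrable lborel f" and g: "integrable lborel g"
    and K[measurable]: "(\<lambda>(x, y). K x y) \<in> borel_measurable (borel \<Otimes>\<^sub>M borel)" and K1: "\<And>x y. norm (K x y) \<le> 1"
  shows "(\<integral>x. (\<integral>y. f x * g y * K x y \<partial>lborel) \<partial>lborel) = (\<integral>y. (\<integral>x. f x * g y * K x y \<partial>lborel) \<partial>lborel)"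
proof -
  have [measurable]: "f \<in> borel_measurable borel" "g \<in> borel_measurable borel" using f g by auto
  have "integrable (lborel \<Otimes>\<^sub>M lborel) (\<lambda>(x, y). f x * g y)"
  proof (rule lborel_pair.Fubini_integrable)
    show "integrable lborel (\<lambda>x. \<integral>y. norm (case (x, y) of (x, y) \<Rightarrow> f x * g y) \<partial>lborel)"
      using f by (simp add: norm_mult)
    show "AE x in lborel. integrable lborel (\<lambda>y. case (x, y) of (x, y) \<Rightarrow> f x * g y)"
      using g by simp
  qed measurable
  then have i: "integrable (lborel \<Otimes>\<^sub>M lborel) (\<lambda>(x, y). f x * g y * K x y)"
  proof (rule Bochner_Integration.integrable_bound)
    show "(\<lambda>(x, y). f x * g y * K x y) \<in> borel_measurable (lborel \<Otimes>\<^sub>M lborel)" by measurable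
    show "AE z in lborel \<Otimes>\<^sub>M lborel. norm (case z of (x, y) \<Rightarrow> f x * g y * K x y) \<le> norm (case z of (x, y) \<Rightarrow> f x * g y)"
      by (rule AE_I2) (auto simp: norm_mult mult_left_le K1)
  qed
  from lborel_pair.Fubini_integral[OF this] show ?thesis by simp
qed

lemma gauss_measurable [measurable]: "gauss \<in> borel_measurable borel"
  unfolding gauss_def by measurable

lemma gauss_fourier_scaled:
  assumes n: "n > 0"
  shows "(\<integral>x. complex_of_real (gauss (x /\<^sub>R n)) * cis (x \<bullet> \<eta>) \<partial>lborel)
    = complex_of_real (n ^ 3 * ((sqrt (2 * pi)) ^ 3 * gauss (n *\<^sub>R \<eta>)))"
proof -
  have "(\<integral>x. complex_of_real (gauss (x /\<^sub>R n)) * cis (x \<bullet> \<eta>) \<partial>lborel)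
    = \<bar>n\<bar> ^ 3 *\<^sub>R (\<integral>x. complex_of_real (gauss ((0 + n *\<^sub>R x) /\<^sub>R n)) * cis ((0 + n *\<^sub>R x) \<bullet> \<eta>) \<partial>lborel)"
    by (rule integral_affine[where f="\<lambda>x. complex_of_real (gauss (x /\<^sub>R n)) * cis (x \<bullet> \<eta>)"]) (use n in \<open>measurable, simp\<close>)
  also have "\<dots> = \<bar>n\<bar> ^ 3 *\<^sub>R (\<integral>x. complex_of_real (gauss x) * cis (x \<bullet> (n *\<^sub>R \<eta>)) \<partial>lborel)"
    using n by simp
  finally show ?thesis unfolding gauss_fourier using n by (simp add: scaleR_conv_of_real)
qed

text \<open>The outer integral is regularised by the Gaussian of width n, so that Fubini applies.
  The inner integral then becomes a Gaussian of width 1/n around \<xi>, and the regularised integral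
  is an average of m that concentrates at \<xi>.\<close>

lemma E_inversion:
  assumes m: "bump m"
  shows "(\<integral>x. E m x * cis (- (x \<bullet> \<xi>)) \<partial>lborel) = complex_of_real ((2 * pi) ^ 3) * m \<xi>"
proof -
  note [measurable] = bump_measurable[OF m] schwartz_measurable[OF schwartz_E[OF m]]
  have mi: "integrable lborel m" by (rule bump_integrable[OF m])
  have Ei: "integrable lborel (E m)" by (rule schwartz_integrable[OF schwartz_E[OF m]])
  obtain M where M: "M > 0" "\<And>x. norm (m x) \<le> M" using bump_bounded[OF m] by blast
  define s where "s = sqrt (2 * pi)"
  define r where "r n = real (Suc n)" for n
  have r: "r n > 0" for n by (simp add: r_def)
  have ri: "(\<lambda>n. inverse (r n)) \<longlonglongrightarrow> 0" unfolding r_def by (rule LIMSEQ_inverse_real_of_nat)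
  define X where "X n = (\<integral>x. E m x * cis (- (x \<bullet> \<xi>)) * complex_of_real (gauss (x /\<^sub>R r n)) \<partial>lborel)" for n
  have lim1: "X \<longlonglongrightarrow> (\<integral>x. E m x * cis (- (x \<bullet> \<xi>)) \<partial>lborel)"
    unfolding X_def
  proof (rule integral_dominated_convergence[where w="\<lambda>x. norm (E m x)"])
    show "AE x in lborel. (\<lambda>n. E m x * cis (- (x \<bullet> \<xi>)) * complex_of_real (gauss (x /\<^sub>R r n))) \<longlonglongrightarrow> E m x * cis (- (x \<bullet> \<xi>))"
    proof (rule AE_I2)
      fix x
      have "(\<lambda>n. E m x * cis (- (x \<bullet> \<xi>)) * complex_of_real (exp (- (norm (inverse (r n) *\<^sub>R x))\<^sup>2 / 2)))
        \<longlonglongrightarrow> E m x * cis (- (x \<bullet> \<xi>)) * complex_of_real (exp (- (norm ((0::real) *\<^sub>R x))\<^sup>2 / 2))"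
        by (intro tendsto_intros ri) auto
      then show "(\<lambda>n. E m x * cis (- (x \<bullet> \<xi>)) * complex_of_real (gauss (x /\<^sub>R r n))) \<longlonglongrightarrow> E m x * cis (- (x \<bullet> \<xi>))"
        by (simp add: gauss_def)
    qed
    show "AE x in lborel. norm (E m x * cis (- (x \<bullet> \<xi>)) * complex_of_real (gauss (x /\<^sub>R r n))) \<le> norm (E m x)" for n
      by (rule AE_I2) (auto simp: norm_mult gauss_def mult_left_le)
  qed (use Ei in auto)
  \<comment> \<open>After exchanging the integrals, the substitution \<eta> = \<xi> + z / n moves
    the shrinking width from the Gaussian into the argument of m; the powers of n cancel with the
    Jacobian.\<close>
  have X: "X n = complex_of_real (s ^ 3) * (\<integral>z. m (\<xi> + z /\<^sub>R r n) * complex_of_real (gauss z) \<partial>lborel)" for n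
  proof -
    have gi: "integrable lborel (\<lambda>x. complex_of_real (gauss (x /\<^sub>R r n)))"
      using integrable_affine[OF gauss_integrable, of "inverse (r n)" 0] r[of n] by simp
    have "X n = (\<integral>x. (\<integral>\<eta>. complex_of_real (gauss (x /\<^sub>R r n)) * m \<eta> * cis (x \<bullet> (\<eta> - \<xi>)) \<partial>lborel) \<partial>lborel)"
      unfolding X_def
    proof (intro Bochner_Integration.integral_cong refl)
      fix x
      have "(\<integral>\<eta>. complex_of_real (gauss (x /\<^sub>R r n)) * m \<eta> * cis (x \<bullet> (\<eta> - \<xi>)) \<partial>lborel)
         = (\<integral>\<eta>. (cis (- (x \<bullet> \<xi>)) * complex_of_real (gauss (x /\<^sub>R r n))) * (m \<eta> * cis (x \<bullet> \<eta>)) \<partial>lborel)"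
      proof (intro Bochner_Integration.integral_cong refl)
        fix \<eta>
        have "cis (x \<bullet> (\<eta> - \<xi>)) = cis (- (x \<bullet> \<xi>)) * cis (x \<bullet> \<eta>)" by (simp add: cis_mult inner_diff_right)
        then show "complex_of_real (gauss (x /\<^sub>R r n)) * m \<eta> * cis (x \<bullet> (\<eta> - \<xi>))
           = (cis (- (x \<bullet> \<xi>)) * complex_of_real (gauss (x /\<^sub>R r n))) * (m \<eta> * cis (x \<bullet> \<eta>))" by (simp only: mult_ac)
      qed
      also have "\<dots> = (cis (- (x \<bullet> \<xi>)) * complex_of_real (gauss (x /\<^sub>R r n))) * E m x"
        unfolding E_def by (rule Bochner_Integration.integral_mult_right_zero)
      finally show "E m x * cis (- (x \<bullet> \<xi>)) * complex_of_real (gauss (x /\<^sub>R r n))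
         = (\<integral>\<eta>. complex_of_real (gauss (x /\<^sub>R r n)) * m \<eta> * cis (x \<bullet> (\<eta> - \<xi>)) \<partial>lborel)" by (simp only: mult_ac)
    qed
    also have "\<dots> = (\<integral>\<eta>. (\<integral>x. complex_of_real (gauss (x /\<^sub>R r n)) * m \<eta> * cis (x \<bullet> (\<eta> - \<xi>)) \<partial>lborel) \<partial>lborel)"
      by (rule Fubini_kernel[OF gi mi]) auto
    also have "\<dots> = (\<integral>\<eta>. m \<eta> * complex_of_real (r n ^ 3 * (s ^ 3 * gauss (r n *\<^sub>R (\<eta> - \<xi>)))) \<partial>lborel)"
    proof (intro Bochner_Integration.integral_cong refl)
      fix \<eta>
      have "(\<integral>x. complex_of_real (gauss (x /\<^sub>R r n)) * m \<eta> * cis (x \<bullet> (\<eta> - \<xi>)) \<partial>lborel)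
        = (\<integral>x. m \<eta> * (complex_of_real (gauss (x /\<^sub>R r n)) * cis (x \<bullet> (\<eta> - \<xi>))) \<partial>lborel)"
        by (simp only: mult_ac)
      also have "\<dots> = m \<eta> * (\<integral>x. complex_of_real (gauss (x /\<^sub>R r n)) * cis (x \<bullet> (\<eta> - \<xi>)) \<partial>lborel)"
        by (rule Bochner_Integration.integral_mult_right_zero)
      finally show "(\<integral>x. complex_of_real (gauss (x /\<^sub>R r n)) * m \<eta> * cis (x \<bullet> (\<eta> - \<xi>)) \<partial>lborel)
        = m \<eta> * complex_of_real (r n ^ 3 * (s ^ 3 * gauss (r n *\<^sub>R (\<eta> - \<xi>))))"
        by (simp only: gauss_fourier_scaled[OF r] s_def)
    qed
    also have "\<dots> = \<bar>inverse (r n)\<bar> ^ 3 *\<^sub>R (\<integral>z. m (\<xi> + inverse (r n) *\<^sub>R z) *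
        complex_of_real (r n ^ 3 * (s ^ 3 * gauss (r n *\<^sub>R ((\<xi> + inverse (r n) *\<^sub>R z) - \<xi>)))) \<partial>lborel)"
      by (rule integral_affine[where f="\<lambda>\<eta>. m \<eta> * complex_of_real (r n ^ 3 * (s ^ 3 * gauss (r n *\<^sub>R (\<eta> - \<xi>))))"])
         (use r[of n] in \<open>measurable, simp\<close>)
    also have "\<dots> = \<bar>inverse (r n)\<bar> ^ 3 *\<^sub>R (\<integral>z. complex_of_real (r n ^ 3 * s ^ 3) * (m (\<xi> + inverse (r n) *\<^sub>R z) * complex_of_real (gauss z)) \<partial>lborel)"
      using r[of n] by (simp add: mult_ac)
    also have "\<dots> = \<bar>inverse (r n)\<bar> ^ 3 *\<^sub>R (complex_of_real (r n ^ 3 * s ^ 3) * (\<integral>z. m (\<xi> + inverse (r n) *\<^sub>R z) * complex_of_real (gauss z) \<partial>lborel))"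
      by (subst Bochner_Integration.integral_mult_right_zero) (rule refl)
    also have "\<dots> = complex_of_real (\<bar>inverse (r n)\<bar> ^ 3 * (r n ^ 3 * s ^ 3)) * (\<integral>z. m (\<xi> + inverse (r n) *\<^sub>R z) * complex_of_real (gauss z) \<partial>lborel)"
      by (simp add: scaleR_conv_of_real)
    also have "\<bar>inverse (r n)\<bar> ^ 3 * (r n ^ 3 * s ^ 3) = s ^ 3"
      using r[of n] by (simp add: power_inverse)
    finally show ?thesis .
  qed
  have lim2: "(\<lambda>n. \<integral>z. m (\<xi> + z /\<^sub>R r n) * complex_of_real (gauss z) \<partial>lborel) \<longlonglongrightarrow> (\<integral>z. m \<xi> * complex_of_real (gauss z) \<partial>lborel)"
  proof (rule integral_dominated_convergence[where w="\<lambda>z. M * gauss z"])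
    show "AE z in lborel. (\<lambda>n. m (\<xi> + z /\<^sub>R r n) * complex_of_real (gauss z)) \<longlonglongrightarrow> m \<xi> * complex_of_real (gauss z)"
    proof (rule AE_I2)
      fix z
      have "(\<lambda>n. \<xi> + inverse (r n) *\<^sub>R z) \<longlonglongrightarrow> \<xi> + 0 *\<^sub>R z" by (intro tendsto_intros ri)
      moreover have "isCont m \<xi>" using smooth_continuous[OF bump_smooth[OF m], of UNIV] by (simp add: continuous_on_eq_continuous_at)
      ultimately have "(\<lambda>n. m (\<xi> + inverse (r n) *\<^sub>R z)) \<longlonglongrightarrow> m \<xi>"
        by (intro isCont_tendsto_compose[of \<xi> m]) simp_all
      then show "(\<lambda>n. m (\<xi> + z /\<^sub>R r n) * complex_of_real (gauss z)) \<longlonglongrightarrow> m \<xi> * complex_of_real (gauss z)"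
        by (intro tendsto_intros)
    qed
    show "AE z in lborel. norm (m (\<xi> + z /\<^sub>R r n) * complex_of_real (gauss z)) \<le> M * gauss z" for n
      by (rule AE_I2) (auto simp: norm_mult gauss_def intro!: mult_right_mono M(2))
    show "integrable lborel (\<lambda>z. M * gauss z)" using gauss_integrable by simp
  qed measurable
  \<comment> \<open>One factor s^3 is the mass of the Gaussian, the other comes from its transform;
    together they make (2 pi)^3.\<close>
  have "(\<integral>z. complex_of_real (gauss z) \<partial>lborel) = complex_of_real (s ^ 3)"
    using gauss_fourier[of 0] by (simp add: s_def gauss_def)
  then have "X \<longlonglongrightarrow> complex_of_real (s ^ 3) * (m \<xi> * complex_of_real (s ^ 3))"
    unfolding X using tendsto_mult_left[OF lim2, of "complex_of_real (s ^ 3)"] by (simp del: of_real_power)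
  with lim1 have "(\<integral>x. E m x * cis (- (x \<bullet> \<xi>)) \<partial>lborel) = complex_of_real (s ^ 3) * (m \<xi> * complex_of_real (s ^ 3))"
    by (rule LIMSEQ_unique)
  also have "\<dots> = complex_of_real (s ^ 3 * s ^ 3) * m \<xi>" by (simp add: mult_ac)
  also have "s ^ 3 * s ^ 3 = (s\<^sup>2) ^ 3" by (simp add: power2_eq_square power_mult_distrib)
  also have "s\<^sup>2 = 2 * pi" by (simp add: s_def)
  finally show ?thesis .
qed

text \<open>The first transform is written out and Fubini applied; what remains inside is the
  inversion formula for the second symbol.\<close>

lemma E_conv:
  assumes m1: "bump m1" and m2: "bump m2"
  shows "(\<integral>y. E m1 (x - y) * E m2 y \<partial>lborel) = complex_of_real ((2 * pi) ^ 3) * E (\<lambda>\<xi>. m1 \<xi> * m2 \<xi>) x"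
proof -
  note [measurable] = bump_measurable[OF m1] schwartz_measurable[OF schwartz_E[OF m2]]
  have "(\<integral>y. E m1 (x - y) * E m2 y \<partial>lborel) = (\<integral>y. (\<integral>\<xi>. E m2 y * m1 \<xi> * cis ((x - y) \<bullet> \<xi>) \<partial>lborel) \<partial>lborel)"
  proof (intro Bochner_Integration.integral_cong refl)
    fix y
    have "E m2 y * E m1 (x - y) = (\<integral>\<xi>. E m2 y * (m1 \<xi> * cis ((x - y) \<bullet> \<xi>)) \<partial>lborel)"
      unfolding E_def[of m1] by (rule Bochner_Integration.integral_mult_right_zero[symmetric])
    then show "E m1 (x - y) * E m2 y = (\<integral>\<xi>. E m2 y * m1 \<xi> * cis ((x - y) \<bullet> \<xi>) \<partial>lborel)" by (simp only: mult_ac)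
  qed
  also have "\<dots> = (\<integral>\<xi>. (\<integral>y. E m2 y * m1 \<xi> * cis ((x - y) \<bullet> \<xi>) \<partial>lborel) \<partial>lborel)"
    by (rule Fubini_kernel[OF schwartz_integrable[OF schwartz_E[OF m2]] bump_integrable[OF m1]]) auto
  also have "\<dots> = (\<integral>\<xi>. complex_of_real ((2 * pi) ^ 3) * (m1 \<xi> * m2 \<xi> * cis (x \<bullet> \<xi>)) \<partial>lborel)"
  proof (intro Bochner_Integration.integral_cong refl)
    fix \<xi>
    have "(\<integral>y. E m2 y * m1 \<xi> * cis ((x - y) \<bullet> \<xi>) \<partial>lborel) = (\<integral>y. (m1 \<xi> * cis (x \<bullet> \<xi>)) * (E m2 y * cis (- (y \<bullet> \<xi>))) \<partial>lborel)"
    proof (intro Bochner_Integration.integral_cong refl)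
      fix y
      have "cis ((x - y) \<bullet> \<xi>) = cis (x \<bullet> \<xi>) * cis (- (y \<bullet> \<xi>))" by (simp add: cis_mult inner_diff_left)
      then show "E m2 y * m1 \<xi> * cis ((x - y) \<bullet> \<xi>) = (m1 \<xi> * cis (x \<bullet> \<xi>)) * (E m2 y * cis (- (y \<bullet> \<xi>)))" by (simp only: mult_ac)
    qed
    also have "\<dots> = (m1 \<xi> * cis (x \<bullet> \<xi>)) * (complex_of_real ((2 * pi) ^ 3) * m2 \<xi>)"
      by (simp only: Bochner_Integration.integral_mult_right_zero E_inversion[OF m2])
    finally show "(\<integral>y. E m2 y * m1 \<xi> * cis ((x - y) \<bullet> \<xi>) \<partial>lborel) = complex_of_real ((2 * pi) ^ 3) * (m1 \<xi> * m2 \<xi> * cis (x \<bullet> \<xi>))"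
      by (simp only: mult_ac)
  qed
  also have "\<dots> = complex_of_real ((2 * pi) ^ 3) * E (\<lambda>\<xi>. m1 \<xi> * m2 \<xi>) x"
    unfolding E_def by (rule Bochner_Integration.integral_mult_right_zero)
  finally show ?thesis .
qed

section \<open>Real convolution kernels of Fourier multipliers\<close>

text \<open>The real part makes the kernel a real function for every symbol. For even symbols
  nothing is lost, since their transform is already real by \<open>E_real\<close>.\<close>

definition ker :: "(R3 \<Rightarrow> real) \<Rightarrow> R3 \<Rightarrow> real" where
  "ker m x = Re (E (\<lambda>\<xi>. complex_of_real (m \<xi>)) x) / (2 * pi) ^ 3"

definition evenf :: "(R3 \<Rightarrow> real) \<Rightarrow> bool" where "evenf m \<longleftrightarrow> (\<forall>x. m (- x) = m x)"

lemma bump_of_real: "bump m \<Longrightarrow> bump (\<lambda>x. complex_of_real (m x))"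
  using bump_bounded_linear[OF bounded_linear_of_real] .

lemma bounded_linear_Re_scaled: "bounded_linear (\<lambda>z. Re z / (2 * pi) ^ 3)"
  by (intro bounded_linear_compose[OF bounded_linear_divide bounded_linear_Re])

lemma schwartz_ker: "bump m \<Longrightarrow> schwartz (ker m)"
  unfolding ker_def[abs_def]
  by (rule schwartz_bounded_linear[OF bounded_linear_Re_scaled schwartz_E[OF bump_of_real]])

lemma E_real:
  assumes m: "bump m" and e: "evenf m"
  shows "E (\<lambda>\<xi>. complex_of_real (m \<xi>)) x = complex_of_real ((2 * pi) ^ 3 * ker m x)"
    and "E (\<lambda>\<xi>. complex_of_real (m \<xi>)) (- x) = E (\<lambda>\<xi>. complex_of_real (m \<xi>)) x"
proof -
  note [measurable] = bump_measurable[OF m]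
  let ?E = "E (\<lambda>\<xi>. complex_of_real (m \<xi>))"
  have "(\<integral>\<xi>. complex_of_real (m (0 - \<xi>)) * cis (x \<bullet> (0 - \<xi>)) \<partial>lborel) = ?E x"
    unfolding E_def
    by (rule integral_shift(2)[where f="\<lambda>\<xi>. complex_of_real (m \<xi>) * cis (x \<bullet> \<xi>)"]) measurable
  then have r: "(\<integral>\<xi>. complex_of_real (m \<xi>) * cis (- (x \<bullet> \<xi>)) \<partial>lborel) = ?E x"
    using e by (simp add: evenf_def)
  then show "?E (- x) = ?E x" by (simp add: E_def)
  have "cnj (?E x) = (\<integral>\<xi>. cnj (complex_of_real (m \<xi>) * cis (x \<bullet> \<xi>)) \<partial>lborel)"
    unfolding E_def using Bochner_Integration.integral_cnj[of lborel "\<lambda>\<xi>. complex_of_real (m \<xi>) * cis (x \<bullet> \<xi>)"] by (simp only:)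
  also have "\<dots> = ?E x" using r by (simp add: cis_cnj)
  finally have "Im (?E x) = 0" by (simp add: complex_eq_iff)
  then show "?E x = complex_of_real ((2 * pi) ^ 3 * ker m x)" by (simp add: ker_def complex_eq_iff)
qed

lemma ker_minus: "bump m \<Longrightarrow> evenf m \<Longrightarrow> ker m (- x) = ker m x"
  by (simp add: ker_def E_real(2))

lemma conv_ker:
  assumes m1: "bump m1" "evenf m1" and m2: "bump m2" "evenf m2"
  shows "conv (ker m1) (ker m2) x = ker (\<lambda>\<xi>. m1 \<xi> * m2 \<xi>) x"
proof -
  have b: "bump (\<lambda>\<xi>. m1 \<xi> * m2 \<xi>)" "evenf (\<lambda>\<xi>. m1 \<xi> * m2 \<xi>)"
    using bump_mult[OF m2(1) bump_smooth[OF m1(1)]] m1 m2 by (auto simp: evenf_def)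
  let ?c = "complex_of_real ((2 * pi) ^ 3)"
  have "?c * ?c * complex_of_real (conv (ker m1) (ker m2) x)
     = (\<integral>y. complex_of_real ((2 * pi) ^ 3 * ker m1 (x - y)) * complex_of_real ((2 * pi) ^ 3 * ker m2 y) \<partial>lborel)"
    unfolding conv_def integral_complex_of_real[symmetric]
    by (subst Bochner_Integration.integral_mult_right_zero[symmetric]) (simp add: mult_ac)
  also have "\<dots> = (\<integral>y. E (\<lambda>\<xi>. complex_of_real (m1 \<xi>)) (x - y) * E (\<lambda>\<xi>. complex_of_real (m2 \<xi>)) y \<partial>lborel)"
    by (simp only: E_real(1)[OF m1] E_real(1)[OF m2])
  also have "\<dots> = ?c * E (\<lambda>\<xi>. complex_of_real (m1 \<xi>) * complex_of_real (m2 \<xi>)) x"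
    by (rule E_conv[OF bump_of_real[OF m1(1)] bump_of_real[OF m2(1)]])
  also have "\<dots> = ?c * complex_of_real ((2 * pi) ^ 3 * ker (\<lambda>\<xi>. m1 \<xi> * m2 \<xi>) x)"
    using E_real(1)[OF b] by simp
  finally have "?c * ?c * complex_of_real (conv (ker m1) (ker m2) x) = ?c * ?c * complex_of_real (ker (\<lambda>\<xi>. m1 \<xi> * m2 \<xi>) x)"
    by simp
  from mult_left_cancel[THEN iffD1, OF _ this]
  have "complex_of_real (conv (ker m1) (ker m2) x) = complex_of_real (ker (\<lambda>\<xi>. m1 \<xi> * m2 \<xi>) x)" by simp
  then show ?thesis by (simp only: of_real_eq_iff)
qed

lemma ker_integral:
  assumes m: "bump m" "evenf m" shows "(\<integral>x. ker m x \<partial>lborel) = m 0"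
proof -
  have "complex_of_real ((2 * pi) ^ 3) * complex_of_real (m 0) = (\<integral>x. complex_of_real ((2 * pi) ^ 3 * ker m x) \<partial>lborel)"
    using E_inversion[OF bump_of_real[OF m(1)], of 0] by (simp add: E_real(1)[OF m] del: of_real_mult of_real_power)
  also have "\<dots> = complex_of_real ((2 * pi) ^ 3 * (\<integral>x. ker m x \<partial>lborel))"
    by (simp only: integral_complex_of_real Bochner_Integration.integral_mult_right_zero)
  finally have "complex_of_real ((2 * pi) ^ 3 * m 0) = complex_of_real ((2 * pi) ^ 3 * (\<integral>x. ker m x \<partial>lborel))" by simp
  then have "(2 * pi) ^ 3 * m 0 = (2 * pi) ^ 3 * (\<integral>x. ker m x \<partial>lborel)" by (simp only: of_real_eq_iff)
  then show ?thesis by simp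
qed

lemma ker_scale:
  assumes m: "bump m" and r: "r > 0"
  shows "ker (\<lambda>\<xi>. m (\<xi> /\<^sub>R r)) x = r ^ 3 * ker m (r *\<^sub>R x)"
proof -
  note [measurable] = bump_measurable[OF m]
  have "E (\<lambda>\<xi>. complex_of_real (m (\<xi> /\<^sub>R r))) x
    = \<bar>r\<bar> ^ 3 *\<^sub>R (\<integral>\<xi>. complex_of_real (m ((0 + r *\<^sub>R \<xi>) /\<^sub>R r)) * cis (x \<bullet> (0 + r *\<^sub>R \<xi>)) \<partial>lborel)"
    unfolding E_def
    by (rule integral_affine[where f="\<lambda>\<xi>. complex_of_real (m (\<xi> /\<^sub>R r)) * cis (x \<bullet> \<xi>)"]) (use r in \<open>measurable, simp\<close>)
  also have "\<dots> = r ^ 3 *\<^sub>R E (\<lambda>\<xi>. complex_of_real (m \<xi>)) (r *\<^sub>R x)"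
    using r by (simp add: E_def)
  finally show ?thesis by (simp add: ker_def)
qed

text \<open>Two differentiations contribute \<i> squared. The Leray projector is put into this form,
  as a second derivative of one kernel, so that it can act on divergence-free fields.\<close>

lemma partial_partial_ker:
  assumes m: "bump m"
  shows "partial i (partial j (ker m)) x = - ker (\<lambda>\<xi>. \<xi> $ i * \<xi> $ j * m \<xi>) x"
proof -
  let ?m = "\<lambda>\<xi>. complex_of_real (m \<xi>)"
  let ?m1 = "\<lambda>\<xi>. \<i> * complex_of_real (\<xi> $ j) * ?m \<xi>"
  let ?m2 = "\<lambda>\<xi>. \<i> * complex_of_real (\<xi> $ i) * ?m1 \<xi>"
  have b: "bump ?m" "bump ?m1" using bump_of_real[OF m] bump_coord by auto
  note pb = partial_bounded_linear(1)[OF bounded_linear_Re_scaled smooth_differentiable[OF schwartz_smooth[OF schwartz_E]]]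
  have 1: "partial j (ker m) = (\<lambda>x. Re (E ?m1 x) / (2 * pi) ^ 3)"
    using pb[OF b(1)] by (auto simp: ker_def[abs_def] partial_E[OF b(1)])
  have "partial i (partial j (ker m)) x = Re (E ?m2 x) / (2 * pi) ^ 3"
    unfolding 1 pb[OF b(2)] partial_E[OF b(2)] by simp
  also have "E ?m2 x = (\<integral>\<xi>. - (complex_of_real (\<xi> $ i * \<xi> $ j * m \<xi>) * cis (x \<bullet> \<xi>)) \<partial>lborel)"
    unfolding E_def by (intro Bochner_Integration.integral_cong refl) (simp add: algebra_simps)
  also have "\<dots> = - E (\<lambda>\<xi>. complex_of_real (\<xi> $ i * \<xi> $ j * m \<xi>)) x"
    unfolding E_def by (rule Bochner_Integration.integral_minus)
  finally show ?thesis
    unfolding ker_def[of "\<lambda>\<xi>. \<xi> $ i * \<xi> $ j * m \<xi>" x] by simp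
qed

lemma ker_diff:
  assumes "bump a" "bump b" shows "ker (\<lambda>\<xi>. a \<xi> - b \<xi>) x = ker a x - ker b x"
  unfolding ker_def E_def
  using integrable_mult_cis[OF bump_integrable[OF bump_of_real[OF assms(1)]], of x]
    integrable_mult_cis[OF bump_integrable[OF bump_of_real[OF assms(2)]], of x]
  by (simp add: left_diff_distrib diff_divide_distrib)

text \<open>By duality the operator acts on a test function in reverse order: inverse transform,
  symbol, transform. Evenness of the symbol makes the resulting kernel the same as for the direct
  operator.\<close>

lemma fourier_multiplier:
  assumes m: "bump m" "evenf m" and f: "integrable lborel f"
  shows "fourier (\<lambda>\<xi>. complex_of_real (m \<xi>) * inv_fourier f \<xi>) x = (\<integral>y. complex_of_real (ker m (x - y)) * f y \<partial>lborel)"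
proof -
  let ?c = "complex_of_real (1 / (2 * pi) ^ 3)"
  let ?m = "\<lambda>\<xi>. complex_of_real (m \<xi>)"
  note [measurable] = bump_measurable[OF m(1)]
  have "fourier (\<lambda>\<xi>. complex_of_real (m \<xi>) * inv_fourier f \<xi>) x
    = (\<integral>\<xi>. (\<integral>y. ?c * ((?m \<xi> * f y) * cis ((y - x) \<bullet> \<xi>)) \<partial>lborel) \<partial>lborel)"
    unfolding fourier_def
  proof (rule Bochner_Integration.integral_cong[OF refl])
    fix \<xi>
    have "(\<integral>y. ?c * ((?m \<xi> * f y) * cis ((y - x) \<bullet> \<xi>)) \<partial>lborel) = (\<integral>y. (?c * ?m \<xi> * cis (- (\<xi> \<bullet> x))) * (f y * cis (\<xi> \<bullet> y)) \<partial>lborel)"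
    proof (intro Bochner_Integration.integral_cong refl)
      fix y
      have "cis ((y - x) \<bullet> \<xi>) = cis (- (\<xi> \<bullet> x)) * cis (\<xi> \<bullet> y)" by (simp add: cis_mult inner_diff_left inner_diff_right inner_commute)
      then show "?c * ((?m \<xi> * f y) * cis ((y - x) \<bullet> \<xi>)) = (?c * ?m \<xi> * cis (- (\<xi> \<bullet> x))) * (f y * cis (\<xi> \<bullet> y))"
        by (simp only: mult_ac)
    qed
    also have "\<dots> = (?c * ?m \<xi> * cis (- (\<xi> \<bullet> x))) * (\<integral>y. f y * cis (\<xi> \<bullet> y) \<partial>lborel)"
      by (rule Bochner_Integration.integral_mult_right_zero)
    finally show "?m \<xi> * inv_fourier f \<xi> * cis (- (\<xi> \<bullet> x)) = (\<integral>y. ?c * ((?m \<xi> * f y) * cis ((y - x) \<bullet> \<xi>)) \<partial>lborel)"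
      unfolding inv_fourier_def by (simp only: mult_ac)
  qed
  also have "\<dots> = ?c * (\<integral>\<xi>. (\<integral>y. (?m \<xi> * f y) * cis ((y - x) \<bullet> \<xi>) \<partial>lborel) \<partial>lborel)"
    by (simp only: Bochner_Integration.integral_mult_right_zero)
  also have "(\<integral>\<xi>. (\<integral>y. (?m \<xi> * f y) * cis ((y - x) \<bullet> \<xi>) \<partial>lborel) \<partial>lborel)
     = (\<integral>y. (\<integral>\<xi>. (?m \<xi> * f y) * cis ((y - x) \<bullet> \<xi>) \<partial>lborel) \<partial>lborel)"
    by (rule Fubini_kernel[OF bump_integrable[OF bump_of_real[OF m(1)]] f]) auto
  also have "\<dots> = (\<integral>y. complex_of_real ((2 * pi) ^ 3) * (complex_of_real (ker m (x - y)) * f y) \<partial>lborel)"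
  proof (intro Bochner_Integration.integral_cong refl)
    fix y
    have "(\<integral>\<xi>. (?m \<xi> * f y) * cis ((y - x) \<bullet> \<xi>) \<partial>lborel) = (\<integral>\<xi>. f y * (?m \<xi> * cis ((y - x) \<bullet> \<xi>)) \<partial>lborel)"
      by (simp only: mult_ac)
    also have "\<dots> = f y * E ?m (y - x)" unfolding E_def by (rule Bochner_Integration.integral_mult_right_zero)
    also have "E ?m (y - x) = complex_of_real ((2 * pi) ^ 3 * ker m (x - y))"
      using E_real(1)[OF m, of "x - y"] E_real(2)[OF m, of "x - y"] by simp
    finally show "(\<integral>\<xi>. (?m \<xi> * f y) * cis ((y - x) \<bullet> \<xi>) \<partial>lborel) = complex_of_real ((2 * pi) ^ 3) * (complex_of_real (ker m (x - y)) * f y)"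
      by (simp add: mult_ac)
  qed
  also have "\<dots> = complex_of_real ((2 * pi) ^ 3) * (\<integral>y. complex_of_real (ker m (x - y)) * f y \<partial>lborel)"
    by (rule Bochner_Integration.integral_mult_right_zero)
  finally show ?thesis by simp
qed

section \<open>Convolution algebra and the action of multipliers on functions\<close>

lemma Fubini_dom:
  fixes F :: "R3 \<Rightarrow> R3 \<Rightarrow> 'b::{banach,second_countable_topology}"
  assumes meas: "(\<lambda>(x, y). F x y) \<in> borel_measurable (borel \<Otimes>\<^sub>M borel)"
    and a: "integrable lborel a" and b: "integrable lborel b" and F: "\<And>x y. norm (F x y) \<le> a x * b y"
  shows "integrable (lborel \<Otimes>\<^sub>M lborel) (\<lambda>(x, y). F x y)"
    and "(\<integral>x. (\<integral>y. F x y \<partial>lborel) \<partial>lborel) = (\<integral>y. (\<integral>x. F x y \<partial>lborel) \<partial>lborel)"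
    and "integrable lborel (\<lambda>x. \<integral>y. F x y \<partial>lborel)" and "integrable lborel (\<lambda>y. \<integral>x. F x y \<partial>lborel)"
proof -
  have [measurable]: "a \<in> borel_measurable borel" "b \<in> borel_measurable borel" using a b by auto
  have m: "(\<lambda>(x, y). F x y) \<in> borel_measurable (lborel \<Otimes>\<^sub>M lborel)"
    using meas by (simp cong: measurable_cong_sets)
  have "integrable (lborel \<Otimes>\<^sub>M lborel) (\<lambda>(x, y). a x * b y)"
  proof (rule lborel_pair.Fubini_integrable)
    show "integrable lborel (\<lambda>x. \<integral>y. norm (case (x, y) of (x, y) \<Rightarrow> a x * b y) \<partial>lborel)"
      using a by (simp add: abs_mult)
    show "AE x in lborel. integrable lborel (\<lambda>y. case (x, y) of (x, y) \<Rightarrow> a x * b y)"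
      using b by simp
  qed measurable
  then show i: "integrable (lborel \<Otimes>\<^sub>M lborel) (\<lambda>(x, y). F x y)"
    by (rule Bochner_Integration.integrable_bound[OF _ m])
       (auto intro!: AE_I2 order_trans[OF F abs_ge_self])
  show "(\<integral>x. (\<integral>y. F x y \<partial>lborel) \<partial>lborel) = (\<integral>y. (\<integral>x. F x y \<partial>lborel) \<partial>lborel)"
    by (rule lborel_pair.Fubini_integral[OF i, symmetric])
  show "integrable lborel (\<lambda>x. \<integral>y. F x y \<partial>lborel)" by (rule lborel_pair.integrable_fst[OF i])
  show "integrable lborel (\<lambda>y. \<integral>x. F x y \<partial>lborel)" by (rule lborel_pair.integrable_snd[OF i])
qed

lemma tame_integrable:
  assumes "integrable lborel u" shows "tame u"
  unfolding tame_def
proof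
  show u: "u \<in> borel_measurable borel" using assms by auto
  show "integrable lborel (\<lambda>y. wt y * \<bar>u y\<bar>)"
    by (rule Bochner_Integration.integrable_bound[OF assms])
       (use u in \<open>auto intro!: AE_I2 mult_left_le_one_le wt_le_1 simp: abs_mult wt_nonneg\<close>)
qed

lemma tame_bounded:
  assumes u: "u \<in> borel_measurable borel" and M: "\<And>x. \<bar>u x\<bar> \<le> M" shows "tame u"
  unfolding tame_def
proof
  show "integrable lborel (\<lambda>y. wt y * \<bar>u y\<bar>)"
  proof (rule Bochner_Integration.integrable_bound[OF integrable_mult_left[OF wt_integrable, of M]])
    show "AE x in lborel. norm (wt x * \<bar>u x\<bar>) \<le> norm (wt x * M)"
      using mult_left_mono[OF M wt_nonneg] wt_nonneg by (auto intro!: AE_I2 order_trans[OF _ abs_ge_self])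
  qed (use u in measurable)
qed fact

lemma LP_wt: "LP 2 wt (sqrt (\<integral>x. wt x \<partial>lborel))"
proof (rule LPI)
  have le: "\<bar>wt x\<bar> ^ 2 \<le> wt x" for x
    using wt_nonneg[of x] wt_le_1[of x] by (simp add: power2_eq_square mult_left_le)
  show i: "integrable lborel (\<lambda>x. \<bar>wt x\<bar> ^ 2)"
    by (rule Bochner_Integration.integrable_bound[OF wt_integrable]) (use le wt_nonneg in \<open>auto intro!: AE_I2\<close>)
  have "(\<integral>x. \<bar>wt x\<bar> ^ 2 \<partial>lborel) \<le> (\<integral>x. wt x \<partial>lborel)"
    by (rule integral_mono[OF i wt_integrable le])
  then show "(\<integral>x. \<bar>wt x\<bar> ^ 2 \<partial>lborel) \<le> (sqrt (\<integral>x. wt x \<partial>lborel)) ^ 2"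
    by (simp add: wt_nonneg)
qed (auto simp: wt_nonneg)

lemma tame_LP2:
  assumes "LP 2 u A" shows "tame u"
  using integrable_abs[OF LP2_prod(2)[OF LP_wt assms]] LP_measurable[OF assms]
  by (simp add: tame_def abs_mult wt_nonneg)

lemma schwartz_LP2:
  assumes k: "schwartz k" shows "\<exists>A. LP 2 k A"
proof -
  obtain C where C: "C > 0" "\<And>x. norm (k x) \<le> C * wt x" using schwartz_wt[OF k] by blast
  have "LP 2 (\<lambda>x. C * wt x) (\<bar>C\<bar> * sqrt (\<integral>x. wt x \<partial>lborel))" by (rule LP_cmult[OF LP_wt])
  then have "LP 2 k (\<bar>C\<bar> * sqrt (\<integral>x. wt x \<partial>lborel))"
    by (rule LP_mono_abs) (use schwartz_measurable[OF k] C wt_nonneg in \<open>auto intro: order_trans[OF _ abs_ge_self]\<close>)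
  then show ?thesis by blast
qed

lemma schwartz_tame: "schwartz k \<Longrightarrow> tame k"
  by (rule tame_integrable[OF schwartz_integrable])

lemma conv_bound_LP2:
  assumes "LP 2 k A" "LP 2 u B" shows "\<bar>conv k u x\<bar> \<le> A * B"
  unfolding conv_def by (rule LP2_prod(3)[OF LP_shift(2)[OF assms(1)] assms(2)])

lemma conv_diff_left:
  assumes "schwartz k" "schwartz l" "tame u"
  shows "conv (\<lambda>x. k x - l x) u x = conv k u x - conv l u x"
  unfolding conv_def using conv_integrable[OF assms(1,3), of x] conv_integrable[OF assms(2,3), of x]
  by (simp add: left_diff_distrib)

lemma conv_diff_right:
  assumes "schwartz k" "tame u" "tame v"
  shows "conv k (\<lambda>x. u x - v x) x = conv k u x - conv k v x"
  unfolding conv_def using conv_integrable[OF assms(1,2), of x] conv_integrable[OF assms(1,3), of x]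
  by (simp add: right_diff_distrib)

lemma pow_shift: "1 / (1 + norm (x - y)) ^ n \<le> (1 + norm x) ^ n / (1 + norm (y :: 'a::real_normed_vector)) ^ n"
proof -
  have "(1 + norm y) ^ n \<le> ((1 + norm x) * (1 + norm (x - y))) ^ n"
    by (intro power_mono one_plus_norm_le) auto
  then show ?thesis by (simp add: power_mult_distrib divide_le_eq pos_le_divide_eq mult.commute)
qed

lemma conv_assoc:
  assumes k: "schwartz k" and l: "schwartz l" and u: "tame u"
  shows "conv k (conv l u) x = conv (conv k l) u x"
proof -
  \<comment> \<open>Order 12 is spent in two halves: one weight in y absorbs the loss (1 + norm y)^6
    caused by moving the weight of l from y - z to z, the other makes the y-integral
    converge.\<close>
  obtain C where C: "C > 0" "\<And>x. norm (k x) \<le> C / (1 + norm x) ^ 12" using schwartz_bound[OF k, of 12] by blast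
  obtain D where D: "D > 0" "\<And>x. norm (l x) \<le> D * wt x" using schwartz_wt[OF l] by blast
  note [measurable] = schwartz_measurable[OF k] schwartz_measurable[OF l] tame_measurable[OF u]
  let ?F = "\<lambda>y z. k (x - y) * (l (y - z) * u z)"
  have F: "norm (?F y z) \<le> (C * (1 + norm x) ^ 12 * wt y) * (D * (wt z * \<bar>u z\<bar>))" for y z
  proof -
    have "\<bar>k (x - y)\<bar> \<le> C * ((1 + norm x) ^ 12 * (wt y * wt y))"
    proof -
      have "\<bar>k (x - y)\<bar> \<le> C * (1 / (1 + norm (x - y)) ^ 12)" using C(2)[of "x - y"] by simp
      also have "\<dots> \<le> C * ((1 + norm x) ^ 12 / (1 + norm y) ^ 12)" using pow_shift C(1) by (intro mult_left_mono) auto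
      also have "(1 + norm x) ^ 12 / (1 + norm y) ^ 12 = (1 + norm x) ^ 12 * (wt y * wt y)"
        by (simp add: wt_def power_add[symmetric])
      finally show ?thesis .
    qed
    moreover have "\<bar>l (y - z)\<bar> \<le> D * ((1 + norm y) ^ 6 * wt z)"
      using order_trans[OF D(2)[of "y - z"] mult_left_mono[OF wt_shift[of y z] less_imp_le[OF D(1)]]]
      by (simp only: real_norm_def)
    ultimately have "\<bar>k (x - y)\<bar> * (\<bar>l (y - z)\<bar> * \<bar>u z\<bar>)
      \<le> C * ((1 + norm x) ^ 12 * (wt y * wt y)) * (D * ((1 + norm y) ^ 6 * wt z) * \<bar>u z\<bar>)"
      using C D wt_nonneg by (intro mult_mono mult_nonneg_nonneg) auto
    also have "\<dots> = (C * (1 + norm x) ^ 12 * wt y) * (D * (wt z * \<bar>u z\<bar>)) * (wt y * (1 + norm y) ^ 6)"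
      by (simp only: mult_ac)
    also have "wt y * (1 + norm y) ^ 6 = 1" by (simp add: wt_def)
    finally show ?thesis by (simp add: abs_mult)
  qed
  have ui: "integrable lborel (\<lambda>z. wt z * \<bar>u z\<bar>)" using u by (simp add: tame_def)
  have "(\<integral>y. (\<integral>z. ?F y z \<partial>lborel) \<partial>lborel) = (\<integral>z. (\<integral>y. ?F y z \<partial>lborel) \<partial>lborel)"
    by (rule Fubini_dom(2)[where a="\<lambda>y. C * (1 + norm x) ^ 12 * wt y" and b="\<lambda>z. D * (wt z * \<bar>u z\<bar>)"])
       (use F ui wt_integrable in auto)
  moreover have "(\<integral>z. ?F y z \<partial>lborel) = k (x - y) * conv l u y" for y
    unfolding conv_def by (rule Bochner_Integration.integral_mult_right_zero)
  moreover have "(\<integral>y. ?F y z \<partial>lborel) = conv k l (x - z) * u z" for z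
  proof -
    have "(\<integral>y. ?F y z \<partial>lborel) = (\<integral>y. (k (x - y) * l (y - z)) * u z \<partial>lborel)" by (simp only: mult_ac)
    also have "\<dots> = (\<integral>y. k (x - y) * l (y - z) \<partial>lborel) * u z" by (rule Bochner_Integration.integral_mult_left_zero)
    also have "(\<integral>y. k (x - y) * l (y - z) \<partial>lborel) = conv k l (x - z)"
      unfolding conv_def using integral_shift(1)[of "\<lambda>y. k (x - z - y) * l y" z] by simp
    finally show ?thesis .
  qed
  ultimately show ?thesis unfolding conv_def[of k "conv l u" x] conv_def[of "conv k l" u x] by (simp only:)
qed

lemma conv_comm:
  assumes "schwartz k" "schwartz l" shows "conv k l = conv l k"
proof
  fix x
  show "conv k l x = conv l k x"
    unfolding conv_commute[OF schwartz_measurable[OF assms(1)] schwartz_measurable[OF assms(2)]]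
    by (simp add: conv_def mult.commute)
qed

text \<open>Fubini for the kernel k(x - y), symmetric because k is even. The absolute integrability
  enters as a hypothesis, to be supplied either by two square integrable functions or by one
  integrable and one bounded function.\<close>

lemma conv_adjoint:
  assumes k: "schwartz k" "\<And>x. k (- x) = k x" and v: "v \<in> borel_measurable borel" and g: "tame g"
    and i: "integrable lborel (\<lambda>x. v x * conv (\<lambda>z. \<bar>k z\<bar>) (\<lambda>y. \<bar>g y\<bar>) x)"
  shows "(\<integral>x. v x * conv k g x \<partial>lborel) = (\<integral>x. conv k v x * g x \<partial>lborel)"
proof -
  note [measurable] = schwartz_measurable[OF k(1)] v tame_measurable[OF g]
  let ?F = "\<lambda>x y. v x * (k (x - y) * g y)"
  have "integrable (lborel \<Otimes>\<^sub>M lborel) (\<lambda>(x, y). ?F x y)"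
  proof (rule lborel_pair.Fubini_integrable)
    have "(\<integral>y. norm (?F x y) \<partial>lborel) = \<bar>v x * conv (\<lambda>z. \<bar>k z\<bar>) (\<lambda>y. \<bar>g y\<bar>) x\<bar>" for x
    proof -
      have "(\<integral>y. norm (?F x y) \<partial>lborel) = (\<integral>y. \<bar>v x\<bar> * (\<bar>k (x - y)\<bar> * \<bar>g y\<bar>) \<partial>lborel)" by (simp add: abs_mult)
      also have "\<dots> = \<bar>v x\<bar> * conv (\<lambda>z. \<bar>k z\<bar>) (\<lambda>y. \<bar>g y\<bar>) x"
        unfolding conv_def by (rule Bochner_Integration.integral_mult_right_zero)
      also have "\<dots> = \<bar>v x * conv (\<lambda>z. \<bar>k z\<bar>) (\<lambda>y. \<bar>g y\<bar>) x\<bar>"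
        by (simp add: abs_mult conv_def)
      finally show ?thesis .
    qed
    then show "integrable lborel (\<lambda>x. \<integral>y. norm (case (x, y) of (x, y) \<Rightarrow> ?F x y) \<partial>lborel)"
      using integrable_abs[OF i] by simp
    show "AE x in lborel. integrable lborel (\<lambda>y. case (x, y) of (x, y) \<Rightarrow> ?F x y)"
      using conv_integrable[OF k(1) g] by simp
  qed measurable
  from lborel_pair.Fubini_integral[OF this]
  have "(\<integral>x. (\<integral>y. ?F x y \<partial>lborel) \<partial>lborel) = (\<integral>y. (\<integral>x. ?F x y \<partial>lborel) \<partial>lborel)" by simp
  moreover have "(\<integral>y. ?F x y \<partial>lborel) = v x * conv k g x" for x
    unfolding conv_def by (rule Bochner_Integration.integral_mult_right_zero)
  moreover have "(\<integral>x. ?F x y \<partial>lborel) = conv k v y * g y" for y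
  proof -
    have "k (x - y) = k (y - x)" for x using k(2)[of "x - y"] by simp
    then have "(\<integral>x. ?F x y \<partial>lborel) = (\<integral>x. (k (y - x) * v x) * g y \<partial>lborel)" by (simp add: mult_ac)
    also have "\<dots> = conv k v y * g y" unfolding conv_def by (rule Bochner_Integration.integral_mult_left_zero)
    finally show ?thesis .
  qed
  ultimately show ?thesis by (simp only:)
qed

lemma schwartz_abs_integral:
  assumes "schwartz (k :: R3 \<Rightarrow> real)"
  shows "(\<integral>\<^sup>+y. ennreal \<bar>k y\<bar> \<partial>lborel) \<le> ennreal (\<integral>y. \<bar>k y\<bar> \<partial>lborel)" "0 \<le> (\<integral>y. \<bar>k y\<bar> \<partial>lborel)"
  using schwartz_integrable[OF assms] by (simp_all add: nn_integral_eq_integral)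

lemma LP_conv_schwartz:
  assumes "schwartz k" "LP p u A" "p > 0" shows "LP p (conv k u) ((\<integral>y. \<bar>k y\<bar> \<partial>lborel) * A)"
  by (rule LP_conv[OF schwartz_measurable[OF assms(1)] schwartz_abs_integral[OF assms(1)] assms(2,3)])

lemma conv_adjoint_LP2:
  assumes k: "schwartz k" "\<And>x. k (- x) = k x" and v: "LP 2 v A" and g: "LP 2 g B"
  shows "(\<integral>x. v x * conv k g x \<partial>lborel) = (\<integral>x. conv k v x * g x \<partial>lborel)"
proof (rule conv_adjoint[OF k LP_measurable[OF v] tame_LP2[OF g]])
  have "LP 2 (\<lambda>y. \<bar>g y\<bar>) B" by (rule LP_mono_abs[OF g]) (use LP_measurable[OF g] in auto)
  then have "LP 2 (conv (\<lambda>z. \<bar>k z\<bar>) (\<lambda>y. \<bar>g y\<bar>)) ((\<integral>y. \<bar>k y\<bar> \<partial>lborel) * B)"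
    by (rule LP_conv[rotated 3]) (use schwartz_measurable[OF k(1)] schwartz_abs_integral[OF k(1)] in auto)
  from LP2_prod(2)[OF v this]
  show "integrable lborel (\<lambda>x. v x * conv (\<lambda>z. \<bar>k z\<bar>) (\<lambda>y. \<bar>g y\<bar>) x)" .
qed

lemma conv_adjoint_L1:
  assumes k: "schwartz k" "\<And>x. k (- x) = k x" and v: "integrable lborel v"
    and g: "g \<in> borel_measurable borel" "\<And>x. \<bar>g x\<bar> \<le> M"
  shows "(\<integral>x. v x * conv k g x \<partial>lborel) = (\<integral>x. conv k v x * g x \<partial>lborel)"
proof (rule conv_adjoint[OF k _ tame_bounded[OF g]])
  note [measurable] = schwartz_measurable[OF k(1)] g(1)
  show vm[measurable]: "v \<in> borel_measurable borel" using v by auto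
  show "integrable lborel (\<lambda>x. v x * conv (\<lambda>z. \<bar>k z\<bar>) (\<lambda>y. \<bar>g y\<bar>) x)"
  proof (rule Bochner_Integration.integrable_bound[OF integrable_mult_left[OF v, of "(\<integral>y. \<bar>k y\<bar> \<partial>lborel) * M"]])
    have "\<bar>conv (\<lambda>z. \<bar>k z\<bar>) (\<lambda>y. \<bar>g y\<bar>) x\<bar> \<le> \<bar>(\<integral>y. \<bar>k y\<bar> \<partial>lborel) * M\<bar>" for x
    proof -
      have ki: "integrable lborel (\<lambda>y. \<bar>k (x - y)\<bar>)" using integrable_shift(2)[OF integrable_abs[OF schwartz_integrable[OF k(1)]], of x] .
      have "norm (\<integral>y. \<bar>k (x - y)\<bar> * \<bar>g y\<bar> \<partial>lborel) \<le> (\<integral>y. \<bar>k (x - y)\<bar> * M \<partial>lborel)"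
      proof (rule norm_integral_le)
        show "integrable lborel (\<lambda>y. \<bar>k (x - y)\<bar> * \<bar>g y\<bar>)"
          using integrable_abs[OF conv_integrable[OF k(1) tame_bounded[OF g], of x]] by (simp add: abs_mult)
        show "norm (\<bar>k (x - y)\<bar> * \<bar>g y\<bar>) \<le> \<bar>k (x - y)\<bar> * M" for y
          using mult_left_mono[OF g(2)[of y] abs_ge_zero[of "k (x - y)"]] by (simp add: abs_mult)
      qed (use ki in simp)
      also have "\<dots> = (\<integral>y. \<bar>k y\<bar> \<partial>lborel) * M"
        using integral_shift(2)[of "\<lambda>y. \<bar>k y\<bar>" x] by simp
      finally show ?thesis unfolding conv_def by simp
    qed
    then show "AE x in lborel. norm (v x * conv (\<lambda>z. \<bar>k z\<bar>) (\<lambda>y. \<bar>g y\<bar>) x) \<le> norm (v x * ((\<integral>y. \<bar>k y\<bar> \<partial>lborel) * M))"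
      by (intro AE_I2) (simp only: real_norm_def abs_mult[of "v _"] mult_left_mono abs_ge_zero)
    show "(\<lambda>x. v x * conv (\<lambda>z. \<bar>k z\<bar>) (\<lambda>y. \<bar>g y\<bar>) x) \<in> borel_measurable lborel"
      unfolding conv_def by measurable
  qed
qed

lemma conv_dual:
  fixes f :: "R3 \<Rightarrow> complex"
  assumes k: "schwartz k" "\<And>x. k (- x) = k x" and v: "tame v" and f: "schwartz f"
  shows "(\<integral>x. complex_of_real (v x) * (\<integral>y. complex_of_real (k (x - y)) * f y \<partial>lborel) \<partial>lborel)
      = (\<integral>y. complex_of_real (conv k v y) * f y \<partial>lborel)" (is ?eq)
    and "integrable lborel (\<lambda>y. complex_of_real (conv k v y) * f y)" (is ?int)
proof -
  obtain C where C: "C > 0" "\<And>x. norm (k x) \<le> C * wt x" using schwartz_wt[OF k(1)] by blast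
  \<comment> \<open>The test function decays to order 12: half of it absorbs the loss from
    recentring the weight of k at x, half stays as an integrable majorant in y.\<close>
  obtain D where D: "D > 0" "\<And>x. norm (f x) \<le> D / (1 + norm x) ^ 12" using schwartz_bound[OF f, of 12] by blast
  note [measurable] = schwartz_measurable[OF k(1)] schwartz_measurable[OF f] tame_measurable[OF v]
  let ?F = "\<lambda>x y. complex_of_real (v x) * (complex_of_real (k (x - y)) * f y)"
  have vi: "integrable lborel (\<lambda>z. wt z * \<bar>v z\<bar>)" using v by (simp add: tame_def)
  have kk: "k (x - y) = k (y - x)" for x y using k(2)[of "x - y"] by simp
  have F: "norm (?F x y) \<le> (C * (wt x * \<bar>v x\<bar>)) * (D * wt y)" for x y
  proof -
    have "\<bar>k (x - y)\<bar> \<le> C * ((1 + norm y) ^ 6 * wt x)"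
      unfolding kk[of x y] using order_trans[OF C(2)[of "y - x"] mult_left_mono[OF wt_shift[of y x] less_imp_le[OF C(1)]]]
      by (simp only: real_norm_def)
    moreover have "norm (f y) \<le> D * (wt y * wt y)"
      using D(2)[of y] by (simp add: wt_def power_add[symmetric])
    ultimately have "\<bar>v x\<bar> * (\<bar>k (x - y)\<bar> * norm (f y)) \<le> \<bar>v x\<bar> * (C * ((1 + norm y) ^ 6 * wt x) * (D * (wt y * wt y)))"
      using C D wt_nonneg by (intro mult_left_mono mult_mono) auto
    also have "\<dots> = (C * (wt x * \<bar>v x\<bar>)) * (D * wt y) * (wt y * (1 + norm y) ^ 6)" by (simp only: mult_ac)
    also have "wt y * (1 + norm y) ^ 6 = 1" by (simp add: wt_def)
    finally show ?thesis by (simp add: norm_mult)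
  qed
  have m: "(\<lambda>(x, y). ?F x y) \<in> borel_measurable (borel \<Otimes>\<^sub>M borel)" by measurable
  have ab: "integrable lborel (\<lambda>x. C * (wt x * \<bar>v x\<bar>))" "integrable lborel (\<lambda>y. D * wt y)" using vi wt_integrable by auto
  have x: "(\<integral>y. ?F x y \<partial>lborel) = complex_of_real (v x) * (\<integral>y. complex_of_real (k (x - y)) * f y \<partial>lborel)" for x
    by (rule Bochner_Integration.integral_mult_right_zero)
  have y: "(\<integral>x. ?F x y \<partial>lborel) = complex_of_real (conv k v y) * f y" for y
  proof -
    have "(\<integral>x. ?F x y \<partial>lborel) = (\<integral>x. complex_of_real (k (y - x) * v x) * f y \<partial>lborel)"
      by (simp add: kk[of _ y] mult_ac)
    also have "\<dots> = (\<integral>x. complex_of_real (k (y - x) * v x) \<partial>lborel) * f y"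
      by (rule Bochner_Integration.integral_mult_left_zero)
    finally show ?thesis by (simp only: integral_complex_of_real conv_def)
  qed
  show ?eq using Fubini_dom(2)[OF m ab F] unfolding x y .
  show ?int using Fubini_dom(4)[OF m ab F] unfolding y .
qed

lemma dist_multiplier:
  assumes m: "bump m" "evenf m" and v: "tame v" and f: "schwartz f"
  shows "dist_inv_fourier (dist_mult (\<lambda>\<xi>. complex_of_real (m \<xi>)) (dist_fourier (dist_of (\<lambda>x. complex_of_real (v x))))) f
     = (\<integral>y. complex_of_real (conv (ker m) v y) * f y \<partial>lborel)"
proof -
  have "fourier (\<lambda>\<xi>. complex_of_real (m \<xi>) * inv_fourier f \<xi>) = (\<lambda>x. \<integral>y. complex_of_real (ker m (x - y)) * f y \<partial>lborel)"
    by (rule ext) (rule fourier_multiplier[OF m schwartz_integrable[OF f]])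
  then show ?thesis
    unfolding dist_inv_fourier_def dist_mult_def dist_fourier_def dist_of_def
    using conv_dual(1)[OF schwartz_ker[OF m(1)] ker_minus[OF m] v f] by simp
qed

section \<open>Littlewood-Paley kernels\<close>

lemma bump_affine:
  fixes m :: "R3 \<Rightarrow> 'b::real_normed_vector"
  assumes m: "bump m" and a: "a \<noteq> 0" shows "bump (\<lambda>x. c *\<^sub>R m (a *\<^sub>R x + b))"
proof -
  obtain R where R: "R > 0" "\<forall>x. norm x > R \<longrightarrow> m x = 0" using bumpD[OF m] by blast
  have "m (a *\<^sub>R x + b) = 0" if x: "norm x > (R + norm b) / \<bar>a\<bar>" for x
  proof -
    have "\<bar>a\<bar> * norm x > R + norm b" using x a by (simp add: divide_less_eq mult.commute)
    moreover have "\<bar>a\<bar> * norm x \<le> norm (a *\<^sub>R x + b) + norm b"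
      using norm_triangle_ineq4[of "a *\<^sub>R x + b" b] by simp
    ultimately show ?thesis using R(2) by simp
  qed
  then have "\<forall>x. norm x > (R + norm b) / \<bar>a\<bar> \<longrightarrow> c *\<^sub>R m (a *\<^sub>R x + b) = 0" by simp
  then show ?thesis using smooth_affine[OF bump_smooth[OF m], of c a b] unfolding bump_def by blast
qed

lemma bump_add:
  assumes a: "bump a" and b: "bump b" shows "bump (\<lambda>x. a x + b x)"
proof -
  obtain R where R: "\<forall>x. norm x > R \<longrightarrow> a x = 0" using bumpD[OF a] by blast
  obtain S where S: "\<forall>x. norm x > S \<longrightarrow> b x = 0" using bumpD[OF b] by blast
  have "\<forall>x. norm x > max R S \<longrightarrow> a x + b x = 0" using R S by auto
  then show ?thesis using smooth_add[OF bump_smooth[OF a] bump_smooth[OF b]] unfolding bump_def by blast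
qed

lemma bump_uminus: "bump (a :: R3 \<Rightarrow> real) \<Longrightarrow> bump (\<lambda>x. - a x)"
  using bump_bounded_linear[OF bounded_linear_minus[OF bounded_linear_ident]] .

lemma bump_diff: "bump (a :: R3 \<Rightarrow> real) \<Longrightarrow> bump b \<Longrightarrow> bump (\<lambda>x. a x - b x)"
  using bump_add[OF _ bump_uminus, of a b] by simp

lemma integral_scale:
  fixes g :: "R3 \<Rightarrow> real"
  assumes g: "integrable lborel g" and r: "r > 0"
  shows "integrable lborel (\<lambda>y. r ^ 3 * g (r *\<^sub>R y))" "(\<integral>y. r ^ 3 * g (r *\<^sub>R y) \<partial>lborel) = (\<integral>y. g y \<partial>lborel)"
proof -
  show "integrable lborel (\<lambda>y. r ^ 3 * g (r *\<^sub>R y))"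
    using integrable_mult_right[OF integrable_affine[OF g, of r 0], of "r ^ 3"] r by simp
  have "g \<in> borel_measurable borel" using g by auto
  from integral_affine[OF this, of r 0] show "(\<integral>y. r ^ 3 * g (r *\<^sub>R y) \<partial>lborel) = (\<integral>y. g y \<partial>lborel)"
    using r by simp
qed

lemma schwartz_moment:
  fixes k :: "R3 \<Rightarrow> real"
  assumes k: "schwartz k" shows "integrable lborel (\<lambda>y. \<bar>k y\<bar> * (1 + norm y) ^ n)"
proof -
  obtain C where C: "C > 0" "\<And>x. norm (k x) \<le> C / (1 + norm x) ^ (6 + n)" using schwartz_bound[OF k, of "6 + n"] by blast
  note [measurable] = schwartz_measurable[OF k]
  show ?thesis
  proof (rule Bochner_Integration.integrable_bound[OF integrable_mult_right[OF wt_integrable, of C]])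
    have "\<bar>k y\<bar> * (1 + norm y) ^ n \<le> C * wt y" for y
    proof -
      have "\<bar>k y\<bar> * (1 + norm y) ^ n \<le> C / (1 + norm y) ^ (6 + n) * (1 + norm y) ^ n"
        using C(2)[of y] by (intro mult_right_mono) auto
      also have "\<dots> = C * wt y" by (simp add: wt_def power_add)
      finally show ?thesis .
    qed
    then show "AE y in lborel. norm (\<bar>k y\<bar> * (1 + norm y) ^ n) \<le> norm (C * wt y)"
      by (intro AE_I2) (use C(1) in \<open>simp add: abs_mult wt_nonneg\<close>)
  qed measurable
qed

locale lp_cut =
  fixes chi :: "R3 \<Rightarrow> real"
  assumes lp: "lp_cutoff chi"
begin

lemma chi_smooth: "smooth chi" and chi_nonneg: "0 \<le> chi x"
  and chi_one: "norm x \<le> 1/2 \<Longrightarrow> chi x = 1"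
  using lp unfolding lp_cutoff_def by blast+

lemma chi_zero: "1 \<le> norm x \<Longrightarrow> chi x = 0"
proof (rule ccontr)
  assume x: "1 \<le> norm x" "chi x \<noteq> 0"
  then have "x \<in> closure {\<xi>. chi \<xi> \<noteq> 0}" using closure_subset[of "{\<xi>. chi \<xi> \<noteq> 0}"] by blast
  then have "x \<in> ball 0 1" using lp unfolding lp_cutoff_def by blast
  then show False using x by simp
qed

lemma chi_bump: "bump chi"
  unfolding bump_def by (intro conjI exI[of _ 1] allI impI chi_smooth chi_zero less_imp_le)

lemma chi_even: "evenf chi"
  using lp unfolding evenf_def lp_cutoff_def by (metis norm_minus_cancel)

lemma chi_measurable [measurable]: "chi \<in> borel_measurable borel"
  by (rule bump_measurable[OF chi_bump])

definition dil :: "real \<Rightarrow> R3 \<Rightarrow> real" where "dil r \<xi> = chi (\<xi> /\<^sub>R r)"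

lemma dil_bump: "r > 0 \<Longrightarrow> bump (dil r)"
  using bump_affine[OF chi_bump, of "inverse r" 1 0] by (simp add: dil_def[abs_def])

lemma dil_even: "evenf (dil r)"
  using chi_even by (simp add: evenf_def dil_def)

lemma dil_0: "dil r 0 = 1"
  by (simp add: dil_def chi_one)

text \<open>The kernel of the low-pass filter S at frequency r. Real values of r are allowed, since
  the truncated Leray projector uses filters at arbitrarily low frequencies.\<close>

definition hk :: "real \<Rightarrow> R3 \<Rightarrow> real" where "hk r = ker (dil r)"

lemma dil_1: "dil 1 = chi" by (simp add: dil_def fun_eq_iff)

lemma hk_scale: "r > 0 \<Longrightarrow> hk r x = r ^ 3 * hk 1 (r *\<^sub>R x)"
  unfolding hk_def dil_1 using ker_scale[OF chi_bump, of r x] by (simp add: dil_def[abs_def])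

lemma schwartz_hk: "r > 0 \<Longrightarrow> schwartz (hk r)"
  unfolding hk_def by (rule schwartz_ker[OF dil_bump])

lemma hk_minus: "r > 0 \<Longrightarrow> hk r (- x) = hk r x"
  unfolding hk_def by (rule ker_minus[OF dil_bump dil_even])

lemma hk_integral: "r > 0 \<Longrightarrow> (\<integral>x. hk r x \<partial>lborel) = 1"
  unfolding hk_def using ker_integral[OF dil_bump dil_even] by (simp add: dil_0)

text \<open>The wider cut-off equals 1 on the ball of radius R/2, which contains the support of the
  narrower one. Band-limited functions are thus reproduced by a convolution, and derivatives and
  increments can be placed on the reproducing kernel.\<close>

lemma hk_conv:
  assumes "r > 0" "2 * r \<le> R" shows "conv (hk R) (hk r) = hk r"
proof
  fix x
  have "dil R \<xi> * dil r \<xi> = dil r \<xi>" for \<xi>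
  proof (cases "norm \<xi> \<ge> r")
    case True
    then have "1 \<le> norm (\<xi> /\<^sub>R r)" using assms by (simp add: field_simps)
    then show ?thesis using chi_zero by (simp add: dil_def)
  next
    case False
    then have "norm (\<xi> /\<^sub>R R) \<le> 1/2" using assms by (simp add: field_simps)
    then show ?thesis using chi_one by (simp add: dil_def)
  qed
  then have "(\<lambda>\<xi>. dil R \<xi> * dil r \<xi>) = dil r" by (rule ext)
  then show "conv (hk R) (hk r) x = hk r x"
    using conv_ker[OF dil_bump dil_even dil_bump dil_even, of R r x] assms by (simp add: hk_def)
qed

lemma partial_hk: "r > 0 \<Longrightarrow> partial i (hk r) x = r ^ 3 * (r * partial i (hk 1) (r *\<^sub>R x))"
proof -
  assume r: "r > 0"
  have d: "hk 1 differentiable (at y)" for y by (rule smooth_differentiable[OF schwartz_smooth[OF schwartz_hk]]) simp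
  have "hk r = (\<lambda>x. r ^ 3 * hk 1 (r *\<^sub>R x))" using hk_scale[OF r] by auto
  then show ?thesis
    using partial_bounded_linear(1)[OF bounded_linear_mult_right[of "r ^ 3"] partial_scale(2)[OF d], of i r x]
      partial_scale(1)[OF d, of i r x] by simp
qed

definition c0 :: real where "c0 = (\<integral>x. \<bar>hk 1 x\<bar> \<partial>lborel)"

lemma hk_abs_integral: "r > 0 \<Longrightarrow> (\<integral>x. \<bar>hk r x\<bar> \<partial>lborel) = c0"
  using integral_scale(2)[OF integrable_abs[OF schwartz_integrable[OF schwartz_hk[of 1]]], of r]
  by (simp add: c0_def hk_scale[of r] abs_mult)

lemma c0_pos: "c0 > 0"
proof -
  have "1 \<le> c0"
    unfolding c0_def using integral_abs_bound[of lborel "hk 1"] hk_integral[of 1] by simp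
  then show ?thesis by simp
qed

lemma LP_conv_hk: "r > 0 \<Longrightarrow> LP p u A \<Longrightarrow> p > 0 \<Longrightarrow> LP p (conv (hk r) u) (c0 * A)"
  using LP_conv_schwartz[OF schwartz_hk, of r p u A] hk_abs_integral[of r] by simp

text \<open>The kernel of \<open>\<Delta>\<^sub>q\<close> for \<open>q = n - 1\<close>; the shift lets the index start at 0.\<close>

definition blk :: "nat \<Rightarrow> R3 \<Rightarrow> real" where
  "blk n = (if n = 0 then hk 1 else (\<lambda>x. hk (2 ^ n) x - hk (2 ^ (n - 1)) x))"

lemma schwartz_diff: "schwartz f \<Longrightarrow> schwartz g \<Longrightarrow> schwartz (\<lambda>x. f x - g x :: real)"
  using schwartz_add[of f "\<lambda>x. - g x"] schwartz_bounded_linear[OF bounded_linear_minus[OF bounded_linear_ident], of g] by simp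

lemma schwartz_blk: "schwartz (blk n)"
  by (cases n) (simp_all add: blk_def schwartz_hk schwartz_diff)

lemma conv_blk_sum:
  assumes v: "tame v" shows "(\<Sum>n\<le>N. conv (blk n) v x) = conv (hk (2 ^ N)) v x"
proof (induction N)
  case (Suc N)
  have "conv (blk (Suc N)) v x = conv (hk (2 ^ Suc N)) v x - conv (hk (2 ^ N)) v x"
    unfolding blk_def using conv_diff_left[OF schwartz_hk schwartz_hk v, of "2 ^ Suc N" "2 ^ N" x] by simp
  then show ?case using Suc by simp
qed (simp add: blk_def)

lemma lp_symbol_eq:
  "lp_symbol chi (int n - 1) = (if n = 0 then dil 1 else (\<lambda>\<xi>. dil (2 ^ n) \<xi> - dil (2 ^ (n - 1)) \<xi>))"
proof (cases n)
  case (Suc m)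
  have "wave_number (int m) = 2 ^ m" by (simp add: wave_number_def powr_realpow)
  then show ?thesis
    by (auto simp: Suc lp_symbol_def lp_bump_def dil_def fun_eq_iff mult.commute)
qed (auto simp: lp_symbol_def dil_1 fun_eq_iff)

lemma lp_symbol_bump: "bump (lp_symbol chi (int n - 1))" "evenf (lp_symbol chi (int n - 1))"
  "ker (lp_symbol chi (int n - 1)) = blk n"
proof -
  show "bump (lp_symbol chi (int n - 1))" unfolding lp_symbol_eq
    using bump_diff[OF dil_bump dil_bump, of "2 ^ n" "2 ^ (n - 1)"] dil_bump[of 1] by auto
  show "evenf (lp_symbol chi (int n - 1))" unfolding lp_symbol_eq
    using dil_even by (auto simp: evenf_def)
  show "ker (lp_symbol chi (int n - 1)) = blk n" unfolding lp_symbol_eq blk_def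
    using ker_diff[OF dil_bump dil_bump, of "2 ^ n" "2 ^ (n - 1)"] by (auto simp: hk_def fun_eq_iff)
qed

lemma lp_block_eq:
  assumes "tame v" "schwartz f"
  shows "lp_block chi (int n - 1) (dist_of (\<lambda>x. complex_of_real (v x))) f
    = (\<integral>y. complex_of_real (conv (blk n) v y) * f y \<partial>lborel)"
  unfolding lp_block_def dist_multiplier[OF lp_symbol_bump(1,2) assms] lp_symbol_bump(3) ..

lemma conv_mult_integrable:
  fixes f :: "R3 \<Rightarrow> complex"
  assumes m: "bump m" "evenf m" and v: "tame v" and f: "schwartz f"
  shows "integrable lborel (\<lambda>y. complex_of_real (conv (ker m) v y) * f y)"
  by (rule conv_dual(2)[OF schwartz_ker[OF m(1)] ker_minus[OF m] v f])

text \<open>The block sum telescopes. It leaves the filter at 2 ^ Suc Q, not 2 ^ Q: the cut-off of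
  \<open>S\<^sub>Q\<close> sits at the wave number of index Q + 1.\<close>

lemma lp_partial_sum_eq:
  assumes v: "tame v" and f: "schwartz f"
  shows "lp_partial_sum chi (int Q) (dist_of (\<lambda>x. complex_of_real (v x))) f
    = (\<integral>y. complex_of_real (conv (hk (2 ^ Suc Q)) v y) * f y \<partial>lborel)"
proof -
  have "{-1..int Q} = (\<lambda>n. int n - 1) ` {..Suc Q}"
  proof (intro set_eqI iffI)
    fix q assume "q \<in> {-1..int Q}"
    then show "q \<in> (\<lambda>n. int n - 1) ` {..Suc Q}" by (intro image_eqI[of _ _ "nat (q + 1)"]) auto
  qed auto
  then have "lp_partial_sum chi (int Q) (dist_of (\<lambda>x. complex_of_real (v x))) f
    = (\<Sum>n\<le>Suc Q. lp_block chi (int n - 1) (dist_of (\<lambda>x. complex_of_real (v x))) f)"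
    unfolding lp_partial_sum_def by (simp add: sum.reindex inj_on_def del: sum.atMost_Suc)
  also have "\<dots> = (\<Sum>n\<le>Suc Q. (\<integral>y. complex_of_real (conv (blk n) v y) * f y \<partial>lborel))"
    by (simp only: lp_block_eq[OF v f])
  also have "\<dots> = (\<integral>y. (\<Sum>n\<le>Suc Q. complex_of_real (conv (blk n) v y) * f y) \<partial>lborel)"
  proof (rule Bochner_Integration.integral_sum[symmetric])
    fix n
    show "integrable lborel (\<lambda>y. complex_of_real (conv (blk n) v y) * f y)"
      using conv_mult_integrable[OF lp_symbol_bump(1,2) v f, of n] unfolding lp_symbol_bump(3) .
  qed
  also have "\<dots> = (\<integral>y. complex_of_real (conv (hk (2 ^ Suc Q)) v y) * f y \<partial>lborel)"
    by (simp only: sum_distrib_right[symmetric] of_real_sum[symmetric] conv_blk_sum[OF v])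
  finally show ?thesis .
qed

section \<open>Mollifiers and the identification of distributions with functions\<close>

lemma chi_integral_pos: "(\<integral>x. chi x \<partial>lborel) > 0"
proof (rule ccontr)
  assume "\<not> ?thesis"
  then have "(\<integral>x. chi x \<partial>lborel) = 0" using chi_nonneg by (simp add: not_less antisym)
  then have ae: "AE x in lborel. chi x = 0"
    using integral_nonneg_eq_0_iff_AE[OF bump_integrable[OF chi_bump]] chi_nonneg by simp
  have "AE x in lborel. x \<notin> ball (0::R3) (1/2)"
    using ae by eventually_elim (use chi_one in force)
  then have "ball (0::R3) (1/2) \<in> null_sets lborel"
    by (subst (asm) AE_iff_null_sets[symmetric]) auto
  then have "negligible (ball (0::R3) (1/2))"
    using null_sets_completionI[of _ lborel] by (simp add: negligible_iff_null_sets)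
  then show False using open_not_negligible[of "ball (0::R3) (1/2)"] by simp
qed

text \<open>The frequency cut-off doubles as a mollifier in physical space: rescaled and normalised,
  it is a nonnegative approximate identity with compact support, and its translates are admissible
  test functions.\<close>

definition mol :: "nat \<Rightarrow> R3 \<Rightarrow> real" where
  "mol n x = real (Suc n) ^ 3 * chi (real (Suc n) *\<^sub>R x) / (\<integral>x. chi x \<partial>lborel)"

lemma mol_bump: "bump (\<lambda>y. mol n (x - y))" "bump (mol n)"
proof -
  let ?c = "real (Suc n) ^ 3 / (\<integral>x. chi x \<partial>lborel)"
  have "(\<lambda>y. mol n (x - y)) = (\<lambda>y. ?c *\<^sub>R chi ((- real (Suc n)) *\<^sub>R y + real (Suc n) *\<^sub>R x))"
    by (simp add: mol_def fun_eq_iff scaleR_diff_right del: of_nat_Suc)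
  then show "bump (\<lambda>y. mol n (x - y))"
    using bump_affine[OF chi_bump, of "- real (Suc n)" ?c "real (Suc n) *\<^sub>R x"] by (simp del: of_nat_Suc)
  show "bump (mol n)"
    using bump_affine[OF chi_bump, of "real (Suc n)" ?c 0]
    by (simp add: mol_def[abs_def])
qed

lemma mol_abs_integral: "(\<integral>\<^sup>+y. ennreal \<bar>mol n y\<bar> \<partial>lborel) \<le> ennreal 1"
proof -
  have "(\<integral>y. real (Suc n) ^ 3 * chi (real (Suc n) *\<^sub>R y) \<partial>lborel) = (\<integral>y. chi y \<partial>lborel)"
    by (rule integral_scale(2)[OF bump_integrable[OF chi_bump]]) simp
  then have "(\<integral>y. \<bar>mol n y\<bar> \<partial>lborel) = 1"
    using chi_integral_pos chi_nonneg by (simp add: mol_def abs_mult)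
  then show ?thesis
    using schwartz_abs_integral(1)[OF bump_schwartz[OF mol_bump(2)], of n] by simp
qed

lemma mol_conv_tendsto:
  assumes G: "continuous_on UNIV G" shows "(\<lambda>n. conv (mol n) G x) \<longlonglongrightarrow> G x"
proof -
  let ?I = "\<integral>x. chi x \<partial>lborel"
  have [measurable]: "G \<in> borel_measurable borel" by (rule borel_measurable_continuous_onI[OF G])
  have [measurable]: "mol n \<in> borel_measurable borel" for n by (rule bump_measurable[OF mol_bump(2)])
  have "compact (G ` cball x 1)" by (intro compact_continuous_image continuous_on_subset[OF G]) auto
  from compact_imp_bounded[OF this] obtain M where M: "M > 0" "\<forall>y\<in>G ` cball x 1. norm y \<le> M"
    unfolding bounded_pos by blast
  have eq: "conv (mol n) G x = (\<integral>z. chi z * G (x - z /\<^sub>R real (Suc n)) \<partial>lborel) / ?I" for n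
  proof -
    have "conv (mol n) G x = (\<integral>y. mol n y * G (x - y) \<partial>lborel)"
      by (rule conv_commute) (use bump_measurable[OF mol_bump(2)] in auto)
    also have "\<dots> = \<bar>inverse (real (Suc n))\<bar> ^ 3 *\<^sub>R (\<integral>z. mol n (0 + inverse (real (Suc n)) *\<^sub>R z) * G (x - (0 + inverse (real (Suc n)) *\<^sub>R z)) \<partial>lborel)"
    proof (rule integral_affine[where f="\<lambda>y. mol n y * G (x - y)"])
      show "(\<lambda>y. mol n y * G (x - y)) \<in> borel_measurable borel" by measurable
    qed simp
    also have "\<dots> = inverse (real (Suc n)) ^ 3 * (\<integral>z. (real (Suc n) ^ 3 / ?I) * (chi z * G (x - z /\<^sub>R real (Suc n))) \<partial>lborel)"
      by (simp add: mol_def mult_ac del: of_nat_Suc)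
    also have "\<dots> = inverse (real (Suc n)) ^ 3 * ((real (Suc n) ^ 3 / ?I) * (\<integral>z. chi z * G (x - z /\<^sub>R real (Suc n)) \<partial>lborel))"
      by (simp only: Bochner_Integration.integral_mult_right_zero)
    also have "\<dots> = (\<integral>z. chi z * G (x - z /\<^sub>R real (Suc n)) \<partial>lborel) / ?I"
      by (simp add: power_inverse del: of_nat_Suc)
    finally show ?thesis .
  qed
  have "(\<lambda>n. \<integral>z. chi z * G (x - z /\<^sub>R real (Suc n)) \<partial>lborel) \<longlonglongrightarrow> (\<integral>z. chi z * G x \<partial>lborel)"
  proof (rule integral_dominated_convergence[where w="\<lambda>z. chi z * M"])
    show "AE z in lborel. (\<lambda>n. chi z * G (x - z /\<^sub>R real (Suc n))) \<longlonglongrightarrow> chi z * G x"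
    proof (rule AE_I2)
      fix z
      have "(\<lambda>n. x - inverse (real (Suc n)) *\<^sub>R z) \<longlonglongrightarrow> x - 0 *\<^sub>R z"
        by (intro tendsto_intros LIMSEQ_inverse_real_of_nat)
      then have "(\<lambda>n. G (x - inverse (real (Suc n)) *\<^sub>R z)) \<longlonglongrightarrow> G x"
        using G by (intro isCont_tendsto_compose[of x G]) (simp_all add: continuous_on_eq_continuous_at)
      then show "(\<lambda>n. chi z * G (x - z /\<^sub>R real (Suc n))) \<longlonglongrightarrow> chi z * G x" by (intro tendsto_intros)
    qed
    show "AE z in lborel. norm (chi z * G (x - z /\<^sub>R real (Suc n))) \<le> chi z * M" for n
    proof (rule AE_I2)
      fix z
      show "norm (chi z * G (x - z /\<^sub>R real (Suc n))) \<le> chi z * M"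
      proof (cases "norm z \<ge> 1")
        case False
        have "norm z / real (Suc n) \<le> 1" using False by (simp add: divide_le_eq)
        then have "x - z /\<^sub>R real (Suc n) \<in> cball x 1" by (simp add: dist_norm divide_inverse mult.commute)
        then have "\<bar>G (x - z /\<^sub>R real (Suc n))\<bar> \<le> M" using M(2) by (metis image_eqI real_norm_def)
        then show ?thesis using chi_nonneg[of z] by (simp add: abs_mult mult_left_mono)
      qed (use chi_zero in simp)
    qed
    show "integrable lborel (\<lambda>z. chi z * M)" using bump_integrable[OF chi_bump] by simp
  qed measurable
  from tendsto_divide[OF this tendsto_const, of ?I]
  show ?thesis unfolding eq using chi_integral_pos by simp
qed

lemma mol_test: "schwartz (\<lambda>y. complex_of_real (mol n (x - y)))"
  by (rule bump_schwartz[OF bump_of_real[OF mol_bump(1)]])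

lemma conv_mol_Re:
  assumes "integrable lborel (\<lambda>y. g y * complex_of_real (mol n (x - y)))"
  shows "conv (mol n) (\<lambda>y. Re (g y)) x = Re (\<integral>y. g y * complex_of_real (mol n (x - y)) \<partial>lborel)"
    "conv (mol n) (\<lambda>y. Im (g y)) x = Im (\<integral>y. g y * complex_of_real (mol n (x - y)) \<partial>lborel)"
  unfolding conv_def integral_Re[OF assms, symmetric] integral_Im[OF assms, symmetric]
  by (simp_all add: mult.commute)

text \<open>Testing with translated mollifiers recovers the value of a continuous representative at
  each point, so \<open>fun_of_dist\<close> picks a well-defined function. Real and imaginary parts
  are separated because \<open>conv\<close> is real.\<close>

lemma represents_unique:
  assumes g: "continuous_on UNIV g1" "continuous_on UNIV g2" and r: "represents g1 U" "represents g2 U"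
  shows "g1 = g2"
proof
  fix x
  have rr: "integrable lborel (\<lambda>y. g y * complex_of_real (mol n (x - y)))"
    "(\<integral>y. g y * complex_of_real (mol n (x - y)) \<partial>lborel) = U (\<lambda>y. complex_of_real (mol n (x - y)))"
    if "represents g U" for g n
    using that mol_test[of n x] unfolding represents_def dist_of_def by simp_all
  have eq: "(\<integral>y. g1 y * complex_of_real (mol n (x - y)) \<partial>lborel) = (\<integral>y. g2 y * complex_of_real (mol n (x - y)) \<partial>lborel)" for n
    by (simp only: rr(2)[OF r(1)] rr(2)[OF r(2)])
  note i = rr(1)[OF r(1)] rr(1)[OF r(2)]
  have c: "continuous_on UNIV (\<lambda>y. Re (g1 y))" "continuous_on UNIV (\<lambda>y. Re (g2 y))"
    "continuous_on UNIV (\<lambda>y. Im (g1 y))" "continuous_on UNIV (\<lambda>y. Im (g2 y))"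
    using g by (auto intro!: continuous_intros)
  have "(\<lambda>n. conv (mol n) (\<lambda>y. Re (g1 y)) x) = (\<lambda>n. conv (mol n) (\<lambda>y. Re (g2 y)) x)"
    "(\<lambda>n. conv (mol n) (\<lambda>y. Im (g1 y)) x) = (\<lambda>n. conv (mol n) (\<lambda>y. Im (g2 y)) x)"
    unfolding conv_mol_Re[OF i(1)] conv_mol_Re[OF i(2)] eq by auto
  with mol_conv_tendsto[OF c(1), of x] mol_conv_tendsto[OF c(2), of x]
      mol_conv_tendsto[OF c(3), of x] mol_conv_tendsto[OF c(4), of x]
  have "Re (g1 x) = Re (g2 x)" "Im (g1 x) = Im (g2 x)"
    by (simp_all add: LIMSEQ_unique)
  then show "g1 x = g2 x" by (rule complex_eqI)
qed

lemma fun_of_dist_eq: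
  assumes v: "tame v"
  shows "fun_of_dist (lp_partial_sum chi (int Q) (dist_of (\<lambda>x. complex_of_real (v x))))
    = (\<lambda>x. complex_of_real (conv (hk (2 ^ Suc Q)) v x))"
  unfolding fun_of_dist_def
proof (rule the_equality)
  let ?U = "lp_partial_sum chi (int Q) (dist_of (\<lambda>x. complex_of_real (v x)))"
  let ?g = "\<lambda>x. complex_of_real (conv (hk (2 ^ Suc Q)) v x)"
  have r: "represents ?g ?U" unfolding represents_def dist_of_def
    using lp_partial_sum_eq[OF v, of _ Q] conv_mult_integrable[OF dil_bump dil_even v, of "2 ^ Suc Q"]
    unfolding dist_of_def hk_def by simp
  have c: "continuous_on UNIV ?g"
    by (intro smooth_continuous smooth_of_real smooth_conv schwartz_hk v) simp
  show "continuous_on UNIV ?g \<and> represents ?g ?U" using r c by blast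
  show "g = ?g" if "continuous_on UNIV g \<and> represents g ?U" for g
    using represents_unique that r c by blast
qed

text \<open>Only this lower bound for the distributional norm is needed: mollifying a representative
  gives the same function as mollifying the continuous one.\<close>

lemma dist_Lp_norm_lower:
  assumes G: "continuous_on UNIV G"
    and V: "\<And>f. schwartz f \<Longrightarrow> V j f = (\<integral>y. complex_of_real (G y) * f y \<partial>lborel)"
    and i: "\<And>f. schwartz f \<Longrightarrow> integrable lborel (\<lambda>y. complex_of_real (G y) * f y)"
    and D: "dist_Lp_norm 3 V \<le> ennreal D" "D \<ge> 0"
  shows "LP 3 G D"
proof (rule LP_limit)
  fix \<epsilon> :: real assume e: "\<epsilon> > 0"
  have Gm: "G \<in> borel_measurable borel" by (rule borel_measurable_continuous_onI[OF G])
  \<comment> \<open>The infimum need not be attained, so a representative F is taken whose norm is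
    below D + \<epsilon>.\<close>
  have "dist_Lp_norm 3 V < ennreal (D + \<epsilon>)" using D e by (auto intro: le_less_trans ennreal_lessI)
  then obtain F where F: "in_Lp 3 F" "\<forall>j. represents (\<lambda>x. F x $ j) (V j)" "ennreal (Lp_norm 3 F) < ennreal (D + \<epsilon>)"
    unfolding dist_Lp_norm_def INF_less_iff by blast
  have "Lp_norm 3 F < D + \<epsilon>" using F(3) by (subst (asm) ennreal_less_iff) (simp add: Lp_norm_def)
  then have N: "Lp_norm 3 F \<le> D + \<epsilon>" by simp
  have Fm[measurable]: "F \<in> borel_measurable borel" using F(1) by (simp add: in_Lp_def)
  define g where "g y = Re (F y $ j)" for y
  have [measurable]: "(\<lambda>x. F x $ j) \<in> borel_measurable borel"
    by (rule measurable_compose[OF Fm borel_measurable_continuous_onI[OF linear_continuous_on[OF bounded_linear_vec_nth]]])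
  have gm[measurable]: "g \<in> borel_measurable borel" unfolding g_def by measurable
  have gF: "\<bar>g y\<bar> \<le> norm (F y)" for y
    unfolding g_def using abs_Re_le_cmod[of "F y $ j"] Finite_Cartesian_Product.norm_nth_le[of "F y" j] by linarith
  have iF: "integrable lborel (\<lambda>x. norm (F x) ^ 3)"
    using F(1) by (simp add: in_Lp_def)
  have "LP 3 g (Lp_norm 3 F)"
  proof (rule LPI)
    show ig: "integrable lborel (\<lambda>x. \<bar>g x\<bar> ^ 3)"
      by (rule Bochner_Integration.integrable_bound[OF iF]) (auto intro!: AE_I2 power_mono gF simp: power_abs)
    have "(\<integral>x. \<bar>g x\<bar> ^ 3 \<partial>lborel) \<le> (\<integral>x. norm (F x) ^ 3 \<partial>lborel)"
      by (rule integral_mono[OF ig iF]) (auto intro!: power_mono gF)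
    also have "\<dots> = Lp_norm 3 F ^ 3"
    proof -
      let ?I = "\<integral>x. norm (F x) ^ 3 \<partial>lborel"
      have "?I \<ge> 0" by simp
      then have "(?I powr (1/3)) ^ 3 = ?I"
        by (cases "?I = 0") (simp_all add: powr_realpow[symmetric] powr_powr)
      then show ?thesis by (simp add: Lp_norm_def)
    qed
    finally show "(\<integral>x. \<bar>g x\<bar> ^ 3 \<partial>lborel) \<le> Lp_norm 3 F ^ 3" .
  qed (auto simp: Lp_norm_def)
  then have gL: "LP 3 g (D + \<epsilon>)" by (rule LP_mono[OF _ N])
  have "conv (mol n) g x = conv (mol n) G x" for n x
  proof -
    have r: "represents (\<lambda>x. F x $ j) (V j)" using F(2) by blast
    have iF: "integrable lborel (\<lambda>y. F y $ j * complex_of_real (mol n (x - y)))"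
      and eF: "V j (\<lambda>y. complex_of_real (mol n (x - y))) = (\<integral>y. F y $ j * complex_of_real (mol n (x - y)) \<partial>lborel)"
      using r mol_test[of n x] unfolding represents_def dist_of_def by blast+
    show ?thesis
      using conv_mol_Re(1)[OF iF] conv_mol_Re(1)[OF i[OF mol_test[of n x]]] V[OF mol_test[of n x]] eF
      by (simp add: g_def[abs_def])
  qed
  then have "conv (mol n) G = conv (mol n) g" for n by (intro ext) simp
  \<comment> \<open>Mollification does not distinguish g from G and does not increase the L^3 bound;
    Fatou then returns from the mollified functions to G itself.\<close>
  then have "LP 3 (conv (mol n) G) (D + \<epsilon>)" for n
    using LP_conv[OF bump_measurable[OF mol_bump(2)] mol_abs_integral _ gL, of n] by simp
  then show "LP 3 G (D + \<epsilon>)"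
    by (rule LP_Fatou[OF _ Gm]) (auto intro!: AE_I2 mol_conv_tendsto[OF G])
qed (rule D)

lemma block_LP3:
  assumes v: "tame (\<lambda>x. u x $ j)"
    and D: "dist_Lp_norm 3 (\<lambda>j. lp_block chi (int n - 1) (field_dist u j)) \<le> ennreal D" "D \<ge> 0"
  shows "LP 3 (conv (blk n) (\<lambda>x. u x $ j)) D"
proof (rule dist_Lp_norm_lower[where V="\<lambda>j. lp_block chi (int n - 1) (field_dist u j)" and j=j])
  show "continuous_on UNIV (conv (blk n) (\<lambda>x. u x $ j))"
    by (intro smooth_continuous smooth_conv schwartz_blk v)
  show "lp_block chi (int n - 1) (field_dist u j) f = (\<integral>y. complex_of_real (conv (blk n) (\<lambda>x. u x $ j) y) * f y \<partial>lborel)"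
    if "schwartz f" for f unfolding field_dist_def by (rule lp_block_eq[OF v that])
  show "integrable lborel (\<lambda>y. complex_of_real (conv (blk n) (\<lambda>x. u x $ j) y) * f y)" if "schwartz f" for f
    using conv_mult_integrable[OF lp_symbol_bump(1,2) v that, of n] unfolding lp_symbol_bump(3) .
qed (rule D)+

end

section \<open>Approximation in the Lebesgue spaces\<close>

definition NP :: "nat \<Rightarrow> (R3 \<Rightarrow> real) \<Rightarrow> real" where
  "NP p f = root p (\<integral>x. \<bar>f x\<bar> ^ p \<partial>lborel)"

lemma NP_nonneg: "0 \<le> NP p f"
  by (cases "p = 0") (simp_all add: NP_def real_root_ge_zero)

lemma NP_pow: "p > 0 \<Longrightarrow> NP p f ^ p = (\<integral>x. \<bar>f x\<bar> ^ p \<partial>lborel)"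
  by (simp add: NP_def real_root_pow_pos2)

lemma NP_LP: "LP p f A \<Longrightarrow> p > 0 \<Longrightarrow> LP p f (NP p f)"
  by (rule LPI) (auto simp: LP_measurable LP_integrable NP_nonneg NP_pow)

lemma NP_le:
  assumes "LP p f A" "p > 0" shows "NP p f \<le> A"
proof (rule power_le_imp_le_base)
  show "NP p f ^ Suc (p - 1) \<le> A ^ Suc (p - 1)"
    using LP_integral_le[OF assms(1)] NP_pow[OF assms(2), of f] assms(2) by simp
qed (use LP_nonneg[OF assms(1)] in simp)

lemma NP_tendsto_0:
  assumes "(\<lambda>n. \<integral>x. \<bar>f n x\<bar> ^ p \<partial>lborel) \<longlonglongrightarrow> 0" shows "(\<lambda>n. NP p (f n)) \<longlonglongrightarrow> 0"
  using tendsto_real_root[OF assms, of p] by (simp add: NP_def)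

lemma NP_null:
  assumes "\<And>n. LP p (f n) (A n)" "A \<longlonglongrightarrow> 0" "p > 0" shows "(\<lambda>n. NP p (f n)) \<longlonglongrightarrow> 0"
  by (rule tendsto_sandwich[OF _ _ tendsto_const assms(2)]) (use NP_nonneg NP_le[OF assms(1,3)] in auto)

lemma NP_dominated:
  assumes f: "f \<in> borel_measurable borel" and w: "integrable lborel (\<lambda>x. w x ^ p)"
    and b: "\<And>x. \<bar>f x\<bar> \<le> w x" and p: "p > 0"
  shows "LP p f (NP p f)"
proof -
  note [measurable] = f
  have "integrable lborel (\<lambda>x. \<bar>f x\<bar> ^ p)"
    by (rule Bochner_Integration.integrable_bound[OF w])
       (use f in \<open>auto intro!: AE_I2 power_mono order_trans[OF b abs_ge_self] simp: power_abs\<close>)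
  then show ?thesis
    by (intro LPI) (use f NP_nonneg NP_pow[OF p, of f] in auto)
qed

lemma NP_dct:
  assumes f: "\<And>n. f n \<in> borel_measurable borel" and w: "integrable lborel (\<lambda>x. w x ^ p)"
    and b: "\<And>n x. \<bar>f n x\<bar> \<le> w x" and l: "AE x in lborel. (\<lambda>n. f n x) \<longlonglongrightarrow> 0" and p: "p > 0"
  shows "(\<lambda>n. NP p (f n)) \<longlonglongrightarrow> 0"
proof -
  note [measurable] = f
  have "(\<lambda>n. \<integral>x. \<bar>f n x\<bar> ^ p \<partial>lborel) \<longlonglongrightarrow> (\<integral>x. (0::real) \<partial>(lborel :: R3 measure))"
  proof (rule integral_dominated_convergence[OF _ _ w])
    show "AE x in lborel. (\<lambda>n. \<bar>f n x\<bar> ^ p) \<longlonglongrightarrow> 0"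
      using l
    proof eventually_elim
      case (elim x)
      have "(\<lambda>n. \<bar>f n x\<bar> ^ p) \<longlonglongrightarrow> \<bar>0\<bar> ^ p" by (intro tendsto_intros elim)
      moreover have "\<bar>0::real\<bar> ^ p = 0" using p by (simp add: zero_power)
      ultimately show ?case by (simp only:)
    qed
    show "AE x in lborel. norm (\<bar>f n x\<bar> ^ p) \<le> w x ^ p" for n
      by (rule AE_I2) (use b in \<open>simp add: power_abs power_mono\<close>)
  qed measurable
  then show ?thesis by (intro NP_tendsto_0) simp
qed

lemma integrable_ball_const: "integrable lborel (\<lambda>x::R3. indicator (cball 0 R) x * c :: real)"
  using borel_integrable_compact[of "cball (0::R3) R" "\<lambda>_. c"] by (simp add: mult.commute)

text \<open>Truncation in size and support comes first. A Lebesgue measurable function is an almost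
  everywhere limit of continuous ones; clipping these to the same size and support supplies the
  majorant for dominated convergence.\<close>

lemma LP2_dense_continuous:
  assumes u: "LP 2 u A" and e: "\<epsilon> > 0"
  shows "\<exists>g R M. continuous_on UNIV g \<and> (\<forall>x. norm x > R \<longrightarrow> g x = 0) \<and> (\<forall>x. \<bar>g x\<bar> \<le> M) \<and> LP 2 (\<lambda>x. u x - g x) \<epsilon>"
proof -
  note [measurable] = LP_measurable[OF u]
  define v where "v n x = (if norm x \<le> real n then max (- real n) (min (real n) (u x)) else 0)" for n x
  have vm[measurable]: "v n \<in> borel_measurable borel" for n unfolding v_def by measurable
  have b1: "\<bar>u x - v n x\<bar> \<le> \<bar>u x\<bar>" for n x by (auto simp: v_def)
  have w1: "integrable lborel (\<lambda>x. \<bar>u x\<bar> ^ 2)" by (rule LP_integrable[OF u])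
  have m1: "(\<lambda>x. u x - v n x) \<in> borel_measurable borel" for n by measurable
  have "AE x in lborel. (\<lambda>n. u x - v n x) \<longlonglongrightarrow> 0"
    proof (rule AE_I2)
      fix x
      obtain N where N: "real N \<ge> max (norm x) \<bar>u x\<bar>" using real_arch_simple by blast
      have "\<forall>n\<ge>N. u x - v n x = 0"
      proof (intro allI impI)
        fix n assume "n \<ge> N"
        then have "real n \<ge> max (norm x) \<bar>u x\<bar>" using N by linarith
        then show "u x - v n x = 0" by (auto simp: v_def)
      qed
      then show "(\<lambda>n. u x - v n x) \<longlonglongrightarrow> 0"
        by (intro tendsto_eventually) (auto simp: eventually_sequentially)
    qed
  note 1 = NP_dct[OF m1 w1 b1 this zero_less_numeral] NP_dominated[OF m1 w1 b1 zero_less_numeral]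
  have "\<forall>\<^sub>F n in sequentially. NP 2 (\<lambda>x. u x - v n x) < \<epsilon> / 2"
    using order_tendstoD(2)[OF 1(1), of "\<epsilon> / 2"] e by simp
  then obtain n where n: "NP 2 (\<lambda>x. u x - v n x) < \<epsilon> / 2" using eventually_happens'[OF sequentially_bot] by blast
  have "v n \<in> borel_measurable lebesgue" using measurable_completion[of "v n" lborel borel] vm by simp
  then have "v n measurable_on UNIV" by (rule lebesgue_measurable_imp_measurable_on) simp
  then obtain N g where N: "negligible N" "\<And>k. continuous_on UNIV (g k)"
    "\<And>x. x \<notin> N \<Longrightarrow> (\<lambda>k. g k x) \<longlonglongrightarrow> v n x" unfolding measurable_on_def by auto
  have aeN: "AE x in lborel. x \<notin> N"
    using AE_not_in[of N lebesgue] N(1) by (simp add: negligible_iff_null_sets AE_completion_iff)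
  \<comment> \<open>A continuous cut-off equal to 1 on the ball of radius n, so that it leaves v n
    unchanged, and to 0 beyond radius n + 1.\<close>
  define c where "c x = max 0 (min 1 (real n + 1 - norm x))" for x :: R3
  define G where "G k x = max (- real n) (min (real n) (g k x)) * c x" for k x
  have Gc: "continuous_on UNIV (G k)" for k
    unfolding G_def c_def by (intro continuous_intros N(2))
  have [measurable]: "G k \<in> borel_measurable borel" for k by (rule borel_measurable_continuous_onI[OF Gc])
  have c: "0 \<le> c x" "c x \<le> 1" "norm x > real n + 1 \<Longrightarrow> c x = 0" "norm x \<le> real n \<Longrightarrow> c x = 1" for x
    by (auto simp: c_def)
  have Gb: "\<bar>G k x\<bar> \<le> real n" for k x
  proof -
    have "\<bar>max (- real n) (min (real n) (g k x))\<bar> * \<bar>c x\<bar> \<le> real n * 1"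
      using c[of x] by (intro mult_mono) auto
    then show ?thesis by (simp add: G_def abs_mult)
  qed
  have b2: "\<bar>v n x - G k x\<bar> \<le> indicator (cball 0 (real n + 1)) x * (2 * real n)" for k x
  proof (cases "norm x > real n + 1")
    case True then show ?thesis using c(3)[of x] by (simp add: v_def G_def)
  next
    case False
    have "\<bar>v n x\<bar> \<le> real n" by (auto simp: v_def)
    then show ?thesis using Gb[of k x] False by simp
  qed
  have "(\<lambda>x::R3. (indicator (cball 0 (real n + 1)) x * (2 * real n)) ^ 2) = (\<lambda>x. indicator (cball 0 (real n + 1)) x * (2 * real n) ^ 2)"
    by (auto simp: fun_eq_iff indicator_def)
  then have w2: "integrable lborel (\<lambda>x::R3. (indicator (cball 0 (real n + 1)) x * (2 * real n)) ^ 2)"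
    by (simp only: integrable_ball_const)
  have m2: "(\<lambda>x. v n x - G k x) \<in> borel_measurable borel" for k by measurable
  have "AE x in lborel. (\<lambda>k. v n x - G k x) \<longlonglongrightarrow> 0"
    using aeN
  proof eventually_elim
    case (elim x)
    have "(\<lambda>k. v n x - max (- real n) (min (real n) (g k x)) * c x) \<longlonglongrightarrow> v n x - max (- real n) (min (real n) (v n x)) * c x"
      by (intro tendsto_intros N(3)[OF elim])
    moreover have "max (- real n) (min (real n) (v n x)) * c x = v n x"
      by (cases "norm x \<le> real n") (auto simp: c(4), auto simp: v_def)
    ultimately show ?case by (simp add: G_def)
  qed
  note 2 = NP_dct[OF m2 w2 b2 this zero_less_numeral] NP_dominated[OF m2 w2 b2 zero_less_numeral]
  have "\<forall>\<^sub>F k in sequentially. NP 2 (\<lambda>x. v n x - G k x) < \<epsilon> / 2"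
    using order_tendstoD(2)[OF 2(1), of "\<epsilon> / 2"] e by simp
  then obtain k where k: "NP 2 (\<lambda>x. v n x - G k x) < \<epsilon> / 2" using eventually_happens'[OF sequentially_bot] by blast
  have "LP 2 (\<lambda>x. (u x - v n x) + (v n x - G k x)) (NP 2 (\<lambda>x. u x - v n x) + NP 2 (\<lambda>x. v n x - G k x))"
    by (rule LP_add[OF 1(2) 2(2)]) simp
  then have "LP 2 (\<lambda>x. u x - G k x) \<epsilon>" by (rule LP_mono[THEN back_subst[of "\<lambda>h. LP 2 h \<epsilon>"]]) (use n k in auto)
  then show ?thesis using Gc[of k] Gb[of k] c(3)
    by (intro exI[of _ "G k"] exI[of _ "real n + 1"] exI[of _ "real n"]) (auto simp: G_def)
qed

text \<open>For continuous functions with bounded support this is dominated convergence. The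
  approximation error enters twice, once translated and once not, which is why it is taken as
  \<epsilon>/4.\<close>

lemma LP2_translation_continuous:
  assumes u: "LP 2 u A" and y: "y \<longlonglongrightarrow> 0"
  shows "(\<lambda>n. NP 2 (\<lambda>x. u (x - y n) - u x)) \<longlonglongrightarrow> 0"
proof (rule LIMSEQ_I)
  fix \<epsilon> :: real assume e: "\<epsilon> > 0"
  obtain g R M where g: "continuous_on UNIV g" "\<forall>x. norm x > R \<longrightarrow> g x = 0" "\<forall>x. \<bar>g x\<bar> \<le> M" "LP 2 (\<lambda>x. u x - g x) (\<epsilon> / 4)"
    using LP2_dense_continuous[OF u, of "\<epsilon> / 4"] e by auto
  have [measurable]: "g \<in> borel_measurable borel" by (rule borel_measurable_continuous_onI[OF g(1)])
  obtain Y where Y: "\<And>n. norm (y n) \<le> Y" using convergent_imp_Bseq[OF convergentI[OF y]] by (auto simp: Bseq_def)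
  have b1: "\<bar>g (x - y n) - g x\<bar> \<le> indicator (cball 0 (R + Y)) x * (2 * M)" for n x
  proof (cases "norm x > R + Y")
    case True
    have "norm x \<le> norm (x - y n) + norm (y n)" by (metis diff_add_cancel norm_triangle_ineq)
    then have "norm (x - y n) > R" "norm x > R" using True Y[of n] order_trans[OF norm_ge_zero Y[of n]] by linarith+
    then show ?thesis using g(2) True by simp
  next
    case False
    have "\<bar>g (x - y n)\<bar> \<le> M" "\<bar>g x\<bar> \<le> M" using g(3) by auto
    then show ?thesis using False by simp
  qed
  have "(\<lambda>x::R3. (indicator (cball 0 (R + Y)) x * (2 * M)) ^ 2) = (\<lambda>x. indicator (cball 0 (R + Y)) x * (2 * M) ^ 2)"
    by (auto simp: fun_eq_iff indicator_def)
  then have w1: "integrable lborel (\<lambda>x::R3. (indicator (cball 0 (R + Y)) x * (2 * M)) ^ 2)"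
    by (simp only: integrable_ball_const)
  have m1: "(\<lambda>x. g (x - y n) - g x) \<in> borel_measurable borel" for n by measurable
  have "AE x in lborel. (\<lambda>n. g (x - y n) - g x) \<longlonglongrightarrow> 0"
  proof (rule AE_I2)
    fix x
    have "(\<lambda>n. x - y n) \<longlonglongrightarrow> x - 0" by (intro tendsto_intros y)
    then have "(\<lambda>n. g (x - y n)) \<longlonglongrightarrow> g x"
      using g(1) by (intro isCont_tendsto_compose[of x g]) (simp_all add: continuous_on_eq_continuous_at)
    from tendsto_diff[OF this tendsto_const, of "g x"] show "(\<lambda>n. g (x - y n) - g x) \<longlonglongrightarrow> 0" by simp
  qed
  note 1 = NP_dct[OF m1 w1 b1 this zero_less_numeral] NP_dominated[OF m1 w1 b1 zero_less_numeral]
  obtain n0 where n0: "\<And>n. n \<ge> n0 \<Longrightarrow> NP 2 (\<lambda>x. g (x - y n) - g x) < \<epsilon> / 4"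
    using order_tendstoD(2)[OF 1(1), of "\<epsilon> / 4"] e by (auto simp: eventually_sequentially)
  show "\<exists>n0. \<forall>n\<ge>n0. norm (NP 2 (\<lambda>x. u (x - y n) - u x) - 0) < \<epsilon>"
  proof (intro exI allI impI)
    fix n assume n: "n \<ge> n0"
    have "LP 2 (\<lambda>x. ((u (x - y n) - g (x - y n)) - (u x - g x)) + (g (x - y n) - g x)) ((\<epsilon> / 4 + \<epsilon> / 4) + NP 2 (\<lambda>x. g (x - y n) - g x))"
      by (intro LP_add LP_diff 1(2) LP_shift(1)[OF g(4)] g(4)) auto
    moreover have "(\<lambda>x. ((u (x - y n) - g (x - y n)) - (u x - g x)) + (g (x - y n) - g x)) = (\<lambda>x. u (x - y n) - u x)"
      by auto
    ultimately have "LP 2 (\<lambda>x. u (x - y n) - u x) ((\<epsilon> / 4 + \<epsilon> / 4) + NP 2 (\<lambda>x. g (x - y n) - g x))" by simp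
    from NP_le[OF this] n0[OF n] NP_nonneg[of 2 "\<lambda>x. u (x - y n) - u x"] e
    show "norm (NP 2 (\<lambda>x. u (x - y n) - u x) - 0) < \<epsilon>" by simp
  qed
qed

text \<open>L^2 convergence gives almost everywhere convergence along a subsequence, and Fatou
  passes the bound in the other exponent. Tails of the dyadic sum get their L^3 bounds this
  way.\<close>

lemma LP_of_L2_limit:
  assumes f: "\<And>n. LP p (f n) A" and g: "g \<in> borel_measurable borel"
    and d: "\<And>n. LP 2 (\<lambda>x. f n x - g x) (B n)" and l: "(\<lambda>n. NP 2 (\<lambda>x. f n x - g x)) \<longlonglongrightarrow> 0"
  shows "LP p g A"
proof -
  have "(\<lambda>n. NP 2 (\<lambda>x. f n x - g x) ^ 2) \<longlonglongrightarrow> 0 ^ 2" by (intro tendsto_intros l)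
  then have "(\<lambda>n. \<integral>x. norm (\<bar>f n x - g x\<bar> ^ 2) \<partial>lborel) \<longlonglongrightarrow> 0" by (simp add: NP_pow)
  from tendsto_L1_AE_subseq[OF _ this] LP_integrable[OF d]
  obtain r :: "nat \<Rightarrow> nat" where r: "AE x in lborel. (\<lambda>n. \<bar>f (r n) x - g x\<bar> ^ 2) \<longlonglongrightarrow> 0" by blast
  show ?thesis
  proof (rule LP_Fatou[where f="\<lambda>n. f (r n)"])
    show "AE x in lborel. (\<lambda>n. f (r n) x) \<longlonglongrightarrow> g x"
      using r
    proof eventually_elim
      case (elim x)
      have "(\<lambda>n. sqrt (\<bar>f (r n) x - g x\<bar> ^ 2)) \<longlonglongrightarrow> sqrt 0" by (intro tendsto_intros elim)
      then have "(\<lambda>n. f (r n) x - g x) \<longlonglongrightarrow> 0" by (simp add: tendsto_rabs_zero_iff)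
      from tendsto_add[OF this tendsto_const, of "g x"] show ?case by simp
    qed
  qed (use f g in auto)
qed

section \<open>Low-pass filters at high and at low frequency\<close>

context lp_cut
begin

lemma conv_hk_increment:
  assumes r: "r > 0" and u: "tame u"
  shows "conv (hk r) u x - u x = (\<integral>y. hk r y * (u (x - y) - u x) \<partial>lborel)"
    and "integrable lborel (\<lambda>y. hk r y * u (x - y))"
proof -
  have hi: "integrable lborel (hk r)" by (rule schwartz_integrable[OF schwartz_hk[OF r]])
  show i: "integrable lborel (\<lambda>y. hk r y * u (x - y))"
    using integrable_shift(2)[OF conv_integrable[OF schwartz_hk[OF r] u, of x], of x] by simp
  have "conv (hk r) u x = (\<integral>y. hk r y * u (x - y) \<partial>lborel)"
    by (rule conv_commute[OF schwartz_measurable[OF schwartz_hk[OF r]] tame_measurable[OF u]])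
  moreover have "(\<integral>y. hk r y * (u (x - y) - u x) \<partial>lborel) = (\<integral>y. hk r y * u (x - y) \<partial>lborel) - (\<integral>y. hk r y * u x \<partial>lborel)"
    unfolding right_diff_distrib by (rule Bochner_Integration.integral_diff[OF i integrable_mult_left[OF hi]])
  moreover have "(\<integral>y. hk r y * u x \<partial>lborel) = u x" using hk_integral[OF r] by simp
  ultimately show "conv (hk r) u x - u x = (\<integral>y. hk r y * (u (x - y) - u x) \<partial>lborel)" by simp
qed

text \<open>Since the kernel has mass one, the error is an average of u(x - y) - u(x). After
  rescaling, its squared norm is controlled by the average of the translation modulus at z / r_n,
  which tends to 0 by dominated convergence.\<close>

lemma conv_hk_tendsto_L2:
  assumes u: "LP 2 u A" and r: "\<And>n. r n > 0" "filterlim r at_top sequentially"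
  shows "(\<lambda>n. NP 2 (\<lambda>x. conv (hk (r n)) u x - u x)) \<longlonglongrightarrow> 0"
    and "LP 2 (\<lambda>x. conv (hk (r n)) u x - u x) (c0 * A + A)"
proof -
  show "LP 2 (\<lambda>x. conv (hk (r n)) u x - u x) (c0 * A + A)" for n
    by (intro LP_diff LP_conv_hk r u) auto
  note [measurable] = LP_measurable[OF u] schwartz_measurable[OF schwartz_hk[OF r(1)]] schwartz_measurable[OF schwartz_hk[of 1]]
  define W where "W y = (\<integral>x. \<bar>u (x - y) - u x\<bar> ^ 2 \<partial>lborel)" for y
  have [measurable]: "W \<in> borel_measurable borel" unfolding W_def by measurable
  have dl: "LP 2 (\<lambda>x. u (x - y) - u x) (A + A)" for y by (intro LP_diff LP_shift(1) u) auto
  have W: "W y = NP 2 (\<lambda>x. u (x - y) - u x) ^ 2" for y by (simp add: W_def NP_pow)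
  define D where "D = (A + A) ^ 2"
  have W0: "0 \<le> W y" and Wb: "W y \<le> D" for y
    using LP_integral_le[OF dl[of y]] by (simp_all add: W_def D_def)
  define I where "I n = (\<integral>z. \<bar>hk 1 z\<bar> * W (z /\<^sub>R r n) \<partial>lborel)" for n
  have hi: "integrable lborel (\<lambda>z. \<bar>hk 1 z\<bar> * D)"
    using schwartz_integrable[OF schwartz_hk[of 1]] by simp
  have gi: "integrable lborel (\<lambda>z. \<bar>hk 1 z\<bar> * W (z /\<^sub>R r n))" for n
    by (rule Bochner_Integration.integrable_bound[OF hi]) (auto intro!: AE_I2 mult_left_mono order_trans[OF Wb abs_ge_self] simp: abs_mult W0)
  have I0: "I n \<ge> 0" for n unfolding I_def by (simp add: W0)
  have "I \<longlonglongrightarrow> (\<integral>z. (0::real) \<partial>(lborel :: R3 measure))"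
    unfolding I_def
  proof (rule integral_dominated_convergence[OF _ _ hi])
    show "AE z in lborel. (\<lambda>n. \<bar>hk 1 z\<bar> * W (z /\<^sub>R r n)) \<longlonglongrightarrow> 0"
    proof (rule AE_I2)
      fix z :: R3
      have "(\<lambda>n. inverse (r n)) \<longlonglongrightarrow> 0" by (rule tendsto_inverse_0_at_top[OF r(2)])
      then have "(\<lambda>n. inverse (r n) *\<^sub>R z) \<longlonglongrightarrow> 0 *\<^sub>R z" by (rule tendsto_scaleR[OF _ tendsto_const])
      then have "(\<lambda>n. z /\<^sub>R r n) \<longlonglongrightarrow> 0" by simp
      from LP2_translation_continuous[OF u this]
      have "(\<lambda>n. \<bar>hk 1 z\<bar> * NP 2 (\<lambda>x. u (x - z /\<^sub>R r n) - u x) ^ 2) \<longlonglongrightarrow> \<bar>hk 1 z\<bar> * 0 ^ 2"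
        by (intro tendsto_intros)
      then show "(\<lambda>n. \<bar>hk 1 z\<bar> * W (z /\<^sub>R r n)) \<longlonglongrightarrow> 0" by (simp add: W)
    qed
    show "AE z in lborel. norm (\<bar>hk 1 z\<bar> * W (z /\<^sub>R r n)) \<le> \<bar>hk 1 z\<bar> * D" for n
      by (auto intro!: AE_I2 mult_left_mono Wb simp: abs_mult W0)
  qed measurable
  then have I: "I \<longlonglongrightarrow> 0" by simp
  \<comment> \<open>The shape c0 * sqrt (I n / c0) is the product C * A of
    \<open>LP_integral\<close>, with A chosen so that the second moment I n equals C * A^2.\<close>
  have L: "LP 2 (\<lambda>x. conv (hk (r n)) u x - u x) (c0 * sqrt (I n / c0))" for n
  proof -
    have "LP 2 (\<lambda>x. \<integral>y. hk (r n) y * (u (x - y) - u x) \<partial>lborel) (c0 * sqrt (I n / c0))"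
    proof (rule LP_integral[where w="\<lambda>y. NP 2 (\<lambda>x. u (x - y) - u x)"])
      show "LP 2 (\<lambda>x. u (x - y) - u x) (NP 2 (\<lambda>x. u (x - y) - u x))" for y by (rule NP_LP[OF dl]) simp
      show "(\<integral>\<^sup>+y. ennreal \<bar>hk (r n) y\<bar> \<partial>lborel) \<le> ennreal c0"
        using schwartz_abs_integral(1)[OF schwartz_hk[OF r(1)], of n] hk_abs_integral[OF r(1)] by simp
      have e: "\<bar>hk (r n) y\<bar> * W y = r n ^ 3 * (\<bar>hk 1 (r n *\<^sub>R y)\<bar> * W ((r n *\<^sub>R y) /\<^sub>R r n))" for y
        using r(1)[of n] by (simp add: hk_scale[OF r(1)] abs_mult)
      have "(\<integral>\<^sup>+y. ennreal (\<bar>hk (r n) y\<bar> * W y) \<partial>lborel) = ennreal (\<integral>y. \<bar>hk (r n) y\<bar> * W y \<partial>lborel)"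
        unfolding e using integral_scale(1)[OF gi r(1), of n n] W0 r(1)[of n] by (intro nn_integral_eq_integral) auto
      also have "(\<integral>y. \<bar>hk (r n) y\<bar> * W y \<partial>lborel) = I n"
        unfolding e I_def by (rule integral_scale(2)[OF gi r(1)])
      also have "I n = c0 * (sqrt (I n / c0)) ^ 2" using c0_pos I0[of n] by simp
      finally show "(\<integral>\<^sup>+y. ennreal (\<bar>hk (r n) y\<bar> * NP 2 (\<lambda>x. u (x - y) - u x) ^ 2) \<partial>lborel) \<le> ennreal (c0 * (sqrt (I n / c0)) ^ 2)"
        by (simp add: W)
    qed (use c0_pos I0[of n] in auto)
    then show ?thesis by (simp only: conv_hk_increment(1)[OF r(1) tame_LP2[OF u]])
  qed
  have "(\<lambda>n. c0 * sqrt (I n / c0)) \<longlonglongrightarrow> c0 * sqrt (0 / c0)"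
    using c0_pos by (intro tendsto_intros I) auto
  then show "(\<lambda>n. NP 2 (\<lambda>x. conv (hk (r n)) u x - u x)) \<longlonglongrightarrow> 0"
    by (intro NP_null[OF L]) auto
qed

text \<open>On a bounded g with bounded support the roles in Young's inequality are exchanged: g is
  the integrable kernel, and the L^2 norm of \<open>hk r\<close> scales like r^(3/2). Density
  handles the rest. The low frequencies excluded from the Leray projector become negligible by
  this.\<close>

lemma conv_hk_low_freq:
  assumes u: "LP 2 u A" and r: "\<And>n. r n > 0" "r \<longlonglongrightarrow> 0"
  shows "(\<lambda>n. NP 2 (conv (hk (r n)) u)) \<longlonglongrightarrow> 0"
proof (rule LIMSEQ_I)
  fix \<epsilon> :: real assume e: "\<epsilon> > 0"
  obtain g R M where g: "continuous_on UNIV g" "\<forall>x. norm x > R \<longrightarrow> g x = 0" "\<forall>x. \<bar>g x\<bar> \<le> M" "LP 2 (\<lambda>x. u x - g x) (\<epsilon> / (2 * c0))"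
    using LP2_dense_continuous[OF u, of "\<epsilon> / (2 * c0)"] e c0_pos by auto
  have gm[measurable]: "g \<in> borel_measurable borel" by (rule borel_measurable_continuous_onI[OF g(1)])
  have gi: "integrable lborel g"
    by (rule Bochner_Integration.integrable_bound[OF integrable_ball_const[of R M]])
       (use g(2,3) in \<open>auto intro!: AE_I2 simp: indicator_def intro: order_trans[OF _ abs_ge_self]\<close>)
  have gt: "tame g" by (rule tame_integrable[OF gi])
  define a where "a = (\<integral>x. \<bar>g x\<bar> \<partial>lborel)"
  obtain B where B: "LP 2 (hk 1) B" using schwartz_LP2[OF schwartz_hk[of 1]] by auto
  have hL: "LP 2 (hk (r n)) (sqrt (r n ^ 3) * B)" for n
  proof (rule LPI)
    have e: "\<bar>hk (r n) x\<bar> ^ 2 = r n ^ 3 * (r n ^ 3 * \<bar>hk 1 (r n *\<^sub>R x)\<bar> ^ 2)" for x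
    proof -
      have "\<bar>hk (r n) x\<bar> = r n ^ 3 * \<bar>hk 1 (r n *\<^sub>R x)\<bar>"
        using r(1)[of n] by (simp add: hk_scale[OF r(1), of n x] abs_mult)
      then show ?thesis by (simp only: power2_eq_square mult_ac)
    qed
    show "integrable lborel (\<lambda>x. \<bar>hk (r n) x\<bar> ^ 2)"
      unfolding e by (intro integrable_mult_right integral_scale(1)[OF LP_integrable[OF B] r(1)])
    have "(\<integral>x. \<bar>hk (r n) x\<bar> ^ 2 \<partial>lborel) = r n ^ 3 * (\<integral>x. \<bar>hk 1 x\<bar> ^ 2 \<partial>lborel)"
      unfolding e by (subst Bochner_Integration.integral_mult_right_zero) (simp only: integral_scale(2)[OF LP_integrable[OF B] r(1)])
    also have "\<dots> \<le> r n ^ 3 * B ^ 2" using LP_integral_le[OF B] r(1)[of n] by simp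
    also have "\<dots> = (sqrt (r n ^ 3) * B) ^ 2" using r(1)[of n] by (simp add: power_mult_distrib)
    finally show "(\<integral>x. \<bar>hk (r n) x\<bar> ^ 2 \<partial>lborel) \<le> (sqrt (r n ^ 3) * B) ^ 2" .
  qed (use schwartz_measurable[OF schwartz_hk[OF r(1)]] r(1)[of n] LP_nonneg[OF B] in auto)
  have sw: "conv (hk (r n)) g = conv g (hk (r n))" for n
  proof
    fix x show "conv (hk (r n)) g x = conv g (hk (r n)) x"
      using conv_commute[OF schwartz_measurable[OF schwartz_hk[OF r(1)]] gm, of n x]
      by (simp add: conv_def mult.commute)
  qed
  have L: "LP 2 (conv (hk (r n)) u) (\<epsilon> / 2 + a * (sqrt (r n ^ 3) * B))" for n
  proof -
    have 1: "LP 2 (conv (hk (r n)) (\<lambda>x. u x - g x)) (c0 * (\<epsilon> / (2 * c0)))"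
      by (rule LP_conv_hk[OF r(1) g(4)]) simp
    have 2: "LP 2 (conv g (hk (r n))) (a * (sqrt (r n ^ 3) * B))"
      by (rule LP_conv[OF gm _ _ hL]) (use gi in \<open>auto simp: a_def nn_integral_eq_integral\<close>)
    have "conv (hk (r n)) u x = conv (hk (r n)) (\<lambda>x. u x - g x) x + conv g (hk (r n)) x" for x
      using conv_diff_right[OF schwartz_hk[OF r(1)] tame_LP2[OF u] gt, of n x] by (simp add: sw)
    then have "conv (hk (r n)) u = (\<lambda>x. conv (hk (r n)) (\<lambda>x. u x - g x) x + conv g (hk (r n)) x)" by (rule ext)
    then show ?thesis using LP_add[OF 1 2] c0_pos by simp
  qed
  have "(\<lambda>n. a * (sqrt (r n ^ 3) * B)) \<longlonglongrightarrow> a * (sqrt (0 ^ 3) * B)" by (intro tendsto_intros r(2))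
  then have "(\<lambda>n. a * (sqrt (r n ^ 3) * B)) \<longlonglongrightarrow> 0" by simp
  from order_tendstoD(2)[OF this, of "\<epsilon> / 2"] e
  obtain n0 where n0: "\<And>n. n \<ge> n0 \<Longrightarrow> a * (sqrt (r n ^ 3) * B) < \<epsilon> / 2"
    by (auto simp: eventually_sequentially)
  show "\<exists>n0. \<forall>n\<ge>n0. norm (NP 2 (conv (hk (r n)) u) - 0) < \<epsilon>"
  proof (intro exI allI impI)
    fix n assume "n \<ge> n0"
    then show "norm (NP 2 (conv (hk (r n)) u) - 0) < \<epsilon>"
      using n0[of n] NP_le[OF L[of n]] NP_nonneg[of 2 "conv (hk (r n)) u"] by simp
  qed
qed

end

section \<open>The energy flux\<close>

lemma bump_compact_support: "bump (f :: R3 \<Rightarrow> real) \<Longrightarrow> compact (closure {x. f x \<noteq> 0})"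
proof -
  assume "bump f"
  then obtain R where "\<forall>x. norm x > R \<longrightarrow> f x = 0" using bumpD by blast
  then have "{x. f x \<noteq> 0} \<subseteq> cball 0 R" by (auto simp: not_less[symmetric])
  then have "bounded {x. f x \<noteq> 0}" using bounded_subset bounded_cball by blast
  then show ?thesis by (simp add: compact_eq_bounded_closed bounded_closure)
qed

lemma integrable_mult_bdd:
  fixes f g :: "'a \<Rightarrow> real"
  assumes "integrable M f" "g \<in> borel_measurable M" "\<And>x. \<bar>g x\<bar> \<le> B"
  shows "integrable M (\<lambda>x. f x * g x)"
proof (rule Bochner_Integration.integrable_bound[OF integrable_mult_left[OF assms(1), of B]])
  have "\<bar>f x\<bar> * \<bar>g x\<bar> \<le> \<bar>f x\<bar> * \<bar>B\<bar>" for x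
    by (rule mult_left_mono[OF order_trans[OF assms(3) abs_ge_self] abs_ge_zero])
  then show "AE x in M. norm (f x * g x) \<le> norm (f x * B)" by (intro AE_I2) (simp add: abs_mult)
qed (use assms in auto)

context lp_cut
begin

text \<open>The definition of \<open>div_free\<close> tests with compactly supported functions, so
  the reflected kernel k(x - y) is cut off by chi(y / n). The derivative of the cut-off gains 1/n
  and disappears in the limit.\<close>

lemma conv_div_free:
  assumes k: "schwartz k" and u: "\<And>i. LP 2 (\<lambda>x. u x $ i) (A i)" and d: "div_free u"
  shows "(\<Sum>i\<in>UNIV. conv (partial i k) (\<lambda>y. u y $ i) x) = 0"
proof -
  define r where "r n = real (Suc n)" for n
  have r: "r n > 0" "r n \<ge> 1" for n by (auto simp: r_def)
  define c where "c n y = chi (y /\<^sub>R r n)" for n y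
  define K where "K y = k (x - y)" for y
  have cb: "bump (c n)" for n
    using bump_affine[OF chi_bump, of "inverse (r n)" 1 0] r(1)[of n] by (simp add: c_def[abs_def])
  have Ks: "smooth K" using smooth_affine[OF schwartz_smooth[OF k], of 1 "-1" x] by (simp add: K_def[abs_def])
  have dk: "k differentiable (at y)" for y by (rule smooth_differentiable[OF schwartz_smooth[OF k]])
  have dchi: "chi differentiable (at y)" for y by (rule smooth_differentiable[OF chi_smooth])
  have pK: "partial i K y = - partial i k (x - y)" for i y
    using partial_affine(1)[where f=k and a="-1" and x=y and b=x and i=i, OF dk] by (simp add: K_def[abs_def])
  have pc: "partial i (c n) y = inverse (r n) * partial i chi (y /\<^sub>R r n)" for i n y
    using partial_scale(1)[where f=chi and a="inverse (r n)" and x=y and i=i, OF dchi] by (simp add: c_def[abs_def])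
  have pf: "partial i (\<lambda>y. K y * c n y) y = partial i K y * c n y + K y * partial i (c n) y" for i n y
    by (rule partial_mult[OF smooth_differentiable[OF Ks] smooth_differentiable[OF bump_smooth[OF cb]]])
  have z: "(\<integral>y. (\<Sum>i\<in>UNIV. u y $ i * partial i (\<lambda>y. K y * c n y) y) \<partial>lborel) = 0" for n
    using d bump_mult[OF cb Ks, of n] bump_compact_support[OF bump_mult[OF cb Ks, of n]]
    unfolding div_free_def bump_def by blast
  have "\<exists>M>0. \<forall>y. \<bar>partial i chi y\<bar> \<le> M" for i
    using bump_bounded[OF bump_partial[OF chi_bump, of i]] by (metis real_norm_def)
  then obtain M where M: "\<And>i. M i > 0" "\<And>i y. \<bar>partial i chi y\<bar> \<le> M i" by metis
  obtain M0 where M0: "M0 > 0" "\<And>y. norm (chi y) \<le> M0" using bump_bounded[OF chi_bump] by blast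
  note [measurable] = LP_measurable[OF u] schwartz_measurable[OF k] schwartz_measurable[OF schwartz_partial[OF k]]
    bump_measurable[OF bump_partial[OF chi_bump]]
  have i1: "integrable lborel (\<lambda>y. u y $ i * k (x - y))" for i
    using conv_integrable[OF k tame_LP2[OF u], of x i] by (simp add: mult.commute)
  have i2: "integrable lborel (\<lambda>y. u y $ i * partial i k (x - y))" for i
    using conv_integrable[OF schwartz_partial[OF k] tame_LP2[OF u], of i x i] by (simp add: mult.commute)
  have lim0: "(\<lambda>n. \<integral>y. (\<Sum>i\<in>UNIV. u y $ i * partial i (\<lambda>y. K y * c n y) y) \<partial>lborel) \<longlonglongrightarrow> (\<integral>y. (\<Sum>i\<in>UNIV. u y $ i * (- partial i k (x - y))) \<partial>lborel)"
  proof (rule integral_dominated_convergence[where w="\<lambda>y. \<Sum>i\<in>UNIV. \<bar>u y $ i * partial i k (x - y)\<bar> * M0 + \<bar>u y $ i * k (x - y)\<bar> * M i"])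
    show "(\<lambda>y. \<Sum>i\<in>UNIV. u y $ i * partial i (\<lambda>y. K y * c n y) y) \<in> borel_measurable lborel" for n
      unfolding pf pK pc unfolding K_def c_def by measurable
    show "AE y in lborel. (\<lambda>n. \<Sum>i\<in>UNIV. u y $ i * partial i (\<lambda>y. K y * c n y) y) \<longlonglongrightarrow> (\<Sum>i\<in>UNIV. u y $ i * - partial i k (x - y))"
    proof (rule AE_I2)
      fix y :: R3
      have ri: "(\<lambda>n. inverse (r n)) \<longlonglongrightarrow> 0" unfolding r_def by (rule LIMSEQ_inverse_real_of_nat)
      have "(\<lambda>n. inverse (r n) *\<^sub>R y) \<longlonglongrightarrow> 0 *\<^sub>R y" by (rule tendsto_scaleR[OF ri tendsto_const])
      then have y0: "(\<lambda>n. inverse (r n) *\<^sub>R y) \<longlonglongrightarrow> 0" by simp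
      have lim: "(\<lambda>n. f (inverse (r n) *\<^sub>R y)) \<longlonglongrightarrow> f 0" if "smooth f" for f :: "R3 \<Rightarrow> real"
        by (rule isCont_tendsto_compose[OF _ y0])
           (use smooth_continuous[OF that, of UNIV] in \<open>simp add: continuous_on_eq_continuous_at\<close>)
      have c1: "(\<lambda>n. c n y) \<longlonglongrightarrow> 1"
        using lim[OF chi_smooth] chi_one[of 0] by (simp add: c_def)
      have c2: "(\<lambda>n. partial i (c n) y) \<longlonglongrightarrow> 0 * partial i chi 0" for i
        unfolding pc by (intro tendsto_mult ri lim smooth_partial chi_smooth)
      have "(\<lambda>n. \<Sum>i\<in>UNIV. u y $ i * (partial i K y * c n y + K y * partial i (c n) y))
        \<longlonglongrightarrow> (\<Sum>i\<in>UNIV. u y $ i * (partial i K y * 1 + K y * (0 * partial i chi 0)))"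
        by (intro tendsto_sum tendsto_mult tendsto_add tendsto_const c1 c2)
      then show "(\<lambda>n. \<Sum>i\<in>UNIV. u y $ i * partial i (\<lambda>y. K y * c n y) y) \<longlonglongrightarrow> (\<Sum>i\<in>UNIV. u y $ i * - partial i k (x - y))"
        by (simp add: pf pK)
    qed
    show "integrable lborel (\<lambda>y. \<Sum>i\<in>UNIV. \<bar>u y $ i * partial i k (x - y)\<bar> * M0 + \<bar>u y $ i * k (x - y)\<bar> * M i)"
      using integrable_abs[OF i1] integrable_abs[OF i2] by (intro Bochner_Integration.integrable_sum Bochner_Integration.integrable_add integrable_mult_left)
    show "AE y in lborel. norm (\<Sum>i\<in>UNIV. u y $ i * partial i (\<lambda>y. K y * c n y) y)
       \<le> (\<Sum>i\<in>UNIV. \<bar>u y $ i * partial i k (x - y)\<bar> * M0 + \<bar>u y $ i * k (x - y)\<bar> * M i)" for n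
    proof (rule AE_I2)
      fix y
      have "\<bar>u y $ i * partial i (\<lambda>y. K y * c n y) y\<bar> \<le> \<bar>u y $ i * partial i k (x - y)\<bar> * M0 + \<bar>u y $ i * k (x - y)\<bar> * M i" for i
      proof -
        have a1: "\<bar>c n y\<bar> \<le> M0" using M0(2) by (simp add: c_def)
        have "inverse (r n) * \<bar>partial i chi (y /\<^sub>R r n)\<bar> \<le> 1 * M i"
          using r(2)[of n] M(2)[of i] by (intro mult_mono) (auto simp: inverse_le_1_iff)
        then have a2: "\<bar>partial i (c n) y\<bar> \<le> M i" using r(1)[of n] by (simp add: pc abs_mult)
        have "u y $ i * partial i (\<lambda>y. K y * c n y) y = - (u y $ i * partial i k (x - y)) * c n y + (u y $ i * k (x - y)) * partial i (c n) y"
          unfolding pf pK unfolding K_def by (simp add: algebra_simps)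
        also have "\<bar>\<dots>\<bar> \<le> \<bar>- (u y $ i * partial i k (x - y)) * c n y\<bar> + \<bar>(u y $ i * k (x - y)) * partial i (c n) y\<bar>"
          by (rule abs_triangle_ineq)
        also have "\<dots> \<le> \<bar>u y $ i * partial i k (x - y)\<bar> * M0 + \<bar>u y $ i * k (x - y)\<bar> * M i"
          unfolding abs_mult[of "- (u y $ i * partial i k (x - y))"] abs_mult[of "u y $ i * k (x - y)"] abs_minus_cancel
          by (intro add_mono mult_left_mono a1 a2 abs_ge_zero)
        finally show ?thesis .
      qed
      then show "norm (\<Sum>i\<in>UNIV. u y $ i * partial i (\<lambda>y. K y * c n y) y)
       \<le> (\<Sum>i\<in>UNIV. \<bar>u y $ i * partial i k (x - y)\<bar> * M0 + \<bar>u y $ i * k (x - y)\<bar> * M i)"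
        unfolding real_norm_def by (intro order_trans[OF sum_abs sum_mono])
    qed
  qed measurable
  have "(\<integral>y. (\<Sum>i\<in>UNIV. u y $ i * (- partial i k (x - y))) \<partial>lborel) = 0"
    by (rule LIMSEQ_unique[OF lim0[unfolded z] tendsto_const])
  moreover have "(\<integral>y. (\<Sum>i\<in>UNIV. u y $ i * (- partial i k (x - y))) \<partial>lborel) = (\<Sum>i\<in>UNIV. \<integral>y. u y $ i * (- partial i k (x - y)) \<partial>lborel)"
    by (rule Bochner_Integration.integral_sum) (use i2 in simp)
  moreover have "(\<integral>y. u y $ i * (- partial i k (x - y)) \<partial>lborel) = - conv (partial i k) (\<lambda>y. u y $ i) x" for i
    by (simp add: conv_def mult.commute)
  ultimately show ?thesis by (simp add: sum_negf)
qed

text \<open>The integral of the derivative of v_j^2 v_i in direction i vanishes, so twice the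
  integral of v_i v_j times the i-th derivative of v_j is minus that of v_j^2 times the i-th
  derivative of v_i. Summing over i leaves the divergence of v, which is 0.\<close>

lemma convective_term_zero:
  assumes r: "r > 0" and u: "\<And>i. LP 2 (\<lambda>x. u x $ i) (A i)" and d: "div_free u"
  shows "(\<Sum>i\<in>UNIV. \<Sum>j\<in>UNIV. \<integral>x. conv (hk r) (\<lambda>y. u y $ i) x * conv (hk r) (\<lambda>y. u y $ j) x
     * partial i (conv (hk r) (\<lambda>y. u y $ j)) x \<partial>lborel) = 0"
proof -
  define v where "v i = conv (hk r) (\<lambda>y. u y $ i)" for i
  note sk = schwartz_hk[OF r]
  have ut: "tame (\<lambda>y. u y $ i)" for i by (rule tame_LP2[OF u])
  have pv: "partial i (v j) = conv (partial i (hk r)) (\<lambda>y. u y $ j)" for i j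
    unfolding v_def by (rule partial_conv[OF sk ut])
  have vs: "smooth (v i)" for i unfolding v_def by (rule smooth_conv[OF sk ut])
  have vd: "v i differentiable (at x)" for i x by (rule smooth_differentiable[OF vs])
  note [measurable] = smooth_measurable[OF vs] smooth_measurable[OF smooth_partial[OF vs]]
  have vL: "LP 2 (v i) (c0 * A i)" for i unfolding v_def by (rule LP_conv_hk[OF r u]) simp
  obtain B where B: "LP 2 (hk r) B" using schwartz_LP2[OF sk] by blast
  have vb: "\<bar>v i x\<bar> \<le> B * A i" for i x unfolding v_def by (rule conv_bound_LP2[OF B u])
  have "\<exists>C. LP 2 (partial i (hk r)) C" for i by (rule schwartz_LP2[OF schwartz_partial[OF sk]])
  then obtain C where C: "\<And>i. LP 2 (partial i (hk r)) (C i)" by metis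
  have pvb: "\<bar>partial i (v j) x\<bar> \<le> C i * A j" for i j x unfolding pv by (rule conv_bound_LP2[OF C u])
  have pvL: "\<exists>D. LP 2 (partial i (v j)) D" for i j
    unfolding pv using LP_conv_schwartz[OF schwartz_partial[OF sk] u zero_less_numeral] by blast
  have vvi: "integrable lborel (\<lambda>x. v i x * v j x)" for i j by (rule LP2_prod(2)[OF vL vL])
  have vvp: "integrable lborel (\<lambda>x. v i x * v j x * partial i' (v j') x)" for i j i' j'
    by (rule integrable_mult_bdd[OF vvi _ pvb]) measurable
  have vvv: "integrable lborel (\<lambda>x. v j x * v j x * v i x)" for i j
    by (rule integrable_mult_bdd[OF vvi _ vb]) measurable
  define F where "F i j x = v j x * v j x * v i x" for i j x
  have pF: "partial i (F i j) x = 2 * (v i x * v j x * partial i (v j) x) + v j x * v j x * partial i (v i) x" for i j x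
    unfolding F_def using partial_mult[where f="v j" and g="v j" and x=x and i=i, OF vd vd]
      partial_mult[where f="\<lambda>x. v j x * v j x" and g="v i" and x=x and i=i, OF differentiable_mult[OF vd vd] vd]
    by (simp add: algebra_simps)
  have Fs: "smooth (F i j)" for i j unfolding F_def by (intro smooth_mult vs)
  have z0: "(\<integral>x. partial i (F i j) x \<partial>lborel) = 0" for i j
  proof (rule integral_partial_eq_0)
    show "F i j differentiable (at x)" for x by (rule smooth_differentiable[OF Fs])
    show "continuous_on UNIV (partial i (F i j))" by (rule smooth_continuous[OF smooth_partial[OF Fs]])
    show "integrable lborel (F i j)" unfolding F_def by (rule vvv)
    show "integrable lborel (partial i (F i j))" unfolding pF using vvp by (intro Bochner_Integration.integrable_add integrable_mult_right)
  qed
  have e: "2 * (\<integral>x. v i x * v j x * partial i (v j) x \<partial>lborel) = - (\<integral>x. v j x * v j x * partial i (v i) x \<partial>lborel)" for i j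
    using z0[of i j, unfolded pF] vvp[of i j i j] vvp[of j j i i] by simp
  have divv: "(\<Sum>i\<in>UNIV. partial i (v i) x) = 0" for x
    unfolding pv using conv_div_free[OF sk u d] .
  have "2 * (\<Sum>i\<in>UNIV. \<Sum>j\<in>UNIV. \<integral>x. v i x * v j x * partial i (v j) x \<partial>lborel)
     = - (\<Sum>i\<in>UNIV. \<Sum>j\<in>UNIV. \<integral>x. v j x * v j x * partial i (v i) x \<partial>lborel)"
    by (simp add: sum_distrib_left e sum_negf)
  also have "(\<Sum>i\<in>UNIV. \<Sum>j\<in>UNIV. \<integral>x. v j x * v j x * partial i (v i) x \<partial>lborel)
     = (\<Sum>j\<in>UNIV. \<Sum>i\<in>UNIV. \<integral>x. v j x * v j x * partial i (v i) x \<partial>lborel)" by (rule sum.swap)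
  also have "\<dots> = (\<Sum>j\<in>UNIV. \<integral>x. (\<Sum>i\<in>UNIV. v j x * v j x * partial i (v i) x) \<partial>lborel)"
    using vvp by (intro sum.cong refl Bochner_Integration.integral_sum[symmetric])
  also have "\<dots> = 0" by (simp add: sum_distrib_left[symmetric] divv)
  finally show ?thesis by (simp add: v_def)
qed

text \<open>The third power is the one \<open>LP_integral\<close> asks for at p = 3 when the
  increments grow like 1 + r |y|.\<close>

definition mom :: "(R3 \<Rightarrow> real) \<Rightarrow> real" where "mom k = (\<integral>y. \<bar>k y\<bar> * (1 + norm y) ^ 3 \<partial>lborel)"

lemma mom_nonneg: "mom k \<ge> 0" by (simp add: mom_def)

text \<open>A weighted mean of increments is bounded through the rescaled third moment, which
  dominates the mass as well, so \<open>LP_integral\<close> applies with C = s * mom k. The factor s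
  is 1 for the filter kernel and r for its gradient.\<close>

lemma LP3_increment_kernel:
  assumes k: "schwartz k" and s: "s \<ge> 0" and r: "r > 0" and um: "u \<in> borel_measurable borel"
    and w: "\<And>y. LP 3 (\<lambda>x. u (x - y) - u x) (\<omega> * (1 + r * norm y))" and om: "\<omega> \<ge> 0"
  shows "LP 3 (\<lambda>x. \<integral>y. s * (r ^ 3 * k (r *\<^sub>R y)) * (u (x - y) - u x) \<partial>lborel) (s * mom k * \<omega>)"
    and "(\<integral>\<^sup>+y. ennreal (\<bar>r ^ 3 * k (r *\<^sub>R y)\<bar> * (1 + r * norm y) ^ 3) \<partial>lborel) = ennreal (mom k)"
proof -
  note [measurable] = schwartz_measurable[OF k] um
  let ?g = "\<lambda>y. \<bar>k y\<bar> * (1 + norm y) ^ 3"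
  have gi: "integrable lborel ?g" by (rule schwartz_moment[OF k])
  have e: "\<bar>r ^ 3 * k (r *\<^sub>R y)\<bar> * (1 + r * norm y) ^ 3 = r ^ 3 * ?g (r *\<^sub>R y)" for y
    using r by (simp add: abs_mult)
  show M: "(\<integral>\<^sup>+y. ennreal (\<bar>r ^ 3 * k (r *\<^sub>R y)\<bar> * (1 + r * norm y) ^ 3) \<partial>lborel) = ennreal (mom k)"
    unfolding e mom_def integral_scale(2)[OF gi r, symmetric]
    using r by (intro nn_integral_eq_integral integral_scale(1)[OF gi]) auto
  have Ms: "(\<integral>\<^sup>+y. ennreal (\<bar>s * (r ^ 3 * k (r *\<^sub>R y))\<bar> * (\<omega> * (1 + r * norm y)) ^ 3) \<partial>lborel) = ennreal (s * mom k * \<omega> ^ 3)" if "\<omega> \<ge> 0" for \<omega>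
  proof -
    have "\<bar>s * (r ^ 3 * k (r *\<^sub>R y))\<bar> * (\<omega> * (1 + r * norm y)) ^ 3 = (s * \<omega> ^ 3) * (\<bar>r ^ 3 * k (r *\<^sub>R y)\<bar> * (1 + r * norm y) ^ 3)" for y
      using s by (simp add: abs_mult power_mult_distrib)
    then have "(\<integral>\<^sup>+y. ennreal (\<bar>s * (r ^ 3 * k (r *\<^sub>R y))\<bar> * (\<omega> * (1 + r * norm y)) ^ 3) \<partial>lborel)
       = (\<integral>\<^sup>+y. ennreal (s * \<omega> ^ 3) * ennreal (\<bar>r ^ 3 * k (r *\<^sub>R y)\<bar> * (1 + r * norm y) ^ 3) \<partial>lborel)"
      using s r that by (simp only: ennreal_mult[symmetric] zero_le_power mult_nonneg_nonneg abs_ge_zero add_nonneg_nonneg zero_le_one norm_ge_zero less_imp_le)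
    also have "\<dots> = ennreal (s * \<omega> ^ 3) * ennreal (mom k)" by (subst nn_integral_cmult) (simp_all only: M, measurable)
    finally show ?thesis using s that mom_nonneg by (simp add: ennreal_mult[symmetric] mult_ac)
  qed
  show "LP 3 (\<lambda>x. \<integral>y. s * (r ^ 3 * k (r *\<^sub>R y)) * (u (x - y) - u x) \<partial>lborel) (s * mom k * \<omega>)"
  proof (rule LP_integral[where w="\<lambda>y. \<omega> * (1 + r * norm y)"])
    show "(\<integral>\<^sup>+y. ennreal \<bar>s * (r ^ 3 * k (r *\<^sub>R y))\<bar> \<partial>lborel) \<le> ennreal (s * mom k)"
    proof -
      have "(\<integral>\<^sup>+y. ennreal \<bar>s * (r ^ 3 * k (r *\<^sub>R y))\<bar> \<partial>lborel) \<le> (\<integral>\<^sup>+y. ennreal (\<bar>s * (r ^ 3 * k (r *\<^sub>R y))\<bar> * (1 * (1 + r * norm y)) ^ 3) \<partial>lborel)"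
      proof (rule nn_integral_mono, rule ennreal_leI)
        fix y :: R3
        have "1 \<le> (1 * (1 + r * norm y)) ^ 3" using r by (intro one_le_power) simp
        from mult_left_mono[OF this abs_ge_zero]
        show "\<bar>s * (r ^ 3 * k (r *\<^sub>R y))\<bar> \<le> \<bar>s * (r ^ 3 * k (r *\<^sub>R y))\<bar> * (1 * (1 + r * norm y)) ^ 3" by (simp only: mult_1_right)
      qed
      also have "\<dots> = ennreal (s * mom k)" using Ms[of 1] by simp
      finally show ?thesis .
    qed
    show "(\<integral>\<^sup>+y. ennreal (\<bar>s * (r ^ 3 * k (r *\<^sub>R y))\<bar> * (\<omega> * (1 + r * norm y)) ^ 3) \<partial>lborel) \<le> ennreal (s * mom k * \<omega> ^ 3)"
      using Ms[OF om] by simp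
    show "LP 3 (\<lambda>x. u (x - y) - u x) (\<omega> * (1 + r * norm y))" for y by (rule w)
    show "(\<lambda>(x, y). u (x - y) - u x) \<in> borel_measurable (borel \<Otimes>\<^sub>M borel)" by measurable
    show "(\<lambda>y. s * (r ^ 3 * k (r *\<^sub>R y))) \<in> borel_measurable borel" by measurable
  qed (use s mom_nonneg om in auto)
qed

text \<open>A real form of the energy flux for filters at any frequency r, with the double sum
  outside the integral; the flux of index Q is the case r = 2 ^ Suc Q.\<close>

definition flux :: "real \<Rightarrow> (R3 \<Rightarrow> R3) \<Rightarrow> real" where
  "flux r u = (\<Sum>i\<in>UNIV. \<Sum>j\<in>UNIV. \<integral>x. conv (hk r) (\<lambda>y. u y $ i * u y $ j) x
     * partial i (conv (hk r) (\<lambda>y. u y $ j)) x \<partial>lborel)"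

text \<open>The two summands come from the averaged product of increments and from the product of
  the two filter errors; the last factor comes from the gradient.\<close>

definition Cf :: real where
  "Cf = (\<Sum>i\<in>(UNIV::3 set). \<Sum>j\<in>(UNIV::3 set). (mom (hk 1) + mom (hk 1) * mom (hk 1)) * mom (partial i (hk 1)))"

lemma Cf_nonneg: "Cf \<ge> 0"
  unfolding Cf_def by (intro sum_nonneg mult_nonneg_nonneg add_nonneg_nonneg mom_nonneg)

text \<open>By the commutator identity of Constantin, E and Titi, S(u_i u_j) equals an average of
  products of increments, minus (u_i - v_i)(u_j - v_j), plus v_i v_j. The last term integrates to
  zero against the gradient; the others are Hoelder products of sizes \<omega>, \<omega> and r
  \<omega>.\<close>

lemma flux_bound:
  assumes r: "r > 0" and u: "\<And>i. LP 2 (\<lambda>x. u x $ i) (A i)" and d: "div_free u" and om: "\<omega> \<ge> 0"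
    and w: "\<And>i y. LP 3 (\<lambda>x. u (x - y) $ i - u x $ i) (\<omega> * (1 + r * norm y))"
  shows "\<bar>flux r u\<bar> \<le> Cf * r * \<omega> ^ 3"
proof -
  define U where "U i x = u x $ i" for i x
  define v where "v i = conv (hk r) (U i)" for i
  define m where "m = mom (hk 1)"
  define mi where "mi i = mom (partial i (hk 1))" for i
  have m0: "m \<ge> 0" "mi i \<ge> 0" for i by (simp_all add: m_def mi_def mom_nonneg)
  have uL: "LP 2 (U i) (A i)" for i using u by (simp add: U_def[abs_def])
  have wU: "LP 3 (\<lambda>x. U i (x - y) - U i x) (\<omega> * (1 + r * norm y))" for i y using w by (simp add: U_def)
  note sk = schwartz_hk[OF r]
  have sh1: "schwartz (hk 1)" by (rule schwartz_hk) simp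
  have ut: "tame (U i)" for i by (rule tame_LP2[OF uL])
  have Um[measurable]: "U i \<in> borel_measurable borel" for i by (rule LP_measurable[OF uL])
  have pv: "partial i (v j) = conv (partial i (hk r)) (U j)" for i j
    unfolding v_def by (rule partial_conv[OF sk ut])
  have vs: "smooth (v i)" for i unfolding v_def by (rule smooth_conv[OF sk ut])
  note [measurable] = smooth_measurable[OF vs] smooth_measurable[OF smooth_partial[OF vs]] schwartz_measurable[OF sk]
    schwartz_measurable[OF sh1]
  have vL: "LP 2 (v i) (c0 * A i)" for i unfolding v_def by (rule LP_conv_hk[OF r uL]) simp
  have "\<exists>C. LP 2 (partial i (hk r)) C" for i by (rule schwartz_LP2[OF schwartz_partial[OF sk]])
  then obtain C where C: "\<And>i. LP 2 (partial i (hk r)) (C i)" by metis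
  have pvb: "\<bar>partial i (v j) x\<bar> \<le> C i * A j" for i j x unfolding pv by (rule conv_bound_LP2[OF C uL])
  have uv: "LP 2 (\<lambda>x. U i x - v i x) (A i + c0 * A i)" for i by (intro LP_diff uL vL) simp
  have hi: "integrable lborel (hk r)" by (rule schwartz_integrable[OF sk])
  have uui: "integrable lborel (\<lambda>x. U i x * U j x)" for i j by (rule LP2_prod(2)[OF uL uL])
  have hs: "hk r y = 1 * (r ^ 3 * hk 1 (r *\<^sub>R y))" for y using hk_scale[OF r] by simp
  have D3: "LP 3 (\<lambda>x. v i x - U i x) (m * \<omega>)" for i
    using LP3_increment_kernel(1)[OF sh1 zero_le_one r Um wU om, of i]
    unfolding hs[symmetric] conv_hk_increment(1)[OF r ut, symmetric] m_def v_def by simp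
  have G3: "LP 3 (partial i (v j)) (r * mi i * \<omega>)" for i j
  proof -
    have ps: "schwartz (partial i (hk 1))" and psr: "schwartz (partial i (hk r))"
      by (intro schwartz_partial sh1 sk)+
    have e: "partial i (hk r) y = r * (r ^ 3 * partial i (hk 1) (r *\<^sub>R y))" for y
      using partial_hk[OF r, of i y] by simp
    \<comment> \<open>The gradient of the kernel has mean zero, so U j x may be subtracted and the
      gradient of v is a mean of increments.\<close>
    have i0: "(\<integral>y. partial i (hk r) y \<partial>lborel) = 0"
      by (intro integral_partial_eq_0 smooth_differentiable smooth_continuous smooth_partial schwartz_smooth sk schwartz_integrable schwartz_partial)
    have ii: "integrable lborel (\<lambda>y. partial i (hk r) y * U j (x - y))" for x
      using integrable_shift(2)[OF conv_integrable[OF psr ut[of j], of x], of x] by simp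
    have "partial i (v j) x = (\<integral>y. partial i (hk r) y * (U j (x - y) - U j x) \<partial>lborel)" for x
    proof -
      have "(\<integral>y. partial i (hk r) y * (U j (x - y) - U j x) \<partial>lborel) = (\<integral>y. partial i (hk r) y * U j (x - y) \<partial>lborel) - (\<integral>y. partial i (hk r) y * U j x \<partial>lborel)"
        unfolding right_diff_distrib by (rule Bochner_Integration.integral_diff[OF ii integrable_mult_left[OF schwartz_integrable[OF psr]]])
      also have "(\<integral>y. partial i (hk r) y * U j x \<partial>lborel) = 0" by (simp add: i0)
      finally show ?thesis unfolding pv using conv_commute[OF schwartz_measurable[OF psr] Um[of j], of x] by simp
    qed
    then have "partial i (v j) = (\<lambda>x. \<integral>y. partial i (hk r) y * (U j (x - y) - U j x) \<partial>lborel)" by auto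
    then show ?thesis using LP3_increment_kernel(1)[OF ps less_imp_le[OF r] r Um wU om, of j]
      unfolding e[symmetric] mi_def by simp
  qed
  define \<rho> where "\<rho> i j x = (\<integral>y. hk r y * ((U i (x - y) - U i x) * (U j (x - y) - U j x)) \<partial>lborel)" for i j x
  \<comment> \<open>Expanding the two increments inside \<rho> and using the unit mass of the kernel
    gives S(u_i u_j) - v_i u_j - v_j u_i + u_i u_j.\<close>
  have rho: "conv (hk r) (\<lambda>y. U i y * U j y) x = \<rho> i j x - (U i x - v i x) * (U j x - v j x) + v i x * v j x" for i j x
  proof -
    have 1: "integrable lborel (\<lambda>y. hk r y * (U i (x - y) * U j (x - y)))"
      using conv_hk_increment(2)[OF r tame_integrable[OF uui[of i j]], of x] .
    have 2: "integrable lborel (\<lambda>y. hk r y * U i (x - y))" for i by (rule conv_hk_increment(2)[OF r ut])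
    have c1: "conv (hk r) (\<lambda>y. U i y * U j y) x = (\<integral>y. hk r y * (U i (x - y) * U j (x - y)) \<partial>lborel)"
      by (rule conv_commute) measurable
    have c2: "v i x = (\<integral>y. hk r y * U i (x - y) \<partial>lborel)" for i unfolding v_def
      by (rule conv_commute) measurable
    have "\<rho> i j x = (\<integral>y. hk r y * (U i (x - y) * U j (x - y)) - hk r y * U i (x - y) * U j x - hk r y * U j (x - y) * U i x + hk r y * (U i x * U j x) \<partial>lborel)"
      unfolding \<rho>_def by (intro Bochner_Integration.integral_cong refl) (simp add: algebra_simps)
    also have "\<dots> = conv (hk r) (\<lambda>y. U i y * U j y) x - v i x * U j x - v j x * U i x + U i x * U j x"
      using 1 2[of i] 2[of j] hi by (simp add: c1 c2[of i] c2[of j] hk_integral[OF r])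
    finally show ?thesis by (simp add: algebra_simps)
  qed
  have rm[measurable]: "\<rho> i j \<in> borel_measurable borel" for i j unfolding \<rho>_def by measurable
  have i1: "integrable lborel (\<lambda>x. (U i x - v i x) * (U j x - v j x) * partial i (v j) x)" for i j
    by (rule integrable_mult_bdd[OF LP2_prod(2)[OF uv uv] _ pvb]) measurable
  have i2: "integrable lborel (\<lambda>x. v i x * v j x * partial i (v j) x)" for i j
    by (rule integrable_mult_bdd[OF LP2_prod(2)[OF vL vL] _ pvb]) measurable
  have b1: "\<bar>\<integral>x. (U i x - v i x) * (U j x - v j x) * partial i (v j) x \<partial>lborel\<bar> \<le> m * m * mi i * (r * \<omega> ^ 3)" for i j
  proof -
    have D: "LP 3 (\<lambda>x. U i x - v i x) (m * \<omega>)" for i using LP_uminus[OF D3[of i]] by simp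
    have "ennreal \<bar>\<integral>x. (U i x - v i x) * (U j x - v j x) * partial i (v j) x \<partial>lborel\<bar> \<le> ennreal (m * \<omega> * (m * \<omega>) * (r * mi i * \<omega>))"
      by (rule order_trans[OF ennreal_abs_integral_le LP3_prod[OF D D G3]])
    also have "m * \<omega> * (m * \<omega>) * (r * mi i * \<omega>) = m * m * mi i * (r * \<omega> ^ 3)" by (simp add: power3_eq_cube)
    finally show ?thesis using m0 r om by (subst (asm) ennreal_le_iff) auto
  qed
  \<comment> \<open>The integral over y is exchanged with the one over x before Hoelder is used for
    each fixed y. Working with \<open>nn_integral\<close> yields integrability of the term together
    with its bound.\<close>
  have nr: "(\<integral>\<^sup>+x. ennreal \<bar>\<rho> i j x * partial i (v j) x\<bar> \<partial>lborel) \<le> ennreal (m * mi i * (r * \<omega> ^ 3))" for i j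
  proof -
    let ?H = "\<lambda>x y. (U i (x - y) - U i x) * (U j (x - y) - U j x) * partial i (v j) x"
    have "(\<integral>\<^sup>+x. ennreal \<bar>\<rho> i j x * partial i (v j) x\<bar> \<partial>lborel) \<le> (\<integral>\<^sup>+x. (\<integral>\<^sup>+y. ennreal (\<bar>hk r y\<bar> * \<bar>?H x y\<bar>) \<partial>lborel) \<partial>lborel)"
    proof (rule nn_integral_mono)
      fix x
      have "\<rho> i j x * partial i (v j) x = (\<integral>y. hk r y * ?H x y \<partial>lborel)"
        unfolding \<rho>_def by (subst Bochner_Integration.integral_mult_left_zero[symmetric]) (simp only: mult.assoc)
      then have "ennreal \<bar>\<rho> i j x * partial i (v j) x\<bar> \<le> (\<integral>\<^sup>+y. ennreal \<bar>hk r y * ?H x y\<bar> \<partial>lborel)"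
        using ennreal_abs_integral_le by simp
      then show "ennreal \<bar>\<rho> i j x * partial i (v j) x\<bar> \<le> (\<integral>\<^sup>+y. ennreal (\<bar>hk r y\<bar> * \<bar>?H x y\<bar>) \<partial>lborel)"
        by (simp only: abs_mult[of "hk r _"])
    qed
    also have "\<dots> = (\<integral>\<^sup>+y. (\<integral>\<^sup>+x. ennreal (\<bar>hk r y\<bar> * \<bar>?H x y\<bar>) \<partial>lborel) \<partial>lborel)"
      by (rule lborel_pair.Fubini'[symmetric]) measurable
    also have "\<dots> \<le> (\<integral>\<^sup>+y. ennreal (r * mi i * \<omega> ^ 3) * ennreal (\<bar>r ^ 3 * hk 1 (r *\<^sub>R y)\<bar> * (1 + r * norm y) ^ 3) \<partial>lborel)"
    proof (rule nn_integral_mono)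
      fix y :: R3
      let ?w = "1 + r * norm y"
      have w1: "?w \<ge> 1" using r by simp
      have "(\<integral>\<^sup>+x. ennreal (\<bar>hk r y\<bar> * \<bar>?H x y\<bar>) \<partial>lborel) = ennreal \<bar>hk r y\<bar> * (\<integral>\<^sup>+x. ennreal \<bar>?H x y\<bar> \<partial>lborel)"
        by (simp only: ennreal_mult abs_ge_zero) (rule nn_integral_cmult, measurable)
      also have "\<dots> \<le> ennreal \<bar>hk r y\<bar> * ennreal (\<omega> * ?w * (\<omega> * ?w) * (r * mi i * \<omega>))"
        by (intro mult_left_mono LP3_prod[OF wU wU G3]) simp
      also have "\<dots> = ennreal (\<bar>hk r y\<bar> * (\<omega> * ?w * (\<omega> * ?w) * (r * mi i * \<omega>)))"
        using om w1 r m0 by (intro ennreal_mult[symmetric]) auto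
      also have "\<dots> \<le> ennreal ((r * mi i * \<omega> ^ 3) * (\<bar>hk r y\<bar> * ?w ^ 3))"
      proof (rule ennreal_leI)
        \<comment> \<open>Only two increments depend on y; one more factor of at least 1 matches the
          third moment in \<open>mom\<close>.\<close>
        have "?w * ?w \<le> ?w ^ 3" using w1 by (simp add: power3_eq_cube mult_right_mono[of 1 ?w "?w * ?w", simplified])
        then have "(r * mi i * \<omega> ^ 3) * (\<bar>hk r y\<bar> * (?w * ?w)) \<le> (r * mi i * \<omega> ^ 3) * (\<bar>hk r y\<bar> * ?w ^ 3)"
          using r m0 om by (intro mult_left_mono mult_nonneg_nonneg) auto
        then show "\<bar>hk r y\<bar> * (\<omega> * ?w * (\<omega> * ?w) * (r * mi i * \<omega>)) \<le> (r * mi i * \<omega> ^ 3) * (\<bar>hk r y\<bar> * ?w ^ 3)"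
          by (simp only: power3_eq_cube[of \<omega>] mult_ac)
      qed
      also have "\<dots> = ennreal (r * mi i * \<omega> ^ 3) * ennreal (\<bar>r ^ 3 * hk 1 (r *\<^sub>R y)\<bar> * ?w ^ 3)"
        using om w1 r m0 by (subst ennreal_mult[symmetric]) (auto simp: hs[of y])
      finally show "(\<integral>\<^sup>+x. ennreal (\<bar>hk r y\<bar> * \<bar>?H x y\<bar>) \<partial>lborel) \<le> ennreal (r * mi i * \<omega> ^ 3) * ennreal (\<bar>r ^ 3 * hk 1 (r *\<^sub>R y)\<bar> * ?w ^ 3)" .
    qed
    also have "\<dots> = ennreal (r * mi i * \<omega> ^ 3) * ennreal m"
      unfolding m_def LP3_increment_kernel(2)[OF sh1 zero_le_one r Um[of 1] wU om, symmetric]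
      by (rule nn_integral_cmult) measurable
    also have "\<dots> = ennreal (m * mi i * (r * \<omega> ^ 3))"
      using r m0 om by (simp add: ennreal_mult[symmetric] mult_ac)
    finally show ?thesis .
  qed
  have i3: "integrable lborel (\<lambda>x. \<rho> i j x * partial i (v j) x)" for i j
    by (rule integrableI_bounded) (use nr[of i j] in \<open>auto intro: le_less_trans\<close>)
  have b2: "\<bar>\<integral>x. \<rho> i j x * partial i (v j) x \<partial>lborel\<bar> \<le> m * mi i * (r * \<omega> ^ 3)" for i j
    using order_trans[OF ennreal_abs_integral_le nr[of i j]] m0 r om by (subst (asm) ennreal_le_iff) auto
  have split: "(\<integral>x. conv (hk r) (\<lambda>y. U i y * U j y) x * partial i (v j) x \<partial>lborel)
     = (\<integral>x. \<rho> i j x * partial i (v j) x \<partial>lborel) - (\<integral>x. (U i x - v i x) * (U j x - v j x) * partial i (v j) x \<partial>lborel)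
       + (\<integral>x. v i x * v j x * partial i (v j) x \<partial>lborel)" for i j
    unfolding rho distrib_right left_diff_distrib[of "\<rho> i j _"] using i1[of i j] i2[of i j] i3[of i j] by simp
  have "flux r u = (\<Sum>i\<in>UNIV. \<Sum>j\<in>UNIV. (\<integral>x. \<rho> i j x * partial i (v j) x \<partial>lborel) - (\<integral>x. (U i x - v i x) * (U j x - v j x) * partial i (v j) x \<partial>lborel))
     + (\<Sum>i\<in>UNIV. \<Sum>j\<in>UNIV. \<integral>x. v i x * v j x * partial i (v j) x \<partial>lborel)"
    unfolding flux_def sum.distrib[symmetric] using split by (simp add: U_def[abs_def] v_def)
  also have "(\<Sum>i\<in>UNIV. \<Sum>j\<in>UNIV. \<integral>x. v i x * v j x * partial i (v j) x \<partial>lborel) = 0"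
    using convective_term_zero[OF r u d] by (simp add: v_def U_def[abs_def])
  finally have fl: "flux r u = (\<Sum>i\<in>UNIV. \<Sum>j\<in>UNIV. (\<integral>x. \<rho> i j x * partial i (v j) x \<partial>lborel) - (\<integral>x. (U i x - v i x) * (U j x - v j x) * partial i (v j) x \<partial>lborel))" by simp
  have "\<bar>flux r u\<bar> \<le> (\<Sum>i\<in>(UNIV::3 set). \<Sum>j\<in>(UNIV::3 set). ((m + m * m) * mi i) * (r * \<omega> ^ 3))"
    unfolding fl
  proof (rule order_trans[OF sum_abs sum_mono], rule order_trans[OF sum_abs sum_mono])
    fix i j
    show "\<bar>(\<integral>x. \<rho> i j x * partial i (v j) x \<partial>lborel) - (\<integral>x. (U i x - v i x) * (U j x - v j x) * partial i (v j) x \<partial>lborel)\<bar> \<le> ((m + m * m) * mi i) * (r * \<omega> ^ 3)"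
      using order_trans[OF abs_triangle_ineq4 add_mono[OF b2 b1], of i j i j] by (simp add: distrib_right)
  qed
  also have "\<dots> = Cf * (r * \<omega> ^ 3)"
    unfolding Cf_def sum_distrib_right m_def mi_def by simp
  finally show ?thesis by (simp add: mult.assoc)
qed

end

section \<open>Increments of functions in the Besov class\<close>

definition theta :: real where "theta = 2 powr (1/3)"

lemma theta_cube: "theta ^ 3 = 2"
  by (simp add: theta_def powr_realpow[symmetric] powr_powr)

lemma theta_gt_1: "theta > 1" by (simp add: theta_def)

lemma theta_lt_2: "theta < 2"
proof -
  have "2 powr (1/3) < (2::real) powr 1" by (rule powr_less_mono) auto
  then show ?thesis by (simp add: theta_def)
qed

lemma theta_pow: "wave_number (int q) powr (1/3) = theta ^ q"
  by (simp add: wave_number_def theta_def powr_powr powr_realpow[symmetric] mult.commute)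

text \<open>For |y| \<le> 1 the mean value inequality applies, the weight varying by at most 2^6 =
  64 over the unit ball. For larger y twice the L^1 norm of k already suffices for a bound linear in
  |y|.\<close>

lemma schwartz_increment:
  fixes k :: "R3 \<Rightarrow> real"
  assumes k: "schwartz k"
  shows "\<exists>C\<ge>0. \<forall>y. (\<integral>x. \<bar>k (x - y) - k x\<bar> \<partial>lborel) \<le> C * norm y"
proof -
  have "\<exists>C>0. \<forall>x. norm (partial i k x) \<le> C * wt x" for i
    using schwartz_wt[OF schwartz_partial[OF k, of i]] by blast
  then obtain C where C: "\<And>i. C i > 0" "\<And>i x. norm (partial i k x) \<le> C i * wt x" by metis
  define D where "D = (\<Sum>i\<in>UNIV. C i)"
  have D: "D \<ge> 0" unfolding D_def using C(1) by (intro sum_nonneg) (auto intro: less_imp_le)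
  have ki: "integrable lborel k" by (rule schwartz_integrable[OF k])
  have di: "integrable lborel (\<lambda>x. \<bar>k (x - y) - k x\<bar>)" for y
    using integrable_shift(1)[OF ki, of y] ki by (intro integrable_abs Bochner_Integration.integrable_diff)
  define K where "K = 64 * D * (\<integral>x. wt x \<partial>lborel) + 2 * (\<integral>x. \<bar>k x\<bar> \<partial>lborel)"
  have W0: "0 \<le> (\<integral>x. wt x \<partial>lborel)" by (simp add: wt_nonneg)
  have K: "(\<integral>x. \<bar>k (x - y) - k x\<bar> \<partial>lborel) \<le> K * norm y" for y
  proof (cases "norm y \<le> 1")
    case True
    have "\<bar>k (x - y) - k x\<bar> \<le> 64 * D * norm y * wt x" for x
    proof -
      have "norm (k (x - y) - k x) \<le> 64 * D * wt x * norm (x - y - x)"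
      proof (rule differentiable_bound[of "cball x 1" k "\<lambda>z v. \<Sum>i\<in>UNIV. v $ i *\<^sub>R partial i k z"])
        fix z assume z: "z \<in> cball x 1"
        show "(k has_derivative (\<lambda>v. \<Sum>i\<in>UNIV. v $ i *\<^sub>R partial i k z)) (at z within cball x 1)"
          by (rule has_derivative_at_withinI[OF has_derivative_partial[OF smooth_differentiable[OF schwartz_smooth[OF k]]]])
        have "wt z = wt ((z - x) - (- x))" by simp
        also have "\<dots> \<le> (1 + norm (z - x)) ^ 6 * wt (- x)" by (rule wt_shift)
        also have "\<dots> \<le> 2 ^ 6 * wt (- x)"
          using z by (intro mult_right_mono power_mono wt_nonneg) (auto simp: dist_norm norm_minus_commute)
        finally have wz: "wt z \<le> 64 * wt x" by (simp add: wt_def)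
        show "onorm (\<lambda>v. \<Sum>i\<in>UNIV. v $ i *\<^sub>R partial i k z) \<le> 64 * D * wt x"
        proof (rule onorm_bound)
          fix v :: R3
          have "norm (\<Sum>i\<in>UNIV. v $ i *\<^sub>R partial i k z) \<le> (\<Sum>i\<in>UNIV. norm v * (C i * (64 * wt x)))"
          proof (rule order_trans[OF norm_sum sum_mono])
            fix i
            have "norm (partial i k z) \<le> C i * (64 * wt x)"
              using order_trans[OF C(2)[of i z] mult_left_mono[OF wz less_imp_le[OF C(1)]]] .
            then show "norm (v $ i *\<^sub>R partial i k z) \<le> norm v * (C i * (64 * wt x))"
              unfolding norm_scaleR using component_le_norm_cart[of v i] by (intro mult_mono) auto
          qed
          also have "\<dots> = 64 * D * wt x * norm v"
            by (simp add: D_def sum_distrib_left sum_distrib_right mult_ac)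
          finally show "norm (\<Sum>i\<in>UNIV. v $ i *\<^sub>R partial i k z) \<le> 64 * D * wt x * norm v" .
        qed (use D wt_nonneg in auto)
      qed (use True in \<open>auto simp: dist_norm\<close>)
      then show ?thesis by (simp add: mult_ac)
    qed
    then have "(\<integral>x. \<bar>k (x - y) - k x\<bar> \<partial>lborel) \<le> (\<integral>x. 64 * D * norm y * wt x \<partial>lborel)"
      using wt_integrable by (intro integral_mono di integrable_mult_right)
    also have "\<dots> = 64 * D * (\<integral>x. wt x \<partial>lborel) * norm y" by simp
    also have "\<dots> \<le> K * norm y" unfolding K_def by (intro mult_right_mono) auto
    finally show ?thesis .
  next
    case False
    have "(\<integral>x. \<bar>k (x - y) - k x\<bar> \<partial>lborel) \<le> (\<integral>x. \<bar>k (x - y)\<bar> + \<bar>k x\<bar> \<partial>lborel)"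
      using integrable_abs[OF integrable_shift(1)[OF ki, of y]] integrable_abs[OF ki]
      by (intro integral_mono di Bochner_Integration.integrable_add) auto
    also have "\<dots> = 2 * (\<integral>x. \<bar>k x\<bar> \<partial>lborel)"
      using integrable_abs[OF integrable_shift(1)[OF ki, of y]] integrable_abs[OF ki]
        integral_shift(1)[of "\<lambda>x. \<bar>k x\<bar>" y] schwartz_measurable[OF k] by simp
    also have "\<dots> \<le> K * 1" unfolding K_def using D W0 by simp
    also have "\<dots> \<le> K * norm y" using False D W0 by (intro mult_left_mono) (auto simp: K_def)
    finally show ?thesis .
  qed
  have "K \<ge> 0" using D W0 by (simp add: K_def)
  with K show ?thesis by blast
qed

text \<open>The low- and high-frequency contributions to the increments at frequency \<open>2\<^sup>Q\<close>, for block sizes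
  \<open>e n / theta ^ n\<close>: low blocks gain a derivative, high blocks are summed directly.\<close>

definition S1 :: "nat \<Rightarrow> (nat \<Rightarrow> real) \<Rightarrow> real" where "S1 Q e = (\<Sum>k. (theta / 2) ^ k * (if k \<le> Q then e (Q - k) else 0))"
definition S2 :: "nat \<Rightarrow> (nat \<Rightarrow> real) \<Rightarrow> real" where "S2 Q e = (\<Sum>k. (1 / theta) ^ k * e (Q + 1 + k))"

text \<open>The sums of the two geometric series: ratio theta/2 = 2^(-2/3) for low frequencies,
  where a derivative is gained, and 1/theta = 2^(-1/3) for high ones.\<close>

definition KD :: real where "KD = 1 / (1 - theta / 2) + 1 / (1 - 1 / theta)"

lemma ratios: "0 \<le> theta / 2" "theta / 2 < 1" "0 \<le> 1 / theta" "1 / theta < 1"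
  using theta_gt_1 theta_lt_2 by auto

lemma geo_summable: "summable (\<lambda>k. (theta / 2) ^ k)" "summable (\<lambda>k. (1 / theta) ^ k)"
  using ratios by (auto intro!: summable_geometric)

lemma S_bounds:
  assumes e: "\<And>n. 0 \<le> e n" "\<And>n. e n \<le> B"
  shows "summable (\<lambda>k. (theta / 2) ^ k * (if k \<le> Q then e (Q - k) else 0))"
    "summable (\<lambda>k. (1 / theta) ^ k * e (Q + 1 + k))"
    "0 \<le> S1 Q e" "0 \<le> S2 Q e" "S1 Q e + S2 Q e \<le> KD * B"
proof -
  have B: "B \<ge> 0" using order_trans[OF e(1) e(2)] .
  have s1: "summable (\<lambda>k. (theta / 2) ^ k * B)" by (rule summable_mult2[OF geo_summable(1)])
  have s2: "summable (\<lambda>k. (1 / theta) ^ k * B)" by (rule summable_mult2[OF geo_summable(2)])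
  have b1: "(theta / 2) ^ k * (if k \<le> Q then e (Q - k) else 0) \<le> (theta / 2) ^ k * B" for k
    using ratios e B by (intro mult_left_mono) auto
  have b2: "(1 / theta) ^ k * e (Q + 1 + k) \<le> (1 / theta) ^ k * B" for k
    using ratios e B by (intro mult_left_mono) auto
  have n1: "0 \<le> (theta / 2) ^ k * (if k \<le> Q then e (Q - k) else 0)" for k
    using ratios e by (intro mult_nonneg_nonneg) auto
  have n2: "0 \<le> (1 / theta) ^ k * e (Q + 1 + k)" for k
    using ratios e by (intro mult_nonneg_nonneg) auto
  show t1: "summable (\<lambda>k. (theta / 2) ^ k * (if k \<le> Q then e (Q - k) else 0))"
    by (rule summable_comparison_test'[OF s1, of 0]) (use n1 b1 in \<open>simp only: real_norm_def abs_of_nonneg\<close>)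
  show t2: "summable (\<lambda>k. (1 / theta) ^ k * e (Q + 1 + k))"
    by (rule summable_comparison_test'[OF s2, of 0]) (use n2 b2 in \<open>simp only: real_norm_def abs_of_nonneg\<close>)
  show "0 \<le> S1 Q e" unfolding S1_def by (rule suminf_nonneg[OF t1 n1])
  show "0 \<le> S2 Q e" unfolding S2_def by (rule suminf_nonneg[OF t2 n2])
  have "S1 Q e \<le> (\<Sum>k. (theta / 2) ^ k * B)" unfolding S1_def by (rule suminf_le[OF b1 t1 s1])
  also have "\<dots> = 1 / (1 - theta / 2) * B"
    using suminf_mult2[OF geo_summable(1), of B] suminf_geometric[of "theta / 2"] ratios by simp
  finally have "S1 Q e \<le> 1 / (1 - theta / 2) * B" .
  moreover have "S2 Q e \<le> (\<Sum>k. (1 / theta) ^ k * B)" unfolding S2_def by (rule suminf_le[OF b2 t2 s2])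
  then have "S2 Q e \<le> 1 / (1 - 1 / theta) * B"
    using suminf_mult2[OF geo_summable(2), of B] suminf_geometric[of "1 / theta"] ratios by simp
  ultimately show "S1 Q e + S2 Q e \<le> KD * B" unfolding KD_def distrib_right by (rule add_mono)
qed

lemma KD_nonneg: "KD \<ge> 0"
  unfolding KD_def using ratios by (intro add_nonneg_nonneg divide_nonneg_nonneg) auto

text \<open>Both series are indexed by the distance k from Q, so each term tends to 0 for fixed k,
  and the geometric factors dominate. Tannery's theorem is dominated convergence for series.\<close>

lemma S_tendsto:
  assumes e: "\<And>n. 0 \<le> e n" "\<And>n. e n \<le> B" and lim: "e \<longlonglongrightarrow> 0"
  shows "(\<lambda>Q. S1 Q e + S2 Q e) \<longlonglongrightarrow> 0"
proof -
  have B: "B \<ge> 0" using order_trans[OF e(1) e(2)] .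
  have s1: "summable (\<lambda>k. (theta / 2) ^ k * B)" by (rule summable_mult2[OF geo_summable(1)])
  have s2: "summable (\<lambda>k. (1 / theta) ^ k * B)" by (rule summable_mult2[OF geo_summable(2)])
  have "(\<lambda>Q. suminf (\<lambda>k. (theta / 2) ^ k * (if k \<le> Q then e (Q - k) else 0))) \<longlonglongrightarrow> suminf (\<lambda>k. 0 :: real)"
  proof (rule tannerys_theorem[THEN conjunct2, THEN conjunct2])
    fix k
    have "(\<lambda>Q. (if k \<le> Q then e (Q - k) else 0)) \<longlonglongrightarrow> 0"
    proof (rule LIMSEQ_offset[of _ k])
      show "(\<lambda>n. if k \<le> n + k then e (n + k - k) else 0) \<longlonglongrightarrow> 0" using lim by simp
    qed
    from tendsto_mult_left[OF this, of "(theta / 2) ^ k"]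
    show "(\<lambda>Q. (theta / 2) ^ k * (if k \<le> Q then e (Q - k) else 0)) \<longlonglongrightarrow> 0" by simp
  next
    show "\<forall>\<^sub>F (k, n) in sequentially \<times>\<^sub>F sequentially. norm ((theta / 2) ^ k * (if k \<le> n then e (n - k) else 0)) \<le> (theta / 2) ^ k * B"
      using ratios e B by (intro always_eventually) (auto simp: abs_mult intro!: mult_left_mono)
  qed (use s1 in auto)
  then have 1: "(\<lambda>Q. S1 Q e) \<longlonglongrightarrow> 0" by (simp add: S1_def)
  have "(\<lambda>Q. suminf (\<lambda>k. (1 / theta) ^ k * e (Q + 1 + k))) \<longlonglongrightarrow> suminf (\<lambda>k. 0 :: real)"
  proof (rule tannerys_theorem[THEN conjunct2, THEN conjunct2])
    fix k
    have "(\<lambda>Q. e (Q + (1 + k))) \<longlonglongrightarrow> 0" by (rule LIMSEQ_ignore_initial_segment[OF lim])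
    from tendsto_mult_left[OF this, of "(1 / theta) ^ k"]
    show "(\<lambda>Q. (1 / theta) ^ k * e (Q + 1 + k)) \<longlonglongrightarrow> 0" by (simp add: add.assoc)
  next
    show "\<forall>\<^sub>F (k, n) in sequentially \<times>\<^sub>F sequentially. norm ((1 / theta) ^ k * e (n + 1 + k)) \<le> (1 / theta) ^ k * B"
      using ratios e B by (intro always_eventually) (auto simp: abs_mult intro!: mult_left_mono)
  qed (use s2 in auto)
  then have 2: "(\<lambda>Q. S2 Q e) \<longlonglongrightarrow> 0" by (simp add: S2_def)
  from tendsto_add[OF 1 2] show ?thesis by simp
qed

context lp_cut
begin

definition C1 :: real where
  "C1 = (SOME C. C \<ge> 0 \<and> (\<forall>y. (\<integral>x. \<bar>hk 1 (x - y) - hk 1 x\<bar> \<partial>lborel) \<le> C * norm y))"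

lemma C1: "C1 \<ge> 0" "(\<integral>x. \<bar>hk 1 (x - y) - hk 1 x\<bar> \<partial>lborel) \<le> C1 * norm y"
proof -
  have "\<exists>C. C \<ge> 0 \<and> (\<forall>y. (\<integral>x. \<bar>hk 1 (x - y) - hk 1 x\<bar> \<partial>lborel) \<le> C * norm y)"
    using schwartz_increment[OF schwartz_hk[of 1]] by auto
  from someI_ex[OF this] show "C1 \<ge> 0" "(\<integral>x. \<bar>hk 1 (x - y) - hk 1 x\<bar> \<partial>lborel) \<le> C1 * norm y"
    unfolding C1_def by blast+
qed

text \<open>The increment is placed on the kernel, whose increment has L^1 norm at most C1 * norm (R
  y) by rescaling; Young's inequality does the rest.\<close>

lemma conv_increment_LP3:
  assumes R: "R > 0" and g: "LP 3 g A" and t: "tame g"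
  shows "LP 3 (\<lambda>x. conv (hk R) g (x - y) - conv (hk R) g x) (C1 * R * norm y * A)"
proof -
  define \<kappa> where "\<kappa> z = hk R (z - y) - hk R z" for z
  have sR: "schwartz (hk R)" and s1: "schwartz (hk 1)" using schwartz_hk R by auto
  note [measurable] = schwartz_measurable[OF sR] schwartz_measurable[OF s1]
  have eqk: "conv \<kappa> g x = conv (hk R) g (x - y) - conv (hk R) g x" for x
  proof -
    have "conv \<kappa> g x = (\<integral>z. hk R (x - y - z) * g z - hk R (x - z) * g z \<partial>lborel)"
      unfolding conv_def \<kappa>_def by (intro Bochner_Integration.integral_cong refl) (simp add: algebra_simps)
    also have "\<dots> = conv (hk R) g (x - y) - conv (hk R) g x"
      unfolding conv_def by (rule Bochner_Integration.integral_diff[OF conv_integrable[OF sR t] conv_integrable[OF sR t]])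
    finally show ?thesis .
  qed
  have "LP 3 (conv \<kappa> g) (C1 * R * norm y * A)"
  proof (rule LP_conv[OF _ _ _ g])
    show "\<kappa> \<in> borel_measurable borel" unfolding \<kappa>_def by measurable
    let ?h = "\<lambda>z. \<bar>hk 1 (z - R *\<^sub>R y) - hk 1 z\<bar>"
    have hi: "integrable lborel ?h"
      using integrable_shift(1)[OF schwartz_integrable[OF s1]] schwartz_integrable[OF s1]
      by (intro integrable_abs Bochner_Integration.integrable_diff)
    have e: "\<bar>\<kappa> z\<bar> = R ^ 3 * ?h (R *\<^sub>R z)" for z
      using R by (simp add: \<kappa>_def hk_scale[OF R] abs_mult scaleR_diff_right right_diff_distrib[symmetric])
    have "(\<integral>\<^sup>+z. ennreal \<bar>\<kappa> z\<bar> \<partial>lborel) = ennreal (\<integral>z. \<bar>\<kappa> z\<bar> \<partial>lborel)"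
      unfolding e using integral_scale(1)[OF hi R] R by (intro nn_integral_eq_integral) auto
    also have "(\<integral>z. \<bar>\<kappa> z\<bar> \<partial>lborel) \<le> C1 * norm (R *\<^sub>R y)"
      unfolding e integral_scale(2)[OF hi R] by (rule C1(2))
    finally show "(\<integral>\<^sup>+z. ennreal \<bar>\<kappa> z\<bar> \<partial>lborel) \<le> ennreal (C1 * R * norm y)"
      using R by (simp add: mult.assoc ennreal_leI)
    show "0 \<le> C1 * R * norm y" using C1(1) R by simp
  qed simp
  moreover have "conv \<kappa> g = (\<lambda>x. conv (hk R) g (x - y) - conv (hk R) g x)" by (rule ext) (rule eqk)
  ultimately show ?thesis by simp
qed

text \<open>The symbol of block n is supported in |\<xi>| \<le> 2^n, where the cut-off at 2 ^ Suc n
  equals 1.\<close>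

lemma conv_hk_blk: "conv (hk (2 ^ Suc n)) (blk n) = blk n"
proof (cases "n = 0")
  case True then show ?thesis using hk_conv[of 1 2] by (simp add: blk_def)
next
  case False
  have p: "(2::real) * 2 ^ (n - 1) \<le> 2 ^ Suc n" using power_increasing[of n "Suc n" "2::real"] False
    by (simp add: power_Suc[symmetric] del: power_Suc)
  have "conv (hk (2 ^ Suc n)) (\<lambda>x. hk (2 ^ n) x - hk (2 ^ (n - 1)) x) x = hk (2 ^ n) x - hk (2 ^ (n - 1)) x" for x
    using conv_diff_right[OF schwartz_hk schwartz_tame[OF schwartz_hk] schwartz_tame[OF schwartz_hk], of "2 ^ Suc n" "2 ^ n" "2 ^ (n - 1)" x]
      hk_conv[of "2 ^ n" "2 ^ Suc n"] hk_conv[of "2 ^ (n - 1)" "2 ^ Suc n"] p by simp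
  then show ?thesis using False by (auto simp: blk_def)
qed

text \<open>A Bernstein-type estimate: the block is reproduced by a filter of comparable frequency,
  and the increment acts on the kernel of that filter.\<close>

lemma blk_increment_LP3:
  assumes v: "LP 2 v A" and g: "LP 3 (conv (blk n) v) B"
  shows "LP 3 (\<lambda>x. conv (blk n) v (x - y) - conv (blk n) v x) (C1 * 2 ^ Suc n * norm y * B)"
proof -
  have t: "tame v" by (rule tame_LP2[OF v])
  have "conv (hk (2 ^ Suc n)) (conv (blk n) v) x = conv (blk n) v x" for x
    using conv_assoc[OF schwartz_hk schwartz_blk t, of "2 ^ Suc n" n x] unfolding conv_hk_blk by simp
  then have "conv (hk (2 ^ Suc n)) (conv (blk n) v) = conv (blk n) v" by (rule ext)
  then show ?thesis
    using conv_increment_LP3[OF _ g tame_LP2[OF LP_conv_schwartz[OF schwartz_blk v]], of "2 ^ Suc n" y] by simp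
qed

text \<open>The blocks from Q + 1 to Q + N telescope to a difference of filters that converges in
  L^2. Their L^3 bounds sum geometrically and survive the limit, although v is assumed to be in L^2
  only.\<close>

lemma tail_LP3:
  assumes v: "LP 2 v A" and e: "\<And>n. 0 \<le> e n" "\<And>n. e n \<le> B"
    and g: "\<And>n. LP 3 (conv (blk n) v) (e n / theta ^ n)"
  shows "LP 3 (\<lambda>x. v x - conv (hk (2 ^ Q)) v x) (S2 Q e / theta ^ Q)"
proof (rule LP_of_L2_limit)
  have t: "tame v" by (rule tame_LP2[OF v])
  let ?f = "\<lambda>N x. \<Sum>k<N. conv (blk (Q + 1 + k)) v x"
  have f: "?f N x = conv (hk (2 ^ (Q + N))) v x - conv (hk (2 ^ Q)) v x" for N x
  proof (induction N)
    case (Suc N)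
    have "conv (blk (Q + 1 + N)) v x = conv (hk (2 ^ (Q + Suc N))) v x - conv (hk (2 ^ (Q + N))) v x"
      unfolding blk_def using conv_diff_left[OF schwartz_hk schwartz_hk t, of "2 ^ (Q + 1 + N)" "2 ^ (Q + N)" x] by simp
    then show ?case using Suc by simp
  qed simp
  have th: "theta > 0" using theta_gt_1 by simp
  show "LP 3 (?f N) (S2 Q e / theta ^ Q)" for N
  proof (rule LP_mono)
    show "LP 3 (?f N) (\<Sum>k<N. e (Q + 1 + k) / theta ^ (Q + 1 + k))" by (intro LP_sum g) auto
    have "(\<Sum>k<N. e (Q + 1 + k) / theta ^ (Q + 1 + k)) \<le> (\<Sum>k<N. ((1 / theta) ^ k * e (Q + 1 + k)) / theta ^ Q)"
    proof (rule sum_mono)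
      fix k
      have "1 / theta ^ (Q + 1 + k) \<le> (1 / theta) ^ k / theta ^ Q"
        using theta_gt_1 by (simp add: power_add power_divide field_simps)
      from mult_left_mono[OF this e(1)[of "Q + 1 + k"]]
      show "e (Q + 1 + k) / theta ^ (Q + 1 + k) \<le> ((1 / theta) ^ k * e (Q + 1 + k)) / theta ^ Q" by (simp add: mult.commute)
    qed
    also have "\<dots> = (\<Sum>k<N. (1 / theta) ^ k * e (Q + 1 + k)) / theta ^ Q" by (rule sum_divide_distrib[symmetric])
    also have "\<dots> \<le> S2 Q e / theta ^ Q"
      unfolding S2_def using th S_bounds(2)[OF e] ratios e by (intro divide_right_mono sum_le_suminf) auto
    finally show "(\<Sum>k<N. e (Q + 1 + k) / theta ^ (Q + 1 + k)) \<le> S2 Q e / theta ^ Q" .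
  qed
  have eq: "(\<lambda>x. ?f N x - (v x - conv (hk (2 ^ Q)) v x)) = (\<lambda>x. conv (hk (2 ^ (Q + N))) v x - v x)" for N
    unfolding f by auto
  have top: "filterlim (\<lambda>N. 2 ^ (Q + N) :: real) at_top sequentially"
  proof (rule filterlim_at_top_mono[OF filterlim_real_sequentially always_eventually], rule allI)
    fix N
    have "real N \<le> 2 ^ N" using of_nat_less_two_power[of N] by (rule less_imp_le)
    also have "\<dots> \<le> 2 ^ (Q + N)" by (rule power_increasing) auto
    finally show "real N \<le> 2 ^ (Q + N)" .
  qed
  show "LP 2 (\<lambda>x. ?f N x - (v x - conv (hk (2 ^ Q)) v x)) (c0 * A + A)" for N
    unfolding eq by (rule conv_hk_tendsto_L2(2)[OF v _ top]) simp
  show "(\<lambda>N. NP 2 (\<lambda>x. ?f N x - (v x - conv (hk (2 ^ Q)) v x))) \<longlonglongrightarrow> 0"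
    unfolding eq by (rule conv_hk_tendsto_L2(1)[OF v _ top]) simp
  show "(\<lambda>x. v x - conv (hk (2 ^ Q)) v x) \<in> borel_measurable borel"
    using LP_measurable[OF v] conv_measurable[OF schwartz_hk t, of "2 ^ Q"] by simp
qed

text \<open>The part 2 * C1 comes from the low blocks, reproduced at twice their frequency; the 2
  counts the translated and the untranslated copy of the tail.\<close>

definition C2 :: real where "C2 = 2 * C1 + 2"

lemma C2_nonneg: "C2 \<ge> 0" using C1(1) by (simp add: C2_def)

text \<open>Blocks up to Q pay the derivative cost 2^n |y|; the tail is estimated without
  cancellation. Factoring out the value at n = Q leaves (theta/2)^(Q - n) for the low part, that is,
  the series \<open>S1\<close>.\<close>

lemma increment_LP3:
  assumes v: "LP 2 v A" and e: "\<And>n. 0 \<le> e n" "\<And>n. e n \<le> B"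
    and g: "\<And>n. LP 3 (conv (blk n) v) (e n / theta ^ n)"
  shows "LP 3 (\<lambda>x. v (x - y) - v x) (C2 * (S1 Q e + S2 Q e) / theta ^ Q * (1 + 2 ^ Q * norm y))"
proof -
  have t: "tame v" by (rule tame_LP2[OF v])
  have th: "theta > 0" using theta_gt_1 by simp
  have a: "LP 3 (\<lambda>x. \<Sum>n\<le>Q. conv (blk n) v (x - y) - conv (blk n) v x) (\<Sum>n\<le>Q. C1 * 2 ^ Suc n * norm y * (e n / theta ^ n))"
    by (intro LP_sum blk_increment_LP3[OF v g]) auto
  have "(\<Sum>n\<le>Q. C1 * 2 ^ Suc n * norm y * (e n / theta ^ n)) = 2 * C1 * norm y * (\<Sum>n\<le>Q. (2 / theta) ^ n * e n)"
    by (simp add: sum_distrib_left power_divide mult_ac)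
  \<comment> \<open>Reversing the sum passes from the block index n to the distance k = Q - n used
    in \<open>S1\<close>.\<close>
  also have "(\<Sum>n\<le>Q. (2 / theta) ^ n * e n) = (\<Sum>k\<le>Q. (2 / theta) ^ (Q - k) * e (Q - k))"
    by (rule sum.nat_diff_reindex[symmetric, of "\<lambda>n. (2 / theta) ^ n * e n" "Suc Q", unfolded lessThan_Suc_atMost diff_Suc_Suc, simplified])
  also have "\<dots> = (2 / theta) ^ Q * (\<Sum>k\<le>Q. (theta / 2) ^ k * e (Q - k))"
    unfolding sum_distrib_left
  proof (rule sum.cong[OF refl])
    fix k assume "k \<in> {..Q}"
    then have "(2 / theta) ^ Q = (2 / theta) ^ (Q - k) * (2 / theta) ^ k" by (simp add: power_add[symmetric])
    moreover have "(2 / theta) ^ k * (theta / 2) ^ k = 1" using th by (simp add: power_mult_distrib[symmetric])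
    ultimately show "(2 / theta) ^ (Q - k) * e (Q - k) = (2 / theta) ^ Q * ((theta / 2) ^ k * e (Q - k))"
      by (metis (no_types, lifting) mult.assoc mult.right_neutral)
  qed
  also have "(\<Sum>k\<le>Q. (theta / 2) ^ k * e (Q - k)) = S1 Q e"
    unfolding S1_def by (subst suminf_finite[of "{..Q}"]) auto
  finally have a': "(\<Sum>n\<le>Q. C1 * 2 ^ Suc n * norm y * (e n / theta ^ n)) = 2 * C1 * norm y * ((2 / theta) ^ Q * S1 Q e)" .
  note b = tail_LP3[OF v e g, of Q]
  let ?T = "\<lambda>x. v x - conv (hk (2 ^ Q)) v x"
  have c: "LP 3 (\<lambda>x. ?T (x - y) - ?T x) (S2 Q e / theta ^ Q + S2 Q e / theta ^ Q)"
    by (intro LP_diff LP_shift(1)[OF b] b) simp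
  have eq: "(\<Sum>n\<le>Q. conv (blk n) v (x - y) - conv (blk n) v x) + (?T (x - y) - ?T x) = v (x - y) - v x" for x
    unfolding sum_subtractf conv_blk_sum[OF t] by simp
  have "LP 3 (\<lambda>x. v (x - y) - v x) (2 * C1 * norm y * ((2 / theta) ^ Q * S1 Q e) + (S2 Q e / theta ^ Q + S2 Q e / theta ^ Q))"
    using LP_add[OF a c] unfolding eq a' by simp
  then show ?thesis
  proof (rule LP_mono)
    have p: "2 * C1 * norm y * ((2 / theta) ^ Q * S1 Q e) + (S2 Q e / theta ^ Q + S2 Q e / theta ^ Q)
       = (2 * C1 * S1 Q e * (2 ^ Q * norm y) + 2 * S2 Q e) / theta ^ Q"
      by (simp add: power_divide add_divide_distrib mult_ac)
    note S = S_bounds(3,4)[OF e, of Q]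
    have "2 * C1 * S1 Q e * (2 ^ Q * norm y) + 2 * S2 Q e \<le> C2 * (S1 Q e + S2 Q e) * (1 + 2 ^ Q * norm y)"
    proof -
      have z: "0 \<le> 2 ^ Q * norm y" by simp
      have "2 * C1 * S1 Q e \<le> C2 * (S1 Q e + S2 Q e)" using S C1(1) by (intro mult_mono) (auto simp: C2_def)
      note m1 = mult_right_mono[OF this z]
      have m2: "2 * S2 Q e \<le> C2 * (S1 Q e + S2 Q e)" using S C1(1) by (intro mult_mono) (auto simp: C2_def)
      have "C2 * (S1 Q e + S2 Q e) * (2 ^ Q * norm y) + C2 * (S1 Q e + S2 Q e) = C2 * (S1 Q e + S2 Q e) * (1 + 2 ^ Q * norm y)"
        by (simp add: distrib_left)
      with add_mono[OF m1 m2] show ?thesis by (simp only:)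
    qed
    from divide_right_mono[OF this, of "theta ^ Q"] th
    show "2 * C1 * norm y * ((2 / theta) ^ Q * S1 Q e) + (S2 Q e / theta ^ Q + S2 Q e / theta ^ Q)
      \<le> C2 * (S1 Q e + S2 Q e) / theta ^ Q * (1 + 2 ^ Q * norm y)"
      unfolding p by simp
  qed
qed

text \<open>Here the exponent 1/3 is critical: 2^Q divided by the cube of theta^Q is exactly 1, so
  no power of the frequency survives.\<close>

lemma flux_besov:
  assumes u: "\<And>i. LP 2 (\<lambda>x. u x $ i) (A i)" and d: "div_free u"
    and e: "\<And>n. 0 \<le> e n" "\<And>n. e n \<le> B"
    and g: "\<And>i n. LP 3 (conv (blk n) (\<lambda>x. u x $ i)) (e n / theta ^ n)"
  shows "\<bar>flux (2 ^ Q) u\<bar> \<le> Cf * C2 ^ 3 * (S1 Q e + S2 Q e) ^ 3"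
proof -
  let ?D = "S1 Q e + S2 Q e"
  have th: "theta > 0" using theta_gt_1 by simp
  have D: "?D \<ge> 0" using S_bounds(3,4)[OF e, of Q] by simp
  have "\<bar>flux (2 ^ Q) u\<bar> \<le> Cf * 2 ^ Q * (C2 * ?D / theta ^ Q) ^ 3"
    by (rule flux_bound[OF _ u d _ increment_LP3[OF u e g]]) (use D C2_nonneg th in auto)
  also have "\<dots> = Cf * (C2 ^ 3 * ?D ^ 3) * (2 ^ Q / (theta ^ 3) ^ Q)"
    by (simp add: power_divide power_mult_distrib power_mult[symmetric] mult.commute)
  also have "2 ^ Q / (theta ^ 3) ^ Q = (1::real)" by (simp add: theta_cube)
  finally show ?thesis by (simp add: mult.assoc)
qed

end

section \<open>Vanishing of the flux in the Besov class\<close>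

lemma in_Lp2_LP:
  assumes "in_Lp 2 u" shows "LP 2 (\<lambda>x. u x $ i) (sqrt (\<integral>x. (norm (u x :: R3))\<^sup>2 \<partial>lborel))"
proof (rule LPI)
  have um: "u \<in> borel_measurable borel" using assms by (simp add: in_Lp_def)
  show m[measurable]: "(\<lambda>x. u x $ i) \<in> borel_measurable borel"
    by (rule measurable_compose[OF um borel_measurable_continuous_onI[OF linear_continuous_on[OF bounded_linear_vec_nth]]])
  have i: "integrable lborel (\<lambda>x. (norm (u x))\<^sup>2)" using assms by (simp add: in_Lp_def)
  have le: "\<bar>u x $ i\<bar>\<^sup>2 \<le> (norm (u x))\<^sup>2" for x by (intro power_mono component_le_norm_cart) auto
  show i2: "integrable lborel (\<lambda>x. \<bar>u x $ i\<bar>\<^sup>2)"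
    by (rule Bochner_Integration.integrable_bound[OF i]) (use le in \<open>auto intro!: AE_I2\<close>)
  have "(\<integral>x. \<bar>u x $ i\<bar>\<^sup>2 \<partial>lborel) \<le> (\<integral>x. (norm (u x))\<^sup>2 \<partial>lborel)" by (rule integral_mono[OF i2 i le])
  then show "(\<integral>x. \<bar>u x $ i\<bar>\<^sup>2 \<partial>lborel) \<le> (sqrt (\<integral>x. (norm (u x))\<^sup>2 \<partial>lborel))\<^sup>2" by simp
qed simp

lemma Lp_norm_2:
  assumes "in_Lp 2 u" shows "(Lp_norm 2 u)\<^sup>2 = (\<Sum>i\<in>UNIV. (NP 2 (\<lambda>x. (u x :: R3) $ i))\<^sup>2)"
proof -
  have i: "integrable lborel (\<lambda>x. \<bar>u x $ i\<bar>\<^sup>2)" for i by (rule LP_integrable[OF in_Lp2_LP[OF assms]])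
  let ?I = "\<integral>x. (norm (u x))\<^sup>2 \<partial>lborel"
  have "(Lp_norm 2 u)\<^sup>2 = ?I" by (simp add: Lp_norm_def powr_half_sqrt)
  also have "?I = (\<integral>x. (\<Sum>i\<in>UNIV. \<bar>u x $ i\<bar>\<^sup>2) \<partial>lborel)" by (simp only: norm_sq_sum power2_abs) (simp only: power2_eq_square)
  also have "\<dots> = (\<Sum>i\<in>UNIV. \<integral>x. \<bar>u x $ i\<bar>\<^sup>2 \<partial>lborel)" by (rule Bochner_Integration.integral_sum[OF i])
  finally show ?thesis by (simp add: NP_pow)
qed

text \<open>The constant adds the L^1 norm and an L^2 bound of k: Young's inequality gives L^2,
  Cauchy-Schwarz the supremum, and interpolation between them L^3.\<close>

lemma schwartz_conv_const:
  assumes k: "schwartz k"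
  shows "\<exists>C\<ge>0. \<forall>f A. LP 2 f A \<longrightarrow> LP 2 (conv k f) (C * A) \<and> LP 3 (conv k f) (C * A) \<and> (\<forall>x. \<bar>conv k f x\<bar> \<le> C * A)"
proof -
  obtain B where B: "LP 2 k B" using schwartz_LP2[OF k] by blast
  define D where "D = (\<integral>y. \<bar>k y\<bar> \<partial>lborel)"
  define C where "C = D + B"
  have nn: "D \<ge> 0" "B \<ge> 0" using LP_nonneg[OF B] by (auto simp: D_def)
  have "LP 2 (conv k f) (C * A) \<and> LP 3 (conv k f) (C * A) \<and> (\<forall>x. \<bar>conv k f x\<bar> \<le> C * A)" if f: "LP 2 f A" for f A
  proof -
    have A: "A \<ge> 0" by (rule LP_nonneg[OF f])
    have 2: "LP 2 (conv k f) (D * A)" unfolding D_def by (rule LP_conv_schwartz[OF k f]) simp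
    have b: "\<bar>conv k f x\<bar> \<le> B * A" for x by (rule conv_bound_LP2[OF B f])
    have DC: "D * A \<le> C * A" "B * A \<le> C * A" using nn A by (auto simp: C_def intro!: mult_right_mono)
    have "B * A * (D * A)\<^sup>2 \<le> (C * A) * (C * A)\<^sup>2"
      using nn A by (intro mult_mono power_mono) (auto simp: C_def)
    then have "B * A * (D * A)\<^sup>2 \<le> (C * A) ^ 3" by (simp add: power3_eq_cube power2_eq_square mult_ac)
    then have "LP 3 (conv k f) (C * A)" using LP_interpolate_3[OF 2 b] nn A by (simp add: C_def)
    then show ?thesis using LP_mono[OF 2 DC(1)] order_trans[OF b DC(2)] by blast
  qed
  then show ?thesis using nn by (intro exI[of _ C]) (auto simp: C_def)
qed

context lp_cut
begin

definition bn :: "nat \<Rightarrow> (R3 \<Rightarrow> R3) \<Rightarrow> real" where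
  "bn n u = (\<Sum>j\<in>UNIV. NP 3 (conv (blk n) (\<lambda>x. u x $ j)))"

text \<open>For n = q + 1 the weight is theta times the Besov weight of block q. This factor below 2
  and the sum over three components account for the 6 in \<open>ee_dist\<close> and for 216 = 6^3
  afterwards.\<close>

definition ee :: "nat \<Rightarrow> (R3 \<Rightarrow> R3) \<Rightarrow> real" where "ee n u = theta ^ n * bn n u"

lemma bn_nonneg: "bn n u \<ge> 0" unfolding bn_def by (intro sum_nonneg NP_nonneg)

lemma ee_nonneg: "ee n u \<ge> 0" unfolding ee_def using theta_gt_1 bn_nonneg by simp

lemma blk_ee:
  assumes "in_Lp 2 u" shows "LP 3 (conv (blk n) (\<lambda>x. u x $ j)) (ee n u / theta ^ n)"
proof -
  obtain A where "LP 3 (conv (blk n) (\<lambda>x. u x $ j)) A"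
    using schwartz_conv_const[OF schwartz_blk[of n]] in_Lp2_LP[OF assms] by blast
  then have "LP 3 (conv (blk n) (\<lambda>x. u x $ j)) (NP 3 (conv (blk n) (\<lambda>x. u x $ j)))" by (rule NP_LP) simp
  moreover have "NP 3 (conv (blk n) (\<lambda>x. u x $ j)) \<le> bn n u"
    unfolding bn_def by (rule member_le_sum) (auto simp: NP_nonneg)
  ultimately have "LP 3 (conv (blk n) (\<lambda>x. u x $ j)) (bn n u)" by (rule LP_mono)
  then show ?thesis using theta_gt_1 by (simp add: ee_def)
qed

lemma bn_dist:
  assumes u: "in_Lp 2 u" and D: "dist_Lp_norm 3 (\<lambda>j. lp_block chi (int n - 1) (field_dist u j)) \<le> ennreal D" "D \<ge> 0"
  shows "bn n u \<le> 3 * D"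
proof -
  have "NP 3 (conv (blk n) (\<lambda>x. u x $ j)) \<le> D" for j
    by (rule NP_le[OF block_LP3[OF tame_LP2[OF in_Lp2_LP[OF u]] D]]) simp
  then have "bn n u \<le> (\<Sum>j\<in>(UNIV::3 set). D)" unfolding bn_def by (rule sum_mono)
  then show ?thesis by simp
qed

lemma ee_dist:
  assumes u: "in_Lp 2 u" and D: "ennreal (wave_number (int q) powr (1/3)) *
        dist_Lp_norm 3 (\<lambda>j. lp_block chi (int q) (field_dist u j)) \<le> ennreal D" "D \<ge> 0"
  shows "ee (Suc q) u \<le> 6 * D"
proof -
  have th: "theta ^ q > 0" using theta_gt_1 by simp
  let ?d = "dist_Lp_norm 3 (\<lambda>j. lp_block chi (int q) (field_dist u j))"
  have "?d = ennreal (1 / theta ^ q) * (ennreal (theta ^ q) * ?d)"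
    using th theta_gt_1 by (simp add: mult.assoc[symmetric] ennreal_mult[symmetric])
  also have "\<dots> \<le> ennreal (1 / theta ^ q) * ennreal D"
    using D(1) unfolding theta_pow by (rule mult_left_mono) simp
  also have "\<dots> = ennreal (D / theta ^ q)" using th D(2) by (simp add: ennreal_mult[symmetric])
  finally have "?d \<le> ennreal (D / theta ^ q)" .
  then have "bn (Suc q) u \<le> 3 * (D / theta ^ q)"
    using th D(2) by (intro bn_dist[OF u]) auto
  then have "theta ^ Suc q * bn (Suc q) u \<le> theta ^ Suc q * (3 * (D / theta ^ q))"
    using theta_gt_1 by (intro mult_left_mono) auto
  also have "\<dots> = theta * (3 * D)" using th by simp
  also have "\<dots> \<le> 2 * (3 * D)" using theta_lt_2 D(2) by (intro mult_right_mono) auto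
  finally show ?thesis by (simp add: ee_def)
qed

lemma besov_c_ee:
  assumes u: "in_Lp 2 u" and b: "besov_c chi (field_dist u)"
  shows "(\<lambda>n. ee n u) \<longlonglongrightarrow> 0"
proof (rule LIMSEQ_imp_Suc, rule LIMSEQ_I)
  fix \<epsilon> :: real assume e: "\<epsilon> > 0"
  let ?s = "\<lambda>q. ennreal (wave_number (int q) powr (1/3)) * dist_Lp_norm 3 (\<lambda>j. lp_block chi (int q) (field_dist u j))"
  have "?s \<longlonglongrightarrow> 0" using b by (simp add: besov_c_def)
  \<comment> \<open>The conversion to \<open>ee\<close> costs a factor 6, and 6/7 of \<epsilon> is
    still strictly below \<epsilon>.\<close>
  moreover have "(0::ennreal) < ennreal (\<epsilon> / 7)" using e by simp
  ultimately have "eventually (\<lambda>q. ?s q < ennreal (\<epsilon> / 7)) sequentially" by (rule order_tendstoD(2))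
  then obtain N where N: "\<And>q. q \<ge> N \<Longrightarrow> ?s q < ennreal (\<epsilon> / 7)" by (auto simp: eventually_sequentially)
  have "ee (Suc q) u < \<epsilon>" if "q \<ge> N" for q
    using ee_dist[OF u less_imp_le[OF N[OF that]]] e by simp
  then show "\<exists>N. \<forall>n\<ge>N. norm (ee (Suc n) u - 0) < \<epsilon>" using ee_nonneg by auto
qed

text \<open>Cubing takes place in \<open>ennreal\<close>, so an infinite norm is covered. The block
  n = 0 is bounded by the first summand of the norm, the others by the supremum.\<close>

lemma ee_besov_norm:
  assumes u: "in_Lp 2 u"
  shows "ennreal (ee n u ^ 3) \<le> 216 * besov_norm chi (field_dist u) ^ 3"
proof (cases "besov_norm chi (field_dist u)")
  case (real b)
  let ?s = "\<lambda>q. ennreal (wave_number (int q) powr (1/3)) * dist_Lp_norm 3 (\<lambda>j. lp_block chi (int q) (field_dist u j))"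
  have "ee n u \<le> 6 * b"
  proof (cases n)
    case 0
    have "dist_Lp_norm 3 (\<lambda>j. lp_block chi (-1) (field_dist u j)) \<le> ennreal b"
      unfolding real(2)[symmetric] besov_norm_def by simp
    then have "bn 0 u \<le> 3 * b" using real(1) by (intro bn_dist[OF u]) auto
    then show ?thesis using real(1) 0 by (simp add: ee_def)
  next
    case (Suc q)
    have "?s q \<le> (SUP q. ?s q)" by (rule SUP_upper) simp
    also have "\<dots> \<le> ennreal b" unfolding real(2)[symmetric] besov_norm_def by simp
    finally show ?thesis unfolding Suc using real(1) by (intro ee_dist[OF u]) auto
  qed
  then have "ee n u ^ 3 \<le> (6 * b) ^ 3" using ee_nonneg by (rule power_mono)
  then have "ennreal (ee n u ^ 3) \<le> ennreal (216 * b ^ 3)" by (intro ennreal_leI) (simp add: power_mult_distrib)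
  also have "\<dots> = 216 * besov_norm chi (field_dist u) ^ 3"
    using real(1) by (simp add: real(2) ennreal_mult ennreal_power)
  finally show ?thesis .
next
  case top then show ?thesis by (simp add: ennreal_mult_top)
qed

lemma integrable_conv_hk:
  assumes r: "r > 0" and w: "integrable lborel w" shows "integrable lborel (conv (hk r) w)"
proof -
  have wm: "w \<in> borel_measurable borel" using w by auto
  have "LP 1 w (\<integral>x. \<bar>w x\<bar> \<partial>lborel)" by (rule LPI) (use w wm in auto)
  then have "LP 1 (conv (hk r) w) (c0 * (\<integral>x. \<bar>w x\<bar> \<partial>lborel))" by (rule LP_conv_hk[OF r]) simp
  from LP_integrable[OF this] LP_measurable[OF this] show ?thesis by (simp add: integrable_abs_iff)
qed

lemma energy_flux_eq:
  assumes u: "in_Lp 2 u"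
  shows "energy_flux chi (int Q) u = complex_of_real (flux (2 ^ Suc Q) u)"
proof -
  define U where "U i x = u x $ i" for i x
  let ?r = "2 ^ Suc Q :: real"
  have r: "?r > 0" by simp
  note sk = schwartz_hk[OF r]
  have uL: "LP 2 (U i) (sqrt (\<integral>x. (norm (u x))\<^sup>2 \<partial>lborel))" for i unfolding U_def[abs_def] by (rule in_Lp2_LP[OF u])
  have ut: "tame (U i)" for i by (rule tame_LP2[OF uL])
  have uui: "integrable lborel (\<lambda>x. U i x * U j x)" for i j by (rule LP2_prod(2)[OF uL uL])
  have vs: "smooth (conv (hk ?r) (U j))" for j by (rule smooth_conv[OF sk ut])
  have f1: "fun_of_dist (lp_partial_sum chi (int Q) (dist_of (\<lambda>y. complex_of_real (u y $ i * u y $ j))))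
     = (\<lambda>x. complex_of_real (conv (hk ?r) (\<lambda>y. U i y * U j y) x))" for i j
    using fun_of_dist_eq[OF tame_integrable[OF uui[of i j]], of Q] by (simp add: U_def)
  have f2: "partial i (fun_of_dist (lp_partial_sum chi (int Q) (field_dist u j))) x
     = complex_of_real (partial i (conv (hk ?r) (U j)) x)" for i j x
    using fun_of_dist_eq[OF ut, of Q j] partial_bounded_linear(1)[OF bounded_linear_of_real smooth_differentiable[OF vs], of i j x]
    by (simp add: U_def[abs_def] field_dist_def)
  have i: "integrable lborel (\<lambda>x. conv (hk ?r) (\<lambda>y. U i y * U j y) x * partial i (conv (hk ?r) (U j)) x)" for i j
  proof -
    obtain C where "\<forall>f A. LP 2 f A \<longrightarrow> LP 2 (conv (partial i (hk ?r)) f) (C * A) \<and> LP 3 (conv (partial i (hk ?r)) f) (C * A) \<and> (\<forall>x. \<bar>conv (partial i (hk ?r)) f x\<bar> \<le> C * A)"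
      using schwartz_conv_const[OF schwartz_partial[OF sk, of i]] by blast
    then have "\<bar>partial i (conv (hk ?r) (U j)) x\<bar> \<le> C * sqrt (\<integral>x. (norm (u x))\<^sup>2 \<partial>lborel)" for x
      unfolding partial_conv[OF sk ut] using uL by blast
    then show ?thesis
      by (rule integrable_mult_bdd[OF integrable_conv_hk[OF r uui], rotated])
         (use smooth_measurable[OF smooth_partial[OF vs]] in simp)
  qed
  have "energy_flux chi (int Q) u = (\<integral>x. complex_of_real (\<Sum>i\<in>UNIV. \<Sum>j\<in>UNIV. conv (hk ?r) (\<lambda>y. U i y * U j y) x * partial i (conv (hk ?r) (U j)) x) \<partial>lborel)"
    unfolding energy_flux_def f1 f2 by simp
  also have "\<dots> = complex_of_real (\<integral>x. (\<Sum>i\<in>UNIV. \<Sum>j\<in>UNIV. conv (hk ?r) (\<lambda>y. U i y * U j y) x * partial i (conv (hk ?r) (U j)) x) \<partial>lborel)"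
    by (rule integral_complex_of_real)
  also have "(\<integral>x. (\<Sum>i\<in>UNIV. \<Sum>j\<in>UNIV. conv (hk ?r) (\<lambda>y. U i y * U j y) x * partial i (conv (hk ?r) (U j)) x) \<partial>lborel)
    = (\<Sum>i\<in>UNIV. \<Sum>j\<in>UNIV. \<integral>x. conv (hk ?r) (\<lambda>y. U i y * U j y) x * partial i (conv (hk ?r) (U j)) x \<partial>lborel)"
    using i by (simp add: Bochner_Integration.integral_sum)
  also have "\<dots> = flux ?r u" by (simp add: flux_def U_def[abs_def])
  finally show ?thesis .
qed

lemma energy_flux_tendsto:
  assumes u: "in_Lp 2 u" and d: "div_free u" and b: "besov_c chi (field_dist u)"
  shows "(\<lambda>Q. flux (2 ^ Q) u) \<longlonglongrightarrow> 0"
proof -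
  note lim = besov_c_ee[OF u b]
  obtain B where B: "\<And>n. ee n u \<le> B"
    using convergent_imp_Bseq[OF convergentI[OF lim]] ee_nonneg by (auto simp: Bseq_def)
  have bound: "\<bar>flux (2 ^ Q) u\<bar> \<le> Cf * C2 ^ 3 * (S1 Q (\<lambda>n. ee n u) + S2 Q (\<lambda>n. ee n u)) ^ 3" for Q
    by (rule flux_besov[OF in_Lp2_LP[OF u] d ee_nonneg B blk_ee[OF u]])
  have "(\<lambda>Q. Cf * C2 ^ 3 * (S1 Q (\<lambda>n. ee n u) + S2 Q (\<lambda>n. ee n u)) ^ 3) \<longlonglongrightarrow> Cf * C2 ^ 3 * 0 ^ 3"
    by (intro tendsto_intros S_tendsto[OF ee_nonneg B lim])
  then have "(\<lambda>Q. Cf * C2 ^ 3 * (S1 Q (\<lambda>n. ee n u) + S2 Q (\<lambda>n. ee n u)) ^ 3) \<longlonglongrightarrow> 0" by simp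
  then show ?thesis
    by (rule Lim_null_comparison[OF always_eventually[OF allI], rotated]) (simp add: bound)
qed

theorem part1:
  assumes u: "in_Lp 2 u" and d: "div_free u" and b: "besov_c chi (field_dist u)"
  shows "(\<lambda>Q::nat. energy_flux chi (int Q) u) \<longlonglongrightarrow> 0"
proof -
  have "(\<lambda>Q. complex_of_real (flux (2 ^ Suc Q) u)) \<longlonglongrightarrow> complex_of_real 0"
    by (intro tendsto_of_real LIMSEQ_Suc energy_flux_tendsto[OF u d b])
  then show ?thesis by (simp only: energy_flux_eq[OF u] of_real_0)
qed

text \<open>The function is its lowest block plus the tail beyond frequency 1. Thus an L^2 field
  with bounded weighted blocks lies in L^3, with a bound that can later be integrated in
  time.\<close>

lemma LP3_of_ee:
  assumes u: "in_Lp 2 u" and B: "\<And>n. ee n u \<le> B"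
  shows "LP 3 (\<lambda>x. u x $ j) ((1 + KD) * B)"
proof -
  note g = blk_ee[OF u]
  have t: "LP 3 (\<lambda>x. u x $ j - conv (hk (2 ^ 0)) (\<lambda>x. u x $ j) x) (S2 0 (\<lambda>n. ee n u) / theta ^ 0)"
    by (rule tail_LP3[OF in_Lp2_LP[OF u] ee_nonneg B g])
  have "LP 3 (\<lambda>x. conv (blk 0) (\<lambda>x. u x $ j) x + (u x $ j - conv (hk (2 ^ 0)) (\<lambda>x. u x $ j) x)) (ee 0 u / theta ^ 0 + S2 0 (\<lambda>n. ee n u) / theta ^ 0)"
    by (rule LP_add[OF g t]) simp
  then have "LP 3 (\<lambda>x. u x $ j) (ee 0 u + S2 0 (\<lambda>n. ee n u))" by (simp add: blk_def)
  then show ?thesis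
  proof (rule LP_mono)
    have "S2 0 (\<lambda>n. ee n u) \<le> KD * B"
      using S_bounds(3,5)[where e="\<lambda>n. ee n u", OF ee_nonneg B, of 0] by simp
    then show "ee 0 u + S2 0 (\<lambda>n. ee n u) \<le> (1 + KD) * B" using B[of 0] by (simp add: distrib_right)
  qed
qed

lemma conv_hk_hk_ker: "r > 0 \<Longrightarrow> conv (hk r) (hk r) = ker (\<lambda>\<xi>. dil r \<xi> * dil r \<xi>)"
  unfolding hk_def by (rule ext) (intro conv_ker dil_bump dil_even)

lemma dil2_bump: "r > 0 \<Longrightarrow> bump (\<lambda>\<xi>. dil r \<xi> * dil r \<xi>)" and dil2_even: "evenf (\<lambda>\<xi>. dil r \<xi> * dil r \<xi>)"
  using bump_mult[OF dil_bump bump_smooth[OF dil_bump]] dil_even[of r] by (auto simp: evenf_def)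

lemma schwartz_hk_hk: "r > 0 \<Longrightarrow> schwartz (conv (hk r) (hk r))"
  unfolding conv_hk_hk_ker by (rule schwartz_ker[OF dil2_bump])

text \<open>The form b(u, \<psi>, u) with the gradient of \<psi> replaced by an arbitrary matrix
  field G.\<close>

definition bf :: "(R3 \<Rightarrow> R3) \<Rightarrow> (3 \<Rightarrow> 3 \<Rightarrow> R3 \<Rightarrow> real) \<Rightarrow> real" where
  "bf u G = (\<Sum>i\<in>UNIV. \<Sum>j\<in>UNIV. \<integral>x. u x $ i * u x $ j * G i j x \<partial>lborel)"

lemma bf_integrable:
  fixes u :: "R3 \<Rightarrow> R3"
  assumes u: "in_Lp 2 u" and G: "G i j \<in> borel_measurable borel" "\<And>x. \<bar>G i j x\<bar> \<le> M"
  shows "integrable lborel (\<lambda>x. u x $ i * u x $ j * G i j x)"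
  by (rule integrable_mult_bdd[OF LP2_prod(2)[OF in_Lp2_LP[OF u] in_Lp2_LP[OF u]] _ G(2)]) (use G in simp)

lemma bf_bound:
  assumes u: "\<And>i. LP 3 (\<lambda>x. u x $ i) A" and G: "\<And>i j. LP 3 (G i j) B"
  shows "\<bar>bf u G\<bar> \<le> 9 * (A * A * B)"
proof -
  have nn: "A * A * B \<ge> 0" using LP_nonneg[OF u] LP_nonneg[OF G] by simp
  have b: "\<bar>\<integral>x. u x $ i * u x $ j * G i j x \<partial>lborel\<bar> \<le> A * A * B" for i j
    using order_trans[OF ennreal_abs_integral_le LP3_prod[OF u u G, of i j i j]] nn
    by (subst (asm) ennreal_le_iff) auto
  have "\<bar>bf u G\<bar> \<le> (\<Sum>i\<in>(UNIV::3 set). \<Sum>j\<in>(UNIV::3 set). A * A * B)"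
    unfolding bf_def by (rule order_trans[OF sum_abs sum_mono], rule order_trans[OF sum_abs sum_mono], rule b)
  then show ?thesis by simp
qed

text \<open>One of the two filters on the test field is moved, by symmetry, onto the integrable
  product u_i u_j; the other stays with the gradient, which is bounded. This is why the weak
  formulation is tested with a doubly filtered field.\<close>

lemma flux_eq_bf:
  assumes r: "r > 0" and u: "in_Lp 2 u"
  shows "bf u (\<lambda>i j. partial i (conv (conv (hk r) (hk r)) (\<lambda>x. u x $ j))) = flux r u"
  unfolding bf_def flux_def
proof (intro sum.cong refl)
  fix i j :: 3
  define U where "U i x = u x $ i" for i x
  note sk = schwartz_hk[OF r]
  have uL: "LP 2 (U i) (sqrt (\<integral>x. (norm (u x))\<^sup>2 \<partial>lborel))" for i unfolding U_def[abs_def] by (rule in_Lp2_LP[OF u])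
  have ut: "tame (U i)" for i by (rule tame_LP2[OF uL])
  have uui: "integrable lborel (\<lambda>x. U i x * U j x)" for i j by (rule LP2_prod(2)[OF uL uL])
  have sp: "schwartz (partial i (hk r))" by (rule schwartz_partial[OF sk])
  have HH: "schwartz (conv (hk r) (hk r))" by (rule schwartz_hk_hk[OF r])
  obtain C where C: "\<forall>f A. LP 2 f A \<longrightarrow> LP 2 (conv (partial i (hk r)) f) (C * A) \<and> LP 3 (conv (partial i (hk r)) f) (C * A) \<and> (\<forall>x. \<bar>conv (partial i (hk r)) f x\<bar> \<le> C * A)"
    using schwartz_conv_const[OF sp] by blast
  have b: "\<bar>conv (partial i (hk r)) (U j) x\<bar> \<le> C * sqrt (\<integral>x. (norm (u x))\<^sup>2 \<partial>lborel)" for x using C uL by blast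
  have "partial i (conv (conv (hk r) (hk r)) (U j)) x = conv (hk r) (conv (partial i (hk r)) (U j)) x" for x
    unfolding partial_conv[OF HH ut] partial_conv[OF sk schwartz_tame[OF sk]] conv_comm[OF sp sk]
    by (rule conv_assoc[OF sk sp ut, symmetric])
  then have "(\<integral>x. U i x * U j x * partial i (conv (conv (hk r) (hk r)) (U j)) x \<partial>lborel)
     = (\<integral>x. (U i x * U j x) * conv (hk r) (conv (partial i (hk r)) (U j)) x \<partial>lborel)" by simp
  also have "\<dots> = (\<integral>x. conv (hk r) (\<lambda>x. U i x * U j x) x * conv (partial i (hk r)) (U j) x \<partial>lborel)"
    by (rule conv_adjoint_L1[OF sk hk_minus[OF r] uui conv_measurable[OF sp ut] b])
  finally show "(\<integral>x. u x $ i * u x $ j * partial i (conv (conv (hk r) (hk r)) (\<lambda>x. u x $ j)) x \<partial>lborel)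
     = (\<integral>x. conv (hk r) (\<lambda>y. u y $ i * u y $ j) x * partial i (conv (hk r) (\<lambda>y. u y $ j)) x \<partial>lborel)"
    unfolding partial_conv[OF sk ut[unfolded U_def[abs_def]]] by (simp add: U_def[abs_def])
qed

end

section \<open>Weak solutions\<close>

text \<open>Continuity in t makes the function a pointwise limit of functions frozen at the grid
  times floor(n t) / n, and countably many grid times keep joint measurability.\<close>

lemma caratheodory_measurable:
  fixes F :: "real \<Rightarrow> R3 \<Rightarrow> real"
  assumes c: "\<And>x. continuous_on UNIV (\<lambda>t. F t x)" and m: "\<And>t. F t \<in> borel_measurable borel"
  shows "(\<lambda>(t, x). F t x) \<in> borel_measurable (borel \<Otimes>\<^sub>M borel)"
proof (rule borel_measurable_LIMSEQ_real)
  let ?G = "\<lambda>n (t, x). F (real_of_int \<lfloor>real (Suc n) * t\<rfloor> / real (Suc n)) x"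
  show "(\<lambda>n. ?G n z) \<longlonglongrightarrow> (case z of (t, x) \<Rightarrow> F t x)" for z
  proof (cases z)
    case (Pair t x)
    have "(\<lambda>n. real_of_int \<lfloor>real (Suc n) * t\<rfloor> / real (Suc n)) \<longlonglongrightarrow> t"
    proof (rule tendsto_sandwich[of "\<lambda>n. t - inverse (real (Suc n))" _ _ "\<lambda>n. t"])
      have "(\<lambda>n. t - inverse (real (Suc n))) \<longlonglongrightarrow> t - 0" by (intro tendsto_intros LIMSEQ_inverse_real_of_nat)
      then show "(\<lambda>n. t - inverse (real (Suc n))) \<longlonglongrightarrow> t" by simp
      show "\<forall>\<^sub>F n in sequentially. t - inverse (real (Suc n)) \<le> real_of_int \<lfloor>real (Suc n) * t\<rfloor> / real (Suc n)"
      proof (rule always_eventually, rule allI)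
        fix n
        have "real (Suc n) * t - 1 \<le> real_of_int \<lfloor>real (Suc n) * t\<rfloor>" by linarith
        then have "(real (Suc n) * t - 1) / real (Suc n) \<le> real_of_int \<lfloor>real (Suc n) * t\<rfloor> / real (Suc n)"
          by (rule divide_right_mono) simp
        then show "t - inverse (real (Suc n)) \<le> real_of_int \<lfloor>real (Suc n) * t\<rfloor> / real (Suc n)"
          by (simp add: diff_divide_distrib inverse_eq_divide del: of_nat_Suc)
      qed
      show "\<forall>\<^sub>F n in sequentially. real_of_int \<lfloor>real (Suc n) * t\<rfloor> / real (Suc n) \<le> t"
      proof (rule always_eventually, rule allI)
        fix n
        have "real_of_int \<lfloor>real (Suc n) * t\<rfloor> / real (Suc n) \<le> (real (Suc n) * t) / real (Suc n)"
          by (rule divide_right_mono) (simp_all del: of_nat_Suc)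
        then show "real_of_int \<lfloor>real (Suc n) * t\<rfloor> / real (Suc n) \<le> t" by (simp del: of_nat_Suc)
      qed
    qed simp
    then have "(\<lambda>n. F (real_of_int \<lfloor>real (Suc n) * t\<rfloor> / real (Suc n)) x) \<longlonglongrightarrow> F t x"
      using c[of x] by (intro isCont_tendsto_compose[of t "\<lambda>t. F t x"]) (simp_all add: continuous_on_eq_continuous_at)
    then show ?thesis by (simp add: Pair)
  qed
  show "?G n \<in> borel_measurable (borel \<Otimes>\<^sub>M borel)" for n
  proof -
    have "(\<lambda>z. F (real_of_int i / real (Suc n)) (snd z)) \<in> borel_measurable (borel \<Otimes>\<^sub>M borel)" for i :: int
      using m by (intro measurable_compose[OF measurable_snd]) auto
    moreover have "(\<lambda>z::real \<times> R3. \<lfloor>real (Suc n) * fst z\<rfloor>) \<in> measurable (borel \<Otimes>\<^sub>M borel) (count_space UNIV)"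
      by measurable
    ultimately have "(\<lambda>z. F (real_of_int \<lfloor>real (Suc n) * fst z\<rfloor> / real (Suc n)) (snd z)) \<in> borel_measurable (borel \<Otimes>\<^sub>M borel)"
      by (rule measurable_compose_countable)
    then show ?thesis by (simp add: case_prod_beta')
  qed
qed

context lp_cut
begin

text \<open>The difference of products is split into two terms, each with one L^2 filter error and
  one bounded L^2 factor. It transfers measurability in time from filtered to unfiltered
  fields.\<close>

lemma conv_hk_product_tendsto:
  assumes f: "LP 2 f A" and g: "LP 2 g B" and G: "G \<in> borel_measurable borel" "\<And>x. \<bar>G x\<bar> \<le> M"
  shows "(\<lambda>n. \<integral>x. conv (hk (2 ^ n)) f x * conv (hk (2 ^ n)) g x * G x \<partial>lborel) \<longlonglongrightarrow> (\<integral>x. f x * g x * G x \<partial>lborel)"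
proof -
  let ?S = "\<lambda>n. conv (hk (2 ^ n))"
  have M: "M \<ge> 0" using order_trans[OF abs_ge_zero G(2)] .
  have top: "filterlim (\<lambda>n. 2 ^ n :: real) at_top sequentially"
    by (rule filterlim_at_top_mono[OF filterlim_real_sequentially always_eventually])
       (simp add: less_imp_le[OF of_nat_less_two_power])
  have pos: "0 < (2 ^ n :: real)" for n by simp
  note lf = conv_hk_tendsto_L2(1)[OF f pos top] and lf2 = conv_hk_tendsto_L2(2)[OF f pos top]
  note lg = conv_hk_tendsto_L2(1)[OF g pos top] and lg2 = conv_hk_tendsto_L2(2)[OF g pos top]
  have Gm: "LP 2 (\<lambda>x. h x * G x) (M * D)" if "LP 2 h D" for h D
  proof (rule LP_mono_abs)
    show "LP 2 (\<lambda>x. M * h x) (M * D)" using LP_cmult[OF that, of M] M by simp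
    show "(\<lambda>x. h x * G x) \<in> borel_measurable borel" using LP_measurable[OF that] G(1) by simp
    show "\<bar>h x * G x\<bar> \<le> \<bar>M * h x\<bar>" for x
      using mult_left_mono[OF G(2)[of x] abs_ge_zero[of "h x"]] M by (simp add: abs_mult mult.commute)
  qed
  have Sg: "LP 2 (?S n g) (c0 * B)" for n by (rule LP_conv_hk[OF pos g zero_less_numeral])
  have Sf: "LP 2 (?S n f) (c0 * A)" for n by (rule LP_conv_hk[OF pos f zero_less_numeral])
  have b: "\<bar>(\<integral>x. ?S n f x * ?S n g x * G x \<partial>lborel) - (\<integral>x. f x * g x * G x \<partial>lborel)\<bar>
    \<le> NP 2 (\<lambda>x. ?S n f x - f x) * (M * (c0 * B)) + NP 2 (\<lambda>x. ?S n g x - g x) * (M * A)" for n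
  proof -
    note d1 = NP_LP[OF lf2[of n] zero_less_numeral] and d2 = NP_LP[OF lg2[of n] zero_less_numeral]
    have alg: "a * (b * c) - d * (e * c) = (a - d) * (b * c) + (b - e) * (d * c)" for a b c d e :: real
      by (simp add: algebra_simps)
    have i1: "integrable lborel (\<lambda>x. ?S n f x * (?S n g x * G x))" by (rule LP2_prod(2)[OF Sf[of n] Gm[OF Sg[of n]]])
    have i2: "integrable lborel (\<lambda>x. f x * (g x * G x))" by (rule LP2_prod(2)[OF f Gm[OF g]])
    have j1: "integrable lborel (\<lambda>x. (?S n f x - f x) * (?S n g x * G x))" by (rule LP2_prod(2)[OF lf2[of n] Gm[OF Sg[of n]]])
    have j2: "integrable lborel (\<lambda>x. (?S n g x - g x) * (f x * G x))" by (rule LP2_prod(2)[OF lg2[of n] Gm[OF f]])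
    have "(\<integral>x. ?S n f x * (?S n g x * G x) \<partial>lborel) - (\<integral>x. f x * (g x * G x) \<partial>lborel)
      = (\<integral>x. ?S n f x * (?S n g x * G x) - f x * (g x * G x) \<partial>lborel)"
      by (rule Bochner_Integration.integral_diff[OF i1 i2, symmetric])
    also have "\<dots> = (\<integral>x. (?S n f x - f x) * (?S n g x * G x) + (?S n g x - g x) * (f x * G x) \<partial>lborel)"
      by (rule Bochner_Integration.integral_cong[OF refl]) (rule alg)
    also have "\<dots> = (\<integral>x. (?S n f x - f x) * (?S n g x * G x) \<partial>lborel) + (\<integral>x. (?S n g x - g x) * (f x * G x) \<partial>lborel)"
      by (rule Bochner_Integration.integral_add[OF j1 j2])
    finally have e: "(\<integral>x. ?S n f x * (?S n g x * G x) \<partial>lborel) - (\<integral>x. f x * (g x * G x) \<partial>lborel)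
      = (\<integral>x. (?S n f x - f x) * (?S n g x * G x) \<partial>lborel) + (\<integral>x. (?S n g x - g x) * (f x * G x) \<partial>lborel)" .
    show ?thesis unfolding mult.assoc[of "?S n f _" "?S n g _" "G _"] mult.assoc[of "f _" "g _" "G _"] e
      by (rule order_trans[OF abs_triangle_ineq add_mono[OF LP2_prod(3)[OF d1 Gm[OF Sg[of n]]] LP2_prod(3)[OF d2 Gm[OF f]]]])
  qed
  have "(\<lambda>n. NP 2 (\<lambda>x. ?S n f x - f x) * (M * (c0 * B)) + NP 2 (\<lambda>x. ?S n g x - g x) * (M * A)) \<longlonglongrightarrow> 0 * (M * (c0 * B)) + 0 * (M * A)"
    by (rule tendsto_add[OF tendsto_mult_right[OF lf] tendsto_mult_right[OF lg]])
  then have z: "(\<lambda>n. NP 2 (\<lambda>x. ?S n f x - f x) * (M * (c0 * B)) + NP 2 (\<lambda>x. ?S n g x - g x) * (M * A)) \<longlonglongrightarrow> 0" by simp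
  have "(\<lambda>n. (\<integral>x. ?S n f x * ?S n g x * G x \<partial>lborel) - (\<integral>x. f x * g x * G x \<partial>lborel)) \<longlonglongrightarrow> 0"
    by (rule Lim_null_comparison[OF always_eventually[OF allI] z]) (unfold real_norm_def, rule b)
  then show ?thesis by (rule LIM_zero_cancel)
qed

end

section \<open>Measurability and integrability in time for a weak solution\<close>

locale euler = lp_cut +
  fixes T :: real and u :: "real \<Rightarrow> R3 \<Rightarrow> R3"
  assumes T: "0 < T" and weak: "weak_euler_solution T u"
    and bes: "in_L3_besov_c chi T (\<lambda>t. field_dist (u t))"
begin

text \<open>The solution is continued by its end values outside [0,T], so that continuity and
  measurability in time can be stated on the whole real line.\<close>

definition U :: "real \<Rightarrow> R3 \<Rightarrow> R3" where "U t = u (max 0 (min T t))"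

lemma U_eq: "t \<in> {0..T} \<Longrightarrow> U t = u t"
proof -
  assume "t \<in> {0..T}"
  then have "max 0 (min T t) = t" by auto
  then show ?thesis by (simp add: U_def)
qed

lemma clamp: "max 0 (min T t) \<in> {0..T}" using T by auto

lemma U_L2: "in_Lp 2 (U t)"
  using weak clamp[of t] unfolding weak_euler_solution_def weakly_continuous_L2_def U_def by blast

lemma U_div: "div_free (U t)"
  using weak clamp[of t] unfolding weak_euler_solution_def U_def by blast

definition nU :: "real \<Rightarrow> real" where "nU t = sqrt (\<integral>x. (norm (U t x))\<^sup>2 \<partial>lborel)"

lemma U_LP2: "LP 2 (\<lambda>x. U t x $ i) (nU t)"
  unfolding nU_def by (rule in_Lp2_LP[OF U_L2])

lemma U_tame: "tame (\<lambda>x. U t x $ i)" by (rule tame_LP2[OF U_LP2])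

lemma U_weak_cont:
  assumes v: "in_Lp 2 v" shows "continuous_on UNIV (\<lambda>t. l2_inner (U t) v)"
proof -
  have "continuous_on {0..T} (\<lambda>t. l2_inner (u t) v)"
    using weak v unfolding weak_euler_solution_def weakly_continuous_L2_def by blast
  moreover have "continuous_on UNIV (\<lambda>t. max 0 (min T t))" by (intro continuous_intros)
  ultimately show ?thesis unfolding U_def
    by (rule continuous_on_compose2[of "{0..T}" "\<lambda>t. l2_inner (u t) v"]) (use clamp in auto)
qed

lemma U_comp_cont:
  assumes k: "LP 2 k B" shows "continuous_on UNIV (\<lambda>t. \<integral>x. k x * U t x $ j \<partial>lborel)"
proof -
  let ?v = "\<lambda>x. k x *\<^sub>R (axis j 1 :: R3)"
  have n: "norm (?v x) powr 2 = \<bar>k x\<bar> ^ 2" for x by (simp add: norm_axis_1)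
  have "in_Lp 2 ?v"
    unfolding in_Lp_def n using LP_measurable[OF k] LP_integrable[OF k] by simp
  from U_weak_cont[OF this] show ?thesis
    by (simp add: l2_inner_def inner_axis)
qed

lemma U_conv_cont:
  assumes k: "schwartz k" shows "continuous_on UNIV (\<lambda>t. conv k (\<lambda>x. U t x $ j) x)"
proof -
  obtain B where "LP 2 k B" using schwartz_LP2[OF k] by blast
  from U_comp_cont[OF LP_shift(2)[OF this, of x], of j] show ?thesis by (simp add: conv_def)
qed

lemma U_conv_measurable:
  assumes k: "schwartz k"
  shows "(\<lambda>(t, x). conv k (\<lambda>x. U t x $ j) x) \<in> borel_measurable (borel \<Otimes>\<^sub>M borel)"
  by (rule caratheodory_measurable[OF U_conv_cont[OF k] conv_measurable[OF k U_tame]])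

lemma ee_measurable [measurable]: "(\<lambda>t. ee n (U t)) \<in> borel_measurable borel"
proof -
  note [measurable] = U_conv_measurable[OF schwartz_blk]
  have "(\<lambda>t. \<integral>x. \<bar>conv (blk n) (\<lambda>x. U t x $ j) x\<bar> ^ 3 \<partial>lborel) \<in> borel_measurable borel" for j by measurable
  then show ?thesis unfolding ee_def bn_def NP_def by measurable
qed

text \<open>Weak continuity gives joint measurability in (t,x) only after filtering. The unfiltered
  form is a pointwise limit in t of filtered ones.\<close>

lemma bf_measurable:
  assumes G: "\<And>i j. G i j \<in> borel_measurable borel" "\<And>i j x. \<bar>G i j x\<bar> \<le> M"
  shows "(\<lambda>t. bf (U t) G) \<in> borel_measurable borel"
proof -
  note [measurable] = G(1)
  have "(\<lambda>t. \<integral>x. U t x $ i * U t x $ j * G i j x \<partial>lborel) \<in> borel_measurable borel" for i j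
  proof (rule borel_measurable_LIMSEQ_real)
    fix n :: nat
    have sk: "schwartz (hk (2 ^ n))" by (rule schwartz_hk) simp
    note [measurable] = U_conv_measurable[OF sk]
    show "(\<lambda>t. \<integral>x. conv (hk (2 ^ n)) (\<lambda>x. U t x $ i) x * conv (hk (2 ^ n)) (\<lambda>x. U t x $ j) x * G i j x \<partial>lborel) \<in> borel_measurable borel"
      by measurable
  next
    fix t
    show "(\<lambda>n. \<integral>x. conv (hk (2 ^ n)) (\<lambda>x. U t x $ i) x * conv (hk (2 ^ n)) (\<lambda>x. U t x $ j) x * G i j x \<partial>lborel) \<longlonglongrightarrow> (\<integral>x. U t x $ i * U t x $ j * G i j x \<partial>lborel)"
      by (rule conv_hk_product_tendsto[OF U_LP2 U_LP2 G])
  qed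
  then show ?thesis unfolding bf_def by measurable
qed

text \<open>A measurable substitute for the cube of the Besov norm, whose own measurability is not known.\<close>

definition M3 :: "real \<Rightarrow> ennreal" where "M3 t = (SUP n. ennreal (ee n (U t) ^ 3))"

text \<open>Where \<open>M3\<close> is infinite, \<open>enn2real\<close> returns 0 and
  \<open>bet\<close> controls nothing; by \<open>M3_finite\<close> this happens in [0,T] only on a
  null set.\<close>

definition bet :: "real \<Rightarrow> real" where "bet t = root 3 (enn2real (M3 t))"

lemma M3_measurable [measurable]: "M3 \<in> borel_measurable borel"
  unfolding M3_def by measurable

lemma bet_nonneg: "0 \<le> bet t" by (simp add: bet_def)

lemma bet_cube: "bet t ^ 3 = enn2real (M3 t)" by (simp add: bet_def real_root_pow_pos2)

lemma bet_measurable [measurable]: "bet \<in> borel_measurable borel"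
  unfolding bet_def by measurable

lemma M3_finite: "(\<integral>\<^sup>+t. M3 t * indicator {0..T} t \<partial>lborel) < \<infinity>"
proof -
  \<comment> \<open>The constant stands on the left because pulling it out of the integral uses
    measurability, which is available for \<open>M3\<close>.\<close>
  have "(\<integral>\<^sup>+t. ennreal (1 / 216) * M3 t \<partial>restrict_space lborel {0..T}) \<le> (\<integral>\<^sup>+t. besov_norm chi (field_dist (u t)) ^ 3 \<partial>restrict_space lborel {0..T})"
  proof (rule nn_integral_mono)
    fix t assume "t \<in> space (restrict_space lborel {0..T})"
    then have t: "U t = u t" by (intro U_eq) (simp add: space_restrict_space)
    have "M3 t \<le> 216 * besov_norm chi (field_dist (u t)) ^ 3"
      unfolding M3_def using ee_besov_norm[OF U_L2, of _ t] t by (intro SUP_least) simp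
    then have "ennreal (1 / 216) * M3 t \<le> ennreal (1 / 216) * (216 * besov_norm chi (field_dist (u t)) ^ 3)"
      by (rule mult_left_mono) simp
    also have "\<dots> = ennreal (1 / 216) * ennreal 216 * besov_norm chi (field_dist (u t)) ^ 3"
      by (simp add: mult.assoc)
    also have "ennreal (1 / 216) * ennreal 216 = 1" by (subst ennreal_mult[symmetric]) simp_all
    finally show "ennreal (1 / 216) * M3 t \<le> besov_norm chi (field_dist (u t)) ^ 3" by simp
  qed
  also have "\<dots> < \<infinity>" using bes by (simp add: in_L3_besov_c_def)
  also have "(\<integral>\<^sup>+t. ennreal (1 / 216) * M3 t \<partial>restrict_space lborel {0..T}) = (\<integral>\<^sup>+t. ennreal (1 / 216) * (M3 t * indicator {0..T} t) \<partial>lborel)"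
    by (subst nn_integral_restrict_space) (simp_all add: mult.assoc)
  also have "\<dots> = ennreal (1 / 216) * (\<integral>\<^sup>+t. M3 t * indicator {0..T} t \<partial>lborel)"
    by (rule nn_integral_cmult) measurable
  finally show ?thesis by (simp add: ennreal_mult_less_top less_top[symmetric] ennreal_mult_eq_top_iff)
qed

lemma ee_le_bet: "AE t in lborel. t \<in> {0..T} \<longrightarrow> (\<forall>n. ee n (U t) \<le> bet t)"
proof -
  have "AE t in lborel. M3 t * indicator {0..T} t \<noteq> \<infinity>"
    using M3_finite by (intro nn_integral_noteq_infinite) (auto simp: less_top)
  then show ?thesis
  proof eventually_elim
    case (elim t)
    show ?case
    proof (intro impI allI)
      fix n assume "t \<in> {0..T}"
      then have f: "M3 t < top" using elim by (simp add: less_top)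
      have "ennreal (ee n (U t) ^ 3) \<le> M3 t" unfolding M3_def by (rule SUP_upper) simp
      also have "\<dots> = ennreal (bet t ^ 3)" unfolding bet_cube using f by simp
      finally have "ee n (U t) ^ 3 \<le> bet t ^ 3" using bet_nonneg by (subst (asm) ennreal_le_iff) auto
      then show "ee n (U t) \<le> bet t" by (rule power_le_imp_le_base[of _ 2, simplified]) (rule bet_nonneg)
    qed
  qed
qed

lemma bet_cube_integrable: "integrable lborel (\<lambda>t. indicator {0..T} t * bet t ^ 3)"
proof (rule integrableI_bounded)
  have "(\<integral>\<^sup>+t. ennreal (norm (indicator {0..T} t * bet t ^ 3)) \<partial>lborel) \<le> (\<integral>\<^sup>+t. M3 t * indicator {0..T} t \<partial>lborel)"
    unfolding bet_cube by (intro nn_integral_mono) (auto simp: indicator_def ennreal_enn2real_if)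
  then show "(\<integral>\<^sup>+t. ennreal (norm (indicator {0..T} t * bet t ^ 3)) \<partial>lborel) < \<infinity>"
    using M3_finite by (rule le_less_trans)
qed measurable

lemma bet_sq_integrable: "integrable lborel (\<lambda>t. indicator {0..T} t * bet t ^ 2)"
proof (rule Bochner_Integration.integrable_bound)
  have "integrable lborel (indicator {0..T} :: real \<Rightarrow> real)" using T by (intro integrable_real_indicator) auto
  then have "integrable lborel (\<lambda>t::real. indicator {0..T} t * 1 :: real)" by simp
  from Bochner_Integration.integrable_add[OF this bet_cube_integrable]
  show "integrable lborel (\<lambda>t. indicator {0..T} t * 1 + indicator {0..T} t * bet t ^ 3)" .
  have "bet t ^ 2 \<le> 1 + bet t ^ 3" for t
  proof (cases "bet t \<le> 1")
    case True then have "bet t ^ 2 \<le> 1" using bet_nonneg by (intro power_le_one)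
    then show ?thesis using bet_nonneg[of t] by (smt (verit) zero_le_power)
  next
    case False then have "bet t ^ 2 \<le> bet t ^ 3" by (intro power_increasing) auto
    then show ?thesis by simp
  qed
  then show "AE t in lborel. norm (indicator {0..T} t * bet t ^ 2) \<le> norm (indicator {0..T} t * 1 + indicator {0..T} t * bet t ^ 3)"
    using bet_nonneg by (intro AE_I2) (auto simp: indicator_def intro: order_trans[OF _ abs_ge_self])
qed measurable

text \<open>Nine pairs of components, and two factors of u, each with L^3 bound (1 + KD) *
  bet.\<close>

definition KU :: real where "KU = 9 * (1 + KD) ^ 2"

lemma KU_nonneg: "KU \<ge> 0" by (simp add: KU_def)

lemma bf_bet:
  assumes t: "\<And>n. ee n (U t) \<le> bet t" and G: "\<And>i j. LP 3 (G i j) B"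
  shows "\<bar>bf (U t) G\<bar> \<le> KU * bet t ^ 2 * B"
proof -
  have "9 * (K * b * (K * b) * B) = 9 * K ^ 2 * b ^ 2 * B" for K b :: real by (simp add: power2_eq_square)
  then show ?thesis
    using bf_bound[where G=G and B=B, OF LP3_of_ee[OF U_L2 t] G] by (simp only: KU_def)
qed

lemma bf_time_integrable:
  assumes G: "\<And>i j. G i j \<in> borel_measurable borel" "\<And>i j x. \<bar>G i j x\<bar> \<le> M" and B: "\<And>i j. LP 3 (G i j) B"
    and S: "S \<in> sets borel" "S \<subseteq> {0..T}"
  shows "integrable lborel (\<lambda>t. indicator S t * bf (U t) G)"
    "\<bar>\<integral>t. indicator S t * bf (U t) G \<partial>lborel\<bar> \<le> KU * B * (\<integral>t. indicator {0..T} t * bet t ^ 2 \<partial>lborel)"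
proof -
  note [measurable] = bf_measurable[OF G] S(1)
  have b: "AE t in lborel. \<bar>indicator S t * bf (U t) G\<bar> \<le> KU * B * (indicator {0..T} t * bet t ^ 2)"
    using ee_le_bet
  proof eventually_elim
    case (elim t)
    show ?case
    proof (cases "t \<in> S")
      case True
      then have "t \<in> {0..T}" using S(2) by blast
      with elim bf_bet[OF _ B] True show ?thesis by (simp add: mult_ac)
    qed (use KU_nonneg LP_nonneg[OF B] bet_nonneg in simp)
  qed
  have i: "integrable lborel (\<lambda>t. KU * B * (indicator {0..T} t * bet t ^ 2))"
    by (rule integrable_mult_right[OF bet_sq_integrable])
  show i1: "integrable lborel (\<lambda>t. indicator S t * bf (U t) G)"
    by (rule Bochner_Integration.integrable_bound[OF i]) (use b in \<open>auto elim!: eventually_mono\<close>)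
  have "\<bar>\<integral>t. indicator S t * bf (U t) G \<partial>lborel\<bar> \<le> (\<integral>t. \<bar>indicator S t * bf (U t) G\<bar> \<partial>lborel)"
    by (rule integral_abs_bound)
  also have "\<dots> \<le> (\<integral>t. KU * B * (indicator {0..T} t * bet t ^ 2) \<partial>lborel)"
    by (rule integral_mono_AE[OF integrable_abs[OF i1] i b])
  also have "\<dots> = KU * B * (\<integral>t. indicator {0..T} t * bet t ^ 2 \<partial>lborel)"
    by (rule Bochner_Integration.integral_mult_right_zero)
  finally show "\<bar>\<integral>t. indicator S t * bf (U t) G \<partial>lborel\<bar> \<le> KU * B * (\<integral>t. indicator {0..T} t * bet t ^ 2 \<partial>lborel)" .
qed

end

section \<open>Divergence-free Schwartz fields and the Leray projector\<close>

lemma partial_ker_sum_zero: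
  assumes m: "\<And>j. bump (m j)" and z: "\<And>\<xi>. (\<Sum>j\<in>UNIV. \<xi> $ j * m j \<xi>) = 0"
  shows "(\<Sum>j\<in>(UNIV::3 set). partial j (ker (m j)) x) = 0"
proof -
  let ?c = "\<lambda>j \<xi>. complex_of_real (m j \<xi>)"
  let ?e = "\<lambda>j \<xi>. \<i> * complex_of_real (\<xi> $ j) * ?c j \<xi>"
  have b: "bump (?c j)" for j by (rule bump_of_real[OF m])
  have p: "partial j (ker (m j)) x = Re (E (?e j) x) / (2 * pi) ^ 3" for j
  proof -
    have "ker (m j) = (\<lambda>y. Re (E (?c j) y) / (2 * pi) ^ 3)" by (simp add: ker_def fun_eq_iff)
    then have "partial j (ker (m j)) x = Re (partial j (E (?c j)) x) / (2 * pi) ^ 3"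
      using partial_bounded_linear(1)[OF bounded_linear_Re_scaled smooth_differentiable[OF schwartz_smooth[OF schwartz_E[OF b[of j]]]], of j x]
      by (simp only:)
    then show ?thesis by (simp only: partial_E[OF b])
  qed
  have i: "integrable lborel (\<lambda>\<xi>. ?e j \<xi> * cis (x \<bullet> \<xi>))" for j
    by (rule integrable_mult_cis[OF bump_integrable[OF bump_coord[OF b]]])
  have "(\<Sum>j\<in>UNIV. E (?e j) x) = (\<integral>\<xi>. (\<Sum>j\<in>UNIV. ?e j \<xi> * cis (x \<bullet> \<xi>)) \<partial>lborel)"
    unfolding E_def by (rule Bochner_Integration.integral_sum[symmetric]) (rule i)
  also have "\<dots> = (\<integral>\<xi>. (0::complex) \<partial>(lborel :: R3 measure))"
  proof (rule Bochner_Integration.integral_cong[OF refl])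
    fix \<xi> :: R3
    have "(\<Sum>j\<in>UNIV. ?e j \<xi> * cis (x \<bullet> \<xi>)) = \<i> * complex_of_real (\<Sum>j\<in>UNIV. \<xi> $ j * m j \<xi>) * cis (x \<bullet> \<xi>)"
      by (simp add: sum_distrib_left sum_distrib_right mult_ac)
    then show "(\<Sum>j\<in>UNIV. ?e j \<xi> * cis (x \<bullet> \<xi>)) = 0" unfolding z by simp
  qed
  finally have "(\<Sum>j\<in>UNIV. E (?e j) x) = 0" by simp
  then have "(\<Sum>j\<in>UNIV. Re (E (?e j) x)) = 0" by (metis Re_sum zero_complex.sel(1))
  then show ?thesis unfolding p sum_divide_distrib[symmetric] by simp
qed

lemma conv_sum_right:
  assumes "schwartz k" "\<And>a. a \<in> S \<Longrightarrow> tame (u a)"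
  shows "conv k (\<lambda>x. \<Sum>a\<in>S. u a x) x = (\<Sum>a\<in>S. conv k (u a) x)"
  unfolding conv_def sum_distrib_left
  by (rule Bochner_Integration.integral_sum) (rule conv_integrable[OF assms])

lemma conv_sum_left:
  assumes "\<And>a. a \<in> S \<Longrightarrow> schwartz (k a)" "tame u"
  shows "conv (\<lambda>x. \<Sum>a\<in>S. k a x) u x = (\<Sum>a\<in>S. conv (k a) u x)"
  unfolding conv_def sum_distrib_right
  by (rule Bochner_Integration.integral_sum) (rule conv_integrable[OF assms])

lemma LP2_cutoff_tendsto:
  assumes v: "LP 2 v A"
  shows "(\<lambda>n. NP 2 (\<lambda>x. v x - indicator (cball 0 (real n)) x * v x)) \<longlonglongrightarrow> 0"
    and "LP 2 (\<lambda>x. v x - indicator (cball 0 (real n)) x * v x) A"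
proof -
  have vm: "v \<in> borel_measurable borel" using v by (rule LP_measurable)
  have b: "\<bar>v x - indicator (cball 0 (real n)) x * v x\<bar> \<le> \<bar>v x\<bar>" for n x by (simp add: indicator_def)
  have me: "(\<lambda>x. v x - indicator (cball 0 (real n)) x * v x) \<in> borel_measurable borel" for n
    by (intro borel_measurable_diff borel_measurable_times borel_measurable_indicator vm borel_closed closed_cball)
  show "LP 2 (\<lambda>x. v x - indicator (cball 0 (real n)) x * v x) A" by (rule LP_mono_abs[OF v me b])
  have l: "(\<lambda>n. v x - indicator (cball 0 (real n)) x * v x) \<longlonglongrightarrow> 0" for x
  proof (rule tendsto_eventually)
    obtain N :: nat where N: "norm x \<le> real N" using real_arch_simple by blast
    show "\<forall>\<^sub>F n in sequentially. v x - indicator (cball 0 (real n)) x * v x = 0"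
      using eventually_ge_at_top[of N]
    proof eventually_elim
      case (elim n)
      then have "norm x \<le> real n" using N by linarith
      then show ?case by (simp add: indicator_def)
    qed
  qed
  show "(\<lambda>n. NP 2 (\<lambda>x. v x - indicator (cball 0 (real n)) x * v x)) \<longlonglongrightarrow> 0"
    by (rule NP_dct[OF me LP_integrable[OF v] b AE_I2[OF l]]) simp
qed

context lp_cut
begin

lemma dil_one: "r > 0 \<Longrightarrow> norm \<xi> \<le> r / 2 \<Longrightarrow> dil r \<xi> = 1"
  unfolding dil_def by (rule chi_one) (simp add: field_simps)

lemma dil_zero: "r > 0 \<Longrightarrow> r \<le> norm \<xi> \<Longrightarrow> dil r \<xi> = 0"
  unfolding dil_def by (rule chi_zero) (simp add: field_simps)

text \<open>The Leray projector restricted to the frequencies between \<open>\<epsilon>\<close> and \<open>r\<close>, where its symbol is smooth.\<close>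

lemma leray_kernel:
  assumes e: "0 < \<epsilon>" "\<epsilon> \<le> r"
  shows "\<exists>k :: 3 \<Rightarrow> 3 \<Rightarrow> R3 \<Rightarrow> real. (\<forall>i j. schwartz (k i j)) \<and> (\<forall>i j. conv (hk (2 * r)) (k i j) = k i j) \<and>
    (\<forall>i x. (\<Sum>j\<in>UNIV. partial j (k i j) x) = 0) \<and>
    (\<forall>v A. (\<forall>i. LP 2 (\<lambda>x. v x $ i) (A i)) \<longrightarrow> div_free v \<longrightarrow>
      (\<forall>j x. (\<Sum>i\<in>UNIV. conv (k i j) (\<lambda>x. v x $ i) x)
        = conv (conv (hk r) (hk r)) (\<lambda>x. v x $ j) x - conv (conv (hk \<epsilon>) (hk \<epsilon>)) (\<lambda>x. v x $ j) x))"
proof -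
  have r: "r > 0" and r2: "2 * r > 0" using e by auto
  \<comment> \<open>Both cut-offs are 1 for |\<xi>| \<le> \<epsilon>/2 and 0 for |\<xi>| \<ge> r, so
    D lives in an annulus and can be divided smoothly by |\<xi>|^2. The squares are there because
    the projector is to be compared with double filtering.\<close>
  define D where "D \<xi> = dil r \<xi> * dil r \<xi> - dil \<epsilon> \<xi> * dil \<epsilon> \<xi>" for \<xi>
  define mu where "mu \<xi> = D \<xi> / (norm \<xi>)\<^sup>2" for \<xi>
  define m where "m i j \<xi> = (if i = j then D \<xi> else 0) - \<xi> $ i * \<xi> $ j * mu \<xi>" for i j :: 3 and \<xi>
  have bD: "bump D" unfolding D_def by (rule bump_diff[OF dil2_bump[OF r] dil2_bump[OF e(1)]])
  have D0: "D \<xi> = 0" if "r \<le> norm \<xi>" for \<xi>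
    using dil_zero[OF r that] dil_zero[OF e(1) order_trans[OF e(2) that]] by (simp add: D_def)
  have D1: "D \<xi> = 0" if "norm \<xi> < \<epsilon> / 2" for \<xi>
  proof -
    have "norm \<xi> \<le> \<epsilon> / 2" "norm \<xi> \<le> r / 2" using that e by auto
    then show ?thesis using dil_one[OF r] dil_one[OF e(1)] by (simp add: D_def)
  qed
  have Dmu: "(norm \<xi>)\<^sup>2 * mu \<xi> = D \<xi>" for \<xi>
    using D1[of \<xi>] e by (cases "\<xi> = 0") (simp_all add: mu_def)
  have bmu: "bump mu" unfolding bump_def
  proof (intro conjI exI allI impI)
    have "\<epsilon> / 2 > 0" using e by simp
    from smooth_div_norm_sq[OF bump_smooth[OF bD] this D1] show "smooth mu" by (simp only: mu_def[abs_def])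
    show "mu \<xi> = 0" if "r < norm \<xi>" for \<xi> using D0[of \<xi>] that by (simp add: mu_def)
  qed
  have bij: "bump (\<lambda>\<xi>. \<xi> $ i * \<xi> $ j * mu \<xi>)" for i j
    by (rule bump_mult[OF bmu smooth_mult[OF smooth_coord smooth_coord]])
  have bz: "bump (\<lambda>\<xi>. if i = j then D \<xi> else 0)" for i j :: 3
    using bD by (cases "i = j") (simp_all add: bump_def)
  have bm: "bump (m i j)" for i j unfolding m_def[abs_def] by (rule bump_diff[OF bz bij])
  have eD: "D (- \<xi>) = D \<xi>" for \<xi>
    using dil_even[of r] dil_even[of \<epsilon>] by (simp add: D_def evenf_def)
  have em: "evenf (m i j)" for i j by (simp add: evenf_def m_def mu_def eD)
  have zm: "(\<Sum>j\<in>UNIV. \<xi> $ j * m i j \<xi>) = 0" for i \<xi>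
  proof -
    have "(\<Sum>j\<in>UNIV. \<xi> $ j * m i j \<xi>) = (\<Sum>j\<in>UNIV. (if i = j then \<xi> $ j * D \<xi> else 0) - (\<xi> $ j * \<xi> $ j) * (\<xi> $ i * mu \<xi>))"
      by (rule sum.cong[OF refl]) (simp add: m_def algebra_simps)
    also have "\<dots> = \<xi> $ i * D \<xi> - (norm \<xi>)\<^sup>2 * (\<xi> $ i * mu \<xi>)"
      unfolding sum_subtractf norm_sq_sum sum_distrib_right by simp
    also have "\<dots> = \<xi> $ i * (D \<xi> - (norm \<xi>)\<^sup>2 * mu \<xi>)" by (simp add: algebra_simps)
    finally show ?thesis by (simp only: Dmu) simp
  qed
  have cm: "conv (hk (2 * r)) (ker (m i j)) = ker (m i j)" for i j
  proof
    fix x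
    have "dil (2 * r) \<xi> * m i j \<xi> = m i j \<xi>" for \<xi>
    proof (cases "r \<le> norm \<xi>")
      case True then show ?thesis using D0 by (simp add: m_def mu_def)
    next
      case False then show ?thesis using dil_one[OF r2, of \<xi>] by simp
    qed
    then have "(\<lambda>\<xi>. dil (2 * r) \<xi> * m i j \<xi>) = m i j" by (rule ext)
    then show "conv (hk (2 * r)) (ker (m i j)) x = ker (m i j) x"
      using conv_ker[OF dil_bump[OF r2] dil_even bm em, of i j x] by (simp only: hk_def)
  qed
  have sD: "schwartz (ker D)" and smu: "schwartz (ker mu)" by (rule schwartz_ker[OF bD], rule schwartz_ker[OF bmu])
  have sp: "schwartz (partial j (ker mu))" for j by (rule schwartz_partial[OF smu])
  \<comment> \<open>The nonlocal part of the projector is a second derivative of the single Schwartz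
    kernel \<open>ker mu\<close>.\<close>
  have km: "ker (m i j) x = (if i = j then ker D x else 0) + partial i (partial j (ker mu)) x" for i j x
  proof -
    have "ker (m i j) x = ker (\<lambda>\<xi>. if i = j then D \<xi> else 0) x - ker (\<lambda>\<xi>. \<xi> $ i * \<xi> $ j * mu \<xi>) x"
      unfolding m_def[abs_def] by (rule ker_diff[OF bz bij])
    moreover have "ker (\<lambda>\<xi>. if i = j then D \<xi> else 0) x = (if i = j then ker D x else 0)"
      by (cases "i = j") (simp_all add: ker_def E_def)
    ultimately show ?thesis using partial_partial_ker[OF bmu, of i j x] by simp
  qed
  have kD: "ker D x = conv (hk r) (hk r) x - conv (hk \<epsilon>) (hk \<epsilon>) x" for x
    unfolding conv_hk_hk_ker[OF r] conv_hk_hk_ker[OF e(1)] D_def[abs_def]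
    by (rule ker_diff[OF dil2_bump[OF r] dil2_bump[OF e(1)]])
  \<comment> \<open>Summed over i, the second-derivative part is a divergence moved onto the kernel
    and vanishes by \<open>conv_div_free\<close>; the diagonal part is the difference of two double
    filters.\<close>
  have fin: "(\<Sum>i\<in>UNIV. conv (ker (m i j)) (\<lambda>x. v x $ i) x)
        = conv (conv (hk r) (hk r)) (\<lambda>x. v x $ j) x - conv (conv (hk \<epsilon>) (hk \<epsilon>)) (\<lambda>x. v x $ j) x"
    if v: "\<And>i. LP 2 (\<lambda>x. v x $ i) (A i)" and d: "div_free v" for v :: "R3 \<Rightarrow> R3" and A j x
  proof -
    note tv = tame_LP2[OF v]
    have c: "conv (ker (m i j)) (\<lambda>x. v x $ i) x = (if i = j then conv (ker D) (\<lambda>x. v x $ i) x else 0)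
      + conv (partial i (partial j (ker mu))) (\<lambda>x. v x $ i) x" for i
    proof -
      let ?z = "\<lambda>y. if i = j then ker D y else 0"
      let ?p = "partial i (partial j (ker mu))"
      have sz: "schwartz ?z" using sD by (cases "i = j") simp_all
      have "conv (ker (m i j)) (\<lambda>x. v x $ i) x = (\<integral>y. ?z (x - y) * v y $ i + ?p (x - y) * v y $ i \<partial>lborel)"
        unfolding conv_def km by (simp only: distrib_right)
      also have "\<dots> = (\<integral>y. ?z (x - y) * v y $ i \<partial>lborel) + (\<integral>y. ?p (x - y) * v y $ i \<partial>lborel)"
        by (rule Bochner_Integration.integral_add[OF conv_integrable[OF sz tv] conv_integrable[OF schwartz_partial[OF sp] tv]])
      also have "(\<integral>y. ?z (x - y) * v y $ i \<partial>lborel) = (if i = j then conv (ker D) (\<lambda>x. v x $ i) x else 0)"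
        by (simp add: conv_def)
      finally show ?thesis by (simp only: conv_def)
    qed
    have "(\<Sum>i\<in>UNIV. conv (ker (m i j)) (\<lambda>x. v x $ i) x) = conv (ker D) (\<lambda>x. v x $ j) x"
      unfolding c sum.distrib conv_div_free[OF sp v d] by simp
    also have "\<dots> = conv (conv (hk r) (hk r)) (\<lambda>x. v x $ j) x - conv (conv (hk \<epsilon>) (hk \<epsilon>)) (\<lambda>x. v x $ j) x"
    proof -
      have "ker D = (\<lambda>x. conv (hk r) (hk r) x - conv (hk \<epsilon>) (hk \<epsilon>) x)" by (rule ext) (rule kD)
      then show ?thesis using conv_diff_left[OF schwartz_hk_hk[OF r] schwartz_hk_hk[OF e(1)] tv] by simp
    qed
    finally show ?thesis .
  qed
  show ?thesis
    apply (rule exI[of _ "\<lambda>i j. ker (m i j)"])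
    apply (intro conjI allI impI)
    subgoal by (rule schwartz_ker[OF bm])
    subgoal by (rule cm)
    subgoal by (rule partial_ker_sum_zero[OF bm zm])
    subgoal for v A j x using fin[of v A j x] by blast
    done
qed

text \<open>Cutting v off to a ball makes the result Schwartz but destroys the divergence condition;
  the Leray kernel, applied after the cut-off, restores it. The error is the removed low frequencies
  (\<delta>/2) plus three cut-off components (\<delta>/6 each).\<close>

lemma div_free_approx:
  fixes v :: "R3 \<Rightarrow> R3"
  assumes r: "r > 0" and v: "\<And>i. LP 2 (\<lambda>x. v x $ i) (A i)" and d: "div_free v" and del: "\<delta> > 0"
  shows "\<exists>\<psi> :: 3 \<Rightarrow> R3 \<Rightarrow> real. (\<forall>j. schwartz (\<psi> j)) \<and> (\<forall>j. conv (hk (2 * r)) (\<psi> j) = \<psi> j) \<and>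
    (\<forall>x. (\<Sum>j\<in>UNIV. partial j (\<psi> j) x) = 0) \<and>
    (\<forall>j. LP 2 (\<lambda>x. conv (conv (hk r) (hk r)) (\<lambda>x. v x $ j) x - \<psi> j x) \<delta>)"
proof -
  let ?v = "\<lambda>i x. v x $ i"
  have r2: "2 * r > 0" using r by simp
  have "\<forall>\<^sub>F n in sequentially. \<forall>j\<in>UNIV. NP 2 (conv (hk (r / real (Suc n))) (?v j)) < \<delta> / (2 * c0)"
  proof (rule eventually_ball_finite)
    show "\<forall>j\<in>UNIV. \<forall>\<^sub>F n in sequentially. NP 2 (conv (hk (r / real (Suc n))) (?v j)) < \<delta> / (2 * c0)"
    proof
      fix j :: 3
      have "(\<lambda>n. r / real (Suc n)) \<longlonglongrightarrow> 0"
        using tendsto_mult_right[OF LIMSEQ_inverse_real_of_nat, of r] by (simp add: field_simps)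
      from conv_hk_low_freq[OF v[of j] _ this] r
      have "(\<lambda>n. NP 2 (conv (hk (r / real (Suc n))) (?v j))) \<longlonglongrightarrow> 0" by simp
      then show "\<forall>\<^sub>F n in sequentially. NP 2 (conv (hk (r / real (Suc n))) (?v j)) < \<delta> / (2 * c0)"
        by (rule order_tendstoD(2)) (use del c0_pos in simp)
    qed
  qed simp
  then obtain n0 where n0: "\<And>j. NP 2 (conv (hk (r / real (Suc n0))) (?v j)) < \<delta> / (2 * c0)"
    unfolding eventually_sequentially by blast
  \<comment> \<open>The lower frequency is chosen as a fraction of r, so that it is at most r as the
    kernel construction demands.\<close>
  define \<epsilon> where "\<epsilon> = r / real (Suc n0)"
  have e: "0 < \<epsilon>" "\<epsilon> \<le> r" using r by (simp_all add: \<epsilon>_def divide_le_eq)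
  from leray_kernel[OF e] obtain k :: "3 \<Rightarrow> 3 \<Rightarrow> R3 \<Rightarrow> real" where
    "(\<forall>i j. schwartz (k i j)) \<and> (\<forall>i j. conv (hk (2 * r)) (k i j) = k i j) \<and>
    (\<forall>i x. (\<Sum>j\<in>UNIV. partial j (k i j) x) = 0) \<and>
    (\<forall>v A. (\<forall>i. LP 2 (\<lambda>x. v x $ i) (A i)) \<longrightarrow> div_free v \<longrightarrow>
      (\<forall>j x. (\<Sum>i\<in>UNIV. conv (k i j) (\<lambda>x. v x $ i) x)
        = conv (conv (hk r) (hk r)) (\<lambda>x. v x $ j) x - conv (conv (hk \<epsilon>) (hk \<epsilon>)) (\<lambda>x. v x $ j) x))"
    by (rule exE)
  note K = this
  note ks = K[THEN conjunct1, rule_format]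
    and kc = K[THEN conjunct2, THEN conjunct1, rule_format]
    and kd = K[THEN conjunct2, THEN conjunct2, THEN conjunct1, rule_format]
    and kv = K[THEN conjunct2, THEN conjunct2, THEN conjunct2, rule_format, OF v d]
  define C where "C = (\<Sum>i\<in>UNIV. \<Sum>j\<in>UNIV. \<integral>y. \<bar>k i j y\<bar> \<partial>lborel)"
  have Cn: "0 \<le> (\<Sum>j\<in>UNIV. \<integral>y. \<bar>k i j y\<bar> \<partial>lborel)" for i by (intro sum_nonneg) simp
  have C0: "C \<ge> 0" unfolding C_def by (intro sum_nonneg) simp
  have C: "(\<integral>y. \<bar>k i j y\<bar> \<partial>lborel) \<le> C" for i j
  proof -
    have "(\<integral>y. \<bar>k i j y\<bar> \<partial>lborel) \<le> (\<Sum>j\<in>UNIV. \<integral>y. \<bar>k i j y\<bar> \<partial>lborel)"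
      by (rule member_le_sum) simp_all
    also have "\<dots> \<le> C" unfolding C_def by (rule member_le_sum) (simp_all add: Cn)
    finally show ?thesis .
  qed
  \<comment> \<open>C + 1 in place of C keeps the divisor positive; the sixth leaves \<delta>/2
    after summing over three components.\<close>
  define \<eta> where "\<eta> = \<delta> / 6 / (C + 1)"
  have eta: "\<eta> > 0" using del C0 by (simp add: \<eta>_def)
  let ?t = "\<lambda>n i x. indicator (cball 0 (real n)) x * v x $ i"
  have "\<forall>\<^sub>F n in sequentially. \<forall>i\<in>UNIV. NP 2 (\<lambda>x. v x $ i - ?t n i x) < \<eta>"
    by (rule eventually_ball_finite) (use order_tendstoD(2)[OF LP2_cutoff_tendsto(1)[OF v] eta] in simp_all)
  then obtain n where n: "\<And>i. NP 2 (\<lambda>x. v x $ i - ?t n i x) < \<eta>"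
    unfolding eventually_sequentially by blast
  let ?w = "?t n"
  have vt: "tame (?v i)" for i by (rule tame_LP2[OF v])
  have wi: "integrable lborel (?w i)" for i
  proof -
    have "LP 2 (indicator (cball 0 (real n))) (sqrt (measure lborel (cball (0::R3) (real n))))"
    proof (rule LPI)
      have s: "\<bar>indicator (cball (0::R3) (real n)) x :: real\<bar> ^ 2 = indicator (cball 0 (real n)) x" for x by (simp add: indicator_def)
      have f: "emeasure lborel (cball (0::R3) (real n)) < \<infinity>" by (rule emeasure_compact_finite) simp
      show "integrable lborel (\<lambda>x. \<bar>indicator (cball (0::R3) (real n)) x :: real\<bar> ^ 2)"
        unfolding s using f by (intro integrable_real_indicator) simp_all
      show "(\<integral>x. \<bar>indicator (cball (0::R3) (real n)) x :: real\<bar> ^ 2 \<partial>lborel) \<le> (sqrt (measure lborel (cball (0::R3) (real n)))) ^ 2"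
        unfolding s using f by simp
      show "(indicator (cball (0::R3) (real n)) :: R3 \<Rightarrow> real) \<in> borel_measurable borel"
        by (intro borel_measurable_indicator borel_closed closed_cball)
    qed simp
    from LP2_prod(2)[OF this v[of i]] show ?thesis .
  qed
  have w0: "?w i y = 0" if "norm y > real n" for i y using that by (simp add: indicator_def)
  have wt: "tame (?w i)" for i by (rule schwartz_conv_bounded_support(1)[OF ks wi w0 of_nat_0_le_iff])
  have ws: "schwartz (conv (k i j) (?w i))" for i j by (rule schwartz_conv_bounded_support(2)[OF ks wi w0 of_nat_0_le_iff])
  define \<psi> where "\<psi> j x = (\<Sum>i\<in>UNIV. conv (k i j) (?w i) x)" for j x
  have 1: "schwartz (\<psi> j)" for j unfolding \<psi>_def[abs_def] by (rule schwartz_sum) (rule ws)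
  have 2: "conv (hk (2 * r)) (\<psi> j) = \<psi> j" for j
  proof
    fix x
    have "conv (hk (2 * r)) (\<psi> j) x = (\<Sum>i\<in>UNIV. conv (hk (2 * r)) (conv (k i j) (?w i)) x)"
      unfolding \<psi>_def[abs_def] by (rule conv_sum_right[OF schwartz_hk[OF r2] schwartz_tame[OF ws]])
    also have "\<dots> = \<psi> j x" unfolding \<psi>_def
      by (rule sum.cong[OF refl]) (simp only: conv_assoc[OF schwartz_hk[OF r2] ks wt] kc)
    finally show "conv (hk (2 * r)) (\<psi> j) x = \<psi> j x" .
  qed
  have 3: "(\<Sum>j\<in>UNIV. partial j (\<psi> j) x) = 0" for x
  proof -
    have "partial j (\<psi> j) x = (\<Sum>i\<in>UNIV. conv (partial j (k i j)) (?w i) x)" for j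
      unfolding \<psi>_def[abs_def] partial_conv[OF ks wt, symmetric]
      by (rule partial_sum[OF conv_differentiable[OF ks wt]])
    then have "(\<Sum>j\<in>UNIV. partial j (\<psi> j) x) = (\<Sum>j\<in>UNIV. \<Sum>i\<in>UNIV. conv (partial j (k i j)) (?w i) x)" by simp
    also have "\<dots> = (\<Sum>i\<in>UNIV. \<Sum>j\<in>UNIV. conv (partial j (k i j)) (?w i) x)" by (rule sum.swap)
    also have "\<dots> = (\<Sum>i\<in>UNIV. conv (\<lambda>x. \<Sum>j\<in>UNIV. partial j (k i j) x) (?w i) x)"
      by (rule sum.cong[OF refl]) (rule conv_sum_left[OF schwartz_partial[OF ks] wt, symmetric])
    also have "\<dots> = 0" unfolding kd by (simp add: conv_def)
    finally show ?thesis .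
  qed
  have 4: "LP 2 (\<lambda>x. conv (conv (hk r) (hk r)) (?v j) x - \<psi> j x) \<delta>" for j
  proof -
    have eq: "conv (conv (hk r) (hk r)) (?v j) x - \<psi> j x
      = (\<Sum>i\<in>UNIV. conv (k i j) (\<lambda>x. ?v i x - ?w i x) x) + conv (hk \<epsilon>) (conv (hk \<epsilon>) (?v j)) x" for x
    proof -
      have "(\<Sum>i\<in>UNIV. conv (k i j) (\<lambda>x. ?v i x - ?w i x) x) = (\<Sum>i\<in>UNIV. conv (k i j) (?v i) x) - \<psi> j x"
        unfolding \<psi>_def sum_subtractf[symmetric] by (rule sum.cong[OF refl]) (rule conv_diff_right[OF ks vt wt])
      then show ?thesis
        using kv[of j x] conv_assoc[OF schwartz_hk[OF e(1)] schwartz_hk[OF e(1)] vt[of j], of x] by linarith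
    qed
    have a: "LP 2 (conv (k i j) (\<lambda>x. ?v i x - ?w i x)) (\<delta> / 6)" for i
    proof (rule LP_mono[OF LP_conv_schwartz[OF ks NP_LP[OF LP2_cutoff_tendsto(2)[OF v]]]])
      have "(\<integral>y. \<bar>k i j y\<bar> \<partial>lborel) * NP 2 (\<lambda>x. ?v i x - ?w i x) \<le> C * \<eta>"
        by (rule mult_mono[OF C less_imp_le[OF n] C0 NP_nonneg])
      also have "\<dots> \<le> (C + 1) * \<eta>" using eta by (intro mult_right_mono) simp_all
      also have "\<dots> = \<delta> / 6"
      proof -
        have "C + 1 \<noteq> 0" using C0 by simp
        then show ?thesis unfolding \<eta>_def by (rule nonzero_mult_div_cancel_left[THEN trans[OF times_divide_eq_right]])
      qed
      finally show "(\<integral>y. \<bar>k i j y\<bar> \<partial>lborel) * NP 2 (\<lambda>x. ?v i x - ?w i x) \<le> \<delta> / 6" .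
    qed simp_all
    have b: "LP 2 (conv (hk \<epsilon>) (conv (hk \<epsilon>) (?v j))) (\<delta> / 2)"
    proof (rule LP_mono[OF LP_conv_hk[OF e(1) NP_LP[OF LP_conv_hk[OF e(1) v]]]])
      have "c0 * NP 2 (conv (hk \<epsilon>) (?v j)) \<le> c0 * (\<delta> / (2 * c0))"
        using n0[of j] c0_pos unfolding \<epsilon>_def by (intro mult_left_mono) simp_all
      also have "\<dots> = \<delta> / 2" using c0_pos by simp
      finally show "c0 * NP 2 (conv (hk \<epsilon>) (?v j)) \<le> \<delta> / 2" .
    qed simp_all
    have s: "LP 2 (\<lambda>x. \<Sum>i\<in>(UNIV::3 set). conv (k i j) (\<lambda>x. ?v i x - ?w i x) x) (\<Sum>i\<in>(UNIV::3 set). \<delta> / 6)"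
      by (rule LP_sum) (simp_all add: a)
    have t: "(\<Sum>i\<in>(UNIV::3 set). \<delta> / 6) + \<delta> / 2 = \<delta>" by simp
    show ?thesis unfolding eq using LP_add[OF s b zero_less_numeral] unfolding t .
  qed
  show ?thesis using 1 2 3 4 by blast
qed

end

lemma partials_zero: "partials is (\<lambda>x. 0) = (\<lambda>x. 0)"
  by (induction "is") simp_all

lemma C1_schwartz_const:
  fixes \<Psi> :: "R3 \<Rightarrow> R3"
  assumes "schwartz \<Psi>" shows "C1_schwartz T (\<lambda>_. \<Psi>) (\<lambda>_ _. 0)"
proof -
  have "schwartz_seminorm k is (\<lambda>x. 0 :: R3) = 0" for k "is"
    by (simp add: schwartz_seminorm_def partials_zero)
  then show ?thesis using assms by (simp add: C1_schwartz_def schwartz_tendsto_def)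
qed

section \<open>The weak formulation tested with band-limited fields\<close>

context lp_cut
begin

lemma bf_diff:
  fixes u :: "R3 \<Rightarrow> R3"
  assumes u: "in_Lp 2 u" and G: "\<And>i j. G i j \<in> borel_measurable borel" "\<And>i j x. \<bar>G i j x\<bar> \<le> M"
    and H: "\<And>i j. H i j \<in> borel_measurable borel" "\<And>i j x. \<bar>H i j x\<bar> \<le> N"
  shows "bf u (\<lambda>i j x. G i j x - H i j x) = bf u G - bf u H"
proof -
  have "(\<integral>x. u x $ i * u x $ j * (G i j x - H i j x) \<partial>lborel)
    = (\<integral>x. u x $ i * u x $ j * G i j x \<partial>lborel) - (\<integral>x. u x $ i * u x $ j * H i j x \<partial>lborel)" for i j
    unfolding right_diff_distrib
    by (rule Bochner_Integration.integral_diff[OF bf_integrable[OF u G] bf_integrable[OF u H]])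
  then show ?thesis unfolding bf_def by (simp only: sum_subtractf)
qed

text \<open>Bernstein's inequality: the derivative falls on the reproducing kernel, and an L^2 bound
  alone controls the gradient in L^3 and in the supremum norm.\<close>

lemma band_limited_gradient:
  assumes R: "R > 0"
  shows "\<exists>C\<ge>0. \<forall>i g A. LP 2 g A \<longrightarrow> conv (hk R) g = g \<longrightarrow>
    partial i g \<in> borel_measurable borel \<and> LP 3 (partial i g) (C * A) \<and> (\<forall>x. \<bar>partial i g x\<bar> \<le> C * A)"
proof -
  have sp: "schwartz (partial i (hk R))" for i by (rule schwartz_partial[OF schwartz_hk[OF R]])
  have "\<forall>i. \<exists>C\<ge>0. \<forall>f A. LP 2 f A \<longrightarrow> LP 2 (conv (partial i (hk R)) f) (C * A) \<and>
      LP 3 (conv (partial i (hk R)) f) (C * A) \<and> (\<forall>x. \<bar>conv (partial i (hk R)) f x\<bar> \<le> C * A)"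
    by (rule allI) (rule schwartz_conv_const[OF sp])
  then obtain c where c: "\<forall>i. c i \<ge> 0 \<and> (\<forall>f A. LP 2 f A \<longrightarrow> LP 2 (conv (partial i (hk R)) f) (c i * A) \<and>
      LP 3 (conv (partial i (hk R)) f) (c i * A) \<and> (\<forall>x. \<bar>conv (partial i (hk R)) f x\<bar> \<le> c i * A))"
    by (rule choice[THEN exE])
  define C where "C = (\<Sum>i\<in>UNIV. c i)"
  have c0: "c i \<ge> 0" for i using c by blast
  have C0: "C \<ge> 0" unfolding C_def by (intro sum_nonneg c0)
  have cC: "c i \<le> C" for i unfolding C_def by (rule member_le_sum) (simp_all add: c0)
  have "partial i g \<in> borel_measurable borel \<and> LP 3 (partial i g) (C * A) \<and> (\<forall>x. \<bar>partial i g x\<bar> \<le> C * A)"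
    if g: "LP 2 g A" and b: "conv (hk R) g = g" for i g A
  proof -
    have e: "partial i g = conv (partial i (hk R)) g"
      using partial_conv[OF schwartz_hk[OF R] tame_LP2[OF g], of i] by (simp only: b)
    have m: "c i * A \<le> C * A" by (rule mult_right_mono[OF cC LP_nonneg[OF g]])
    have l: "LP 3 (partial i g) (c i * A)" and s: "\<bar>partial i g x\<bar> \<le> c i * A" for x
      unfolding e using c g by blast+
    show ?thesis using LP_measurable[OF l] LP_mono[OF l m] order_trans[OF s m] by blast
  qed
  then show ?thesis using C0 by blast
qed

lemma conv_hk_hk_band:
  assumes r: "r > 0" and v: "tame v"
  shows "conv (hk (2 * r)) (conv (conv (hk r) (hk r)) v) = conv (conv (hk r) (hk r)) v"
proof
  fix x
  have r2: "2 * r > 0" using r by simp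
  have "conv (hk (2 * r)) (conv (conv (hk r) (hk r)) v) x = conv (conv (hk (2 * r)) (conv (hk r) (hk r))) v x"
    by (rule conv_assoc[OF schwartz_hk[OF r2] schwartz_hk_hk[OF r] v])
  also have "conv (hk (2 * r)) (conv (hk r) (hk r)) = conv (hk r) (hk r)"
  proof
    fix y
    show "conv (hk (2 * r)) (conv (hk r) (hk r)) y = conv (hk r) (hk r) y"
      using conv_assoc[OF schwartz_hk[OF r2] schwartz_hk[OF r] schwartz_tame[OF schwartz_hk[OF r]], of y]
      by (simp only: hk_conv[OF r order_refl])
  qed
  finally show "conv (hk (2 * r)) (conv (conv (hk r) (hk r)) v) x = conv (conv (hk r) (hk r)) v x" .
qed

text \<open>The bound keeps the norm of the once filtered function, because that is the quantity
  measured by the filtered energy.\<close>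

lemma LP_conv_hk_hk:
  assumes r: "r > 0" and v: "LP 2 v A"
  shows "LP 2 (conv (conv (hk r) (hk r)) v) (c0 * NP 2 (conv (hk r) v))"
proof -
  have "conv (conv (hk r) (hk r)) v = conv (hk r) (conv (hk r) v)"
    by (rule ext) (rule conv_assoc[OF schwartz_hk[OF r] schwartz_hk[OF r] tame_LP2[OF v], symmetric])
  then show ?thesis using LP_conv_hk[OF r NP_LP[OF LP_conv_hk[OF r v]]] by simp
qed

end

context euler
begin

text \<open>The defect of the weak formulation between the times s and t for a test field g constant
  in time. The half-open interval makes consecutive time steps add up without overlap.\<close>

definition W :: "real \<Rightarrow> real \<Rightarrow> (3 \<Rightarrow> R3 \<Rightarrow> real) \<Rightarrow> real" where
  "W s t g = (\<Sum>j\<in>UNIV. \<integral>x. (U t x $ j - U s x $ j) * g j x \<partial>lborel)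
    - (\<integral>\<tau>. indicator {s<..t} \<tau> * bf (U \<tau>) (\<lambda>i j. partial i (g j)) \<partial>lborel)"

lemma l2_inner_U:
  assumes "\<And>j. schwartz (\<psi> j)"
  shows "l2_inner (U t) (\<lambda>x. \<chi> j. \<psi> j x) = (\<Sum>j\<in>UNIV. \<integral>x. U t x $ j * \<psi> j x \<partial>lborel)"
proof -
  have "integrable lborel (\<lambda>x. U t x $ j * \<psi> j x)" for j
  proof -
    obtain B where "LP 2 (\<psi> j) B" using schwartz_LP2[OF assms] by blast
    from LP2_prod(2)[OF U_LP2 this] show ?thesis .
  qed
  then show ?thesis unfolding l2_inner_def inner_vec_def
    by (simp add: Bochner_Integration.integral_sum)
qed

lemma euler_b_U:
  assumes s: "\<And>j. schwartz (\<psi> j)"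
  shows "euler_b (U t) (\<lambda>x. \<chi> j. \<psi> j x) (U t) = bf (U t) (\<lambda>i j. partial i (\<psi> j))"
proof -
  have i: "integrable lborel (\<lambda>x. U t x $ i * U t x $ j * partial i (\<psi> j) x)" for i j
  proof -
    have sp: "schwartz (partial i (\<psi> j))" by (rule schwartz_partial[OF s])
    obtain C where C: "C > 0" "\<And>x. norm (partial i (\<psi> j) x) \<le> C / (1 + norm x) ^ 0"
      using schwartz_bound[OF sp] by blast
    then have "\<bar>partial i (\<psi> j) x\<bar> \<le> C" for x by simp
    from bf_integrable[where G="\<lambda>_ _. partial i (\<psi> j)", OF U_L2 schwartz_measurable[OF sp] this]
    show ?thesis .
  qed
  have "(\<Sum>i\<in>UNIV. U t x $ i *\<^sub>R partial i (\<lambda>x. \<chi> j. \<psi> j x :: R3) x) \<bullet> U t x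
    = (\<Sum>i\<in>UNIV. \<Sum>j\<in>UNIV. U t x $ i * U t x $ j * partial i (\<psi> j) x)" for x
  proof -
    have "(\<Sum>i\<in>UNIV. U t x $ i *\<^sub>R partial i (\<lambda>x. \<chi> j. \<psi> j x :: R3) x) \<bullet> U t x
      = (\<Sum>j\<in>UNIV. (\<Sum>i\<in>UNIV. U t x $ i * partial i (\<psi> j) x) * U t x $ j)"
      by (simp add: inner_vec_def partial_vec[OF schwartz_smooth[OF s]])
    also have "\<dots> = (\<Sum>j\<in>UNIV. \<Sum>i\<in>UNIV. U t x $ i * U t x $ j * partial i (\<psi> j) x)"
      by (simp add: sum_distrib_left sum_distrib_right mult_ac)
    finally show ?thesis by (subst sum.swap)
  qed
  then show ?thesis unfolding euler_b_def bf_def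
    by (simp only: Bochner_Integration.integral_sum i Bochner_Integration.integrable_sum)
qed

lemma weak_const:
  assumes s: "\<And>j. schwartz (\<psi> j)" and d: "\<And>x. (\<Sum>j\<in>UNIV. partial j (\<psi> j) x) = 0" and t: "t \<in> {0..T}"
  shows "(\<Sum>j\<in>UNIV. \<integral>x. U t x $ j * \<psi> j x \<partial>lborel) - (\<Sum>j\<in>UNIV. \<integral>x. U 0 x $ j * \<psi> j x \<partial>lborel)
    = (\<integral>\<tau>. indicator {0..t} \<tau> * bf (U \<tau>) (\<lambda>i j. partial i (\<psi> j)) \<partial>lborel)"
proof -
  let ?P = "\<lambda>x. (\<chi> j. \<psi> j x) :: R3"
  have z: "0 \<in> {0..T}" using T by simp
  have dv: "(\<Sum>i\<in>UNIV. partial i ?P x $ i) = 0" for x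
    using d[of x] by (simp add: partial_vec[OF schwartz_smooth[OF s]])
  from weak have "\<forall>\<psi> \<psi>'. C1_schwartz T \<psi> \<psi>' \<and> (\<forall>t\<in>{0..T}. \<forall>x. (\<Sum>i\<in>UNIV. partial i (\<psi> t) x $ i) = 0) \<longrightarrow>
        (\<forall>t\<in>{0..T}. l2_inner (u t) (\<psi> t) - l2_inner (u 0) (\<psi> 0) - (LBINT s:{0..t}. l2_inner (u s) (\<psi>' s))
           = (LBINT s:{0..t}. euler_b (u s) (\<psi> s) (u s)))"
    unfolding weak_euler_solution_def by (elim conjE)
  from this[THEN spec[of _ "\<lambda>_. ?P"], THEN spec[of _ "\<lambda>_ _. 0"]] C1_schwartz_const[OF schwartz_vec[of \<psi>, OF s]] dv t
  have "l2_inner (u t) ?P - l2_inner (u 0) ?P - (LBINT s:{0..t}. l2_inner (u s) (\<lambda>_. 0))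
    = (LBINT s:{0..t}. euler_b (u s) ?P (u s))" by blast
  then have "l2_inner (u t) ?P - l2_inner (u 0) ?P = (LBINT s:{0..t}. euler_b (u s) ?P (u s))"
    by (simp add: l2_inner_def)
  also have "\<dots> = (\<integral>\<tau>. indicator {0..t} \<tau> * bf (U \<tau>) (\<lambda>i j. partial i (\<psi> j)) \<partial>lborel)"
    unfolding set_lebesgue_integral_def
  proof (rule Bochner_Integration.integral_cong[OF refl])
    fix \<tau>
    show "indicat_real {0..t} \<tau> *\<^sub>R euler_b (u \<tau>) ?P (u \<tau>) = indicator {0..t} \<tau> * bf (U \<tau>) (\<lambda>i j. partial i (\<psi> j))"
    proof (cases "\<tau> \<in> {0..t}")
      case True
      then have "\<tau> \<in> {0..T}" using t by simp
      then show ?thesis using euler_b_U[of \<psi> \<tau>, OF s] True by (simp only: U_eq real_scaleR_def)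
    qed simp
  qed
  finally have "l2_inner (U t) ?P - l2_inner (U 0) ?P
    = (\<integral>\<tau>. indicator {0..t} \<tau> * bf (U \<tau>) (\<lambda>i j. partial i (\<psi> j)) \<partial>lborel)" by (simp only: U_eq[OF t] U_eq[OF z])
  then show ?thesis by (simp only: l2_inner_U[of \<psi>, OF s])
qed

lemma grad_time_integrable:
  assumes R: "R > 0" and g: "\<And>j. LP 2 (g j) A" and b: "\<And>j. conv (hk R) (g j) = g j"
    and S: "S \<in> sets borel" "S \<subseteq> {0..T}"
  shows "integrable lborel (\<lambda>\<tau>. indicator S \<tau> * bf (U \<tau>) (\<lambda>i j. partial i (g j)))"
proof -
  obtain C where C: "\<forall>i g A. LP 2 g A \<longrightarrow> conv (hk R) g = g \<longrightarrow>
    partial i g \<in> borel_measurable borel \<and> LP 3 (partial i g) (C * A) \<and> (\<forall>x. \<bar>partial i g x\<bar> \<le> C * A)"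
    using band_limited_gradient[OF R] by blast
  have 1: "partial i (g j) \<in> borel_measurable borel" "LP 3 (partial i (g j)) (C * A)" "\<bar>partial i (g j) x\<bar> \<le> C * A" for i j x
    using C g b by blast+
  show ?thesis by (rule bf_time_integrable(1)[where G="\<lambda>i j. partial i (g j)", OF 1(1) 1(3) 1(2) S])
qed

lemma W_schwartz:
  assumes s: "\<And>j. schwartz (\<psi> j)" and d: "\<And>x. (\<Sum>j\<in>UNIV. partial j (\<psi> j) x) = 0"
    and R: "R > 0" and b: "\<And>j. conv (hk R) (\<psi> j) = \<psi> j" and t: "0 \<le> \<sigma>" "\<sigma> \<le> t" "t \<le> T"
  shows "W \<sigma> t \<psi> = 0"
proof -
  let ?b = "\<lambda>\<tau>. bf (U \<tau>) (\<lambda>i j. partial i (\<psi> j))"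
  have "\<exists>A. \<forall>j. LP 2 (\<psi> j) A"
  proof -
    have "\<forall>j. \<exists>A. LP 2 (\<psi> j) A" using schwartz_LP2[OF s] by blast
    then obtain A where A: "\<forall>j. LP 2 (\<psi> j) (A j)" by (rule choice[THEN exE])
    have "LP 2 (\<psi> j) (\<Sum>j\<in>UNIV. A j)" for j
    proof (rule LP_mono)
      show "LP 2 (\<psi> j) (A j)" using A by blast
      have "A i \<ge> 0" for i using A LP_nonneg by blast
      then show "A j \<le> (\<Sum>j\<in>UNIV. A j)" by (intro member_le_sum) simp_all
    qed
    then show ?thesis by blast
  qed
  then obtain A where A: "LP 2 (\<psi> j) A" for j by blast
  have i: "integrable lborel (\<lambda>\<tau>. indicator {0..\<sigma>} \<tau> * ?b \<tau>)" "integrable lborel (\<lambda>\<tau>. indicator {0..t} \<tau> * ?b \<tau>)"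
    using t by (intro grad_time_integrable[OF R A b]; simp)+
  have "(\<integral>\<tau>. indicator {\<sigma><..t} \<tau> * ?b \<tau> \<partial>lborel) = (\<integral>\<tau>. indicator {0..t} \<tau> * ?b \<tau> - indicator {0..\<sigma>} \<tau> * ?b \<tau> \<partial>lborel)"
    using t by (intro Bochner_Integration.integral_cong refl) (auto simp: indicator_def)
  also have "\<dots> = (\<integral>\<tau>. indicator {0..t} \<tau> * ?b \<tau> \<partial>lborel) - (\<integral>\<tau>. indicator {0..\<sigma>} \<tau> * ?b \<tau> \<partial>lborel)"
    by (rule Bochner_Integration.integral_diff[OF i(2,1)])
  finally have e: "(\<integral>\<tau>. indicator {\<sigma><..t} \<tau> * ?b \<tau> \<partial>lborel)
    = (\<Sum>j\<in>UNIV. \<integral>x. U t x $ j * \<psi> j x \<partial>lborel) - (\<Sum>j\<in>UNIV. \<integral>x. U \<sigma> x $ j * \<psi> j x \<partial>lborel)"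
    using weak_const[of \<psi> t, OF s d] weak_const[of \<psi> \<sigma>, OF s d] t by simp
  have "(\<integral>x. (U t x $ j - U \<sigma> x $ j) * \<psi> j x \<partial>lborel) = (\<integral>x. U t x $ j * \<psi> j x \<partial>lborel) - (\<integral>x. U \<sigma> x $ j * \<psi> j x \<partial>lborel)" for j
    unfolding left_diff_distrib
    by (rule Bochner_Integration.integral_diff[OF LP2_prod(2)[OF U_LP2 A] LP2_prod(2)[OF U_LP2 A]])
  then show ?thesis unfolding W_def e by (simp only: sum_subtractf diff_self)
qed

lemma W_diff:
  assumes R: "R > 0" and g: "\<And>j. LP 2 (g j) A" "\<And>j. conv (hk R) (g j) = g j"
    and h: "\<And>j. LP 2 (h j) B" "\<And>j. conv (hk R) (h j) = h j" and t: "0 \<le> s" "s \<le> t" "t \<le> T"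
  shows "W s t (\<lambda>j x. g j x - h j x) = W s t g - W s t h"
proof -
  have S: "{s<..t} \<in> sets borel" "{s<..t} \<subseteq> {0..T}" using t by auto
  obtain C where C: "\<forall>i g A. LP 2 g A \<longrightarrow> conv (hk R) g = g \<longrightarrow>
    partial i g \<in> borel_measurable borel \<and> LP 3 (partial i g) (C * A) \<and> (\<forall>x. \<bar>partial i g x\<bar> \<le> C * A)"
    using band_limited_gradient[OF R] by blast
  have 1: "partial i (g j) \<in> borel_measurable borel" "\<bar>partial i (g j) x\<bar> \<le> C * A" for i j x using C g by blast+
  have 2: "partial i (h j) \<in> borel_measurable borel" "\<bar>partial i (h j) x\<bar> \<le> C * B" for i j x using C h by blast+
  have dg: "f differentiable (at x)" if "LP 2 f a" "conv (hk R) f = f" for f a x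
    using conv_differentiable[OF schwartz_hk[OF R] tame_LP2[OF that(1)], of x] by (simp only: that(2))
  have p: "partial i (\<lambda>x. g j x - h j x) x = partial i (g j) x - partial i (h j) x" for i j x
  proof -
    have n: "(\<lambda>x. - h j x) differentiable (at x)" "partial i (\<lambda>x. - h j x) x = - partial i (h j) x"
      using partial_bounded_linear[OF bounded_linear_minus[OF bounded_linear_ident] dg[OF h]] by simp_all
    show ?thesis using partial_add[OF dg[OF g] n(1), of i j] n(2) by simp
  qed
  have "bf (U \<tau>) (\<lambda>i j. partial i (\<lambda>x. g j x - h j x)) = bf (U \<tau>) (\<lambda>i j. partial i (g j)) - bf (U \<tau>) (\<lambda>i j. partial i (h j))" for \<tau>
    using bf_diff[where G="\<lambda>i j. partial i (g j)" and H="\<lambda>i j. partial i (h j)", OF U_L2 1 2] by (simp only: p[abs_def])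
  then have a: "(\<integral>\<tau>. indicator {s<..t} \<tau> * bf (U \<tau>) (\<lambda>i j. partial i (\<lambda>x. g j x - h j x)) \<partial>lborel)
    = (\<integral>\<tau>. indicator {s<..t} \<tau> * bf (U \<tau>) (\<lambda>i j. partial i (g j)) \<partial>lborel) - (\<integral>\<tau>. indicator {s<..t} \<tau> * bf (U \<tau>) (\<lambda>i j. partial i (h j)) \<partial>lborel)"
    using Bochner_Integration.integral_diff[OF grad_time_integrable[OF R g S] grad_time_integrable[OF R h S]]
    by (simp only: right_diff_distrib)
  note ud = LP_diff[OF U_LP2[of t] U_LP2[of s] zero_less_numeral]
  have "(\<integral>x. (U t x $ j - U s x $ j) * (g j x - h j x) \<partial>lborel)
    = (\<integral>x. (U t x $ j - U s x $ j) * g j x \<partial>lborel) - (\<integral>x. (U t x $ j - U s x $ j) * h j x \<partial>lborel)" for j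
    unfolding right_diff_distrib
    by (rule Bochner_Integration.integral_diff[OF LP2_prod(2)[OF ud g(1)] LP2_prod(2)[OF ud h(1)]])
  then show ?thesis unfolding W_def a by (simp add: sum_subtractf)
qed

text \<open>On band-limited fields the defect is continuous in the L^2 norm, with the trilinear part
  controlled by the time integral of the square of \<open>bet\<close>. Approximation of test fields
  in L^2 is therefore enough.\<close>

lemma W_bound:
  assumes R: "R > 0" and t: "0 \<le> s" "s \<le> t" "t \<le> T"
  shows "\<exists>K\<ge>0. \<forall>g a. (\<forall>j. LP 2 (g j) a) \<longrightarrow> (\<forall>j. conv (hk R) (g j) = g j) \<longrightarrow> \<bar>W s t g\<bar> \<le> K * a"
proof -
  have S: "{s<..t} \<in> sets borel" "{s<..t} \<subseteq> {0..T}" using t by auto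
  obtain C where C0: "C \<ge> 0" and C: "\<forall>i g A. LP 2 g A \<longrightarrow> conv (hk R) g = g \<longrightarrow>
    partial i g \<in> borel_measurable borel \<and> LP 3 (partial i g) (C * A) \<and> (\<forall>x. \<bar>partial i g x\<bar> \<le> C * A)"
    using band_limited_gradient[OF R] by blast
  let ?I = "\<integral>t. indicator {0..T} t * bet t ^ 2 \<partial>lborel"
  have I0: "?I \<ge> 0" by (intro integral_nonneg_AE AE_I2) simp
  define K where "K = 3 * (nU t + nU s) + KU * C * ?I"
  have nn: "nU t \<ge> 0" "nU s \<ge> 0" by (rule LP_nonneg[OF U_LP2])+
  have K0: "K \<ge> 0" unfolding K_def using nn KU_nonneg C0 I0 by simp
  have "\<bar>W s t g\<bar> \<le> K * a" if g: "\<And>j. LP 2 (g j) a" and b: "\<And>j. conv (hk R) (g j) = g j" for g a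
  proof -
    have 1: "partial i (g j) \<in> borel_measurable borel" "LP 3 (partial i (g j)) (C * a)" "\<bar>partial i (g j) x\<bar> \<le> C * a" for i j x
      using C g b by blast+
    have x: "\<bar>\<integral>\<tau>. indicator {s<..t} \<tau> * bf (U \<tau>) (\<lambda>i j. partial i (g j)) \<partial>lborel\<bar> \<le> KU * (C * a) * ?I"
      by (rule bf_time_integrable(2)[where G="\<lambda>i j. partial i (g j)", OF 1(1) 1(3) 1(2) S])
    have y: "\<bar>\<integral>x. (U t x $ j - U s x $ j) * g j x \<partial>lborel\<bar> \<le> (nU t + nU s) * a" for j
      by (rule LP2_prod(3)[OF LP_diff[OF U_LP2[of t] U_LP2[of s] zero_less_numeral] g])
    have "\<bar>\<Sum>j\<in>UNIV. \<integral>x. (U t x $ j - U s x $ j) * g j x \<partial>lborel\<bar> \<le> (\<Sum>j\<in>(UNIV::3 set). (nU t + nU s) * a)"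
      by (rule order_trans[OF sum_abs sum_mono[OF y]])
    then have z: "\<bar>\<Sum>j\<in>UNIV. \<integral>x. (U t x $ j - U s x $ j) * g j x \<partial>lborel\<bar> \<le> 3 * ((nU t + nU s) * a)" by simp
    have "K * a = 3 * ((nU t + nU s) * a) + KU * (C * a) * ?I" by (simp add: K_def algebra_simps)
    then show ?thesis unfolding W_def using order_trans[OF abs_triangle_ineq4 add_mono[OF z x]] by (simp only:)
  qed
  then show ?thesis using K0 by blast
qed

text \<open>The defect vanishes on divergence-free band-limited Schwartz fields, which approximate
  the doubly filtered field within the same frequency band; linearity and \<open>W_bound\<close>
  carry the identity over.\<close>

lemma W_smoothed:
  fixes v :: "R3 \<Rightarrow> R3"
  assumes r: "r > 0" and v: "\<And>i. LP 2 (\<lambda>x. v x $ i) A" and d: "div_free v" and t: "0 \<le> s" "s \<le> t" "t \<le> T"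
  shows "W s t (\<lambda>j. conv (conv (hk r) (hk r)) (\<lambda>x. v x $ j)) = 0"
proof -
  let ?g = "\<lambda>j. conv (conv (hk r) (hk r)) (\<lambda>x. v x $ j)"
  have r2: "2 * r > 0" using r by simp
  obtain K where K0: "K \<ge> 0" and K: "\<And>g a. (\<forall>j. LP 2 (g j) a) \<Longrightarrow> (\<forall>j. conv (hk (2 * r)) (g j) = g j) \<Longrightarrow> \<bar>W s t g\<bar> \<le> K * a"
    using W_bound[OF r2 t] by blast
  have gb: "conv (hk (2 * r)) (?g j) = ?g j" for j by (rule conv_hk_hk_band[OF r tame_LP2[OF v]])
  have gl: "LP 2 (?g j) (c0 * (c0 * A))" for j
    by (rule LP_mono[OF LP_conv_hk_hk[OF r v] mult_left_mono[OF NP_le[OF LP_conv_hk[OF r v zero_less_numeral] zero_less_numeral] less_imp_le[OF c0_pos]]])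
  have "\<bar>W s t ?g\<bar> \<le> K * \<delta>" if del: "\<delta> > 0" for \<delta>
  proof -
    from div_free_approx[where A="\<lambda>_. A", OF r v d del] obtain \<psi> :: "3 \<Rightarrow> R3 \<Rightarrow> real" where
      "(\<forall>j. schwartz (\<psi> j)) \<and> (\<forall>j. conv (hk (2 * r)) (\<psi> j) = \<psi> j) \<and>
    (\<forall>x. (\<Sum>j\<in>UNIV. partial j (\<psi> j) x) = 0) \<and> (\<forall>j. LP 2 (\<lambda>x. ?g j x - \<psi> j x) \<delta>)" by (rule exE)
    note P = this
    note ps = P[THEN conjunct1, rule_format] and pb = P[THEN conjunct2, THEN conjunct1, rule_format]
      and pd = P[THEN conjunct2, THEN conjunct2, THEN conjunct1, rule_format]
      and pl = P[THEN conjunct2, THEN conjunct2, THEN conjunct2, rule_format]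
    have pl2: "LP 2 (\<psi> j) (c0 * (c0 * A) + \<delta>)" for j
      using LP_diff[OF gl[of j] pl[of j] zero_less_numeral] by simp
    have db: "conv (hk (2 * r)) (\<lambda>x. ?g j x - \<psi> j x) = (\<lambda>x. ?g j x - \<psi> j x)" for j
    proof
      fix x
      show "conv (hk (2 * r)) (\<lambda>x. ?g j x - \<psi> j x) x = ?g j x - \<psi> j x"
        using conv_diff_right[OF schwartz_hk[OF r2] tame_LP2[OF gl[of j]] schwartz_tame[OF ps[of j]], of x]
        by (simp only: gb pb)
    qed
    have "W s t ?g = W s t (\<lambda>j x. ?g j x - \<psi> j x)"
      using W_diff[where g="?g" and h=\<psi>, OF r2 gl gb pl2 pb t] W_schwartz[where \<psi>=\<psi>, OF ps pd r2 pb t] by simp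
    also have "\<bar>\<dots>\<bar> \<le> K * \<delta>" using K[of "\<lambda>j x. ?g j x - \<psi> j x" \<delta>] pl db by blast
    finally show ?thesis .
  qed
  note b = this
  have "\<bar>W s t ?g\<bar> \<le> 0"
  proof (rule field_le_epsilon)
    fix e :: real assume e: "e > 0"
    have "\<bar>W s t ?g\<bar> \<le> K * (e / (K + 1))" using K0 e by (intro b) simp
    also have "\<dots> \<le> e" using K0 e by (simp add: field_simps)
    finally show "\<bar>W s t ?g\<bar> \<le> 0 + e" by simp
  qed
  then show ?thesis by simp
qed

end

text \<open>The increments of \<open>F\<close> over a fine partition only see \<open>b\<close> near its diagonal.\<close>

lemma diagonal_integral:
  fixes b :: "real \<Rightarrow> real \<Rightarrow> real" and F w :: "real \<Rightarrow> real"
  assumes t: "0 \<le> t"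
    and inc: "\<And>s s'. 0 \<le> s \<Longrightarrow> s \<le> s' \<Longrightarrow> s' \<le> t \<Longrightarrow>
      F s' - F s = (\<integral>\<tau>. indicator {s<..s'} \<tau> * b s' \<tau> \<partial>lborel) + (\<integral>\<tau>. indicator {s<..s'} \<tau> * b s \<tau> \<partial>lborel)"
    and int: "\<And>s s' \<sigma>. 0 \<le> s \<Longrightarrow> s \<le> s' \<Longrightarrow> s' \<le> t \<Longrightarrow> integrable lborel (\<lambda>\<tau>. indicator {s<..s'} \<tau> * b \<sigma> \<tau>)"
    and cont: "\<And>\<tau>. continuous_on UNIV (\<lambda>s. b s \<tau>)"
    and bd: "AE \<tau> in lborel. \<tau> \<in> {0..t} \<longrightarrow> (\<forall>s. \<bar>b s \<tau>\<bar> \<le> w \<tau>)"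
    and w: "integrable lborel (\<lambda>\<tau>. indicator {0..t} \<tau> * w \<tau>)"
  shows "(\<lambda>\<tau>. indicator {0<..t} \<tau> * b \<tau> \<tau>) \<in> borel_measurable borel"
    and "F t - F 0 = 2 * (\<integral>\<tau>. indicator {0<..t} \<tau> * b \<tau> \<tau> \<partial>lborel)"
proof -
  define p where "p n k = t * real k / real (Suc n)" for n k
  \<comment> \<open>On each cell the first argument of b is frozen once at the right and once at the
    left end; the limit therefore counts the diagonal twice.\<close>
  define f where "f n \<tau> = (\<Sum>k<Suc n. indicator {p n k<..p n (Suc k)} \<tau> * b (p n (Suc k)) \<tau> + indicator {p n k<..p n (Suc k)} \<tau> * b (p n k) \<tau>)" for n \<tau>
  have p0: "p n 0 = 0" and pS: "p n (Suc n) = t" for n by (simp_all add: p_def del: of_nat_Suc)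
  have pm: "p n k \<le> p n l" if "k \<le> l" for n k l
    unfolding p_def using t that by (intro divide_right_mono mult_left_mono) simp_all
  have pn: "0 \<le> p n k" for n k unfolding p_def using t by simp
  have pt: "p n k \<le> t" if "k \<le> Suc n" for n k using pm[OF that, of n] by (simp only: pS)
  have pd: "p n (Suc k) = p n k + t / real (Suc n)" for n k
    by (simp add: p_def add_divide_distrib[symmetric] distrib_left del: of_nat_Suc) (simp add: distrib_left add.commute)
  have part: "(\<Sum>k<m. indicator {p n k<..p n (Suc k)} \<tau>) = (indicator {0<..p n m} \<tau> :: real)" for n m \<tau>
  proof (induction m)
    case 0 then show ?case by (simp add: p0)
  next
    case (Suc m)
    then show ?case using pm[of m "Suc m" n] pn[of n m] by (auto simp: indicator_def)
  qed
  have ii: "integrable lborel (\<lambda>\<tau>. indicator {p n k<..p n (Suc k)} \<tau> * b \<sigma> \<tau>)" if "k < Suc n" for n k \<sigma>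
    using that by (intro int pn pm pt) simp_all
  have F: "F t - F 0 = (\<integral>\<tau>. f n \<tau> \<partial>lborel)" for n
  proof -
    have "F t - F 0 = (\<Sum>k<Suc n. F (p n (Suc k)) - F (p n k))"
      by (simp only: sum_lessThan_telescope[of "\<lambda>k. F (p n k)"] p0 pS)
    also have "\<dots> = (\<Sum>k<Suc n. (\<integral>\<tau>. indicator {p n k<..p n (Suc k)} \<tau> * b (p n (Suc k)) \<tau> \<partial>lborel)
        + (\<integral>\<tau>. indicator {p n k<..p n (Suc k)} \<tau> * b (p n k) \<tau> \<partial>lborel))"
      by (rule sum.cong[OF refl], rule inc[OF pn pm pt]) simp_all
    also have "\<dots> = (\<Sum>k<Suc n. \<integral>\<tau>. indicator {p n k<..p n (Suc k)} \<tau> * b (p n (Suc k)) \<tau> + indicator {p n k<..p n (Suc k)} \<tau> * b (p n k) \<tau> \<partial>lborel)"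
      by (rule sum.cong[OF refl], rule Bochner_Integration.integral_add[OF ii ii, symmetric]) simp_all
    also have "\<dots> = (\<integral>\<tau>. f n \<tau> \<partial>lborel)"
      unfolding f_def by (rule Bochner_Integration.integral_sum[symmetric], rule Bochner_Integration.integrable_add[OF ii ii]) simp_all
    finally show ?thesis .
  qed
  have fm: "f n \<in> borel_measurable borel" for n
  proof -
    have "integrable lborel (f n)" unfolding f_def
      by (rule Bochner_Integration.integrable_sum, rule Bochner_Integration.integrable_add[OF ii ii]) simp_all
    then show ?thesis using borel_measurable_integrable by auto
  qed
  \<comment> \<open>Here c stands for the diagonal value. If b stays within e of c over one mesh
    width, the sum is off by at most 2 e, one e for each end of the cell.\<close>
  have dev: "\<bar>f n \<tau> - indicator {0<..t} \<tau> * (2 * c)\<bar> \<le> 2 * e"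
    if h: "\<And>s. \<bar>s - \<tau>\<bar> \<le> t / real (Suc n) \<Longrightarrow> \<bar>b s \<tau> - c\<bar> \<le> e" for n \<tau> c e
  proof -
    have e0: "e \<ge> 0" using order_trans[OF abs_ge_zero h[of \<tau>]] t by simp
    let ?i = "\<lambda>k. indicator {p n k<..p n (Suc k)} \<tau> :: real"
    have "indicator {0<..t} \<tau> * (2 * c) = (\<Sum>k<Suc n. ?i k * (2 * c))"
      unfolding sum_distrib_right[symmetric] part pS by (rule refl)
    then have "f n \<tau> - indicator {0<..t} \<tau> * (2 * c) = (\<Sum>k<Suc n. ?i k * ((b (p n (Suc k)) \<tau> - c) + (b (p n k) \<tau> - c)))"
      unfolding f_def by (simp only: sum_subtractf[symmetric]) (simp add: algebra_simps del: sum.lessThan_Suc)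
    also have "\<bar>\<dots>\<bar> \<le> (\<Sum>k<Suc n. ?i k * (2 * e))"
    proof (rule order_trans[OF sum_abs sum_mono])
      fix k
      show "\<bar>?i k * ((b (p n (Suc k)) \<tau> - c) + (b (p n k) \<tau> - c))\<bar> \<le> ?i k * (2 * e)"
      proof (cases "\<tau> \<in> {p n k<..p n (Suc k)}")
        case True
        then have "\<bar>p n (Suc k) - \<tau>\<bar> \<le> t / real (Suc n)" "\<bar>p n k - \<tau>\<bar> \<le> t / real (Suc n)"
          using pd[of n k] by auto
        from h[OF this(1)] h[OF this(2)] show ?thesis using True by simp
      qed simp
    qed
    also have "\<dots> = indicator {0<..t} \<tau> * (2 * e)" unfolding sum_distrib_right[symmetric] part pS by (rule refl)
    also have "\<dots> \<le> 2 * e" using e0 by (simp add: indicator_def)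
    finally show ?thesis .
  qed
  have lim: "(\<lambda>n. f n \<tau>) \<longlonglongrightarrow> indicator {0<..t} \<tau> * (2 * b \<tau> \<tau>)" for \<tau>
  proof (rule LIMSEQ_I)
    fix e :: real assume e: "0 < e"
    have "isCont (\<lambda>s. b s \<tau>) \<tau>" using cont by (simp add: continuous_on_eq_continuous_at)
    then obtain d where d: "d > 0" "\<And>s. dist s \<tau> < d \<Longrightarrow> dist (b s \<tau>) (b \<tau> \<tau>) < e / 4"
      unfolding continuous_at_eps_delta using e by (metis divide_pos_pos zero_less_numeral)
    have "(\<lambda>n. t * inverse (real (Suc n))) \<longlonglongrightarrow> t * 0" by (rule tendsto_mult_left[OF LIMSEQ_inverse_real_of_nat])
    then have "\<forall>\<^sub>F n in sequentially. t * inverse (real (Suc n)) < d" by (rule order_tendstoD(2)) (simp add: d)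
    then obtain N where N: "\<And>n. n \<ge> N \<Longrightarrow> t / real (Suc n) < d"
      unfolding eventually_sequentially divide_inverse by blast
    have "norm (f n \<tau> - indicator {0<..t} \<tau> * (2 * b \<tau> \<tau>)) < e" if "n \<ge> N" for n
    proof -
      have "\<bar>f n \<tau> - indicator {0<..t} \<tau> * (2 * b \<tau> \<tau>)\<bar> \<le> 2 * (e / 4)"
      proof (rule dev)
        fix s assume "\<bar>s - \<tau>\<bar> \<le> t / real (Suc n)"
        then have "dist s \<tau> < d" using N[OF that] by (simp add: dist_real_def)
        from d(2)[OF this] show "\<bar>b s \<tau> - b \<tau> \<tau>\<bar> \<le> e / 4" by (simp add: dist_real_def)
      qed
      then show ?thesis using e by simp
    qed
    then show "\<exists>no. \<forall>n\<ge>no. norm (f n \<tau> - indicator {0<..t} \<tau> * (2 * b \<tau> \<tau>)) < e" by blast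
  qed
  have m: "(\<lambda>\<tau>. indicator {0<..t} \<tau> * (2 * b \<tau> \<tau>)) \<in> borel_measurable borel"
    by (rule borel_measurable_LIMSEQ_real[OF lim fm])
  \<comment> \<open>Measurability of the diagonal is not assumed; it is inherited from the step
    functions f n and freed of the factor 2 here.\<close>
  have "(\<lambda>\<tau>. (1 / 2) * (indicator {0<..t} \<tau> * (2 * b \<tau> \<tau>))) \<in> borel_measurable borel"
    by (rule borel_measurable_times[OF borel_measurable_const m])
  then show "(\<lambda>\<tau>. indicator {0<..t} \<tau> * b \<tau> \<tau>) \<in> borel_measurable borel" by simp
  have "(\<lambda>n. \<integral>\<tau>. f n \<tau> \<partial>lborel) \<longlonglongrightarrow> (\<integral>\<tau>. indicator {0<..t} \<tau> * (2 * b \<tau> \<tau>) \<partial>lborel)"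
  proof (rule integral_dominated_convergence[where w="\<lambda>\<tau>. 2 * (indicator {0..t} \<tau> * w \<tau>)"])
    show "(\<lambda>\<tau>. indicator {0<..t} \<tau> * (2 * b \<tau> \<tau>)) \<in> borel_measurable lborel" using m by simp
    show "f n \<in> borel_measurable lborel" for n using fm by simp
    show "integrable lborel (\<lambda>\<tau>. 2 * (indicator {0..t} \<tau> * w \<tau>))" by (rule integrable_mult_right[OF w])
    show "AE \<tau> in lborel. (\<lambda>n. f n \<tau>) \<longlonglongrightarrow> indicator {0<..t} \<tau> * (2 * b \<tau> \<tau>)" by (rule AE_I2) (rule lim)
    show "AE \<tau> in lborel. norm (f n \<tau>) \<le> 2 * (indicator {0..t} \<tau> * w \<tau>)" for n
      using bd
    proof eventually_elim
      case (elim \<tau>)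
      let ?i = "\<lambda>k. indicator {p n k<..p n (Suc k)} \<tau> :: real"
      have "\<bar>f n \<tau>\<bar> \<le> (\<Sum>k<Suc n. ?i k * (2 * (indicator {0..t} \<tau> * w \<tau>)))"
        unfolding f_def
      proof (rule order_trans[OF sum_abs sum_mono])
        fix k assume "k \<in> {..<Suc n}"
        then have k: "k < Suc n" by simp
        show "\<bar>?i k * b (p n (Suc k)) \<tau> + ?i k * b (p n k) \<tau>\<bar> \<le> ?i k * (2 * (indicator {0..t} \<tau> * w \<tau>))"
        proof (cases "\<tau> \<in> {p n k<..p n (Suc k)}")
          case True
          then have "\<tau> \<in> {0..t}" using pn[of n k] pt[of "Suc k" n] k by auto
          with elim have "\<bar>b (p n (Suc k)) \<tau>\<bar> \<le> w \<tau>" "\<bar>b (p n k) \<tau>\<bar> \<le> w \<tau>" by blast+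
          then show ?thesis using True \<open>\<tau> \<in> {0..t}\<close> by simp
        qed simp
      qed
      also have "\<dots> = indicator {0<..t} \<tau> * (2 * (indicator {0..t} \<tau> * w \<tau>))"
        unfolding sum_distrib_right[symmetric] part pS by (rule refl)
      also have "\<dots> \<le> 2 * (indicator {0..t} \<tau> * w \<tau>)"
        using elim by (cases "\<tau> \<in> {0<..t}"; cases "\<tau> = 0") (auto simp: indicator_def intro: order_trans[OF abs_ge_zero])
      finally show ?case by simp
    qed
  qed
  then have "(\<lambda>n::nat. F t - F 0) \<longlonglongrightarrow> (\<integral>\<tau>. indicator {0<..t} \<tau> * (2 * b \<tau> \<tau>) \<partial>lborel)" by (simp only: F[symmetric])
  then have "F t - F 0 = (\<integral>\<tau>. indicator {0<..t} \<tau> * (2 * b \<tau> \<tau>) \<partial>lborel)"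
    by (rule LIMSEQ_unique[OF tendsto_const])
  also have "\<dots> = (\<integral>\<tau>. 2 * (indicator {0<..t} \<tau> * b \<tau> \<tau>) \<partial>lborel)"
    by (simp only: mult.left_commute)
  also have "\<dots> = 2 * (\<integral>\<tau>. indicator {0<..t} \<tau> * b \<tau> \<tau> \<partial>lborel)" by (rule Bochner_Integration.integral_mult_right_zero)
  finally show "F t - F 0 = 2 * (\<integral>\<tau>. indicator {0<..t} \<tau> * b \<tau> \<tau> \<partial>lborel)" .
qed

lemma NP_tendsto:
  assumes f: "\<And>n. LP p (f n) (A n)" and g: "LP p g B" and p: "p > 0"
    and l: "(\<lambda>n. NP p (\<lambda>x. f n x - g x)) \<longlonglongrightarrow> 0"
  shows "(\<lambda>n. NP p (f n)) \<longlonglongrightarrow> NP p g"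
proof -
  have "\<bar>NP p (f n) - NP p g\<bar> \<le> NP p (\<lambda>x. f n x - g x)" for n
  proof -
    note d = NP_LP[OF LP_diff[OF f[of n] g p] p] and F = NP_LP[OF f[of n] p] and G = NP_LP[OF g p]
    have "NP p (\<lambda>x. (f n x - g x) + g x) \<le> NP p (\<lambda>x. f n x - g x) + NP p g"
      by (rule NP_le[OF LP_add[OF d G p] p])
    moreover have "NP p (\<lambda>x. f n x - (f n x - g x)) \<le> NP p (f n) + NP p (\<lambda>x. f n x - g x)"
      by (rule NP_le[OF LP_diff[OF F d p] p])
    ultimately show ?thesis by simp
  qed
  then have "(\<lambda>n. NP p (f n) - NP p g) \<longlonglongrightarrow> 0"
    by (intro Lim_null_comparison[OF always_eventually l]) simp
  then show ?thesis by (rule LIM_zero_cancel)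
qed

section \<open>Energy balance of the filtered field and passage to the limit\<close>

context euler
begin

definition Er :: "real \<Rightarrow> real \<Rightarrow> real" where
  "Er r t = (\<Sum>j\<in>UNIV. (NP 2 (conv (hk r) (\<lambda>x. U t x $ j)))\<^sup>2)"

text \<open>The time s at which the test field is frozen is kept apart from the running time \<tau>;
  on the diagonal this is the flux by \<open>flux_eq_bf\<close>.\<close>

definition bb :: "real \<Rightarrow> real \<Rightarrow> real \<Rightarrow> real" where
  "bb r s \<tau> = bf (U \<tau>) (\<lambda>i j. partial i (conv (conv (hk r) (hk r)) (\<lambda>x. U s x $ j)))"

lemma Er_nonneg: "Er r t \<ge> 0" by (simp add: Er_def sum_nonneg)

lemma NP_le_Er: "NP 2 (conv (hk r) (\<lambda>x. U t x $ j)) \<le> sqrt (Er r t)"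
proof -
  have "(NP 2 (conv (hk r) (\<lambda>x. U t x $ j)))\<^sup>2 \<le> Er r t"
    unfolding Er_def by (rule member_le_sum) simp_all
  then show ?thesis by (rule real_le_rsqrt)
qed

lemma Er_eq:
  assumes r: "r > 0"
  shows "Er r t = (\<Sum>j\<in>UNIV. \<integral>x. U t x $ j * conv (conv (hk r) (hk r)) (\<lambda>x. U t x $ j) x \<partial>lborel)"
proof -
  have "(NP 2 (conv (hk r) (\<lambda>x. U t x $ j)))\<^sup>2 = (\<integral>x. U t x $ j * conv (conv (hk r) (hk r)) (\<lambda>x. U t x $ j) x \<partial>lborel)" for j
  proof -
    let ?v = "\<lambda>x. U t x $ j"
    have "(\<integral>x. ?v x * conv (conv (hk r) (hk r)) ?v x \<partial>lborel) = (\<integral>x. ?v x * conv (hk r) (conv (hk r) ?v) x \<partial>lborel)"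
      by (simp only: conv_assoc[OF schwartz_hk[OF r] schwartz_hk[OF r] U_tame])
    also have "\<dots> = (\<integral>x. conv (hk r) ?v x * conv (hk r) ?v x \<partial>lborel)"
      by (rule conv_adjoint_LP2[OF schwartz_hk[OF r] hk_minus[OF r] U_LP2 LP_conv_hk[OF r U_LP2 zero_less_numeral]])
    also have "\<dots> = (\<integral>x. \<bar>conv (hk r) ?v x\<bar> ^ 2 \<partial>lborel)" by (simp add: power2_eq_square)
    also have "\<dots> = (NP 2 (conv (hk r) ?v))\<^sup>2" by (rule NP_pow[symmetric]) simp
    finally show ?thesis by simp
  qed
  then show ?thesis by (simp add: Er_def)
qed

lemma Er_increment:
  assumes r: "r > 0" and t: "0 \<le> s" "s \<le> t" "t \<le> T"
  shows "Er r t - Er r s = (\<integral>\<tau>. indicator {s<..t} \<tau> * bb r t \<tau> \<partial>lborel) + (\<integral>\<tau>. indicator {s<..t} \<tau> * bb r s \<tau> \<partial>lborel)"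
proof -
  let ?H = "conv (hk r) (hk r)"
  let ?p = "\<lambda>a b j. \<integral>x. U a x $ j * conv ?H (\<lambda>x. U b x $ j) x \<partial>lborel"
  have sH: "schwartz ?H" by (rule schwartz_hk_hk[OF r])
  have eH: "?H (- x) = ?H x" for x
    unfolding conv_hk_hk_ker[OF r] by (rule ker_minus[OF dil2_bump[OF r] dil2_even])
  have lH: "LP 2 (conv ?H (\<lambda>x. U b x $ j)) (c0 * NP 2 (conv (hk r) (\<lambda>x. U b x $ j)))" for b j
    by (rule LP_conv_hk_hk[OF r U_LP2])
  have sym: "?p s t j = ?p t s j" for j
    using conv_adjoint_LP2[OF sH eH U_LP2[of s j] U_LP2[of t j]] by (simp only: mult.commute)
  have split: "(\<integral>x. (U t x $ j - U s x $ j) * conv ?H (\<lambda>x. U b x $ j) x \<partial>lborel) = ?p t b j - ?p s b j" for b j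
    unfolding left_diff_distrib
    by (rule Bochner_Integration.integral_diff[OF LP2_prod(2)[OF U_LP2 lH] LP2_prod(2)[OF U_LP2 lH]])
  have w: "(\<Sum>j\<in>UNIV. ?p t b j) - (\<Sum>j\<in>UNIV. ?p s b j) = (\<integral>\<tau>. indicator {s<..t} \<tau> * bb r b \<tau> \<partial>lborel)" for b
    using W_smoothed[OF r U_LP2[of b] U_div[of b] t] unfolding W_def split sum_subtractf bb_def by simp
  have "(\<Sum>j\<in>UNIV. ?p s t j) = (\<Sum>j\<in>UNIV. ?p t s j)" by (rule sum.cong[OF refl sym])
  then show ?thesis using w[of t] w[of s] unfolding Er_eq[OF r] by linarith
qed

lemma gradient_bound:
  assumes r: "r > 0"
  shows "\<exists>C\<ge>0. \<forall>s i j. partial i (conv (conv (hk r) (hk r)) (\<lambda>x. U s x $ j)) \<in> borel_measurable borel \<and>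
    LP 3 (partial i (conv (conv (hk r) (hk r)) (\<lambda>x. U s x $ j))) (C * sqrt (Er r s)) \<and>
    (\<forall>x. \<bar>partial i (conv (conv (hk r) (hk r)) (\<lambda>x. U s x $ j)) x\<bar> \<le> C * sqrt (Er r s))"
proof -
  have r2: "2 * r > 0" using r by simp
  obtain C where C0: "C \<ge> 0" and C: "\<forall>i g A. LP 2 g A \<longrightarrow> conv (hk (2 * r)) g = g \<longrightarrow>
    partial i g \<in> borel_measurable borel \<and> LP 3 (partial i g) (C * A) \<and> (\<forall>x. \<bar>partial i g x\<bar> \<le> C * A)"
    using band_limited_gradient[OF r2] by blast
  have l: "LP 2 (conv (conv (hk r) (hk r)) (\<lambda>x. U s x $ j)) (c0 * sqrt (Er r s))" for s j
    by (rule LP_mono[OF LP_conv_hk_hk[OF r U_LP2] mult_left_mono[OF NP_le_Er less_imp_le[OF c0_pos]]])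
  have "partial i (conv (conv (hk r) (hk r)) (\<lambda>x. U s x $ j)) \<in> borel_measurable borel \<and>
    LP 3 (partial i (conv (conv (hk r) (hk r)) (\<lambda>x. U s x $ j))) (C * (c0 * sqrt (Er r s))) \<and>
    (\<forall>x. \<bar>partial i (conv (conv (hk r) (hk r)) (\<lambda>x. U s x $ j)) x\<bar> \<le> C * (c0 * sqrt (Er r s)))" for s i j
    using C l conv_hk_hk_band[OF r U_tame] by blast
  then show ?thesis using C0 c0_pos by (intro exI[of _ "C * c0"]) (simp add: mult.assoc)
qed

lemma U_clamp: "U (max 0 (min T s)) = U s"
  by (simp only: U_eq[OF clamp]) (simp only: U_def)

text \<open>With a and b the square roots of the filtered energies at s and at 0, the energy
  increment gives a^2 - b^2 \<le> K (a + b), hence a \<le> b + K. The constant K does not depend on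
  s.\<close>

lemma Er_bounded:
  assumes r: "r > 0" shows "\<exists>A\<ge>0. \<forall>s. sqrt (Er r s) \<le> A"
proof -
  obtain C where C0: "C \<ge> 0" and C: "\<forall>s i j. partial i (conv (conv (hk r) (hk r)) (\<lambda>x. U s x $ j)) \<in> borel_measurable borel \<and>
    LP 3 (partial i (conv (conv (hk r) (hk r)) (\<lambda>x. U s x $ j))) (C * sqrt (Er r s)) \<and>
    (\<forall>x. \<bar>partial i (conv (conv (hk r) (hk r)) (\<lambda>x. U s x $ j)) x\<bar> \<le> C * sqrt (Er r s))"
    using gradient_bound[OF r] by blast
  let ?G = "\<lambda>s i j. partial i (conv (conv (hk r) (hk r)) (\<lambda>x. U s x $ j))"
  have 1: "?G s i j \<in> borel_measurable borel" "LP 3 (?G s i j) (C * sqrt (Er r s))" "\<bar>?G s i j x\<bar> \<le> C * sqrt (Er r s)" for s i j x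
    using C by blast+
  define I where "I = (\<integral>t. indicator {0..T} t * bet t ^ 2 \<partial>lborel)"
  have I0: "I \<ge> 0" unfolding I_def by (intro integral_nonneg_AE AE_I2) simp
  define K where "K = KU * C * I"
  have K0: "K \<ge> 0" using KU_nonneg C0 I0 by (simp add: K_def)
  have a: "sqrt (Er r s) \<le> sqrt (Er r 0) + K" if s: "s \<in> {0..T}" for s
  proof (rule ccontr)
    assume n: "\<not> sqrt (Er r s) \<le> sqrt (Er r 0) + K"
    let ?a = "sqrt (Er r s)" and ?b = "sqrt (Er r 0)"
    have S: "{0<..s} \<in> sets borel" "{0<..s} \<subseteq> {0..T}" using s by auto
    have b: "\<bar>\<integral>\<tau>. indicator {0<..s} \<tau> * bb r \<sigma> \<tau> \<partial>lborel\<bar> \<le> K * sqrt (Er r \<sigma>)" for \<sigma>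
    proof -
      have "\<bar>\<integral>\<tau>. indicator {0<..s} \<tau> * bb r \<sigma> \<tau> \<partial>lborel\<bar> \<le> KU * (C * sqrt (Er r \<sigma>)) * I"
        unfolding bb_def I_def by (rule bf_time_integrable(2)[where G="?G \<sigma>", OF 1(1) 1(3) 1(2) S])
      then show ?thesis by (simp add: K_def mult_ac)
    qed
    have "?a\<^sup>2 - ?b\<^sup>2 = Er r s - Er r 0" using Er_nonneg by simp
    also have "\<dots> \<le> K * ?a + K * ?b"
      using Er_increment[OF r, of 0 s] s b[of s] b[of 0] by simp
    finally have "(?a - ?b - K) * (?a + ?b) \<le> 0" by (simp add: power2_eq_square algebra_simps)
    moreover have "?a - ?b - K > 0" "?b \<ge> 0" using n Er_nonneg by simp_all
    moreover then have "?a + ?b > 0" using K0 by linarith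
    ultimately show False using mult_pos_pos[of "?a - ?b - K" "?a + ?b"] by linarith
  qed
  have "sqrt (Er r s) \<le> sqrt (Er r 0) + K" for s
    using a[OF clamp[of s]] by (simp only: Er_def U_clamp)
  moreover have "0 \<le> sqrt (Er r 0) + K" using K0 Er_nonneg by simp
  ultimately show ?thesis by blast
qed

lemma gradient_bound_uniform:
  assumes r: "r > 0"
  shows "\<exists>B\<ge>0. \<forall>s i j. partial i (conv (conv (hk r) (hk r)) (\<lambda>x. U s x $ j)) \<in> borel_measurable borel \<and>
    LP 3 (partial i (conv (conv (hk r) (hk r)) (\<lambda>x. U s x $ j))) B \<and>
    (\<forall>x. \<bar>partial i (conv (conv (hk r) (hk r)) (\<lambda>x. U s x $ j)) x\<bar> \<le> B)"
proof -
  obtain A where A0: "A \<ge> 0" and A: "\<And>s. sqrt (Er r s) \<le> A" using Er_bounded[OF r] by blast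
  obtain C where C0: "C \<ge> 0" and C: "\<forall>s i j. partial i (conv (conv (hk r) (hk r)) (\<lambda>x. U s x $ j)) \<in> borel_measurable borel \<and>
    LP 3 (partial i (conv (conv (hk r) (hk r)) (\<lambda>x. U s x $ j))) (C * sqrt (Er r s)) \<and>
    (\<forall>x. \<bar>partial i (conv (conv (hk r) (hk r)) (\<lambda>x. U s x $ j)) x\<bar> \<le> C * sqrt (Er r s))"
    using gradient_bound[OF r] by blast
  have m: "C * sqrt (Er r s) \<le> C * A" for s by (rule mult_left_mono[OF A C0])
  have "C * A \<ge> 0" using A0 C0 by simp
  then show ?thesis using C LP_mono[OF _ m] order_trans[OF _ m] by (intro exI[of _ "C * A"]) blast
qed

text \<open>Weak continuity makes the filtered gradients converge at each point x; the bound uniform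
  in s provides the majorant for the integral over x.\<close>

lemma bb_continuous:
  assumes r: "r > 0" shows "continuous_on UNIV (\<lambda>s. bb r s \<tau>)"
proof (rule continuous_on_sequentiallyI)
  fix \<sigma> :: "nat \<Rightarrow> real" and s assume l: "\<sigma> \<longlonglongrightarrow> s"
  let ?G = "\<lambda>s i j. partial i (conv (conv (hk r) (hk r)) (\<lambda>x. U s x $ j))"
  obtain B where B: "\<forall>s i j. ?G s i j \<in> borel_measurable borel \<and> LP 3 (?G s i j) B \<and> (\<forall>x. \<bar>?G s i j x\<bar> \<le> B)"
    using gradient_bound_uniform[OF r] by blast
  have Gm: "?G s i j \<in> borel_measurable borel" and Gb: "\<bar>?G s i j x\<bar> \<le> B" for s i j x using B by blast+
  have Gl: "(\<lambda>n. ?G (\<sigma> n) i j x) \<longlonglongrightarrow> ?G s i j x" for i j x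
  proof -
    have sH: "schwartz (conv (hk r) (hk r))" by (rule schwartz_hk_hk[OF r])
    have "isCont (\<lambda>t. conv (partial i (conv (hk r) (hk r))) (\<lambda>x. U t x $ j) x) s"
      using U_conv_cont[OF schwartz_partial[OF sH], of i j x] by (simp add: continuous_on_eq_continuous_at)
    from isCont_tendsto_compose[OF this l] show ?thesis by (simp only: partial_conv[OF sH U_tame])
  qed
  have "(\<lambda>n. \<integral>x. U \<tau> x $ i * U \<tau> x $ j * ?G (\<sigma> n) i j x \<partial>lborel) \<longlonglongrightarrow> (\<integral>x. U \<tau> x $ i * U \<tau> x $ j * ?G s i j x \<partial>lborel)" for i j
  proof (rule integral_dominated_convergence[where w="\<lambda>x. \<bar>U \<tau> x $ i * U \<tau> x $ j\<bar> * B"])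
    have m: "(\<lambda>x. U \<tau> x $ i * U \<tau> x $ j) \<in> borel_measurable borel"
      by (rule borel_measurable_times[OF LP_measurable[OF U_LP2] LP_measurable[OF U_LP2]])
    show "(\<lambda>x. U \<tau> x $ i * U \<tau> x $ j * ?G s i j x) \<in> borel_measurable lborel"
      using borel_measurable_times[OF m Gm] by simp
    show "(\<lambda>x. U \<tau> x $ i * U \<tau> x $ j * ?G (\<sigma> n) i j x) \<in> borel_measurable lborel" for n
      using borel_measurable_times[OF m Gm] by simp
    show "integrable lborel (\<lambda>x. \<bar>U \<tau> x $ i * U \<tau> x $ j\<bar> * B)"
      by (rule integrable_mult_left[OF integrable_abs[OF LP2_prod(2)[OF U_LP2 U_LP2]]])
    show "AE x in lborel. (\<lambda>n. U \<tau> x $ i * U \<tau> x $ j * ?G (\<sigma> n) i j x) \<longlonglongrightarrow> U \<tau> x $ i * U \<tau> x $ j * ?G s i j x"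
      by (rule AE_I2) (rule tendsto_mult_left[OF Gl])
    show "AE x in lborel. norm (U \<tau> x $ i * U \<tau> x $ j * ?G (\<sigma> n) i j x) \<le> \<bar>U \<tau> x $ i * U \<tau> x $ j\<bar> * B" for n
    proof (rule AE_I2)
      fix x
      show "norm (U \<tau> x $ i * U \<tau> x $ j * ?G (\<sigma> n) i j x) \<le> \<bar>U \<tau> x $ i * U \<tau> x $ j\<bar> * B"
        unfolding real_norm_def abs_mult[of "U \<tau> x $ i * U \<tau> x $ j"] by (rule mult_left_mono[OF Gb abs_ge_zero])
    qed
  qed
  then show "(\<lambda>n. bb r (\<sigma> n) \<tau>) \<longlonglongrightarrow> bb r s \<tau>" unfolding bb_def bf_def by (intro tendsto_sum)
qed

lemma energy_balance:
  assumes r: "r > 0" and t: "t \<in> {0..T}"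
  shows "(\<lambda>\<tau>. indicator {0<..t} \<tau> * flux r (U \<tau>)) \<in> borel_measurable borel"
    and "Er r t - Er r 0 = 2 * (\<integral>\<tau>. indicator {0<..t} \<tau> * flux r (U \<tau>) \<partial>lborel)"
proof -
  let ?G = "\<lambda>s i j. partial i (conv (conv (hk r) (hk r)) (\<lambda>x. U s x $ j))"
  obtain B where B: "\<forall>s i j. ?G s i j \<in> borel_measurable borel \<and> LP 3 (?G s i j) B \<and> (\<forall>x. \<bar>?G s i j x\<bar> \<le> B)"
    using gradient_bound_uniform[OF r] by blast
  have G: "?G s i j \<in> borel_measurable borel" "LP 3 (?G s i j) B" "\<bar>?G s i j x\<bar> \<le> B" for s i j x using B by blast+
  have t0: "0 \<le> t" "t \<le> T" using t by simp_all
  have 1: "Er r s' - Er r s = (\<integral>\<tau>. indicator {s<..s'} \<tau> * bb r s' \<tau> \<partial>lborel) + (\<integral>\<tau>. indicator {s<..s'} \<tau> * bb r s \<tau> \<partial>lborel)"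
    if "0 \<le> s" "s \<le> s'" "s' \<le> t" for s s'
    by (rule Er_increment[OF r that(1,2) order_trans[OF that(3) t0(2)]])
  have 2: "integrable lborel (\<lambda>\<tau>. indicator {s<..s'} \<tau> * bb r \<sigma> \<tau>)" if "0 \<le> s" "s \<le> s'" "s' \<le> t" for s s' \<sigma>
  proof -
    have S: "{s<..s'} \<in> sets borel" "{s<..s'} \<subseteq> {0..T}" using that t0 by auto
    show ?thesis unfolding bb_def by (rule bf_time_integrable(1)[where G="?G \<sigma>", OF G(1) G(3) G(2) S])
  qed
  have 3: "AE \<tau> in lborel. \<tau> \<in> {0..t} \<longrightarrow> (\<forall>s. \<bar>bb r s \<tau>\<bar> \<le> KU * bet \<tau> ^ 2 * B)"
    using ee_le_bet
  proof eventually_elim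
    case (elim \<tau>)
    show ?case
    proof (intro impI allI)
      fix s assume "\<tau> \<in> {0..t}"
      then have "\<tau> \<in> {0..T}" using t0 by simp
      with elim have e: "\<And>n. ee n (U \<tau>) \<le> bet \<tau>" by blast
      show "\<bar>bb r s \<tau>\<bar> \<le> KU * bet \<tau> ^ 2 * B" unfolding bb_def by (rule bf_bet[where G="?G s", OF e G(2)])
    qed
  qed
  have 4: "integrable lborel (\<lambda>\<tau>. indicator {0..t} \<tau> * (KU * bet \<tau> ^ 2 * B))"
  proof -
    have s: "{0..t} \<in> sets lborel" by simp
    have "integrable lborel (\<lambda>\<tau>. indicator {0..t} \<tau> *\<^sub>R (KU * B * (indicator {0..T} \<tau> * bet \<tau> ^ 2)))"
      by (rule integrable_mult_indicator[OF s integrable_mult_right[OF bet_sq_integrable]])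
    also have "(\<lambda>\<tau>. indicator {0..t} \<tau> *\<^sub>R (KU * B * (indicator {0..T} \<tau> * bet \<tau> ^ 2))) = (\<lambda>\<tau>. indicator {0..t} \<tau> * (KU * bet \<tau> ^ 2 * B))"
      using t0 by (auto simp: indicator_def fun_eq_iff mult_ac)
    finally show ?thesis .
  qed
  have e: "bb r \<tau> \<tau> = flux r (U \<tau>)" for \<tau> unfolding bb_def by (rule flux_eq_bf[OF r U_L2])
  note D = diagonal_integral[where b="bb r" and F="Er r" and w="\<lambda>\<tau>. KU * bet \<tau> ^ 2 * B", OF t0(1) 1 2 bb_continuous[OF r] 3 4]
  show "(\<lambda>\<tau>. indicator {0<..t} \<tau> * flux r (U \<tau>)) \<in> borel_measurable borel" using D(1) by (simp only: e)
  show "Er r t - Er r 0 = 2 * (\<integral>\<tau>. indicator {0<..t} \<tau> * flux r (U \<tau>) \<partial>lborel)" using D(2) by (simp only: e)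
qed

text \<open>For almost every time the flux tends to 0 by the stationary result, and
  \<open>flux_besov\<close> bounds it by a multiple of the cube of \<open>bet\<close> independent of
  Q. The cube is the power that matches integrability in L^3 of time.\<close>

lemma flux_time_tendsto:
  assumes t: "t \<in> {0..T}"
  shows "(\<lambda>Q. \<integral>\<tau>. indicator {0<..t} \<tau> * flux (2 ^ Q) (U \<tau>) \<partial>lborel) \<longlonglongrightarrow> 0"
proof -
  define M where "M = Cf * C2 ^ 3 * KD ^ 3"
  have "(\<lambda>Q. \<integral>\<tau>. indicator {0<..t} \<tau> * flux (2 ^ Q) (U \<tau>) \<partial>lborel) \<longlonglongrightarrow> (\<integral>\<tau>. (0::real) \<partial>(lborel :: real measure))"
  proof (rule integral_dominated_convergence[where w="\<lambda>\<tau>. M * (indicator {0..T} \<tau> * bet \<tau> ^ 3)"])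
    show "(\<lambda>\<tau>. indicator {0<..t} \<tau> * flux (2 ^ Q) (U \<tau>)) \<in> borel_measurable lborel" for Q :: nat
      using energy_balance(1)[of "2 ^ Q", OF _ t] by simp
    show "integrable lborel (\<lambda>\<tau>. M * (indicator {0..T} \<tau> * bet \<tau> ^ 3))"
      by (rule integrable_mult_right[OF bet_cube_integrable])
    have "AE \<tau> in restrict_space lborel {0..T}. besov_c chi (field_dist (u \<tau>))"
      using bes unfolding in_L3_besov_c_def by (elim conjE)
    then have "AE \<tau> in lborel. \<tau> \<in> {0..T} \<longrightarrow> besov_c chi (field_dist (u \<tau>))"
      by (subst (asm) AE_restrict_space_iff) simp_all
    then show "AE \<tau> in lborel. (\<lambda>Q. indicator {0<..t} \<tau> * flux (2 ^ Q) (U \<tau>)) \<longlonglongrightarrow> 0"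
    proof eventually_elim
      case (elim \<tau>)
      show ?case
      proof (cases "\<tau> \<in> {0<..t}")
        case True
        then have \<tau>: "\<tau> \<in> {0..T}" using t by auto
        with elim have "besov_c chi (field_dist (U \<tau>))" by (simp only: U_eq)
        from energy_flux_tendsto[OF U_L2 U_div this] show ?thesis using True by simp
      qed simp
    qed
    show "AE \<tau> in lborel. norm (indicator {0<..t} \<tau> * flux (2 ^ Q) (U \<tau>)) \<le> M * (indicator {0..T} \<tau> * bet \<tau> ^ 3)" for Q
      using ee_le_bet
    proof eventually_elim
      case (elim \<tau>)
      show ?case
      proof (cases "\<tau> \<in> {0<..t}")
        case True
        then have \<tau>: "\<tau> \<in> {0..T}" using t by auto
        with elim have e: "\<And>n. ee n (U \<tau>) \<le> bet \<tau>" by blast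
        note S = S_bounds[where e="\<lambda>n. ee n (U \<tau>)" and Q=Q, OF ee_nonneg e]
        have "\<bar>flux (2 ^ Q) (U \<tau>)\<bar> \<le> Cf * C2 ^ 3 * (S1 Q (\<lambda>n. ee n (U \<tau>)) + S2 Q (\<lambda>n. ee n (U \<tau>))) ^ 3"
          by (rule flux_besov[OF U_LP2 U_div ee_nonneg e blk_ee[OF U_L2]])
        also have "\<dots> \<le> Cf * C2 ^ 3 * (KD * bet \<tau>) ^ 3"
          using S(3,4,5) Cf_nonneg C2_nonneg by (intro mult_left_mono power_mono) simp_all
        also have "\<dots> = M * bet \<tau> ^ 3" by (simp add: M_def power_mult_distrib)
        finally show ?thesis using True \<tau> by simp
      next
        case False
        then show ?thesis using Cf_nonneg C2_nonneg KD_nonneg bet_nonneg by (simp add: M_def)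
      qed
    qed
  qed simp
  then show ?thesis by simp
qed

lemma Er_tendsto: "(\<lambda>Q. Er (2 ^ Q) t) \<longlonglongrightarrow> (Lp_norm 2 (U t))\<^sup>2"
proof -
  have pos: "0 < (2 ^ n :: real)" for n by simp
  have top: "filterlim (\<lambda>n. 2 ^ n :: real) at_top sequentially"
    by (rule filterlim_at_top_mono[OF filterlim_real_sequentially always_eventually])
       (simp add: less_imp_le[OF of_nat_less_two_power])
  have "(\<lambda>Q. NP 2 (conv (hk (2 ^ Q)) (\<lambda>x. U t x $ j))) \<longlonglongrightarrow> NP 2 (\<lambda>x. U t x $ j)" for j
    by (rule NP_tendsto[OF LP_conv_hk[OF pos U_LP2 zero_less_numeral] U_LP2 zero_less_numeral conv_hk_tendsto_L2(1)[OF U_LP2 pos top]])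
  then show ?thesis unfolding Er_def Lp_norm_2[OF U_L2] by (intro tendsto_sum tendsto_power)
qed

lemma energy_conservation:
  assumes t: "t \<in> {0..T}" shows "(Lp_norm 2 (u t))\<^sup>2 = (Lp_norm 2 (u 0))\<^sup>2"
proof -
  have z: "0 \<in> {0..T}" using T by simp
  have "(\<lambda>Q. Er (2 ^ Q) t - Er (2 ^ Q) 0) \<longlonglongrightarrow> (Lp_norm 2 (U t))\<^sup>2 - (Lp_norm 2 (U 0))\<^sup>2"
    by (rule tendsto_diff[OF Er_tendsto Er_tendsto])
  moreover have "(\<lambda>Q. Er (2 ^ Q) t - Er (2 ^ Q) 0) \<longlonglongrightarrow> 0"
  proof -
    have "Er (2 ^ Q) t - Er (2 ^ Q) 0 = 2 * (\<integral>\<tau>. indicator {0<..t} \<tau> * flux (2 ^ Q) (U \<tau>) \<partial>lborel)" for Q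
      by (rule energy_balance(2)[OF _ t]) simp
    then show ?thesis using tendsto_mult_left[OF flux_time_tendsto[OF t], of 2] by simp
  qed
  ultimately have "(Lp_norm 2 (U t))\<^sup>2 - (Lp_norm 2 (U 0))\<^sup>2 = 0" by (rule LIMSEQ_unique)
  then show ?thesis by (simp add: U_eq[OF t] U_eq[OF z])
qed

end

theorem theorem3p3:
  fixes chi :: "R3 \<Rightarrow> real"
  assumes "lp_cutoff chi"
  shows "(\<forall>u :: R3 \<Rightarrow> R3.
            besov_c chi (field_dist u) \<and> in_Lp 2 u \<and> div_free u \<longrightarrow>
            (\<lambda>Q::nat. energy_flux chi (int Q) u) \<longlonglongrightarrow> 0)
       \<and> (\<forall>(T::real) (u :: real \<Rightarrow> R3 \<Rightarrow> R3).
            0 < T \<and> weak_euler_solution T u \<and> weakly_continuous_L2 T u \<and>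
            in_L3_besov_c chi T (\<lambda>t. field_dist (u t)) \<longrightarrow>
            (\<forall>t\<in>{0..T}. 1/2 * (Lp_norm 2 (u t))\<^sup>2 = 1/2 * (Lp_norm 2 (u 0))\<^sup>2))"
proof (intro conjI allI impI ballI)
  interpret lp_cut chi by (rule lp_cut.intro[OF assms])
  fix u :: "R3 \<Rightarrow> R3"
  assume "besov_c chi (field_dist u) \<and> in_Lp 2 u \<and> div_free u"
  then show "(\<lambda>Q::nat. energy_flux chi (int Q) u) \<longlonglongrightarrow> 0" using part1 by blast
next
  fix T :: real and u :: "real \<Rightarrow> R3 \<Rightarrow> R3" and t
  assume A: "0 < T \<and> weak_euler_solution T u \<and> weakly_continuous_L2 T u \<and> in_L3_besov_c chi T (\<lambda>t. field_dist (u t))"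
    and t: "t \<in> {0..T}"
  interpret euler chi T u
    by (rule euler.intro[OF lp_cut.intro[OF assms]], rule euler_axioms.intro) (use A in blast)+
  show "1/2 * (Lp_norm 2 (u t))\<^sup>2 = 1/2 * (Lp_norm 2 (u 0))\<^sup>2"
    using energy_conservation[OF t] by simp
qed

end
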